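(* Let $p$ be a prime, let $r\ge 1$, and consider a strong Shoda pair $(H,K)$ of a finite group $G$ with $\gcd(p,|G|)=1$, and $\mathcal{C}\in\mathcal{C}_p(H/K)$. Let $R=\mathbb{Z}_{p^r}H\omega_{\mathcal{C}}(H,K)$ and let $S=\mathbb{Z}_{p^r}(\xi_{l_{(H,K)}})$ be the center of $\mathbb{Z}_{p^r}C\omega_{\mathcal{C}}(H,K)$, where $C=\operatorname{Cen}_G(\omega_{\mathcal{C}}(H,K))$. If $\beta$ is a normal element of the Galois extension $R$ over $S$, whose Galois group is generated by $\sigma$ and is of order $l$, and $\{1,\gamma,\dots,\gamma^{l-1}\}$ is a basis of the crossed product $\mathbb{Z}_{p^r}H\omega_{\mathcal{C}}(H,K)*_{\sigma}^{\tau}C/H$ over $\mathbb{Z}_{p^r}H\omega_{\mathcal{C}}(H,K)$, then there exist $\alpha_0,\dots,\alpha_{l-1}$ in $\mathbb{Z}_{p^r}H\omega_{\mathcal{C}}(H,K)$ satisfying the system $$\begin{pmatrix}\beta&\beta^{p^{l_{(H,K)}}}&\cdots&\beta^{p^{(l-1)l_{(H,K)}}}\\ \beta^{p^{l_{(H,K)}}}&\beta^{p^{2l_{(H,K)}}}&\cdots&\beta\\ \vdots&\vdots&\ddots&\vdots\\ \beta^{p^{(l-1)l_{(H,K)}}}&\beta&\cdots&\beta^{p^{(l-2)l_{(H,K)}}}\end{pmatrix}\begin{pmatrix}\alpha_0\\ \alpha_1\\ \vdots\\ \alpha_{l-1}\end{pmatrix}=\begin{pmatrix}\sum_{i=1}^{l}\beta^{p^{i\,l_{(H,K)}}}\\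 \beta-\beta^{p^{l_{(H,K)}}}\\ \vdots\\ \beta-\beta^{p^{(l-1)l_{(H,K)}}}\end{pmatrix}$$ such that $\alpha=\sum_{i=0}^{l-1}\alpha_i\gamma^i$ is invertible and $$\{\,w_{\mathcal{C}}(G,H,K)+\boldsymbol{\alpha}\,t_u^{-1}\gamma^i\alpha^{-1}\widehat{E}\,\alpha\,\gamma^{-j}t_v\,\omega_{\mathcal{C}}(H,K)\ \mid\ 1\le i,j\le l,\ 1\le u,v\le m,\ \boldsymbol{\alpha}\in S\,\}$$ is a complete set of elementary matrices of $\mathbb{Z}_{p^r}Gw_{\mathcal{C}}(G,H,K)$, where $\widehat{E}=\frac1l\sum_{i=0}^{l-1}\gamma^i$ and $\{t_i\mid 1\le i\le m\}$ is a right transversal of $C$ in $G$. (Here the bold $\boldsymbol{\alpha}$ is a scalar ranging over $S$, distinct from the element $\alpha$.)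
   Context: Elementary matrices over a ring $A$ are matrices of the form $I+\boldsymbol{\alpha}E_{ij}$ with $\boldsymbol{\alpha}\in A$, where $I$ is the identity matrix and $E_{ij}$ has $(i,j)$ entry $1$ and all other entries $0$. Elements of $\mathbb{Z}_{p^r}Gw_{\mathcal{C}}(G,H,K)$ are regarded as matrices over $S$ via the isomorphism of this ring with $M_{[G:H]}(S)$, where $[G:H]=ml$. For a group ring element $x$, $\operatorname{Cen}_G(x)=\{g\in G\mid g^{-1}xg=x\}$. $\mathbb{Z}_{p^r}(\xi_d)=\mathbb{Z}_{p^r}[\xi_d]$ is the Galois ring $\mathbb{Z}_{p^r}[x]/\langle h(x)\rangle$, with $h$ monic of degree $d$ over $\mathbb{Z}_{p^r}$ and irreducible modulo $p$, and $\xi_d=x+\langle h(x)\rangle$. Here $l_{(H,K)}=o/[C:H]$ with $o$ the multiplicative order of $p$ modulo $[H:K]$. The rings $R$ and $S$ are Galois rings of characteristic $p^r$ and cardinalities $p^{ro}$ and $p^{r\,l_{(H,K)}}$. A normal element of $R$ over $S$ is a $\beta\in R$ such that $\{\theta(\beta)\mid\theta\in\operatorname{Gal}(R/S)\}$ is a basis of $R$ as an $S$-module. Crossed product: for a ring $R$ and a group $Q$, with maps $\sigma:Q\to\operatorname{Aut}(R)$ (action) and $\tau:Q\times Q\to\mathcal{U}(R)$ (twisting; $\mathcal{U}(R)$ the group of units) satisfying the usual associativity relations, it is the free $R$-module with basis $\{z_g\mid g\in Q\}$ and multiplication $z_gz_h=z_{gh}\tau_{g,h}$, $rz_g=z_g\sigma_g(r)$.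 In the claim, $\mathbb{Z}_{p^r}C\omega_{\mathcal{C}}(H,K)$ is identified with the crossed product of $C/H$ over $R$ whose (faithful) action is given by conjugation by fixed preimages $\bar{x}\in C$ of the elements $x\in C/H$, and whose twisting is $\tau(x,y)=h\,\omega_{\mathcal{C}}(H,K)$, where $h\in H$ satisfies $\bar{x}\bar{y}=h\,\overline{xy}$. The group $C/H$ is cyclic, and for a generator $x$ one can choose $a\in R$ with $(a\bar{x})^{|C/H|}=\omega_{\mathcal{C}}(H,K)$, so that with respect to the basis of powers of $a\bar{x}$ the twisting is trivial. Shoda pair: a pair $(H,K)$ of subgroups of $G$ with $H/K$ cyclic, such that for every $g\in G$, $[H,g]\cap H\subseteq K$ implies $g\in H$. Put $\widehat{L}=\frac1{|L|}\sum_{x\in L}x$ for a subgroup $L$, and let $\varepsilon(H,K)=\widehat{K}$ if $H=K$, and $\varepsilon(H,K)=\prod(\widehat{K}-\widehat{L})$ otherwise, where $L$ runs over the minimal normal subgroups of $H$ properly containing $K$. A Shoda pair $(H,K)$ is a strong Shoda pair if $K\le H\unlhd N_G(K)$, where $N_G(K)$ is the normaliser of $K$ in $G$; $H/K$ is cyclic and a maximal abelian subgroup of $N_G(K)/K$; and $\varepsilon(H,K)\,g^{-1}\varepsilon(H,K)g=0$ for every $g\in G\setminus N_G(K)$. Let $\operatorname{Irr}(H/K)$ be the set of irreducible characters of $H/K$ over $\overline{\mathbb{F}}_p$, let $k=[H:K]$ and let $\zeta_k$ be a primitive $k$th root of unity in $\overline{\mathbb{F}}_p$. The group $\operatorname{Gal}(\mathbb{F}_p(\zeta_k)/\mathbb{F}_p)$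 acts on $\operatorname{Irr}(H/K)$ by composition; the orbits are the $p$-cyclotomic classes, and $\mathcal{C}_p(H/K)$ is the set of those containing generators of $\operatorname{Irr}(H/K)$. For $\mathcal{C}\in\mathcal{C}_p(H/K)$ and $\chi\in\mathcal{C}$, $$\varepsilon_{\mathcal{C}}(H,K)=|H|^{-1}\sum_{h\in H}\operatorname{tr}(\chi(hK))\,h^{-1},$$ where $\operatorname{tr}$ is the trace of $\mathbb{F}_p(\zeta_k)/\mathbb{F}_p$. Regarding $\varepsilon_{\mathcal{C}}(H,K)$ as an element of $\mathbb{Z}_{p^r}H$, define $$\omega_{\mathcal{C}}(H,K)=\Big(\sum_{s=1}^{n}(-1)^{s-1}\binom{n}{s}\varepsilon_{\mathcal{C}}(H,K)^s\Big)^n,$$ where $n$ is the nilpotency index of $\varepsilon_{\mathcal{C}}(H,K)$ in $\mathbb{Z}_{p^r}H$, and let $w_{\mathcal{C}}(G,H,K)$ be the sum of all the distinct $G$-conjugates of $\omega_{\mathcal{C}}(H,K)$.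
   Formalization: β^{p^j} means the j-th Frobenius iterate; σ is the generator inverse to y↦y^{p^{l_(H,K)}}; ω stands before t_v; the scalar bold α∈S acts as Σ t_k^{-1}α t_k; n is the nilpotency index of ε²−ε. As printed, the claim fails (Q8, p^r=9, β=1+i; C7:C3, p=2; m≥2) and ε is not nilpotent. *)

theory Defs
  imports
    "HOL-Algebra.Algebra"
    "HOL-Algebra.Group_Action"
    "HOL-Algebra.Algebraic_Closure_Type"
    "HOL-Number_Theory.Pocklington"
    "Jordan_Normal_Form.VS_Connect"
begin

section \<open>Group rings, subrings and corners\<close>

text \<open>The group ring of a finite group: coefficient functions, extensional on the group, under
  convolution.\<close>

definition group_ring :: "('r, 'x) ring_scheme \<Rightarrow> ('g, 'b) monoid_scheme \<Rightarrow> ('g \<Rightarrow> 'r) ring" where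
  "group_ring Z G = \<lparr>
     carrier = carrier G \<rightarrow>\<^sub>E carrier Z,
     monoid.mult = (\<lambda>f h. \<lambda>x\<in>carrier G. \<Oplus>\<^bsub>Z\<^esub>y\<in>carrier G. f y \<otimes>\<^bsub>Z\<^esub> h (inv\<^bsub>G\<^esub> y \<otimes>\<^bsub>G\<^esub> x)),
     monoid.one = (\<lambda>x\<in>carrier G. if x = \<one>\<^bsub>G\<^esub> then \<one>\<^bsub>Z\<^esub> else \<zero>\<^bsub>Z\<^esub>),
     ring.zero = (\<lambda>x\<in>carrier G. \<zero>\<^bsub>Z\<^esub>),
     ring.add = (\<lambda>f h. \<lambda>x\<in>carrier G. f x \<oplus>\<^bsub>Z\<^esub> h x)\<rparr>"

definition group_elt :: "('r, 'x) ring_scheme \<Rightarrow> ('g, 'b) monoid_scheme \<Rightarrow> 'g \<Rightarrow> 'g \<Rightarrow> 'r" where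
  "group_elt Z G g = (\<lambda>x\<in>carrier G. if x = g then \<one>\<^bsub>Z\<^esub> else \<zero>\<^bsub>Z\<^esub>)"

definition gr_conj ::
  "('r, 'x) ring_scheme \<Rightarrow> ('g, 'b) monoid_scheme \<Rightarrow> 'g \<Rightarrow> ('g \<Rightarrow> 'r) \<Rightarrow> 'g \<Rightarrow> 'r" where
  "gr_conj Z G g f =
     group_elt Z G (inv\<^bsub>G\<^esub> g) \<otimes>\<^bsub>group_ring Z G\<^esub> f \<otimes>\<^bsub>group_ring Z G\<^esub> group_elt Z G g"

definition gr_centralizer ::
  "('r, 'x) ring_scheme \<Rightarrow> ('g, 'b) monoid_scheme \<Rightarrow> ('g \<Rightarrow> 'r) \<Rightarrow> 'g set" where
  "gr_centralizer Z G f = {g \<in> carrier G. gr_conj Z G g f = f}"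

text \<open>The group ring of a subgroup \<open>U\<close>, realised inside the group ring of \<open>G\<close>.\<close>

definition sub_group_ring ::
  "('r, 'x) ring_scheme \<Rightarrow> ('g, 'b) monoid_scheme \<Rightarrow> 'g set \<Rightarrow> ('g \<Rightarrow> 'r) ring" where
  "sub_group_ring Z G U = (group_ring Z G)
     \<lparr>carrier := {f \<in> carrier (group_ring Z G). \<forall>x\<in>carrier G - U. f x = \<zero>\<^bsub>Z\<^esub>}\<rparr>"

text \<open>For a central idempotent \<open>e\<close> of \<open>A\<close>, the ring \<open>Ae\<close> with identity \<open>e\<close>.\<close>

definition corner_ring :: "'a ring \<Rightarrow> 'a \<Rightarrow> 'a ring" where
  "corner_ring A e = A\<lparr>carrier := (\<lambda>y. y \<otimes>\<^bsub>A\<^esub> e) ` carrier A, one := e\<rparr>"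

definition center_ring :: "'a ring \<Rightarrow> 'a ring" where
  "center_ring A =
     A\<lparr>carrier := {z \<in> carrier A. \<forall>y\<in>carrier A. z \<otimes>\<^bsub>A\<^esub> y = y \<otimes>\<^bsub>A\<^esub> z}\<rparr>"

section \<open>Shoda pairs and strong Shoda pairs\<close>

abbreviation subquotient :: "('g, 'b) monoid_scheme \<Rightarrow> 'g set \<Rightarrow> 'g set \<Rightarrow> 'g set monoid" where
  "subquotient G H K \<equiv> (G\<lparr>carrier := H\<rparr>) Mod K"

text \<open>\<open>[H,g]\<close> is read as the set of the commutators \<open>[h,g]\<close> with \<open>h\<close> in \<open>H\<close>.\<close>

definition shoda_pair :: "('g, 'b) monoid_scheme \<Rightarrow> 'g set \<Rightarrow> 'g set \<Rightarrow> bool" where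
  "shoda_pair G H K \<longleftrightarrow>
     subgroup H G \<and> subgroup K G \<and> K \<subseteq> H \<and> K \<lhd> G\<lparr>carrier := H\<rparr> \<and>
     cyclic_group (subquotient G H K) \<and>
     (\<forall>g\<in>carrier G.
        {inv\<^bsub>G\<^esub> h \<otimes>\<^bsub>G\<^esub> inv\<^bsub>G\<^esub> g \<otimes>\<^bsub>G\<^esub> h \<otimes>\<^bsub>G\<^esub> g | h. h \<in> H} \<inter> H \<subseteq> K \<longrightarrow> g \<in> H)"

abbreviation rat_ring :: "rat ring" where
  "rat_ring \<equiv> ring_of_type_algebra"

definition subgroup_avg :: "('g, 'b) monoid_scheme \<Rightarrow> 'g set \<Rightarrow> 'g \<Rightarrow> rat" where
  "subgroup_avg G L = (\<lambda>x\<in>carrier G. if x \<in> L then 1 / of_nat (card L) else 0)"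

definition minimal_normal_over ::
  "('g, 'b) monoid_scheme \<Rightarrow> 'g set \<Rightarrow> 'g set \<Rightarrow> 'g set set" where
  "minimal_normal_over G H K =
     {L. L \<lhd> G\<lparr>carrier := H\<rparr> \<and> K \<subset> L \<and>
         (\<forall>M. M \<lhd> G\<lparr>carrier := H\<rparr> \<longrightarrow> K \<subset> M \<longrightarrow> M \<subseteq> L \<longrightarrow> M = L)}"

text \<open>The product is taken in the center of \<open>\<rat>H\<close>, which contains all the factors: \<open>finprod\<close> needs
  a commutative monoid.\<close>

definition shoda_eps :: "('g, 'b) monoid_scheme \<Rightarrow> 'g set \<Rightarrow> 'g set \<Rightarrow> 'g \<Rightarrow> rat" where
  "shoda_eps G H K =
     (if H = K then subgroup_avg G K
      else \<Otimes>\<^bsub>center_ring (sub_group_ring rat_ring G H)\<^esub>L\<in>minimal_normal_over G H K.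
             (subgroup_avg G K \<ominus>\<^bsub>group_ring rat_ring G\<^esub> subgroup_avg G L))"

definition maximal_abelian_subgroup :: "'q set \<Rightarrow> ('q, 'b) monoid_scheme \<Rightarrow> bool" where
  "maximal_abelian_subgroup A Q \<longleftrightarrow>
     subgroup A Q \<and> comm_group (Q\<lparr>carrier := A\<rparr>) \<and>
     (\<forall>B. subgroup B Q \<longrightarrow> comm_group (Q\<lparr>carrier := B\<rparr>) \<longrightarrow> A \<subseteq> B \<longrightarrow> B = A)"

definition strong_shoda_pair :: "('g, 'b) monoid_scheme \<Rightarrow> 'g set \<Rightarrow> 'g set \<Rightarrow> bool" where
  "strong_shoda_pair G H K \<longleftrightarrow>
     shoda_pair G H K \<and>
     K \<subseteq> H \<and> H \<lhd> G\<lparr>carrier := normalizer G K\<rparr> \<and>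
     cyclic_group (subquotient G H K) \<and>
     maximal_abelian_subgroup (carrier (subquotient G H K)) (subquotient G (normalizer G K) K) \<and>
     (\<forall>g\<in>carrier G - normalizer G K.
        shoda_eps G H K \<otimes>\<^bsub>group_ring rat_ring G\<^esub> gr_conj rat_ring G g (shoda_eps G H K)
          = \<zero>\<^bsub>group_ring rat_ring G\<^esub>)"

section \<open>Galois groups\<close>

text \<open>Automorphisms of \<open>E\<close> fixing \<open>F\<close>. They are taken extensional, so that each automorphism is
  represented by exactly one function.\<close>

definition galois_group :: "'a ring \<Rightarrow> 'a set \<Rightarrow> ('a \<Rightarrow> 'a) set" where
  "galois_group E F =
     {\<theta> \<in> ring_iso E E. \<theta> \<in> extensional (carrier E) \<and> (\<forall>y\<in>F. \<theta> y = y)}"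

section \<open>Characters in characteristic p and cyclotomic classes\<close>

definition is_closure_of_prime_field :: "'k :: alg_closed_field itself \<Rightarrow> nat \<Rightarrow> bool" where
  "is_closure_of_prime_field TYPE('k) p \<longleftrightarrow>
     CHAR('k) = p \<and>
     (\<forall>y::'k. \<exists>f::'k poly. f \<noteq> 0 \<and> (\<forall>i. poly.coeff f i \<in> range of_int) \<and> poly f y = 0)"

definition primitive_root_of_unity :: "nat \<Rightarrow> 'k :: field \<Rightarrow> bool" where
  "primitive_root_of_unity k \<zeta> \<longleftrightarrow> 0 < k \<and> \<zeta> ^ k = 1 \<and> (\<forall>j. 0 < j \<and> j < k \<longrightarrow> \<zeta> ^ j \<noteq> 1)"

text \<open>\<open>\<F>\<^sub>p\<close> and \<open>\<F>\<^sub>p(\<zeta>)\<close> as subfields of \<open>'k\<close>.\<close>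

abbreviation prime_subfield :: "'k :: field set" where
  "prime_subfield \<equiv> generate_field ring_of_type_algebra {}"

definition cyclotomic_field :: "'k :: field \<Rightarrow> 'k ring" where
  "cyclotomic_field \<zeta> =
     ring_of_type_algebra\<lparr>carrier := generate_field ring_of_type_algebra {\<zeta>}\<rparr>"

abbreviation cyclotomic_galois :: "'k :: field \<Rightarrow> ('k \<Rightarrow> 'k) set" where
  "cyclotomic_galois \<zeta> \<equiv> galois_group (cyclotomic_field \<zeta>) prime_subfield"

text \<open>The trace of the Galois extension \<open>\<F>\<^sub>p(\<zeta>)/\<F>\<^sub>p\<close>.\<close>

definition cyclotomic_trace :: "'k :: field \<Rightarrow> 'k \<Rightarrow> 'k" where
  "cyclotomic_trace \<zeta> y = (\<Sum>\<theta>\<in>cyclotomic_galois \<zeta>. \<theta> y)"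

definition irreducible_rep ::
  "('q, 'b) monoid_scheme \<Rightarrow> nat \<Rightarrow> ('q \<Rightarrow> 'k :: field mat) \<Rightarrow> bool" where
  "irreducible_rep Q n \<rho> \<longleftrightarrow>
     \<rho> \<in> hom Q (units_of (ring_mat TYPE('k) n ())) \<and> 0 < n \<and>
     (\<forall>W. VectorSpace.subspace class_ring W (module_vec TYPE('k) n) \<longrightarrow>
          (\<forall>g\<in>carrier Q. \<forall>v\<in>W. \<rho> g *\<^sub>v v \<in> W) \<longrightarrow>
          W = {0\<^sub>v n} \<or> W = carrier_vec n)"

definition irr_chars :: "('q, 'b) monoid_scheme \<Rightarrow> ('q \<Rightarrow> 'k :: field) set" where
  "irr_chars Q =
     {\<lambda>q\<in>carrier Q. \<Sum>i<n. \<rho> q $$ (i, i) | n \<rho>. irreducible_rep Q n \<rho>}"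

text \<open>For a cyclic \<open>Q\<close> of order prime to \<open>p\<close>, \<open>irr_chars Q\<close> is a group under pointwise
  multiplication.\<close>

definition irr_chars_generator :: "('q, 'b) monoid_scheme \<Rightarrow> ('q \<Rightarrow> 'k :: field) \<Rightarrow> bool" where
  "irr_chars_generator Q \<chi> \<longleftrightarrow>
     \<chi> \<in> irr_chars Q \<and> (\<forall>\<psi>\<in>irr_chars Q. \<exists>j::nat. \<psi> = (\<lambda>q\<in>carrier Q. \<chi> q ^ j))"

definition galois_orbit ::
  "('q, 'b) monoid_scheme \<Rightarrow> 'k :: field \<Rightarrow> ('q \<Rightarrow> 'k) \<Rightarrow> ('q \<Rightarrow> 'k) set" where
  "galois_orbit Q \<zeta> \<chi> = {\<lambda>q\<in>carrier Q. \<theta> (\<chi> q) | \<theta>. \<theta> \<in> cyclotomic_galois \<zeta>}"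

definition cyclotomic_classes ::
  "('q, 'b) monoid_scheme \<Rightarrow> 'k :: field \<Rightarrow> ('q \<Rightarrow> 'k) set set" where
  "cyclotomic_classes Q \<zeta> =
     {\<C>. (\<exists>\<chi>\<in>irr_chars Q. \<C> = galois_orbit Q \<zeta> \<chi>) \<and> (\<exists>\<psi>\<in>\<C>. irr_chars_generator Q \<psi>)}"

section \<open>The idempotents\<close>

abbreviation Zmod :: "nat \<Rightarrow> nat \<Rightarrow> int ring" where
  "Zmod p r \<equiv> residue_ring (int p ^ r)"

text \<open>An element of the prime subfield as an integer in \<open>{0..<p}\<close>. Since \<open>{0..<p}\<close> is also a subset
  of the carrier of \<open>Zmod p r\<close>, this regards it as an element of \<open>\<int>/p\<^sup>r\<close> as well.\<close>

definition residue_of :: "nat \<Rightarrow> 'k :: field \<Rightarrow> int" where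
  "residue_of p y = (THE c. 0 \<le> c \<and> c < int p \<and> of_int c = y)"

text \<open>The coefficient at \<open>x = h\<inverse>\<close> is \<open>|H|\<inverse> tr (\<chi>(hK))\<close>. The trace is invariant under
  \<open>cyclotomic_galois \<zeta>\<close>, so the choice of \<open>\<chi>\<close> in \<open>\<C>\<close> is immaterial.\<close>

definition eps_C :: "nat \<Rightarrow> ('g, 'b) monoid_scheme \<Rightarrow> 'g set \<Rightarrow> 'g set \<Rightarrow> 'k :: field \<Rightarrow>
    ('g set \<Rightarrow> 'k) set \<Rightarrow> 'g \<Rightarrow> int" where
  "eps_C p G H K \<zeta> \<C> =
     (\<lambda>x\<in>carrier G.
        if x \<in> H
        then residue_of p (inverse (of_nat (card H)) *
               cyclotomic_trace \<zeta> ((SOME \<chi>. \<chi> \<in> \<C>) (K #>\<^bsub>G\<^esub> inv\<^bsub>G\<^esub> x)))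
        else 0)"

text \<open>\<open>eps_C\<close> is idempotent modulo \<open>p\<close> and in general only \<open>\<epsilon>\<^sup>2 - \<epsilon>\<close> is nilpotent in \<open>(\<int>/p\<^sup>r)H\<close>;
  its nilpotency index is the exponent with which \<open>(1 - (1 - \<epsilon>)\<^sup>n)\<^sup>n\<close> is idempotent.\<close>

definition nilpotency_index :: "'a ring \<Rightarrow> 'a \<Rightarrow> nat" where
  "nilpotency_index A e = (LEAST n. (e \<otimes>\<^bsub>A\<^esub> e \<ominus>\<^bsub>A\<^esub> e) [^]\<^bsub>A\<^esub> n = \<zero>\<^bsub>A\<^esub>)"

definition lifted_idempotent :: "'a ring \<Rightarrow> 'a \<Rightarrow> 'a" where
  "lifted_idempotent A e =
     (let n = nilpotency_index A e in
      (\<Oplus>\<^bsub>A\<^esub>s\<in>{1..n}.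
         [((-1) ^ (s - 1) * int (n choose s))] \<cdot>\<^bsub>A\<^esub> (e [^]\<^bsub>A\<^esub> s)) [^]\<^bsub>A\<^esub> n)"

definition omega_C :: "nat \<Rightarrow> nat \<Rightarrow> ('g, 'b) monoid_scheme \<Rightarrow> 'g set \<Rightarrow> 'g set \<Rightarrow> 'k :: field \<Rightarrow>
    ('g set \<Rightarrow> 'k) set \<Rightarrow> 'g \<Rightarrow> int" where
  "omega_C p r G H K \<zeta> \<C> =
     lifted_idempotent (sub_group_ring (Zmod p r) G H) (eps_C p G H K \<zeta> \<C>)"

definition sum_of_conjugates ::
  "('r, 'x) ring_scheme \<Rightarrow> ('g, 'b) monoid_scheme \<Rightarrow> ('g \<Rightarrow> 'r) \<Rightarrow> 'g \<Rightarrow> 'r" where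
  "sum_of_conjugates Z G f =
     (\<Oplus>\<^bsub>group_ring Z G\<^esub>e\<in>(\<lambda>g. gr_conj Z G g f) ` carrier G. e)"

section \<open>Bases, normal elements and crossed products\<close>

definition left_basis :: "'a ring \<Rightarrow> 'a set \<Rightarrow> 'i set \<Rightarrow> ('i \<Rightarrow> 'a) \<Rightarrow> bool" where
  "left_basis A B I v \<longleftrightarrow>
     finite I \<and> v \<in> I \<rightarrow> carrier A \<and>
     (\<forall>y\<in>carrier A. \<exists>!c. c \<in> I \<rightarrow>\<^sub>E B \<and> y = (\<Oplus>\<^bsub>A\<^esub>i\<in>I. c i \<otimes>\<^bsub>A\<^esub> v i))"

definition normal_element :: "'a ring \<Rightarrow> 'a ring \<Rightarrow> 'a \<Rightarrow> bool" where
  "normal_element R S \<beta> \<longleftrightarrow>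
     \<beta> \<in> carrier R \<and>
     left_basis R (carrier S) {\<theta> \<beta> | \<theta>. \<theta> \<in> galois_group R (carrier S)} (\<lambda>b. b)"

text \<open>\<open>A\<close> is the crossed product of \<open>Q\<close> over its subring \<open>R\<close> with respect to the basis \<open>z\<close>, with
  action \<open>act\<close> and twisting \<open>tw\<close>; the associativity relations hold because \<open>A\<close> is a ring.\<close>

definition crossed_product ::
  "'a ring \<Rightarrow> 'a ring \<Rightarrow> ('q, 'b) monoid_scheme \<Rightarrow> ('q \<Rightarrow> 'a) \<Rightarrow>
   ('q \<Rightarrow> 'a \<Rightarrow> 'a) \<Rightarrow> ('q \<Rightarrow> 'q \<Rightarrow> 'a) \<Rightarrow> bool" where
  "crossed_product A R Q z act tw \<longleftrightarrow>
     ring A \<and> group Q \<and> subring (carrier R) A \<and>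
     left_basis A (carrier R) (carrier Q) z \<and>
     (\<forall>g\<in>carrier Q. act g \<in> ring_iso R R) \<and>
     (\<forall>g\<in>carrier Q. \<forall>h\<in>carrier Q. tw g h \<in> Units R) \<and>
     (\<forall>g\<in>carrier Q. \<forall>y\<in>carrier R. y \<otimes>\<^bsub>A\<^esub> z g = z g \<otimes>\<^bsub>A\<^esub> act g y) \<and>
     (\<forall>g\<in>carrier Q. \<forall>h\<in>carrier Q. z g \<otimes>\<^bsub>A\<^esub> z h = z (g \<otimes>\<^bsub>Q\<^esub> h) \<otimes>\<^bsub>A\<^esub> tw g h)"

section \<open>Galois rings\<close>

text \<open>\<open>A\<close> is the Galois ring \<open>(\<int>/p\<^sup>r)[x]/(h)\<close>, with \<open>h\<close> monic of degree \<open>d\<close> and irreducible modulo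
  \<open>p\<close>. In \<open>poly_ring\<close> polynomials are coefficient lists, leading coefficient first.\<close>

definition is_galois_ring :: "nat \<Rightarrow> nat \<Rightarrow> nat \<Rightarrow> 'a ring \<Rightarrow> bool" where
  "is_galois_ring p r d A \<longleftrightarrow>
     (\<exists>h\<in>carrier (poly_ring (Zmod p r)).
        length h = Suc d \<and> hd h = 1 \<and>
        ring_irreducible\<^bsub>poly_ring (residue_ring (int p))\<^esub> (map (\<lambda>c. c mod int p) h) \<and>
        A \<simeq> poly_ring (Zmod p r) Quot (PIdl\<^bsub>poly_ring (Zmod p r)\<^esub> h))"

text \<open>The Frobenius automorphism of a Galois ring \<open>R\<close> is its unique automorphism inducing
  \<open>y \<mapsto> y\<^sup>p\<close> modulo \<open>p\<close>. For \<open>r > 1\<close> the literal power map is not additive; \<open>galois_pow R p j y\<close>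
  is \<open>y\<close> to the power \<open>p\<^sup>j\<close> in the exponential notation for the Frobenius action. It is the literal
  power if \<open>r = 1\<close>, and also if \<open>y\<close> is a Teichmueller element (zero or of order prime to \<open>p\<close>).\<close>

definition galois_frobenius :: "'a ring \<Rightarrow> nat \<Rightarrow> 'a \<Rightarrow> 'a" where
  "galois_frobenius R p =
     (THE \<theta>. \<theta> \<in> ring_iso R R \<and> \<theta> \<in> extensional (carrier R) \<and>
        (\<forall>y\<in>carrier R. \<exists>w\<in>carrier R. \<theta> y \<ominus>\<^bsub>R\<^esub> y [^]\<^bsub>R\<^esub> p = [p] \<cdot>\<^bsub>R\<^esub> w))"

definition galois_pow :: "'a ring \<Rightarrow> nat \<Rightarrow> nat \<Rightarrow> 'a \<Rightarrow> 'a" where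
  "galois_pow R p j = galois_frobenius R p ^^ j"

text \<open>Rows and columns are numbered from \<open>0\<close>; \<open>d\<close> is the exponent \<open>l\<^sub>(\<^sub>H\<^sub>,\<^sub>K\<^sub>)\<close>.\<close>

definition normal_system ::
  "'a ring \<Rightarrow> nat \<Rightarrow> nat \<Rightarrow> nat \<Rightarrow> 'a \<Rightarrow> (nat \<Rightarrow> 'a) \<Rightarrow> bool" where
  "normal_system R p d l \<beta> \<alpha>s \<longleftrightarrow>
     (\<forall>k<l. (\<Oplus>\<^bsub>R\<^esub>i\<in>{..<l}. galois_pow R p (((k + i) mod l) * d) \<beta> \<otimes>\<^bsub>R\<^esub> \<alpha>s i) =
        (if k = 0 then (\<Oplus>\<^bsub>R\<^esub>i\<in>{1..l}. galois_pow R p (i * d) \<beta>)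
         else \<beta> \<ominus>\<^bsub>R\<^esub> galois_pow R p (k * d) \<beta>))"

section \<open>Matrix rings and elementary matrices\<close>

definition matrix_ring :: "'a ring \<Rightarrow> nat \<Rightarrow> 'a mat ring" where
  "matrix_ring S n = \<lparr>
     carrier = {M \<in> carrier_mat n n. elements_mat M \<subseteq> carrier S},
     monoid.mult = (\<lambda>M N. mat n n (\<lambda>(i, j). \<Oplus>\<^bsub>S\<^esub>k\<in>{..<n}. M $$ (i, k) \<otimes>\<^bsub>S\<^esub> N $$ (k, j))),
     monoid.one = mat n n (\<lambda>(i, j). if i = j then \<one>\<^bsub>S\<^esub> else \<zero>\<^bsub>S\<^esub>),
     ring.zero = mat n n (\<lambda>_. \<zero>\<^bsub>S\<^esub>),
     ring.add = (\<lambda>M N. mat n n (\<lambda>(i, j). M $$ (i, j) \<oplus>\<^bsub>S\<^esub> N $$ (i, j)))\<rparr>"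

text \<open>\<open>I + aE\<^sub>i\<^sub>j\<close>.\<close>

definition elementary_matrix :: "'a ring \<Rightarrow> nat \<Rightarrow> 'a \<Rightarrow> nat \<Rightarrow> nat \<Rightarrow> 'a mat" where
  "elementary_matrix S n a i j =
     \<one>\<^bsub>matrix_ring S n\<^esub> \<oplus>\<^bsub>matrix_ring S n\<^esub>
       mat n n (\<lambda>(s, t). if s = i \<and> t = j then a else \<zero>\<^bsub>S\<^esub>)"

definition complete_elementary_set :: "'b ring \<Rightarrow> 'a ring \<Rightarrow> nat \<Rightarrow> 'b set \<Rightarrow> bool" where
  "complete_elementary_set B S n Y \<longleftrightarrow>
     (\<exists>\<psi>\<in>ring_iso B (matrix_ring S n).
        Y \<subseteq> carrier B \<and>
        \<psi> ` Y = {elementary_matrix S n a i j | a i j. a \<in> carrier S \<and> i < n \<and> j < n})"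

definition right_transversal ::
  "('g, 'b) monoid_scheme \<Rightarrow> 'g set \<Rightarrow> nat \<Rightarrow> (nat \<Rightarrow> 'g) \<Rightarrow> bool" where
  "right_transversal G C m t \<longleftrightarrow>
     t \<in> {1..m} \<rightarrow> carrier G \<and> bij_betw (\<lambda>i. C #>\<^bsub>G\<^esub> t i) {1..m} (rcosets\<^bsub>G\<^esub> C)"

text \<open>The scalar of \<open>(\<int>/p\<^sup>r)Gw\<close> given by \<open>s\<close> in \<open>S\<close>: the center of \<open>(\<int>/p\<^sup>r)Gw\<close> is the image of the
  center \<open>S\<close> of \<open>(\<int>/p\<^sup>r)C\<omega>\<close> under \<open>s \<mapsto> \<Sum>\<^sub>i t\<^sub>i\<inverse> s t\<^sub>i\<close>, and it is through this identification that
  \<open>(\<int>/p\<^sup>r)Gw\<close> is an \<open>S\<close>-algebra.\<close>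

definition central_scalar ::
  "('r, 'x) ring_scheme \<Rightarrow> ('g, 'b) monoid_scheme \<Rightarrow> nat \<Rightarrow> (nat \<Rightarrow> 'g) \<Rightarrow> ('g \<Rightarrow> 'r) \<Rightarrow> 'g \<Rightarrow> 'r"
  where
  "central_scalar Z G m t s = (\<Oplus>\<^bsub>group_ring Z G\<^esub>i\<in>{1..m}. gr_conj Z G (t i) s)"

end

theory Submission imports Defs "Jordan_Normal_Form.Char_Poly" begin

text \<open>Throughout, \<open>G\<close> is a finite group, \<open>\<omega>\<close> the lifted idempotent of a strong Shoda pair \<open>(H, K)\<close> and
  \<open>C\<close> its centralizer; \<open>R\<close> and \<open>A\<close> are the corners of \<open>(\<int>/p\<^sup>r)H\<close> and \<open>(\<int>/p\<^sup>r)C\<close> at \<open>\<omega>\<close>, and \<open>S\<close> is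
  the center of \<open>A\<close>. The matrix units are built in three layers.

  The ring \<open>R\<close>. A character in the cyclotomic class extends to a ring homomorphism \<open>char_ring\<close> from
  \<open>(\<int>/p\<^sup>r)H\<close> to \<open>\<F>\<^sub>p(\<zeta>)\<close>. It maps \<open>\<omega>\<close> to \<open>1\<close>, and on \<open>R\<close> its kernel consists of the multiples of \<open>p\<close>.
  So \<open>R\<close> is local, and an element with nonzero character value is a unit (\<open>unit_if_char_nonzero\<close>).
  Moreover \<open>R\<close> is spanned by the elements \<open>h\<omega>\<close>, whose orders are prime to \<open>p\<close>, so that its ring
  endomorphisms are determined modulo \<open>p\<close> (\<open>ring_endo_rigid\<close>). This identifies the Frobenius
  automorphism of \<open>R\<close> and shows that a nontrivial automorphism moves some element by a unit
  (\<open>T_regular\<close>).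

  The conjugates of \<open>\<omega>\<close>. If \<open>g\<close> is not in \<open>C\<close> then \<open>\<omega>\<close> and its conjugate by \<open>g\<close> are orthogonal
  (\<open>omega_orthogonal\<close>). Inside the normalizer of \<open>K\<close> this holds because \<open>R\<close> has no idempotents other
  than \<open>0\<close> and \<open>\<omega>\<close>. Outside of it, the last condition on a strong Shoda pair says that a rational
  idempotent is orthogonal to its conjugate; a multiple of it by an integer prime to \<open>p\<close> reduces modulo
  \<open>p\<^sup>r\<close> to an element that becomes a unit in \<open>R\<close>. Hence the elements \<open>t\<^sub>u\<^sup>-\<^sup>1 f t\<^sub>v\<close> with \<open>f\<close> in \<open>A\<close> multiply
  like the entries of matrices of size \<open>m\<close> over \<open>A\<close>, and the sum \<open>w\<close> of the conjugates is the identity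
  matrix.

  The crossed product \<open>A\<close>. As \<open>\<gamma>\<^sup>l = 1\<close>, the element \<open>E = (1 + \<gamma> + \<dots> + \<gamma>\<^sup>l\<^sup>-\<^sup>1)/l\<close> is an idempotent with
  \<open>\<gamma>E = E\<close>, and \<open>A\<close> acts faithfully on \<open>AE = RE\<close>. The elements \<open>\<beta>\<^sub>kE\<close> with \<open>\<beta>\<^sub>k = \<gamma>\<^sup>k\<beta>\<gamma>\<^sup>-\<^sup>k\<close> span this module
  over \<open>S\<close>. The system of the theorem asks that \<open>\<alpha>\<beta>\<^sub>0E = tr(\<beta>)E\<close> and \<open>\<alpha>\<beta>\<^sub>kE = (\<beta> - \<beta>\<^sub>k)E\<close> for \<open>k > 0\<close>. It
  is solvable by independence of the automorphisms (\<open>normal_system_solvable\<close>), and \<open>\<alpha>\<close> is a unit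
  because \<open>l\<close> is one. Since \<open>EyE = l\<^sup>-\<^sup>1 tr(y)E\<close> for \<open>y\<close> in \<open>R\<close> and \<open>tr(\<beta> - \<beta>\<^sub>k) = 0\<close>, the conjugate
  \<open>e = \<alpha>\<^sup>-\<^sup>1E\<alpha>\<close> fixes \<open>\<beta>\<^sub>0E\<close> and kills the other \<open>\<beta>\<^sub>kE\<close>. So the \<open>\<gamma>\<^sup>ie\<gamma>\<^sup>-\<^sup>i\<close> are the projections onto
  the lines \<open>S\<beta>\<^sub>iE\<close>, the elements \<open>\<gamma>\<^sup>ie\<gamma>\<^sup>-\<^sup>j\<close> are matrix units, and \<open>eAe = Se\<close> (\<open>matrix_units_exist\<close>).

  Placed in the blocks, they give matrix units of \<open>(\<int>/p\<^sup>r)Gw\<close> with scalars \<open>S\<close>. A ring with such matrix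
  units is a matrix ring (\<open>complete_elementary_set_units\<close>).\<close>

section \<open>Sums, finite rings and corners\<close>

lemma (in abelian_monoid) finsum_swap:
  assumes "finite I" "finite J" "\<And>i j. i \<in> I \<Longrightarrow> j \<in> J \<Longrightarrow> f i j \<in> carrier G"
  shows "(\<Oplus>i\<in>I. \<Oplus>j\<in>J. f i j) = (\<Oplus>j\<in>J. \<Oplus>i\<in>I. f i j)"
  using assms(1,3)
proof (induction I rule: finite_induct)
  case empty
  show ?case by (simp add: finsum_zero)
next
  case (insert i I)
  have "(\<Oplus>i'\<in>insert i I. \<Oplus>j\<in>J. f i' j) = (\<Oplus>j\<in>J. f i j) \<oplus> (\<Oplus>i\<in>I. \<Oplus>j\<in>J. f i j)"
    using insert by (subst finsum_insert) (auto intro!: finsum_closed)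
  also have "\<dots> = (\<Oplus>j\<in>J. f i j) \<oplus> (\<Oplus>j\<in>J. \<Oplus>i\<in>I. f i j)"
    using insert by simp
  also have "\<dots> = (\<Oplus>j\<in>J. f i j \<oplus> (\<Oplus>i\<in>I. f i j))"
    using insert by (subst finsum_addf) (auto intro!: finsum_closed)
  also have "\<dots> = (\<Oplus>j\<in>J. \<Oplus>i\<in>insert i I. f i j)"
    using insert by (intro finsum_cong') (auto simp: finsum_insert Pi_def intro!: finsum_closed)
  finally show ?case .
qed

lemma (in abelian_monoid) finsum_delta:
  assumes "finite I" "i \<in> I" "y \<in> carrier G" "\<And>j. j \<in> I \<Longrightarrow> f j = (if j = i then y else \<zero>)"
  shows "(\<Oplus>j\<in>I. f j) = y"
proof -
  have "(\<Oplus>j\<in>I. f j) = (\<Oplus>j\<in>I. if i = j then (\<lambda>_. y) j else \<zero>)"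
    using assms by (intro finsum_cong') auto
  also have "\<dots> = y"
    using assms by (subst finsum_singleton) auto
  finally show ?thesis .
qed

text \<open>\<open>finsum\<close> refers to the carrier of its ring, so that sums in a ring and in a subring have to be
  identified explicitly.\<close>

lemma finsum_subcarrier:
  assumes "abelian_monoid A" "abelian_monoid B" "carrier A \<subseteq> carrier B" "ring.add A = ring.add B" "ring.zero A = ring.zero B"
    and "f \<in> I \<rightarrow> carrier A"
  shows "finsum A f I = finsum B f I"
proof (cases "finite I")
  case True
  interpret A: abelian_monoid A by fact
  interpret B: abelian_monoid B by fact
  show ?thesis using True assms(6)
  proof (induction I rule: finite_induct)
    case (insert i I)
    have "f \<in> I \<rightarrow> carrier B" "f i \<in> carrier B" using insert assms(3) by auto
    then show ?case using insert assms(4) by (auto simp: A.finsum_insert B.finsum_insert Pi_def)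
  qed (simp add: assms)
next
  case False
  then show ?thesis
    using assms(5) abelian_monoid.finsum_infinite[OF assms(1) False, of f]
      abelian_monoid.finsum_infinite[OF assms(2) False, of f] by simp
qed

lemma a_inv_subcarrier:
  assumes "abelian_group A" "abelian_group B" "carrier A \<subseteq> carrier B" "ring.add A = ring.add B" "ring.zero A = ring.zero B"
    and "y \<in> carrier A"
  shows "\<ominus>\<^bsub>A\<^esub> y = \<ominus>\<^bsub>B\<^esub> y"
proof -
  interpret A: abelian_group A by fact
  interpret B: abelian_group B by fact
  have "\<ominus>\<^bsub>A\<^esub> y \<oplus>\<^bsub>B\<^esub> y = \<zero>\<^bsub>B\<^esub>" using A.l_neg[OF assms(6)] assms(4,5) by simp
  then show ?thesis using B.minus_equality assms A.a_inv_closed by (metis subsetD)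
qed

text \<open>Two of the powers of \<open>y\<close> agree, say \<open>y\<^sup>i = y\<^sup>i\<^sup>+\<^sup>d\<close>; from \<open>y\<^sup>i\<close> on they are periodic, and a multiple of
  the period beyond \<open>i\<close> is an exponent as required.\<close>

lemma (in monoid) finite_idempotent_power:
  assumes "finite (carrier G)" "y \<in> carrier G"
  shows "\<exists>n>0. y [^] n \<otimes> y [^] n = y [^] (n::nat)"
proof -
  have "\<not> inj_on (\<lambda>n::nat. y [^] n) UNIV"
    using assms finite_subset[of "range (\<lambda>n::nat. y [^] n)" "carrier G"]
    by (auto dest: finite_imageD)
  then obtain a b :: nat where ab: "a < b" "y [^] a = y [^] b"
    by (auto simp: inj_on_def) (metis linorder_neq_iff)
  define n where "n = b - a"
  have n: "n > 0" "y [^] (a + n) = y [^] a" using ab by (auto simp: n_def)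
  have step: "y [^] (a + i + n) = y [^] (a + i)" for i
  proof -
    have "y [^] (a + i + n) = y [^] (a + n) \<otimes> y [^] i"
      using assms(2) by (simp add: nat_pow_mult add_ac)
    then show ?thesis using n(2) assms(2) by (simp add: nat_pow_mult)
  qed
  have mult: "y [^] (a + i + j * n) = y [^] (a + i)" for i j
  proof (induction j)
    case (Suc j)
    have "y [^] (a + i + Suc j * n) = y [^] (a + (i + j * n) + n)" by (simp add: algebra_simps)
    also have "\<dots> = y [^] (a + i + j * n)" by (subst step) (simp add: add.assoc)
    finally show ?case using Suc by simp
  qed simp
  have "a \<le> Suc a * n" using n(1) by (cases n) auto
  then obtain i where i: "Suc a * n = a + i" by (metis le_Suc_ex)
  have "y [^] (Suc a * n + Suc a * n) = y [^] (a + i + Suc a * n)" unfolding i ..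
  also have "\<dots> = y [^] (Suc a * n)" using mult[of i "Suc a"] i by simp
  finally have "y [^] (Suc a * n) \<otimes> y [^] (Suc a * n) = y [^] (Suc a * n)"
    using assms(2) by (simp add: nat_pow_mult)
  then show ?thesis using n(1) by (intro exI[of _ "Suc a * n"]) simp
qed

text \<open>Right multiplication by such an element is injective, hence bijective on a finite ring.\<close>

lemma (in ring) finite_Units_if_right_regular:
  assumes "finite (carrier R)" "a \<in> carrier R"
    and reg: "\<And>b. b \<in> carrier R \<Longrightarrow> b \<otimes> a = \<zero> \<Longrightarrow> b = \<zero>"
  shows "a \<in> Units R"
proof -
  have inj: "inj_on (\<lambda>b. b \<otimes> a) (carrier R)"
  proof (rule inj_onI)
    fix b c assume bc: "b \<in> carrier R" "c \<in> carrier R" "b \<otimes> a = c \<otimes> a"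
    then have "(b \<ominus> c) \<otimes> a = \<zero>" using assms(2) by (simp add: a_minus_def l_distr l_minus r_neg)
    then show "b = c" using bc reg[of "b \<ominus> c"] by auto
  qed
  have "(\<lambda>b. b \<otimes> a) ` carrier R = carrier R"
    using assms by (intro endo_inj_surj inj) auto
  then have "\<one> \<in> (\<lambda>b. b \<otimes> a) ` carrier R" by simp
  then obtain b where b: "b \<in> carrier R" "b \<otimes> a = \<one>" by (elim imageE) simp
  have "(a \<otimes> b) \<otimes> a = \<one> \<otimes> a" using b assms(2) by (simp add: m_assoc)
  then have "a \<otimes> b = \<one>" using b assms(2) inj_onD[OF inj, of "a \<otimes> b" \<one>] by simp
  then show ?thesis using b assms(2) by (auto simp: Units_def)
qed

lemma corner_ring_carrier:
  fixes R (structure)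
  assumes "ring R" "e \<in> carrier R" "e \<otimes> e = e"
  shows "y \<in> carrier (corner_ring R e) \<longleftrightarrow> y \<in> carrier R \<and> y \<otimes> e = y"
proof -
  interpret ring R by fact
  show ?thesis using assms(2,3) by (force simp: corner_ring_def m_assoc)
qed

lemma corner_ring_simps [simp]:
  "monoid.mult (corner_ring B e) = monoid.mult B" "ring.add (corner_ring B e) = ring.add B"
  "monoid.one (corner_ring B e) = e" "ring.zero (corner_ring B e) = ring.zero B"
  by (simp_all add: corner_ring_def)

lemma corner_ring_is_ring:
  fixes R (structure)
  assumes "ring R" and e: "e \<in> carrier R" "e \<otimes> e = e" and central: "\<And>y. y \<in> carrier R \<Longrightarrow> e \<otimes> y = y \<otimes> e"
  shows "ring (corner_ring R e)"
proof -
  interpret ring R by fact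
  note [simp] = corner_ring_carrier[OF \<open>ring R\<close> e]
  show ?thesis
  proof (rule ringI)
    show "abelian_group (corner_ring R e)"
    proof (rule abelian_groupI)
      fix y assume "y \<in> carrier (corner_ring R e)"
      then show "\<exists>y'\<in>carrier (corner_ring R e). y' \<oplus>\<^bsub>corner_ring R e\<^esub> y = \<zero>\<^bsub>corner_ring R e\<^esub>"
        using e by (intro bexI[of _ "\<ominus> y"]) (auto simp: l_neg l_minus)
    qed (use e in \<open>auto simp: l_distr a_ac\<close>)
    show "monoid (corner_ring R e)"
    proof (rule monoidI)
      fix y assume "y \<in> carrier (corner_ring R e)"
      then show "\<one>\<^bsub>corner_ring R e\<^esub> \<otimes>\<^bsub>corner_ring R e\<^esub> y = y"
        using central[of y] by simp
    qed (use e in \<open>auto simp: m_assoc\<close>)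
  qed (use e in \<open>auto simp: l_distr r_distr\<close>)
qed

lemma corner_ring_pow:
  assumes "monoid A" "e \<in> carrier A" "y \<in> carrier A" "y \<otimes>\<^bsub>A\<^esub> e = y" "e \<otimes>\<^bsub>A\<^esub> y = y" "n > 0"
  shows "y [^]\<^bsub>corner_ring A e\<^esub> n = y [^]\<^bsub>A\<^esub> (n::nat)"
proof -
  interpret monoid A by fact
  have "y [^]\<^bsub>corner_ring A e\<^esub> Suc n = y [^]\<^bsub>A\<^esub> Suc n" for n
    by (induction n) (use assms in \<open>auto simp: nat_pow_def corner_ring_def\<close>)
  then show ?thesis using assms(6) by (metis Suc_pred)
qed

section \<open>Lifting idempotents\<close>

text \<open>Write \<open>q = 1 - e\<close>, so that \<open>U = 1 - q\<^sup>n\<close> is the alternating sum in the definition of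
  \<open>lifted_idempotent\<close>. It is divisible by \<open>e\<close>, while \<open>1 - U\<^sup>n = 1 - (1 - q\<^sup>n)\<^sup>n\<close> is divisible by \<open>q\<^sup>n\<close>;
  hence \<open>U\<^sup>n (1 - U\<^sup>n)\<close> is a multiple of \<open>(eq)\<^sup>n = 0\<close>.\<close>

definition lift_poly :: "nat \<Rightarrow> int poly" where
  "lift_poly n = 1 - [:1, -1:] ^ n"

lemma lift_poly_sum:
  "lift_poly n = (\<Sum>s\<in>{1..n}. Polynomial.smult ((-1) ^ (s - 1) * int (n choose s)) ([:0, 1:] ^ s))"
proof -
  have "[:1, -1:] = [:0, -1:] + (1::int poly)" by (simp add: one_pCons)
  then have "[:1, -1:] ^ n = (\<Sum>s\<le>n. of_nat (n choose s) * [:0, -1::int:] ^ s)"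
    using binomial_ring[of "[:0, -1:]" "1 :: int poly" n] by simp
  also have "\<dots> = 1 + (\<Sum>s\<in>{1..n}. of_nat (n choose s) * [:0, -1::int:] ^ s)"
  proof -
    have "{..n} = insert 0 {1..n}" by auto
    then show ?thesis by simp
  qed
  also have "(\<Sum>s\<in>{1..n}. of_nat (n choose s) * [:0, -1::int:] ^ s)
     = - (\<Sum>s\<in>{1..n}. Polynomial.smult ((-1) ^ (s - 1) * int (n choose s)) ([:0, 1:] ^ s))"
    unfolding sum_negf[symmetric]
  proof (rule sum.cong[OF refl])
    fix s assume "s \<in> {1..n}"
    then obtain s' where s: "s = Suc s'" by (cases s) auto
    have "[:0, -1::int:] = Polynomial.smult (-1) [:0, 1:]" by simp
    then have "[:0, -1::int:] ^ s = Polynomial.smult ((-1) ^ s) ([:0, 1:] ^ s)"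
      by (metis smult_power)
    then show "of_nat (n choose s) * [:0, -1::int:] ^ s
      = - Polynomial.smult ((-1) ^ (s - 1) * int (n choose s)) ([:0, 1:] ^ s)"
      by (simp add: s of_nat_poly mult.commute del: power_Suc)
  qed
  finally show ?thesis by (simp add: lift_poly_def)
qed

lemma X_dvd_lift_poly: "[:0, 1:] dvd lift_poly n"
proof -
  have "1 - [:1, -1:] dvd 1 ^ n - [:1, -1::int:] ^ n"
    unfolding power_diff_sumr2 by (rule dvd_triv_left)
  moreover have "1 - [:1, -1:] = [:0, 1::int:]" by (simp add: one_pCons)
  ultimately show ?thesis by (simp add: lift_poly_def)
qed

lemma lift_poly_idempotent_dvd:
  "([:0, 1:] * [:0, 1:] - [:0, 1:]) ^ n dvd lift_poly n ^ n * lift_poly n ^ n - lift_poly n ^ n"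
proof -
  let ?V = "[:1, -1::int:] ^ n" and ?X = "[:0, 1::int:]" and ?U = "lift_poly n ^ n"
  have "1 - (1 - ?V) dvd 1 ^ n - (1 - ?V) ^ n"
    unfolding power_diff_sumr2 by (rule dvd_triv_left)
  then have V: "?V dvd 1 - ?U" by (simp add: lift_poly_def)
  have "(?X * [:1, -1:]) ^ n dvd ?U * (1 - ?U)"
    unfolding power_mult_distrib by (intro mult_dvd_mono V dvd_power_same X_dvd_lift_poly)
  then obtain W where W: "?U * (1 - ?U) = (?X * [:1, -1:]) ^ n * W" by (elim dvdE)
  have X: "?X * ?X - ?X = - (?X * [:1, -1:])" by simp
  have "?U * ?U - ?U = - (?U * (1 - ?U))" by (simp add: right_diff_distrib)
  also have "\<dots> = ((-1) ^ n * (-1) ^ n) * (?X * [:1, -1:]) ^ n * - W"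
    unfolding W by (simp flip: power_mult_distrib)
  also have "\<dots> = (- (?X * [:1, -1:])) ^ n * ((-1) ^ n * - W)"
    by (subst power_minus) (simp only: mult_ac)
  finally show ?thesis unfolding X by (metis dvd_triv_left)
qed

text \<open>Integer polynomials in one element of a noncommutative ring form a commutative ring, in which
  the identities behind the lifting of idempotents are computed.\<close>

definition int_poly_eval :: "('a, 'b) ring_scheme \<Rightarrow> 'a \<Rightarrow> int poly \<Rightarrow> 'a" where
  "int_poly_eval A e P = fold_coeffs (\<lambda>c y. [c] \<cdot>\<^bsub>A\<^esub> \<one>\<^bsub>A\<^esub> \<oplus>\<^bsub>A\<^esub> e \<otimes>\<^bsub>A\<^esub> y) P \<zero>\<^bsub>A\<^esub>"

context ring
begin

lemma int_add_pow_0: "[(0::int)] \<cdot> y = \<zero>"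
  by (simp add: add_pow_def int_pow_def2)

lemma int_one_mult: fixes c :: int
  shows "y \<in> carrier R \<Longrightarrow> ([c] \<cdot> \<one>) \<otimes> y = [c] \<cdot> y"
  "y \<in> carrier R \<Longrightarrow> y \<otimes> ([c] \<cdot> \<one>) = [c] \<cdot> y"
  by (simp_all add: add_pow_ldistr_int add_pow_rdistr_int)

context
  fixes e assumes e [simp]: "e \<in> carrier R"
begin

lemma int_poly_eval_0 [simp]: "int_poly_eval R e 0 = \<zero>"
  by (simp add: int_poly_eval_def)

lemma int_poly_eval_pCons [simp]:
  "int_poly_eval R e (pCons c P) = [c] \<cdot> \<one> \<oplus> e \<otimes> int_poly_eval R e P"
  by (cases "c = 0 \<and> P = 0") (auto simp: int_poly_eval_def int_add_pow_0)

lemma int_poly_eval_closed [simp]: "int_poly_eval R e P \<in> carrier R"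
  by (induction P) auto

lemma int_poly_eval_add:
  "int_poly_eval R e (P + Q) = int_poly_eval R e P \<oplus> int_poly_eval R e Q"
  by (induction P Q rule: poly_induct2) (simp_all add: add.int_pow_mult r_distr a_ac)

lemma int_poly_eval_smult: "int_poly_eval R e (Polynomial.smult c P) = [c] \<cdot> int_poly_eval R e P"
proof (induction P)
  case (pCons a P)
  have "[c] \<cdot> ([a] \<cdot> \<one> \<oplus> e \<otimes> int_poly_eval R e P)
    = [c] \<cdot> \<one> \<otimes> ([a] \<cdot> \<one> \<oplus> e \<otimes> int_poly_eval R e P)"
    by (simp add: int_one_mult)
  also have "\<dots> = [(c * a)] \<cdot> \<one> \<oplus> e \<otimes> [c] \<cdot> int_poly_eval R e P"
    by (simp add: r_distr int_one_mult add.int_pow_pow mult.commute add_pow_rdistr_int)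
  finally show ?case using pCons by simp
qed (use int_one_mult(1)[of \<zero> c] in simp)

lemma int_poly_eval_commute:
  assumes "y \<in> carrier R" "y \<otimes> e = e \<otimes> y"
  shows "y \<otimes> int_poly_eval R e P = int_poly_eval R e P \<otimes> y"
proof (induction P)
  case (pCons a P)
  have "y \<otimes> (e \<otimes> int_poly_eval R e P) = (e \<otimes> int_poly_eval R e P) \<otimes> y"
    using assms pCons by (metis e int_poly_eval_closed m_assoc)
  then show ?case using assms pCons by (simp add: l_distr r_distr int_one_mult)
qed (use assms in simp)

lemma int_poly_eval_mult:
  "int_poly_eval R e (P * Q) = int_poly_eval R e P \<otimes> int_poly_eval R e Q"
  by (induction P)
    (simp_all add: int_poly_eval_add int_poly_eval_smult l_distr int_one_mult m_assoc int_add_pow_0)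

lemma int_poly_eval_1 [simp]: "int_poly_eval R e 1 = \<one>"
proof -
  have "int_poly_eval R e [:1:] = \<one>" by (simp only: int_poly_eval_pCons int_poly_eval_0) simp
  then show ?thesis by (simp only: one_pCons)
qed

lemma int_poly_eval_pow: "int_poly_eval R e (P ^ n) = int_poly_eval R e P [^] n"
proof (induction n)
  case (Suc n)
  then show ?case by (simp only: int_poly_eval_mult power_Suc nat_pow_Suc2 int_poly_eval_closed)
qed simp

lemma int_poly_eval_X: "int_poly_eval R e [:0, 1:] = e"
  by (simp only: int_poly_eval_pCons int_poly_eval_0) (simp add: int_add_pow_0)

lemma int_poly_eval_sum:
  "finite I \<Longrightarrow> int_poly_eval R e (\<Sum>i\<in>I. P i) = (\<Oplus>i\<in>I. int_poly_eval R e (P i))"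
  by (induction I rule: finite_induct) (simp_all add: int_poly_eval_add finsum_insert)

end

lemma int_poly_eval_diff:
  assumes [simp]: "e \<in> carrier R"
  shows "int_poly_eval R e (P - Q) = int_poly_eval R e P \<ominus> int_poly_eval R e Q"
proof -
  have "int_poly_eval R e P = int_poly_eval R e (P - Q) \<oplus> int_poly_eval R e Q"
    by (simp flip: int_poly_eval_add)
  then show ?thesis by (simp add: a_minus_def a_assoc r_neg)
qed

end

lemma lifted_idempotent_eq:
  fixes R (structure)
  assumes "ring R" "e \<in> carrier R"
  shows "lifted_idempotent R e
    = int_poly_eval R e (lift_poly (nilpotency_index R e) ^ nilpotency_index R e)"
proof -
  interpret ring R by fact
  have "int_poly_eval R e (lift_poly n)
    = (\<Oplus>s\<in>{1..n}. [((-1) ^ (s - 1) * int (n choose s))] \<cdot>\<^bsub>R\<^esub> (e [^] s))" for n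
    unfolding lift_poly_sum int_poly_eval_sum[OF assms(2) finite_atLeastAtMost]
      int_poly_eval_smult[OF assms(2)] int_poly_eval_pow[OF assms(2)] int_poly_eval_X[OF assms(2)] ..
  then show ?thesis
    unfolding lifted_idempotent_def Let_def int_poly_eval_pow[OF assms(2)] by simp
qed

lemma lifted_idempotent_idempotent:
  fixes R (structure)
  assumes "ring R" and e: "e \<in> carrier R" and nil: "(e \<otimes> e \<ominus> e) [^] (n::nat) = \<zero>"
  shows "lifted_idempotent R e \<otimes> lifted_idempotent R e = lifted_idempotent R e"
proof -
  interpret ring R by fact
  define N where "N = nilpotency_index R e"
  let ?ev = "int_poly_eval R e"
  have "(e \<otimes> e \<ominus> e) [^] N = \<zero>"
    unfolding N_def nilpotency_index_def using nil by (rule LeastI)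
  then have 0: "?ev (([:0, 1:] * [:0, 1:] - [:0, 1:]) ^ N) = \<zero>"
    by (simp only: int_poly_eval_pow[OF e] int_poly_eval_diff[OF e] int_poly_eval_mult[OF e] int_poly_eval_X[OF e])
  obtain W where "lift_poly N ^ N * lift_poly N ^ N - lift_poly N ^ N = ([:0, 1:] * [:0, 1:] - [:0, 1:]) ^ N * W"
    using lift_poly_idempotent_dvd[of N] by (auto elim: dvdE)
  then have "?ev (lift_poly N ^ N * lift_poly N ^ N - lift_poly N ^ N) = \<zero>"
    using 0 e by (simp only: int_poly_eval_mult int_poly_eval_closed l_null)
  then show ?thesis
    unfolding lifted_idempotent_eq[OF \<open>ring R\<close> e] N_def[symmetric]
    using e by (simp add: int_poly_eval_mult int_poly_eval_diff)
qed

section \<open>Group rings\<close>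

locale finite_group_ring = group G + Z: cring Z
  for G :: "('g, 'b) monoid_scheme" (structure) and Z :: "('r, 'x) ring_scheme" +
  assumes fin [simp]: "finite (carrier G)"
begin

abbreviation "ZG \<equiv> group_ring Z G"
abbreviation "\<delta> \<equiv> group_elt Z G"

lemma gr_carrier: "f \<in> carrier ZG \<longleftrightarrow> f \<in> carrier G \<rightarrow>\<^sub>E carrier Z"
  by (simp add: group_ring_def)

lemma gr_closed [simp]: "f \<in> carrier ZG \<Longrightarrow> x \<in> carrier G \<Longrightarrow> f x \<in> carrier Z"
  by (auto simp: gr_carrier)

lemma gr_ext:
  assumes "f \<in> carrier ZG" "h \<in> carrier ZG" "\<And>x. x \<in> carrier G \<Longrightarrow> f x = h x"
  shows "f = h"
  using assms by (auto simp: gr_carrier intro: PiE_ext)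

lemma gr_mult_apply:
  "x \<in> carrier G \<Longrightarrow> (f \<otimes>\<^bsub>ZG\<^esub> h) x = (\<Oplus>\<^bsub>Z\<^esub>y\<in>carrier G. f y \<otimes>\<^bsub>Z\<^esub> h (inv y \<otimes> x))"
  by (simp add: group_ring_def)

lemma gr_add_apply: "x \<in> carrier G \<Longrightarrow> (f \<oplus>\<^bsub>ZG\<^esub> h) x = f x \<oplus>\<^bsub>Z\<^esub> h x"
  by (simp add: group_ring_def)

lemma gr_zero_apply: "x \<in> carrier G \<Longrightarrow> \<zero>\<^bsub>ZG\<^esub> x = \<zero>\<^bsub>Z\<^esub>"
  by (simp add: group_ring_def)

lemma gr_one_eq: "\<one>\<^bsub>ZG\<^esub> = \<delta> \<one>"
  by (simp add: group_ring_def group_elt_def)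

lemma gr_elt_apply: "x \<in> carrier G \<Longrightarrow> \<delta> g x = (if x = g then \<one>\<^bsub>Z\<^esub> else \<zero>\<^bsub>Z\<^esub>)"
  by (simp add: group_elt_def)

lemma gr_elt_closed [simp]: "\<delta> g \<in> carrier ZG"
  by (auto simp: gr_carrier group_elt_def)

lemma finsum_translate:
  assumes "F \<in> carrier G \<rightarrow> carrier Z" "g \<in> carrier G"
  shows "(\<Oplus>\<^bsub>Z\<^esub>y\<in>carrier G. F (g \<otimes> y)) = (\<Oplus>\<^bsub>Z\<^esub>y\<in>carrier G. F y)"
proof -
  have "(\<lambda>y. g \<otimes> y) ` carrier G = carrier G" by (rule surj_const_mult[OF assms(2)])
  then show ?thesis
    using Z.finsum_reindex[of F "\<lambda>y. g \<otimes> y" "carrier G"] assms inj_on_cmult by simp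
qed

lemma gr_mult_closed:
  assumes "f \<in> carrier ZG" "h \<in> carrier ZG"
  shows "f \<otimes>\<^bsub>ZG\<^esub> h \<in> carrier ZG"
  unfolding gr_carrier
proof (rule PiE_I)
  fix x assume "x \<in> carrier G"
  then show "(f \<otimes>\<^bsub>ZG\<^esub> h) x \<in> carrier Z"
    using assms by (simp add: gr_mult_apply Z.finsum_closed Pi_def)
qed (simp add: group_ring_def)

lemma gr_add_closed:
  assumes "f \<in> carrier ZG" "h \<in> carrier ZG"
  shows "f \<oplus>\<^bsub>ZG\<^esub> h \<in> carrier ZG"
  unfolding gr_carrier
proof (rule PiE_I)
  fix x assume "x \<in> carrier G"
  then show "(f \<oplus>\<^bsub>ZG\<^esub> h) x \<in> carrier Z"
    using assms by (simp add: gr_add_apply)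
qed (simp add: group_ring_def)

lemma gr_zero_closed: "\<zero>\<^bsub>ZG\<^esub> \<in> carrier ZG"
  by (simp add: group_ring_def)

lemma gr_mult_assoc:
  assumes f: "f \<in> carrier ZG" and h: "h \<in> carrier ZG" and k: "k \<in> carrier ZG"
  shows "(f \<otimes>\<^bsub>ZG\<^esub> h) \<otimes>\<^bsub>ZG\<^esub> k = f \<otimes>\<^bsub>ZG\<^esub> (h \<otimes>\<^bsub>ZG\<^esub> k)"
proof (rule gr_ext)
  fix x assume x: "x \<in> carrier G"
  have "((f \<otimes>\<^bsub>ZG\<^esub> h) \<otimes>\<^bsub>ZG\<^esub> k) x
    = (\<Oplus>\<^bsub>Z\<^esub>y\<in>carrier G. (\<Oplus>\<^bsub>Z\<^esub>u\<in>carrier G. f u \<otimes>\<^bsub>Z\<^esub> h (inv u \<otimes> y)) \<otimes>\<^bsub>Z\<^esub> k (inv y \<otimes> x))"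
    using x f h k by (simp only: gr_mult_apply) (intro Z.finsum_cong' refl, auto simp: gr_mult_apply
        intro!: Z.finsum_closed Z.m_closed)
  also have "\<dots> = (\<Oplus>\<^bsub>Z\<^esub>y\<in>carrier G. \<Oplus>\<^bsub>Z\<^esub>u\<in>carrier G. f u \<otimes>\<^bsub>Z\<^esub> h (inv u \<otimes> y) \<otimes>\<^bsub>Z\<^esub> k (inv y \<otimes> x))"
    using x f h k by (intro Z.finsum_cong' refl Z.finsum_ldistr) (auto intro!: Z.finsum_closed)
  also have "\<dots> = (\<Oplus>\<^bsub>Z\<^esub>u\<in>carrier G. \<Oplus>\<^bsub>Z\<^esub>y\<in>carrier G. f u \<otimes>\<^bsub>Z\<^esub> h (inv u \<otimes> y) \<otimes>\<^bsub>Z\<^esub> k (inv y \<otimes> x))"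
    using x f h k by (intro Z.finsum_swap) auto
  also have "\<dots> = (\<Oplus>\<^bsub>Z\<^esub>u\<in>carrier G. f u \<otimes>\<^bsub>Z\<^esub> (h \<otimes>\<^bsub>ZG\<^esub> k) (inv u \<otimes> x))"
  proof (intro Z.finsum_cong' refl)
    fix u assume u: "u \<in> carrier G"
    have "(\<Oplus>\<^bsub>Z\<^esub>y\<in>carrier G. f u \<otimes>\<^bsub>Z\<^esub> h (inv u \<otimes> y) \<otimes>\<^bsub>Z\<^esub> k (inv y \<otimes> x))
      = (\<Oplus>\<^bsub>Z\<^esub>y\<in>carrier G. f u \<otimes>\<^bsub>Z\<^esub> h (inv u \<otimes> (u \<otimes> y)) \<otimes>\<^bsub>Z\<^esub> k (inv (u \<otimes> y) \<otimes> x))"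
      using f h k x u
      by (intro finsum_translate[of "\<lambda>y. f u \<otimes>\<^bsub>Z\<^esub> h (inv u \<otimes> y) \<otimes>\<^bsub>Z\<^esub> k (inv y \<otimes> x)", symmetric]) auto
    also have "\<dots> = (\<Oplus>\<^bsub>Z\<^esub>y\<in>carrier G. f u \<otimes>\<^bsub>Z\<^esub> (h y \<otimes>\<^bsub>Z\<^esub> k (inv y \<otimes> (inv u \<otimes> x))))"
      using f h k x u by (intro Z.finsum_cong') (auto simp: inv_mult_group m_assoc Z.m_assoc l_inv_ex simp flip: m_assoc)
    also have "\<dots> = f u \<otimes>\<^bsub>Z\<^esub> (h \<otimes>\<^bsub>ZG\<^esub> k) (inv u \<otimes> x)"
      using f h k x u by (simp add: gr_mult_apply) (rule Z.finsum_rdistr[symmetric], auto)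
    finally show "(\<Oplus>\<^bsub>Z\<^esub>y\<in>carrier G. f u \<otimes>\<^bsub>Z\<^esub> h (inv u \<otimes> y) \<otimes>\<^bsub>Z\<^esub> k (inv y \<otimes> x))
      = f u \<otimes>\<^bsub>Z\<^esub> (h \<otimes>\<^bsub>ZG\<^esub> k) (inv u \<otimes> x)" .
  qed (simp_all add: f h k x gr_mult_closed Pi_def)
  also have "\<dots> = (f \<otimes>\<^bsub>ZG\<^esub> (h \<otimes>\<^bsub>ZG\<^esub> k)) x" using x by (simp add: gr_mult_apply)
  finally show "((f \<otimes>\<^bsub>ZG\<^esub> h) \<otimes>\<^bsub>ZG\<^esub> k) x = (f \<otimes>\<^bsub>ZG\<^esub> (h \<otimes>\<^bsub>ZG\<^esub> k)) x" .
qed (simp_all add: f h k gr_mult_closed)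

lemma gr_elt_mult_left_apply:
  assumes "f \<in> carrier ZG" "g \<in> carrier G" "x \<in> carrier G"
  shows "(\<delta> g \<otimes>\<^bsub>ZG\<^esub> f) x = f (inv g \<otimes> x)"
proof -
  have "(\<delta> g \<otimes>\<^bsub>ZG\<^esub> f) x = (\<Oplus>\<^bsub>Z\<^esub>y\<in>carrier G. \<delta> g y \<otimes>\<^bsub>Z\<^esub> f (inv y \<otimes> x))"
    using assms by (simp add: gr_mult_apply)
  also have "\<dots> = f (inv g \<otimes> x)"
    using assms by (intro Z.finsum_delta[where i = g]) (auto simp: gr_elt_apply)
  finally show ?thesis .
qed

lemma gr_elt_mult_right_apply:
  assumes "f \<in> carrier ZG" "g \<in> carrier G" "x \<in> carrier G"
  shows "(f \<otimes>\<^bsub>ZG\<^esub> \<delta> g) x = f (x \<otimes> inv g)"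
proof -
  have iff: "inv y \<otimes> x = g \<longleftrightarrow> y = x \<otimes> inv g" if "y \<in> carrier G" for y
    using that assms by (metis inv_closed inv_solve_left inv_solve_right)
  have "(f \<otimes>\<^bsub>ZG\<^esub> \<delta> g) x = (\<Oplus>\<^bsub>Z\<^esub>y\<in>carrier G. f y \<otimes>\<^bsub>Z\<^esub> \<delta> g (inv y \<otimes> x))"
    using assms by (simp add: gr_mult_apply)
  also have "\<dots> = f (x \<otimes> inv g)"
    using assms by (intro Z.finsum_delta[where i = "x \<otimes> inv g"]) (auto simp: gr_elt_apply iff)
  finally show ?thesis .
qed

lemma gr_elt_mult: 
  assumes "g \<in> carrier G" "h \<in> carrier G"
  shows "\<delta> g \<otimes>\<^bsub>ZG\<^esub> \<delta> h = \<delta> (g \<otimes> h)"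
proof (rule gr_ext)
  fix x assume x: "x \<in> carrier G"
  have "inv g \<otimes> x = h \<longleftrightarrow> x = g \<otimes> h"
    using x assms by (metis inv_solve_left)
  then show "(\<delta> g \<otimes>\<^bsub>ZG\<^esub> \<delta> h) x = \<delta> (g \<otimes> h) x"
    using x assms by (simp add: gr_elt_mult_left_apply gr_elt_apply)
qed (simp_all add: gr_mult_closed)

lemma ring_group_ring: "ring ZG"
proof (rule ringI)
  show "abelian_group ZG"
  proof (rule abelian_groupI)
    fix f h k assume fhk: "f \<in> carrier ZG" "h \<in> carrier ZG" "k \<in> carrier ZG"
    show "f \<oplus>\<^bsub>ZG\<^esub> h \<oplus>\<^bsub>ZG\<^esub> k = f \<oplus>\<^bsub>ZG\<^esub> (h \<oplus>\<^bsub>ZG\<^esub> k)"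
      by (rule gr_ext) (simp_all add: fhk gr_add_closed gr_add_apply Z.a_assoc)
    show "f \<oplus>\<^bsub>ZG\<^esub> h = h \<oplus>\<^bsub>ZG\<^esub> f"
      by (rule gr_ext) (simp_all add: fhk gr_add_closed gr_add_apply Z.a_comm)
  next
    fix f assume f: "f \<in> carrier ZG"
    show "\<zero>\<^bsub>ZG\<^esub> \<oplus>\<^bsub>ZG\<^esub> f = f"
      by (rule gr_ext) (simp_all add: f gr_add_closed gr_zero_closed gr_add_apply gr_zero_apply)
    define h where "h = (\<lambda>x\<in>carrier G. \<ominus>\<^bsub>Z\<^esub> f x)"
    have h: "h \<in> carrier ZG" unfolding h_def gr_carrier restrict_PiE_iff using f by simp
    have "h \<oplus>\<^bsub>ZG\<^esub> f = \<zero>\<^bsub>ZG\<^esub>"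
    proof (rule gr_ext)
      fix x assume "x \<in> carrier G"
      then show "(h \<oplus>\<^bsub>ZG\<^esub> f) x = \<zero>\<^bsub>ZG\<^esub> x"
        using f by (simp add: gr_add_apply gr_zero_apply h_def Z.l_neg)
    qed (simp_all add: gr_add_closed gr_zero_closed f h)
    then show "\<exists>h\<in>carrier ZG. h \<oplus>\<^bsub>ZG\<^esub> f = \<zero>\<^bsub>ZG\<^esub>" using h by blast
  qed (simp_all add: gr_add_closed gr_zero_closed)
  show "monoid ZG"
  proof (rule monoidI)
    fix f assume f: "f \<in> carrier ZG"
    show "\<one>\<^bsub>ZG\<^esub> \<otimes>\<^bsub>ZG\<^esub> f = f" "f \<otimes>\<^bsub>ZG\<^esub> \<one>\<^bsub>ZG\<^esub> = f"
      by (rule gr_ext; simp add: f gr_mult_closed gr_one_eq gr_elt_mult_left_apply gr_elt_mult_right_apply)+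
  qed (simp_all add: gr_one_eq gr_mult_assoc gr_mult_closed)
next
  fix f h k assume fhk: "f \<in> carrier ZG" "h \<in> carrier ZG" "k \<in> carrier ZG"
  show "(f \<oplus>\<^bsub>ZG\<^esub> h) \<otimes>\<^bsub>ZG\<^esub> k = f \<otimes>\<^bsub>ZG\<^esub> k \<oplus>\<^bsub>ZG\<^esub> h \<otimes>\<^bsub>ZG\<^esub> k"
  proof (rule gr_ext)
    fix x assume x: "x \<in> carrier G"
    have "((f \<oplus>\<^bsub>ZG\<^esub> h) \<otimes>\<^bsub>ZG\<^esub> k) x
      = (\<Oplus>\<^bsub>Z\<^esub>y\<in>carrier G. f y \<otimes>\<^bsub>Z\<^esub> k (inv y \<otimes> x) \<oplus>\<^bsub>Z\<^esub> h y \<otimes>\<^bsub>Z\<^esub> k (inv y \<otimes> x))"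
      using x fhk by (simp only: gr_mult_apply, intro Z.finsum_cong') (auto simp: gr_add_apply Z.l_distr)
    also have "\<dots> = (f \<otimes>\<^bsub>ZG\<^esub> k \<oplus>\<^bsub>ZG\<^esub> h \<otimes>\<^bsub>ZG\<^esub> k) x"
      using x fhk by (subst Z.finsum_addf) (auto simp: gr_mult_apply gr_add_apply)
    finally show "((f \<oplus>\<^bsub>ZG\<^esub> h) \<otimes>\<^bsub>ZG\<^esub> k) x = (f \<otimes>\<^bsub>ZG\<^esub> k \<oplus>\<^bsub>ZG\<^esub> h \<otimes>\<^bsub>ZG\<^esub> k) x" .
  qed (simp_all add: fhk gr_add_closed gr_mult_closed)
  show "k \<otimes>\<^bsub>ZG\<^esub> (f \<oplus>\<^bsub>ZG\<^esub> h) = k \<otimes>\<^bsub>ZG\<^esub> f \<oplus>\<^bsub>ZG\<^esub> k \<otimes>\<^bsub>ZG\<^esub> h"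
  proof (rule gr_ext)
    fix x assume x: "x \<in> carrier G"
    have "(k \<otimes>\<^bsub>ZG\<^esub> (f \<oplus>\<^bsub>ZG\<^esub> h)) x
      = (\<Oplus>\<^bsub>Z\<^esub>y\<in>carrier G. k y \<otimes>\<^bsub>Z\<^esub> f (inv y \<otimes> x) \<oplus>\<^bsub>Z\<^esub> k y \<otimes>\<^bsub>Z\<^esub> h (inv y \<otimes> x))"
      using x fhk by (simp only: gr_mult_apply, intro Z.finsum_cong') (auto simp: gr_add_apply Z.r_distr)
    also have "\<dots> = (k \<otimes>\<^bsub>ZG\<^esub> f \<oplus>\<^bsub>ZG\<^esub> k \<otimes>\<^bsub>ZG\<^esub> h) x"
      using x fhk by (subst Z.finsum_addf) (auto simp: gr_mult_apply gr_add_apply)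
    finally show "(k \<otimes>\<^bsub>ZG\<^esub> (f \<oplus>\<^bsub>ZG\<^esub> h)) x = (k \<otimes>\<^bsub>ZG\<^esub> f \<oplus>\<^bsub>ZG\<^esub> k \<otimes>\<^bsub>ZG\<^esub> h) x" .
  qed (simp_all add: fhk gr_add_closed gr_mult_closed)
qed

sublocale ZG: ring ZG by (rule ring_group_ring)

lemma gr_conj_closed [simp]: "f \<in> carrier ZG \<Longrightarrow> gr_conj Z G g f \<in> carrier ZG"
  by (simp add: gr_conj_def)

lemma gr_conj_apply:
  assumes "f \<in> carrier ZG" "g \<in> carrier G" "x \<in> carrier G"
  shows "gr_conj Z G g f x = f (g \<otimes> x \<otimes> inv g)"
  using assms by (simp add: gr_conj_def gr_elt_mult_left_apply gr_elt_mult_right_apply m_assoc)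

lemma gr_elt_inv:
  assumes "g \<in> carrier G"
  shows "\<delta> g \<otimes>\<^bsub>ZG\<^esub> \<delta> (inv g) = \<one>\<^bsub>ZG\<^esub>" "\<delta> (inv g) \<otimes>\<^bsub>ZG\<^esub> \<delta> g = \<one>\<^bsub>ZG\<^esub>"
  using assms by (simp_all add: gr_elt_mult gr_one_eq)

lemma gr_elt_inv_cancel:
  assumes "g \<in> carrier G" "f \<in> carrier ZG"
  shows "\<delta> g \<otimes>\<^bsub>ZG\<^esub> (\<delta> (inv g) \<otimes>\<^bsub>ZG\<^esub> f) = f" "\<delta> (inv g) \<otimes>\<^bsub>ZG\<^esub> (\<delta> g \<otimes>\<^bsub>ZG\<^esub> f) = f"
  using assms by (simp_all add: gr_elt_inv flip: ZG.m_assoc)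

lemma gr_conj_mult:
  assumes "f \<in> carrier ZG" "h \<in> carrier ZG" "g \<in> carrier G"
  shows "gr_conj Z G g (f \<otimes>\<^bsub>ZG\<^esub> h) = gr_conj Z G g f \<otimes>\<^bsub>ZG\<^esub> gr_conj Z G g h"
  using assms by (simp add: gr_conj_def ZG.m_assoc gr_elt_inv_cancel)

lemma gr_conj_zero: "g \<in> carrier G \<Longrightarrow> gr_conj Z G g \<zero>\<^bsub>ZG\<^esub> = \<zero>\<^bsub>ZG\<^esub>"
  by (simp add: gr_conj_def)

lemma gr_conj_conj:
  assumes "f \<in> carrier ZG" "g \<in> carrier G" "h \<in> carrier G"
  shows "gr_conj Z G h (gr_conj Z G g f) = gr_conj Z G (g \<otimes> h) f"
proof -
  have "\<delta> g \<otimes>\<^bsub>ZG\<^esub> \<delta> h = \<delta> (g \<otimes> h)" "\<delta> (inv h) \<otimes>\<^bsub>ZG\<^esub> \<delta> (inv g) = \<delta> (inv (g \<otimes> h))"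
    using assms by (simp_all add: gr_elt_mult inv_mult_group)
  then show ?thesis using assms by (metis (no_types, lifting) ZG.m_assoc ZG.m_closed gr_conj_def gr_elt_closed)
qed

lemma gr_conj_one: "f \<in> carrier ZG \<Longrightarrow> gr_conj Z G \<one> f = f"
  by (simp add: gr_conj_def flip: gr_one_eq)

lemma gr_conj_move:
  assumes "f \<in> carrier ZG" "g \<in> carrier G"
  shows "f \<otimes>\<^bsub>ZG\<^esub> \<delta> g = \<delta> g \<otimes>\<^bsub>ZG\<^esub> gr_conj Z G g f"
  using assms by (simp add: gr_conj_def ZG.m_assoc gr_elt_inv_cancel)

lemma gr_conj_eq_iff_commute:
  assumes "f \<in> carrier ZG" "g \<in> carrier G"
  shows "gr_conj Z G g f = f \<longleftrightarrow> f \<otimes>\<^bsub>ZG\<^esub> \<delta> g = \<delta> g \<otimes>\<^bsub>ZG\<^esub> f"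
proof
  assume "f \<otimes>\<^bsub>ZG\<^esub> \<delta> g = \<delta> g \<otimes>\<^bsub>ZG\<^esub> f"
  then show "gr_conj Z G g f = f"
    using assms by (simp add: gr_conj_def ZG.m_assoc gr_elt_inv_cancel)
qed (use assms gr_conj_move in metis)

lemma subgroup_gr_centralizer:
  assumes f: "f \<in> carrier ZG"
  shows "subgroup (gr_centralizer Z G f) G"
proof (rule subgroupI)
  show "gr_centralizer Z G f \<noteq> {}" using gr_conj_one[OF f] by (auto simp: gr_centralizer_def)
next
  fix g assume "g \<in> gr_centralizer Z G f"
  then have g: "g \<in> carrier G" "gr_conj Z G g f = f" by (auto simp: gr_centralizer_def)
  then have "gr_conj Z G (inv g) f = gr_conj Z G (inv g) (gr_conj Z G g f)" by simp
  also have "\<dots> = f" using g(1) f by (simp add: gr_conj_conj gr_conj_one del: g(2))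
  finally show "inv g \<in> gr_centralizer Z G f" using g by (simp add: gr_centralizer_def)
next
  fix g h assume "g \<in> gr_centralizer Z G f" "h \<in> gr_centralizer Z G f"
  then show "g \<otimes> h \<in> gr_centralizer Z G f"
    using f by (auto simp: gr_centralizer_def simp flip: gr_conj_conj)
qed (auto simp: gr_centralizer_def)

definition supported :: "'g set \<Rightarrow> ('g \<Rightarrow> 'r) set" where
  "supported U = {f \<in> carrier ZG. \<forall>x\<in>carrier G - U. f x = \<zero>\<^bsub>Z\<^esub>}"

lemma supportedD: "f \<in> supported U \<Longrightarrow> f \<in> carrier ZG"
  by (simp add: supported_def)

lemma gr_elt_supported: "g \<in> U \<Longrightarrow> \<delta> g \<in> supported U"
  by (auto simp: supported_def gr_elt_apply)

lemma supported_mono: "U \<subseteq> V \<Longrightarrow> supported U \<subseteq> supported V"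
  by (auto simp: supported_def)

lemma subring_supported:
  assumes U: "subgroup U G"
  shows "subring (supported U) ZG"
proof (rule ZG.subringI)
  show "\<one>\<^bsub>ZG\<^esub> \<in> supported U"
    using subgroup.one_closed[OF U] by (simp add: gr_one_eq gr_elt_supported)
next
  fix f assume f: "f \<in> supported U"
  have "(\<ominus>\<^bsub>ZG\<^esub> f) x = \<zero>\<^bsub>Z\<^esub>" if x: "x \<in> carrier G - U" for x
  proof -
    have "(\<ominus>\<^bsub>ZG\<^esub> f \<oplus>\<^bsub>ZG\<^esub> f) x = \<zero>\<^bsub>Z\<^esub>" using f x by (simp add: supported_def ZG.l_neg gr_zero_apply)
    then show ?thesis using f x by (simp add: supported_def gr_add_apply)
  qed
  then show "\<ominus>\<^bsub>ZG\<^esub> f \<in> supported U" using f by (simp add: supported_def)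
next
  fix f h assume fh: "f \<in> supported U" "h \<in> supported U"
  then show "f \<oplus>\<^bsub>ZG\<^esub> h \<in> supported U" by (auto simp: supported_def gr_add_apply)
  have "(f \<otimes>\<^bsub>ZG\<^esub> h) x = \<zero>\<^bsub>Z\<^esub>" if x: "x \<in> carrier G - U" for x
  proof -
    have "f y \<otimes>\<^bsub>Z\<^esub> h (inv y \<otimes> x) = \<zero>\<^bsub>Z\<^esub>" if y: "y \<in> carrier G" for y
    proof (cases "y \<in> U")
      case True
      then have "inv y \<otimes> x \<notin> U"
        using x y subgroup.m_closed[OF U True, of "inv y \<otimes> x"] by (auto simp flip: m_assoc)
      then show ?thesis using fh x y by (simp add: supported_def)
    next
      case False
      then show ?thesis using fh x y by (simp add: supported_def)
    qed
    then show ?thesis using x by (simp add: gr_mult_apply Z.add.finprod_one_eqI)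
  qed
  then show "f \<otimes>\<^bsub>ZG\<^esub> h \<in> supported U" using fh by (simp add: supported_def)
qed (auto simp: supported_def)

lemma sub_group_ring_eq: "sub_group_ring Z G U = ZG\<lparr>carrier := supported U\<rparr>"
  by (simp add: sub_group_ring_def supported_def)

lemma ring_sub_group_ring: "subgroup U G \<Longrightarrow> ring (sub_group_ring Z G U)"
  unfolding sub_group_ring_eq by (intro ZG.subring_is_ring subring_supported)

end

section \<open>Group rings over the integers modulo m\<close>

locale finite_group_Zmod = group G
  for G :: "('g, 'b) monoid_scheme" (structure) and M :: int +
  assumes finite_carrier: "finite (carrier G)" and modulus: "M > 1"

sublocale finite_group_Zmod \<subseteq> finite_group_ring G "residue_ring M"
proof -
  interpret residues M "residue_ring M" by unfold_locales (rule modulus)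
  interpret cring "residue_ring M" by (rule cring)
  show "finite_group_ring G (residue_ring M)" by unfold_locales (rule finite_carrier)
qed

context finite_group_Zmod
begin

lemma residue_ring_simps:
  "\<zero>\<^bsub>residue_ring M\<^esub> = 0" "\<one>\<^bsub>residue_ring M\<^esub> = 1" "carrier (residue_ring M) = {0..<M}"
  "a \<oplus>\<^bsub>residue_ring M\<^esub> b = (a + b) mod M" "a \<otimes>\<^bsub>residue_ring M\<^esub> b = (a * b) mod M"
  by (auto simp: residue_ring_def)

lemma finsum_residue:
  assumes "finite I" "f \<in> I \<rightarrow> {0..<M}"
  shows "finsum (residue_ring M) f I = sum f I mod M"
  using assms
proof (induction I rule: finite_induct)
  case (insert i I)
  then show ?case
    by (subst Z.finsum_insert) (auto simp: residue_ring_simps Pi_def mod_simps)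
qed (simp add: residue_ring_simps)

lemma grm_range: "f \<in> carrier ZG \<Longrightarrow> x \<in> carrier G \<Longrightarrow> 0 \<le> f x \<and> f x < M"
  using gr_closed[of f x] by (simp add: residue_ring_simps)

lemma grm_mod: "f \<in> carrier ZG \<Longrightarrow> x \<in> carrier G \<Longrightarrow> f x mod M = f x"
  using grm_range[of f x] by simp

lemma grm_mult_apply:
  assumes "f \<in> carrier ZG" "h \<in> carrier ZG" "x \<in> carrier G"
  shows "(f \<otimes>\<^bsub>ZG\<^esub> h) x = (\<Sum>y\<in>carrier G. f y * h (inv y \<otimes> x)) mod M"
proof -
  have "(f \<otimes>\<^bsub>ZG\<^esub> h) x = (\<Sum>y\<in>carrier G. (f y * h (inv y \<otimes> x)) mod M) mod M"
    using assms modulus by (simp add: gr_mult_apply residue_ring_simps finsum_residue)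
  then show ?thesis by (simp add: mod_sum_eq)
qed

lemma grm_add_apply: "x \<in> carrier G \<Longrightarrow> (f \<oplus>\<^bsub>ZG\<^esub> h) x = (f x + h x) mod M"
  by (simp add: gr_add_apply residue_ring_simps)

lemma grm_zero_apply: "x \<in> carrier G \<Longrightarrow> \<zero>\<^bsub>ZG\<^esub> x = 0"
  by (simp add: gr_zero_apply residue_ring_simps)

lemma grm_elt_apply: "x \<in> carrier G \<Longrightarrow> \<delta> g x = (if x = g then 1 else 0)"
  by (simp add: gr_elt_apply residue_ring_simps)

lemma grm_minus_apply:
  assumes "f \<in> carrier ZG" "h \<in> carrier ZG" "x \<in> carrier G"
  shows "(f \<ominus>\<^bsub>ZG\<^esub> h) x = (f x - h x) mod M"
proof -
  have "((f \<ominus>\<^bsub>ZG\<^esub> h) \<oplus>\<^bsub>ZG\<^esub> h) x = f x"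
    using assms by (simp add: a_minus_def ZG.a_assoc ZG.l_neg)
  then have "f x = ((f \<ominus>\<^bsub>ZG\<^esub> h) x + h x) mod M" using assms by (simp add: grm_add_apply)
  then have "(f x - h x) mod M = (f \<ominus>\<^bsub>ZG\<^esub> h) x mod M" by (simp add: mod_simps)
  then show ?thesis using assms by (simp add: grm_mod)
qed

lemma grm_nat_smult_apply:
  assumes "f \<in> carrier ZG" "x \<in> carrier G"
  shows "([n] \<cdot>\<^bsub>ZG\<^esub> f) x = (int n * f x) mod M"
proof (induction n)
  case 0
  then show ?case using assms by (simp add: add_pow_def nat_pow_def grm_zero_apply)
next
  case (Suc n)
  have "[Suc n] \<cdot>\<^bsub>ZG\<^esub> f = [n] \<cdot>\<^bsub>ZG\<^esub> f \<oplus>\<^bsub>ZG\<^esub> f"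
    by (simp add: add_pow_def nat_pow_def)
  then show ?case using assms Suc by (simp add: grm_add_apply mod_simps algebra_simps)
qed

lemma finite_gr_carrier: "finite (carrier ZG)"
proof -
  have "carrier ZG = carrier G \<rightarrow>\<^sub>E carrier (residue_ring M)" by (simp add: group_ring_def)
  then show ?thesis using finite_carrier by (simp add: finite_PiE residue_ring_simps(3))
qed

text \<open>Since the coefficients are sums of ones, additive statements about elements of the group ring
  have to be checked on group elements only.\<close>

lemma supported_induct [consumes 2, case_names zero add]:
  assumes "f \<in> supported U" and U: "U \<subseteq> carrier G"
    and zero: "P \<zero>\<^bsub>ZG\<^esub>"
    and add: "\<And>f u. f \<in> supported U \<Longrightarrow> P f \<Longrightarrow> u \<in> U \<Longrightarrow> P (f \<oplus>\<^bsub>ZG\<^esub> \<delta> u)"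
  shows "P f"
  using assms(1)
proof (induction "\<Sum>x\<in>carrier G. nat (f x)" arbitrary: f rule: less_induct)
  case less
  have f: "f \<in> carrier ZG" using less.prems by (rule supportedD)
  show ?case
  proof (cases "\<forall>x\<in>carrier G. f x = 0")
    case True
    then have "f = \<zero>\<^bsub>ZG\<^esub>" using f by (intro gr_ext) (auto simp: grm_zero_apply)
    then show ?thesis using zero by simp
  next
    case False
    then obtain u where u: "u \<in> carrier G" "f u \<noteq> 0" by auto
    then have uU: "u \<in> U" using less.prems by (auto simp: supported_def residue_ring_simps)
    have pos: "f u > 0" using grm_range[OF f u(1)] u(2) by simp
    define h where "h = f(u := f u - 1)"
    have h: "h \<in> carrier ZG"
    proof -
      have "h x \<in> {0..<M}" if "x \<in> carrier G" for x
        using grm_range[OF f that] pos by (auto simp: h_def)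
      then show ?thesis
        using f u(1) by (auto simp: gr_carrier residue_ring_simps PiE_def extensional_def h_def)
    qed
    then have "h \<in> supported U" using less.prems uU by (auto simp: supported_def h_def)
    moreover have "(\<Sum>x\<in>carrier G. nat (h x)) < (\<Sum>x\<in>carrier G. nat (f x))"
      using pos u(1) finite_carrier by (intro sum_strict_mono_ex1) (auto simp: h_def)
    ultimately have "P h" using less.hyps by blast
    moreover have "f = h \<oplus>\<^bsub>ZG\<^esub> \<delta> u"
    proof (rule gr_ext)
      fix x assume x: "x \<in> carrier G"
      then show "f x = (h \<oplus>\<^bsub>ZG\<^esub> \<delta> u) x"
        using grm_range[OF f x] by (auto simp: grm_add_apply grm_elt_apply h_def)
    qed (use f h in auto)
    ultimately show ?thesis using add[of h u] \<open>h \<in> supported U\<close> uU by simp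
  qed
qed

lemma supported_carrier: "supported (carrier G) = carrier ZG"
  by (auto simp: supported_def)

lemma commute_supported:
  assumes "f \<in> supported U" "U \<subseteq> carrier G" "y \<in> carrier ZG"
    and "\<And>u. u \<in> U \<Longrightarrow> y \<otimes>\<^bsub>ZG\<^esub> \<delta> u = \<delta> u \<otimes>\<^bsub>ZG\<^esub> y"
  shows "y \<otimes>\<^bsub>ZG\<^esub> f = f \<otimes>\<^bsub>ZG\<^esub> y"
  using assms(1,2)
proof (induction rule: supported_induct)
  case (add f u)
  then show ?case using assms(3,4) supportedD[of f U] by (simp add: ZG.l_distr ZG.r_distr)
qed (use assms in auto)

end

section \<open>Irreducible characters of cyclic groups\<close>

lemma finite_cyclic_group_generator:
  assumes "group Q" "finite (carrier Q)" "cyclic_group Q"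
  obtains q where "q \<in> carrier Q" "\<And>g. g \<in> carrier Q \<Longrightarrow> \<exists>i<Coset.order Q. g = q [^]\<^bsub>Q\<^esub> (i::nat)"
proof -
  interpret group Q by fact
  obtain q where q: "q \<in> carrier Q" "carrier Q = range (\<lambda>n::int. q [^]\<^bsub>Q\<^esub> n)"
    using assms(3) cyclic_group by blast
  define k where "k = Coset.order Q"
  have k: "k > 0" using assms(2) by (simp add: k_def order_gt_0_iff_finite)
  have "\<exists>i<k. g = q [^]\<^bsub>Q\<^esub> (i::nat)" if "g \<in> carrier Q" for g
  proof -
    have "g \<in> range (\<lambda>n::int. q [^]\<^bsub>Q\<^esub> n)" using that q(2) by simp
    then obtain n :: int where n: "g = q [^]\<^bsub>Q\<^esub> n" by (elim rangeE)
    have "n = int k * (n div int k) + int (nat (n mod int k))" using k by simp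
    then have "g = q [^]\<^bsub>Q\<^esub> (int k * (n div int k)) \<otimes>\<^bsub>Q\<^esub> q [^]\<^bsub>Q\<^esub> int (nat (n mod int k))"
      using n q(1) int_pow_mult by metis
    also have "q [^]\<^bsub>Q\<^esub> (int k * (n div int k)) = (q [^]\<^bsub>Q\<^esub> int k) [^]\<^bsub>Q\<^esub> (n div int k)"
      using q(1) by (simp add: int_pow_pow)
    also have "q [^]\<^bsub>Q\<^esub> int k = \<one>\<^bsub>Q\<^esub>" using q(1) pow_order_eq_1 by (simp add: int_pow_int k_def)
    finally have "g = q [^]\<^bsub>Q\<^esub> nat (n mod int k)" using q(1) by (simp add: int_pow_int)
    moreover have "nat (n mod int k) < k" using k by (simp add: nat_less_iff)
    ultimately show ?thesis by blast
  qed
  then show ?thesis using that q(1) k_def by blast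
qed

text \<open>Over an algebraically closed field a generator of the group has an eigenvector; its span is
  invariant, so an irreducible representation has dimension one.\<close>

lemma irreducible_rep_cyclic_dim:
  fixes \<rho> :: "'q \<Rightarrow> 'k :: alg_closed_field mat"
  assumes "group Q" "finite (carrier Q)" "cyclic_group Q" and rep: "irreducible_rep Q n \<rho>"
  shows "n = 1"
proof -
  interpret group Q by fact
  obtain q where q: "q \<in> carrier Q" "\<And>g. g \<in> carrier Q \<Longrightarrow> \<exists>i<Coset.order Q. g = q [^]\<^bsub>Q\<^esub> (i::nat)"
    using finite_cyclic_group_generator[OF assms(1-3)] by blast
  have hom: "\<rho> \<in> hom Q (units_of (ring_mat TYPE('k) n ()))" and n: "0 < n"
    and irr: "\<And>W. VectorSpace.subspace class_ring W (module_vec TYPE('k) n) \<Longrightarrow>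
          (\<forall>g\<in>carrier Q. \<forall>v\<in>W. \<rho> g *\<^sub>v v \<in> W) \<Longrightarrow> W = {0\<^sub>v n} \<or> W = carrier_vec n"
    using rep by (auto simp: irreducible_rep_def)
  have carr: "\<rho> g \<in> carrier_mat n n" if "g \<in> carrier Q" for g
    using subsetD[OF hom_carrier[OF hom] imageI[OF that]] by (simp add: units_of_carrier Units_def ring_mat_simps)
  have mult: "\<rho> (g \<otimes>\<^bsub>Q\<^esub> h) = \<rho> g * \<rho> h" if "g \<in> carrier Q" "h \<in> carrier Q" for g h
    using hom_mult[OF hom that] by (simp add: units_of_mult ring_mat_simps)
  interpret gh: group_hom Q "units_of (ring_mat TYPE('k) n ())" \<rho>
  proof (rule group_hom.intro[OF assms(1)])
    show "group (units_of (ring_mat TYPE('k) n ()))"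
      using ring.is_monoid[OF ring_mat] by (rule monoid.units_group)
  qed (rule group_hom_axioms.intro[OF hom])
  have one: "\<rho> \<one>\<^bsub>Q\<^esub> = 1\<^sub>m n"
    using gh.hom_one by (simp add: units_of_one ring_mat_simps)
  obtain c where "poly (char_poly (\<rho> q)) c = 0"
    using alg_closed_imp_poly_has_root[of "char_poly (\<rho> q)"] degree_monic_char_poly[OF carr[OF q(1)]] n by auto
  then obtain v where "eigenvector (\<rho> q) v c"
    using eigenvalue_root_char_poly[OF carr[OF q(1)]] by (auto simp: eigenvalue_def)
  then have v: "v \<in> carrier_vec n" "v \<noteq> 0\<^sub>v n" "\<rho> q *\<^sub>v v = c \<cdot>\<^sub>v v"
    using carr[OF q(1)] by (auto simp: eigenvector_def)
  have pow: "\<rho> (q [^]\<^bsub>Q\<^esub> i) *\<^sub>v v = c ^ i \<cdot>\<^sub>v v" for i :: nat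
  proof (induction i)
    case (Suc i)
    have "\<rho> (q [^]\<^bsub>Q\<^esub> Suc i) *\<^sub>v v = \<rho> (q [^]\<^bsub>Q\<^esub> i) *\<^sub>v (\<rho> q *\<^sub>v v)"
      using mult[of "q [^]\<^bsub>Q\<^esub> i" q] q(1) v(1) carr[of "q [^]\<^bsub>Q\<^esub> i"] carr[OF q(1)]
      by (simp add: assoc_mult_mat_vec[of _ n n _ n])
    also have "\<dots> = c \<cdot>\<^sub>v (c ^ i \<cdot>\<^sub>v v)"
      using v carr[of "q [^]\<^bsub>Q\<^esub> i"] q(1) Suc by (simp add: mult_mat_vec[of _ n n])
    finally show ?case using v(1) by (simp add: smult_smult_assoc)
  qed (use one v(1) in simp)
  define W where "W = range (\<lambda>a. a \<cdot>\<^sub>v v)"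
  have "VectorSpace.subspace class_ring W (module_vec TYPE('k) n)"
    unfolding VectorSpace.subspace_def submodule_def
  proof (intro conjI allI impI)
    show "vectorspace class_ring (module_vec TYPE('k) n)" by (rule vec_vs)
    show "module class_ring (module_vec TYPE('k) n)" by (rule vec_module)
    show "W \<subseteq> carrier (module_vec TYPE('k) n)" using v(1) by (auto simp: W_def module_vec_simps)
    show "\<zero>\<^bsub>module_vec TYPE('k) n\<^esub> \<in> W"
      using v(1) by (auto simp: W_def module_vec_simps intro!: image_eqI[of _ _ 0])
  next
    fix y y' assume "y \<in> W" "y' \<in> W"
    then obtain b b' where "y = b \<cdot>\<^sub>v v" "y' = b' \<cdot>\<^sub>v v" by (auto simp: W_def)
    then have "y + y' = (b + b') \<cdot>\<^sub>v v" by (simp add: add_smult_distrib_vec)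
    then show "y \<oplus>\<^bsub>module_vec TYPE('k) n\<^esub> y' \<in> W" by (simp add: W_def module_vec_simps)
  next
    fix b y assume "y \<in> W"
    then obtain b' where "y = b' \<cdot>\<^sub>v v" by (auto simp: W_def)
    then have "b \<cdot>\<^sub>v y = (b * b') \<cdot>\<^sub>v v" by (simp add: smult_smult_assoc)
    then show "b \<odot>\<^bsub>module_vec TYPE('k) n\<^esub> y \<in> W" by (simp add: W_def module_vec_simps)
  qed
  moreover have "\<forall>g\<in>carrier Q. \<forall>y\<in>W. \<rho> g *\<^sub>v y \<in> W"
  proof (intro ballI)
    fix g y assume g: "g \<in> carrier Q" and y: "y \<in> W"
    obtain i where i: "g = q [^]\<^bsub>Q\<^esub> (i::nat)" using q(2)[OF g] by blast
    obtain b where b: "y = b \<cdot>\<^sub>v v" using y by (auto simp: W_def)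
    have "\<rho> g *\<^sub>v y = b \<cdot>\<^sub>v (c ^ i \<cdot>\<^sub>v v)"
      using pow[of i] carr[OF g] v(1) by (simp add: b i mult_mat_vec[of _ n n])
    then show "\<rho> g *\<^sub>v y \<in> W" by (simp add: W_def smult_smult_assoc)
  qed
  moreover have "v \<in> W" by (auto simp: W_def intro!: image_eqI[of _ _ 1])
  ultimately have W: "W = carrier_vec n" using irr v(2) by blast
  show "n = 1"
  proof (rule ccontr)
    assume "n \<noteq> 1"
    then have n2: "0 < n" "1 < n" using n by auto
    have "unit_vec n 0 \<in> W" "unit_vec n 1 \<in> W" by (simp_all add: W)
    then obtain b b' where b: "unit_vec n 0 = b \<cdot>\<^sub>v v" "unit_vec n 1 = b' \<cdot>\<^sub>v v" by (auto simp: W_def)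
    have 00: "b * vec_index v 0 = 1" and 01: "b * vec_index v 1 = 0"
      using arg_cong[OF b(1), of "\<lambda>u. vec_index u 0"] arg_cong[OF b(1), of "\<lambda>u. vec_index u 1"] n2 v(1) by auto
    have 11: "b' * vec_index v 1 = 1" using arg_cong[OF b(2), of "\<lambda>u. vec_index u 1"] n2 v(1) by auto
    have "b \<noteq> 0" using 00 by auto
    then have "vec_index v 1 = 0" using 01 by simp
    then show False using 11 by simp
  qed
qed

lemma irr_chars_cyclic:
  fixes \<chi> :: "'q \<Rightarrow> 'k :: alg_closed_field"
  assumes "group Q" "finite (carrier Q)" "cyclic_group Q" and \<chi>: "\<chi> \<in> irr_chars Q"
  shows "\<And>g h. g \<in> carrier Q \<Longrightarrow> h \<in> carrier Q \<Longrightarrow> \<chi> (g \<otimes>\<^bsub>Q\<^esub> h) = \<chi> g * \<chi> h"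
    and "\<chi> \<one>\<^bsub>Q\<^esub> = 1"
proof -
  interpret group Q by fact
  obtain n \<rho> where \<rho>: "irreducible_rep Q n \<rho>" "\<chi> = (\<lambda>q\<in>carrier Q. \<Sum>i<n. \<rho> q $$ (i, i))"
    using \<chi> by (auto simp: irr_chars_def)
  have n: "n = 1" by (rule irreducible_rep_cyclic_dim[OF assms(1-3) \<rho>(1)])
  have hom: "\<rho> \<in> hom Q (units_of (ring_mat TYPE('k) 1 ()))"
    using \<rho>(1) by (simp add: irreducible_rep_def n)
  have carr: "\<rho> g \<in> carrier_mat 1 1" if "g \<in> carrier Q" for g
    using subsetD[OF hom_carrier[OF hom] imageI[OF that]] by (simp add: units_of_carrier Units_def ring_mat_simps)
  have mult: "\<rho> (g \<otimes>\<^bsub>Q\<^esub> h) = \<rho> g * \<rho> h" if "g \<in> carrier Q" "h \<in> carrier Q" for g h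
    using hom_mult[OF hom that] by (simp add: units_of_mult ring_mat_simps)
  have \<chi>_eq: "\<chi> g = \<rho> g $$ (0, 0)" if "g \<in> carrier Q" for g using that by (simp add: \<rho>(2) n)
  show "\<chi> (g \<otimes>\<^bsub>Q\<^esub> h) = \<chi> g * \<chi> h" if "g \<in> carrier Q" "h \<in> carrier Q" for g h
    using that carr[OF that(1)] carr[OF that(2)]
    by (simp add: \<chi>_eq mult times_mat_def scalar_prod_def)
  interpret gh: group_hom Q "units_of (ring_mat TYPE('k) 1 ())" \<rho>
  proof (rule group_hom.intro[OF assms(1)])
    show "group (units_of (ring_mat TYPE('k) 1 ()))"
      using ring.is_monoid[OF ring_mat] by (rule monoid.units_group)
  qed (rule group_hom_axioms.intro[OF hom])
  show "\<chi> \<one>\<^bsub>Q\<^esub> = 1"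
    using gh.hom_one by (simp add: \<chi>_eq units_of_one ring_mat_simps)
qed

section \<open>Roots of unity and the trace in characteristic p\<close>

lemma root_of_unity_is_power:
  fixes \<zeta> y :: "'k :: field"
  assumes \<zeta>: "primitive_root_of_unity k \<zeta>" and y: "y ^ k = 1"
  shows "\<exists>i<k. y = \<zeta> ^ i"
proof -
  have k: "k > 0" "\<zeta> ^ k = 1" and min: "\<And>j. 0 < j \<Longrightarrow> j < k \<Longrightarrow> \<zeta> ^ j \<noteq> 1"
    using \<zeta> by (auto simp: primitive_root_of_unity_def)
  have \<zeta>0: "\<zeta> \<noteq> 0" using k by (auto simp: power_0_left)
  have neq: "\<zeta> ^ i \<noteq> \<zeta> ^ j" if "i < j" "j < k" for i j
  proof
    assume "\<zeta> ^ i = \<zeta> ^ j"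
    moreover have "\<zeta> ^ i * \<zeta> ^ (j - i) = \<zeta> ^ j" using that by (simp flip: power_add)
    ultimately have "\<zeta> ^ i * \<zeta> ^ (j - i) = \<zeta> ^ i * 1" by simp
    then show False using \<zeta>0 min[of "j - i"] that by simp
  qed
  have inj: "inj_on (\<lambda>i. \<zeta> ^ i) {..<k}"
    by (rule inj_onI) (metis lessThan_iff linorder_neqE_nat neq)
  define P :: "'k poly" where "P = Polynomial.monom 1 k - 1"
  have "Polynomial.coeff P k = 1" using k by (simp add: P_def)
  then have P0: "P \<noteq> 0" by auto
  have deg: "Polynomial.degree P \<le> k" unfolding P_def by (intro degree_diff_le) (auto simp: degree_monom_le)
  have roots: "{z. poly P z = 0} = {z. z ^ k = 1}" by (auto simp: P_def poly_monom)
  have "card {z. poly P z = 0} \<le> card ((\<lambda>i. \<zeta> ^ i) ` {..<k})"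
    using card_poly_roots_bound[OF P0] deg by (simp add: card_image[OF inj])
  moreover have "(\<lambda>i. \<zeta> ^ i) ` {..<k} \<subseteq> {z. poly P z = 0}"
  proof -
    have "(\<zeta> ^ i) ^ k = (\<zeta> ^ k) ^ i" for i by (simp add: mult.commute flip: power_mult)
    then show ?thesis using k by (auto simp: roots)
  qed
  ultimately have "(\<lambda>i. \<zeta> ^ i) ` {..<k} = {z. poly P z = 0}"
    by (intro card_seteq poly_roots_finite P0)
  then show ?thesis using y roots by blast
qed

lemma finite_roots_of_unity: "k > 0 \<Longrightarrow> finite {y :: 'k :: field. y ^ k = 1}"
proof -
  assume k: "k > 0"
  define P :: "'k poly" where "P = Polynomial.monom 1 k - 1"
  have "Polynomial.coeff P k = 1" using k by (simp add: P_def)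
  then have "P \<noteq> 0" by auto
  then have "finite {y. poly P y = 0}" by (rule poly_roots_finite)
  then show ?thesis by (simp add: P_def poly_monom)
qed

text \<open>The \<open>p\<close> images of the integers exhaust the roots of \<open>x\<^sup>p - x\<close>.\<close>

lemma prime_field_characterization:
  fixes y :: "'k :: field"
  assumes p: "Factorial_Ring.prime p" "CHAR('k) = p" and y: "y ^ p = y"
  shows "\<exists>!c. 0 \<le> c \<and> c < int p \<and> of_int c = y"
proof -
  have cong: "of_int a = (of_int b :: 'k) \<longleftrightarrow> [a = b] (mod int p)" for a b
    using of_int_eq_iff_cong_CHAR[where 'a = 'k] p(2) by simp
  have inj: "inj_on (of_int :: int \<Rightarrow> 'k) {0..<int p}"
    by (rule inj_onI) (auto simp: cong cong_def)
  define P :: "'k poly" where "P = Polynomial.monom 1 p - Polynomial.monom 1 1"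
  have p1: "p > 1" using p(1) by (rule prime_gt_1_nat)
  have "Polynomial.coeff P p = 1" using p1 by (simp add: P_def)
  then have P0: "P \<noteq> 0" by auto
  have deg: "Polynomial.degree P \<le> p"
    unfolding P_def using p1 by (intro degree_diff_le) (auto simp: degree_monom_eq)
  have roots: "{z. poly P z = 0} = {z. z ^ p = z}" by (auto simp: P_def poly_monom)
  have "(of_int c :: 'k) ^ p = of_int c" for c
  proof -
    have "of_nat n ^ p = (of_nat n :: 'k)" for n
    proof (induction n)
      case (Suc n)
      have "(1 + of_nat n :: 'k) ^ p = 1 ^ p + of_nat n ^ p"
        by (rule freshmans_dream) (simp_all add: p)
      then show ?case using Suc by simp
    qed (use p1 in \<open>simp add: power_0_left\<close>)
    then have nat: "of_int (int n) ^ p = (of_int (int n) :: 'k)" for n by simp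
    have "(of_int c :: 'k) = of_int (int (nat (c mod int p)))"
      using p1 by (subst cong) (simp add: cong_def)
    then show ?thesis using nat by metis
  qed
  then have "of_int ` {0..<int p} \<subseteq> {z :: 'k. poly P z = 0}" by (auto simp: roots)
  moreover have "card {z :: 'k. poly P z = 0} \<le> card ((of_int :: int \<Rightarrow> 'k) ` {0..<int p})"
    using card_poly_roots_bound[OF P0] deg by (simp add: card_image[OF inj])
  ultimately have "of_int ` {0..<int p} = {z :: 'k. poly P z = 0}"
    by (intro card_seteq poly_roots_finite P0)
  then have "y \<in> of_int ` {0..<int p}" using y roots by simp
  then obtain c where "c \<in> {0..<int p}" "of_int c = y" by auto
  then show ?thesis using inj by (intro ex1I[of _ c]) (auto dest: inj_onD)
qed

lemma residue_of:
  fixes y :: "'k :: field"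
  assumes "Factorial_Ring.prime p" "CHAR('k) = p" "y ^ p = y"
  shows "of_int (residue_of p y) = y" "0 \<le> residue_of p y" "residue_of p y < int p"
  using theI'[OF prime_field_characterization[OF assms]] by (auto simp: residue_of_def)

lemma ring_of_type_algebra_simps:
  "carrier ring_of_type_algebra = UNIV"
  "x \<otimes>\<^bsub>ring_of_type_algebra\<^esub> y = x * y" "x \<oplus>\<^bsub>ring_of_type_algebra\<^esub> y = x + y"
  "\<one>\<^bsub>ring_of_type_algebra\<^esub> = 1" "\<zero>\<^bsub>ring_of_type_algebra\<^esub> = 0"
  by (simp_all add: ring_of_type_algebra_def)

lemma ring_of_type_algebra_minus: "\<ominus>\<^bsub>ring_of_type_algebra\<^esub> (y :: 'k :: field) = - y"
proof -
  interpret field "ring_of_type_algebra :: 'k ring" by (rule field_from_type_algebra)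
  show ?thesis by (rule minus_equality) (simp_all add: ring_of_type_algebra_simps)
qed

lemma ring_of_type_algebra_inv:
  "(y :: 'k :: field) \<noteq> 0 \<Longrightarrow> inv\<^bsub>ring_of_type_algebra\<^esub> y = inverse y"
proof -
  assume y: "y \<noteq> 0"
  interpret field "ring_of_type_algebra :: 'k ring" by (rule field_from_type_algebra)
  show ?thesis using y by (intro comm_inv_char) (simp_all add: ring_of_type_algebra_simps)
qed

lemma generate_field_type_induct [consumes 1, case_names one incl minus inverse add mult]:
  fixes y :: "'k :: field"
  assumes "y \<in> generate_field ring_of_type_algebra A"
    and "P 1" "\<And>y. y \<in> A \<Longrightarrow> P y"
    and "\<And>y. y \<in> generate_field ring_of_type_algebra A \<Longrightarrow> P y \<Longrightarrow> P (- y)"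
    and "\<And>y. y \<in> generate_field ring_of_type_algebra A \<Longrightarrow> y \<noteq> 0 \<Longrightarrow> P y \<Longrightarrow> P (inverse y)"
    and "\<And>y z. y \<in> generate_field ring_of_type_algebra A \<Longrightarrow> z \<in> generate_field ring_of_type_algebra A
      \<Longrightarrow> P y \<Longrightarrow> P z \<Longrightarrow> P (y + z)"
    and "\<And>y z. y \<in> generate_field ring_of_type_algebra A \<Longrightarrow> z \<in> generate_field ring_of_type_algebra A
      \<Longrightarrow> P y \<Longrightarrow> P z \<Longrightarrow> P (y * z)"
  shows "P y"
  using assms(1)
proof (induction rule: generate_field.induct)
  case one
  show ?case using assms(2) by (simp add: ring_of_type_algebra_simps)
next
  case (a_inv h)
  then show ?case using assms(4) by (simp add: ring_of_type_algebra_minus)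
next
  case (m_inv h)
  then show ?case using assms(5) by (simp add: ring_of_type_algebra_inv ring_of_type_algebra_simps)
next
  case (eng_add h1 h2)
  then show ?case using assms(6) by (simp add: ring_of_type_algebra_simps)
next
  case (eng_mult h1 h2)
  then show ?case using assms(7) by (simp add: ring_of_type_algebra_simps)
qed (use assms(3) in auto)

locale cyclotomic_extension =
  fixes p k :: nat and \<zeta> :: "'k :: field"
  assumes p: "Factorial_Ring.prime p" and char: "CHAR('k) = p"
    and \<zeta>: "primitive_root_of_unity k \<zeta>" and coprime_pk: "coprime p k"
begin

abbreviation "F \<equiv> generate_field (ring_of_type_algebra :: 'k ring) {\<zeta>}"
abbreviation "\<Gamma> \<equiv> cyclotomic_galois \<zeta>"

lemma k_pos: "k > 0" and \<zeta>_k: "\<zeta> ^ k = 1"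
  using \<zeta> by (auto simp: primitive_root_of_unity_def)

lemma F_one: "1 \<in> F" and F_\<zeta>: "\<zeta> \<in> F"
  and F_minus: "y \<in> F \<Longrightarrow> - y \<in> F"
  and F_inverse: "y \<in> F \<Longrightarrow> y \<noteq> 0 \<Longrightarrow> inverse y \<in> F"
  and F_add: "y \<in> F \<Longrightarrow> y' \<in> F \<Longrightarrow> y + y' \<in> F"
  and F_mult: "y \<in> F \<Longrightarrow> y' \<in> F \<Longrightarrow> y * y' \<in> F"
proof -
  show "1 \<in> F" using generate_field.one[of ring_of_type_algebra "{\<zeta>}"] by (simp add: ring_of_type_algebra_simps)
  show "\<zeta> \<in> F" by (rule generate_field.incl) simp
  show "y \<in> F \<Longrightarrow> - y \<in> F"
    using generate_field.a_inv[of y ring_of_type_algebra "{\<zeta>}"] by (simp add: ring_of_type_algebra_minus)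
  show "y \<in> F \<Longrightarrow> y \<noteq> 0 \<Longrightarrow> inverse y \<in> F"
    using generate_field.m_inv[of y ring_of_type_algebra "{\<zeta>}"]
    by (simp add: ring_of_type_algebra_inv ring_of_type_algebra_simps)
  show "y \<in> F \<Longrightarrow> y' \<in> F \<Longrightarrow> y + y' \<in> F"
    using generate_field.eng_add[of y ring_of_type_algebra "{\<zeta>}" y'] by (simp add: ring_of_type_algebra_simps)
  show "y \<in> F \<Longrightarrow> y' \<in> F \<Longrightarrow> y * y' \<in> F"
    using generate_field.eng_mult[of y ring_of_type_algebra "{\<zeta>}" y'] by (simp add: ring_of_type_algebra_simps)
qed

lemma F_zero: "0 \<in> F"
  using F_add[OF F_one F_minus[OF F_one]] by simp

lemma F_power: "y \<in> F \<Longrightarrow> y ^ n \<in> F"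
  by (induction n) (auto simp: F_one F_mult)

lemma F_sum: "(\<And>i. i \<in> I \<Longrightarrow> f i \<in> F) \<Longrightarrow> sum f I \<in> F"
  by (induction I rule: infinite_finite_induct) (auto simp: F_zero F_add)

lemma F_of_int: "of_int c \<in> F"
proof -
  have nat: "of_nat n \<in> F" for n by (induction n) (auto simp: F_zero F_one F_add)
  show ?thesis by (cases c rule: int_cases2) (use nat in \<open>auto intro: F_minus\<close>)
qed

lemma root_of_unity_in_F: "y ^ k = 1 \<Longrightarrow> y \<in> F"
  using root_of_unity_is_power[OF \<zeta>] F_power[OF F_\<zeta>] by blast

lemma galois_iff:
  "\<theta> \<in> \<Gamma> \<longleftrightarrow> \<theta> \<in> extensional F \<and> bij_betw \<theta> F F \<and> \<theta> 1 = 1 \<and>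
     (\<forall>y\<in>F. \<forall>z\<in>F. \<theta> (y + z) = \<theta> y + \<theta> z \<and> \<theta> (y * z) = \<theta> y * \<theta> z) \<and>
     (\<forall>y\<in>prime_subfield. \<theta> y = y)"
proof -
  have "\<theta> ` F \<subseteq> F" if "bij_betw \<theta> F F" using that by (auto simp: bij_betw_def)
  then show ?thesis
    by (auto simp: galois_group_def cyclotomic_field_def ring_iso_def Ring.ring_hom_def ring_of_type_algebra_simps
        dest: bij_betwE)
qed

lemma galois_closed: "\<theta> \<in> \<Gamma> \<Longrightarrow> y \<in> F \<Longrightarrow> \<theta> y \<in> F"
  using galois_iff[of \<theta>] by (auto dest: bij_betwE)

lemma galois_add: "\<theta> \<in> \<Gamma> \<Longrightarrow> y \<in> F \<Longrightarrow> z \<in> F \<Longrightarrow> \<theta> (y + z) = \<theta> y + \<theta> z"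
  and galois_mult: "\<theta> \<in> \<Gamma> \<Longrightarrow> y \<in> F \<Longrightarrow> z \<in> F \<Longrightarrow> \<theta> (y * z) = \<theta> y * \<theta> z"
  and galois_one: "\<theta> \<in> \<Gamma> \<Longrightarrow> \<theta> 1 = 1"
  using galois_iff[of \<theta>] by auto

lemma galois_zero: "\<theta> \<in> \<Gamma> \<Longrightarrow> \<theta> 0 = 0"
proof -
  assume "\<theta> \<in> \<Gamma>"
  then have "\<theta> (0 + 0) = \<theta> 0 + \<theta> 0" by (intro galois_add F_zero)
  then have "\<theta> 0 + 0 = \<theta> 0 + \<theta> 0" unfolding add_0_right .
  then show ?thesis by (rule add_left_imp_eq[THEN sym])
qed

lemma galois_minus: "\<theta> \<in> \<Gamma> \<Longrightarrow> y \<in> F \<Longrightarrow> \<theta> (- y) = - \<theta> y"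
  using galois_add[of \<theta> y "- y"] F_minus[of y] galois_zero[of \<theta>] by (simp add: eq_neg_iff_add_eq_0 add.commute)

lemma galois_inverse: "\<theta> \<in> \<Gamma> \<Longrightarrow> y \<in> F \<Longrightarrow> y \<noteq> 0 \<Longrightarrow> \<theta> (inverse y) = inverse (\<theta> y)"
proof -
  assume *: "\<theta> \<in> \<Gamma>" "y \<in> F" "y \<noteq> 0"
  have "\<theta> y * \<theta> (inverse y) = 1"
    using galois_mult[OF *(1,2) F_inverse[OF *(2,3)]] galois_one[OF *(1)] *(3) by simp
  then show ?thesis by (metis inverse_unique)
qed

lemma galois_power: "\<theta> \<in> \<Gamma> \<Longrightarrow> y \<in> F \<Longrightarrow> \<theta> (y ^ n) = \<theta> y ^ n"
  by (induction n) (auto simp: galois_one galois_mult F_power)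

lemma galois_inj: "\<theta> \<in> \<Gamma> \<Longrightarrow> y \<in> F \<Longrightarrow> z \<in> F \<Longrightarrow> \<theta> y = \<theta> z \<Longrightarrow> y = z"
  using galois_iff[of \<theta>] by (auto simp: bij_betw_def dest: inj_onD)

lemma galois_eqI:
  assumes "\<theta> \<in> \<Gamma>" "\<theta>' \<in> \<Gamma>" "\<theta> \<zeta> = \<theta>' \<zeta>"
  shows "\<theta> = \<theta>'"
proof -
  have "\<theta> y = \<theta>' y" if "y \<in> F" for y
    using that
  proof (induction rule: generate_field_type_induct)
    case (inverse y)
    then show ?case using assms by (simp add: galois_inverse)
  qed (use assms in \<open>auto simp: galois_one galois_minus galois_add galois_mult\<close>)
  moreover have "\<theta> \<in> extensional F" "\<theta>' \<in> extensional F" using assms galois_iff by auto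
  ultimately show ?thesis by (meson extensionalityI)
qed

lemma prime_subfield_F:
  assumes "y \<in> (prime_subfield :: 'k set)"
  shows "y \<in> F"
  using assms
  by (induction rule: generate_field_type_induct) (blast intro: F_one F_minus F_inverse F_add F_mult)+

lemma galois_id: "restrict id F \<in> \<Gamma>"
proof -
  have "bij_betw (restrict id F) F F" by (rule bij_betwI[where g = id]) simp_all
  then show ?thesis
    unfolding galois_iff by (simp add: F_add F_mult F_one prime_subfield_F)
qed

lemma finite_galois: "finite \<Gamma>"
proof (rule finite_imageD)
  have "\<theta> \<zeta> ^ k = 1" if "\<theta> \<in> \<Gamma>" for \<theta>
    using galois_power[OF that F_\<zeta>, of k] galois_one[OF that] by (simp add: \<zeta>_k)
  then have "(\<lambda>\<theta>. \<theta> \<zeta>) ` \<Gamma> \<subseteq> {y. y ^ k = 1}" by auto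
  then show "finite ((\<lambda>\<theta>. \<theta> \<zeta>) ` \<Gamma>)" using finite_roots_of_unity[OF k_pos] finite_subset by blast
  show "inj_on (\<lambda>\<theta>. \<theta> \<zeta>) \<Gamma>" by (rule inj_onI) (auto intro: galois_eqI)
qed

lemma frobenius_add: "(y + z :: 'k) ^ p = y ^ p + z ^ p"
  by (rule freshmans_dream) (simp_all add: p char)

lemma frobenius_sum: "(sum f I :: 'k) ^ p = (\<Sum>i\<in>I. f i ^ p)"
  by (rule freshmans_dream_sum) (simp_all add: p char)

lemma frobenius_inj: "(y :: 'k) ^ p = z ^ p \<Longrightarrow> y = z"
proof -
  assume *: "y ^ p = z ^ p"
  have "z ^ p + (y - z) ^ p = y ^ p" using frobenius_add[of z "y - z"] by simp
  then have "(y - z) ^ p = 0" using * by simp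
  then show "y = z" by simp
qed

lemma frobenius_minus: "(- y :: 'k) ^ p = - (y ^ p)"
proof -
  have "y ^ p + (- y) ^ p = 0" using frobenius_add[of y "- y"] prime_gt_0_nat[OF p] by (simp add: power_0_left)
  then show ?thesis by (simp add: eq_neg_iff_add_eq_0 add.commute)
qed

lemma frobenius_prime_subfield: "(y :: 'k) \<in> prime_subfield \<Longrightarrow> y ^ p = y"
  by (induction rule: generate_field_type_induct)
    (auto simp: frobenius_minus frobenius_add power_mult_distrib power_inverse)

lemma frobenius_surj:
  assumes "y \<in> F"
  shows "\<exists>z\<in>F. y = z ^ p"
  using assms
proof (induction rule: generate_field_type_induct)
  case one
  show ?case using F_one by (intro bexI[of _ 1]) auto
next
  case (incl y)
  obtain j where j: "[p * j = Suc 0] (mod k)" using cong_solve_coprime_nat[OF coprime_pk] by blast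
  have "\<zeta> ^ (p * j) = \<zeta> ^ (1::nat)"
  proof -
    have pow: "\<zeta> ^ n = \<zeta> ^ (n mod k)" for n
    proof -
      have "\<zeta> ^ n = \<zeta> ^ (k * (n div k) + n mod k)" by simp
      also have "\<dots> = (\<zeta> ^ k) ^ (n div k) * \<zeta> ^ (n mod k)" by (simp only: power_add power_mult)
      finally show ?thesis by (simp add: \<zeta>_k)
    qed
    show ?thesis using j pow[of "p * j"] pow[of 1] by (simp add: cong_def)
  qed
  then have "\<zeta> = (\<zeta> ^ j) ^ p" by (simp add: mult.commute flip: power_mult)
  then show ?case using incl F_power[OF F_\<zeta>] by auto
next
  case (minus y)
  then show ?case using frobenius_minus F_minus by metis
next
  case (inverse y)
  then obtain z where "z \<in> F" "y = z ^ p" by blast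
  then show ?case using inverse(2) F_inverse[of z] prime_gt_0_nat[OF p]
    by (intro bexI[of _ "inverse z"]) (auto simp: power_inverse)
next
  case (add y z)
  then show ?case using frobenius_add F_add by metis
next
  case (mult y z)
  then show ?case using power_mult_distrib F_mult by metis
qed

lemma galois_frobenius_comp:
  assumes \<theta>: "\<theta> \<in> \<Gamma>"
  shows "(\<lambda>y\<in>F. \<theta> y ^ p) \<in> \<Gamma>"
proof -
  let ?f = "\<lambda>y\<in>F. \<theta> y ^ p"
  have "bij_betw ?f F F"
    unfolding bij_betw_def
  proof
    show "inj_on ?f F"
      by (rule inj_onI) (use \<theta> in \<open>auto dest!: frobenius_inj intro: galois_inj\<close>)
    show "?f ` F = F"
    proof (intro equalityI subsetI)
      fix y assume "y \<in> F"
      then obtain z where z: "z \<in> F" "y = z ^ p" using frobenius_surj by blast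
      have "\<theta> ` F = F" using \<theta> galois_iff by (auto simp: bij_betw_def)
      then obtain u where "u \<in> F" "z = \<theta> u" using z(1) by blast
      then show "y \<in> ?f ` F" using z(2) by (auto intro!: image_eqI[of _ _ u])
    qed (auto simp: F_power galois_closed \<theta>)
  qed
  moreover have "\<theta> y = y" if "y \<in> prime_subfield" for y using \<theta> that galois_iff by blast
  ultimately show ?thesis
    unfolding galois_iff by (simp add: \<theta> F_one F_add F_mult galois_one galois_add galois_mult frobenius_add
        power_mult_distrib frobenius_prime_subfield prime_subfield_F)
qed

text \<open>Composition with the Frobenius map permutes the Galois group, so that traces are fixed by
  it.\<close>

lemma trace_frobenius:
  assumes y: "y \<in> F"
  shows "cyclotomic_trace \<zeta> y ^ p = cyclotomic_trace \<zeta> y"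
proof -
  let ?c = "\<lambda>\<theta>. \<lambda>y\<in>F. (\<theta> y :: 'k) ^ p"
  have inj: "inj_on ?c \<Gamma>"
  proof (rule inj_onI)
    fix \<theta> \<theta>' assume *: "\<theta> \<in> \<Gamma>" "\<theta>' \<in> \<Gamma>" "?c \<theta> = ?c \<theta>'"
    have "\<theta> \<zeta> ^ p = \<theta>' \<zeta> ^ p" using fun_cong[OF *(3), of \<zeta>] F_\<zeta> by simp
    then show "\<theta> = \<theta>'" using * frobenius_inj galois_eqI by blast
  qed
  have "?c ` \<Gamma> \<subseteq> \<Gamma>" using galois_frobenius_comp by blast
  then have img: "?c ` \<Gamma> = \<Gamma>" using inj finite_galois by (intro endo_inj_surj)
  have "cyclotomic_trace \<zeta> y ^ p = (\<Sum>\<theta>\<in>\<Gamma>. \<theta> y ^ p)"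
    by (simp add: cyclotomic_trace_def frobenius_sum)
  also have "\<dots> = (\<Sum>\<theta>\<in>\<Gamma>. ?c \<theta> y)" using y by simp
  also have "\<dots> = (\<Sum>\<theta>\<in>?c ` \<Gamma>. \<theta> y)" by (rule sum.reindex_cong[OF inj refl refl, symmetric])
  also have "\<dots> = cyclotomic_trace \<zeta> y" by (simp add: img cyclotomic_trace_def)
  finally show ?thesis .
qed

end

section \<open>The characters in a cyclotomic class\<close>

text \<open>The character of degree one mapping a generator to \<open>\<zeta>\<close>.\<close>

lemma faithful_irr_char:
  fixes \<zeta> :: "'k :: alg_closed_field"
  assumes "group Q" "finite (carrier Q)" "cyclic_group Q" "primitive_root_of_unity (Coset.order Q) \<zeta>"
  shows "\<exists>\<chi>\<in>irr_chars Q. \<forall>g\<in>carrier Q. \<chi> g = (1 :: 'k) \<longrightarrow> g = \<one>\<^bsub>Q\<^esub>"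
proof -
  interpret group Q by fact
  define k where "k = Coset.order Q"
  obtain q where q: "q \<in> carrier Q" "\<And>g. g \<in> carrier Q \<Longrightarrow> \<exists>i<k. g = q [^]\<^bsub>Q\<^esub> (i::nat)"
    using finite_cyclic_group_generator[OF assms(1-3)] unfolding k_def by blast
  have \<zeta>: "k > 0" "\<zeta> ^ k = 1" "\<And>j. 0 < j \<Longrightarrow> j < k \<Longrightarrow> \<zeta> ^ j \<noteq> 1"
    using assms(4) by (auto simp: primitive_root_of_unity_def k_def)
  define ind where "ind g = (SOME i. i < k \<and> g = q [^]\<^bsub>Q\<^esub> (i::nat))" for g
  have ind: "ind g < k" "g = q [^]\<^bsub>Q\<^esub> ind g" if "g \<in> carrier Q" for g
    using someI_ex[of "\<lambda>i. i < k \<and> g = q [^]\<^bsub>Q\<^esub> i"] q(2)[OF that] by (auto simp: ind_def)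
  have inj: "inj_on ind (carrier Q)" by (rule inj_onI) (metis ind(2))
  have "ind ` carrier Q = {..<k}"
    using inj ind(1) by (intro card_seteq) (auto simp: card_image k_def Coset.order_def)
  then have ind_surj: "\<exists>g\<in>carrier Q. ind g = i" if "i < k" for i using that by (metis imageE lessThan_iff)
  have ind_pow: "ind (q [^]\<^bsub>Q\<^esub> i) = i" if "i < k" for i
    using ind_surj[OF that] ind(2) by metis
  have qk: "q [^]\<^bsub>Q\<^esub> k = \<one>\<^bsub>Q\<^esub>" using q(1) pow_order_eq_1 by (simp add: k_def)
  have ind_mult: "ind (g \<otimes>\<^bsub>Q\<^esub> h) = (ind g + ind h) mod k" if "g \<in> carrier Q" "h \<in> carrier Q" for g h
  proof -
    have "g \<otimes>\<^bsub>Q\<^esub> h = q [^]\<^bsub>Q\<^esub> (ind g + ind h)" using ind(2)[OF that(1)] ind(2)[OF that(2)] q(1) nat_pow_mult by metis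
    also have "\<dots> = q [^]\<^bsub>Q\<^esub> (k * ((ind g + ind h) div k)) \<otimes>\<^bsub>Q\<^esub> q [^]\<^bsub>Q\<^esub> ((ind g + ind h) mod k)"
      using q(1) by (simp add: nat_pow_mult)
    also have "\<dots> = q [^]\<^bsub>Q\<^esub> ((ind g + ind h) mod k)"
      using q(1) qk by (simp flip: nat_pow_pow)
    finally show ?thesis using ind_pow \<zeta>(1) by simp
  qed
  define \<rho> where "\<rho> g = mat 1 1 (\<lambda>_. \<zeta> ^ ind g)" for g
  have pow_mod: "\<zeta> ^ (n mod k) = \<zeta> ^ n" for n
  proof -
    have "\<zeta> ^ n = \<zeta> ^ (k * (n div k) + n mod k)" by simp
    also have "\<dots> = (\<zeta> ^ k) ^ (n div k) * \<zeta> ^ (n mod k)" by (simp only: power_add power_mult)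
    finally show ?thesis by (simp add: \<zeta>(2))
  qed
  have \<rho>_mult: "\<rho> (g \<otimes>\<^bsub>Q\<^esub> h) = \<rho> g * \<rho> h" if "g \<in> carrier Q" "h \<in> carrier Q" for g h
    by (rule eq_matI) (use that in \<open>auto simp: \<rho>_def ind_mult pow_mod times_mat_def scalar_prod_def power_add\<close>)
  have \<rho>_one: "\<rho> \<one>\<^bsub>Q\<^esub> = 1\<^sub>m 1"
    by (rule eq_matI) (use ind_pow[of 0] \<zeta>(1) in \<open>auto simp: \<rho>_def\<close>)
  have \<rho>_carr: "\<rho> g \<in> carrier_mat 1 1" for g by (simp add: \<rho>_def)
  have "irreducible_rep Q 1 \<rho>"
    unfolding irreducible_rep_def
  proof (intro conjI allI impI)
    show "\<rho> \<in> hom Q (units_of (ring_mat TYPE('k) 1 ()))"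
    proof (rule homI)
      fix g assume g: "g \<in> carrier Q"
      have "\<rho> g * \<rho> (inv\<^bsub>Q\<^esub> g) = 1\<^sub>m 1" "\<rho> (inv\<^bsub>Q\<^esub> g) * \<rho> g = 1\<^sub>m 1"
        using \<rho>_mult[of g "inv\<^bsub>Q\<^esub> g"] \<rho>_mult[of "inv\<^bsub>Q\<^esub> g" g] g by (simp_all add: \<rho>_one)
      then show "\<rho> g \<in> carrier (units_of (ring_mat TYPE('k) 1 ()))"
        using \<rho>_carr by (auto simp: units_of_carrier Units_def ring_mat_simps)
    qed (simp add: units_of_mult ring_mat_simps \<rho>_mult)
  next
    fix W :: "'k vec set"
    assume W: "VectorSpace.subspace class_ring W (module_vec TYPE('k) 1)"
    then have sub: "W \<subseteq> carrier_vec 1" and sm: "\<And>c y. y \<in> W \<Longrightarrow> c \<cdot>\<^sub>v y \<in> W" and z: "0\<^sub>v 1 \<in> W"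
      by (auto simp: VectorSpace.subspace_def submodule_def module_vec_simps)
    show "W = {0\<^sub>v 1} \<or> W = carrier_vec 1"
    proof (cases "W \<subseteq> {0\<^sub>v 1}")
      case False
      then obtain y where y: "y \<in> W" "y \<noteq> 0\<^sub>v 1" by auto
      then have y1: "y \<in> carrier_vec 1" "vec_index y 0 \<noteq> 0" using sub by (auto simp: vec_eq_iff)
      have "u \<in> W" if u: "u \<in> carrier_vec 1" for u
      proof -
        have "u = (vec_index u 0 / vec_index y 0) \<cdot>\<^sub>v y" using u y1 by (auto simp: vec_eq_iff)
        then show ?thesis using sm[OF y(1)] by metis
      qed
      then show ?thesis using sub by auto
    qed (use z in auto)
  qed simp
  then have "(\<lambda>g\<in>carrier Q. \<Sum>i<1. \<rho> g $$ (i, i)) \<in> irr_chars Q"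
    unfolding irr_chars_def by blast
  moreover have "g = \<one>\<^bsub>Q\<^esub>" if "g \<in> carrier Q" "(\<lambda>g\<in>carrier Q. \<Sum>i<1. \<rho> g $$ (i, i)) g = 1" for g
  proof -
    have "\<zeta> ^ ind g = 1" using that by (simp add: \<rho>_def)
    then have "ind g = 0" using \<zeta>(3) ind(1)[OF that(1)] by (metis gr0I)
    then show ?thesis using ind(2)[OF that(1)] by simp
  qed
  ultimately show ?thesis by blast
qed

text \<open>A class in \<open>cyclotomic_classes\<close> contains a generator of the character group, and some power of that
  generator is faithful. So the generator is faithful itself, and with it all its conjugates.\<close>

lemma cyclotomic_class_character:
  fixes \<zeta> :: "'k :: alg_closed_field"
  assumes Q: "group Q" "finite (carrier Q)" "cyclic_group Q"
    and p: "Factorial_Ring.prime p" "CHAR('k) = p" "coprime p (Coset.order Q)"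
    and \<zeta>: "primitive_root_of_unity (Coset.order Q) \<zeta>"
    and \<C>: "\<C> \<in> cyclotomic_classes Q \<zeta>" and \<chi>: "\<chi> \<in> \<C>"
  shows "\<And>g h. g \<in> carrier Q \<Longrightarrow> h \<in> carrier Q \<Longrightarrow> \<chi> (g \<otimes>\<^bsub>Q\<^esub> h) = \<chi> g * \<chi> h"
    and "\<chi> \<one>\<^bsub>Q\<^esub> = 1"
    and "\<And>g. g \<in> carrier Q \<Longrightarrow> \<chi> g = 1 \<Longrightarrow> g = \<one>\<^bsub>Q\<^esub>"
proof -
  interpret group Q by fact
  interpret cyclotomic_extension p "Coset.order Q" \<zeta> by unfold_locales (use p \<zeta> in auto)
  obtain \<chi>0 \<psi> where \<chi>0: "\<chi>0 \<in> irr_chars Q" "\<C> = galois_orbit Q \<zeta> \<chi>0"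
    and \<psi>: "\<psi> \<in> \<C>" "irr_chars_generator Q \<psi>"
    using \<C> by (auto simp: cyclotomic_classes_def)
  note hom = irr_chars_cyclic[OF Q \<chi>0(1)]
  have pow: "\<chi>0 (g [^]\<^bsub>Q\<^esub> n) = \<chi>0 g ^ n" if "g \<in> carrier Q" for g and n :: nat
    by (induction n) (use that in \<open>simp_all add: hom mult.commute\<close>)
  have in_F: "\<chi>0 g \<in> F" if "g \<in> carrier Q" for g
    using pow[OF that, of "Coset.order Q"] pow_order_eq_1[OF that] hom(2) by (intro root_of_unity_in_F) simp
  obtain \<theta> where \<theta>: "\<theta> \<in> \<Gamma>" "\<chi> = (\<lambda>q\<in>carrier Q. \<theta> (\<chi>0 q))" using \<chi> \<chi>0(2) by (auto simp: galois_orbit_def)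
  obtain \<theta>' where \<theta>': "\<theta>' \<in> \<Gamma>" "\<psi> = (\<lambda>q\<in>carrier Q. \<theta>' (\<chi>0 q))" using \<psi>(1) \<chi>0(2) by (auto simp: galois_orbit_def)
  show "\<chi> (g \<otimes>\<^bsub>Q\<^esub> h) = \<chi> g * \<chi> h" if "g \<in> carrier Q" "h \<in> carrier Q" for g h
    using that \<theta>(1) by (simp add: \<theta>(2) hom galois_mult in_F)
  show "\<chi> \<one>\<^bsub>Q\<^esub> = 1" by (simp add: \<theta>(2) hom galois_one \<theta>(1))
  show "g = \<one>\<^bsub>Q\<^esub>" if g: "g \<in> carrier Q" "\<chi> g = 1" for g
  proof -
    have "\<theta> (\<chi>0 g) = \<theta> 1" using g by (simp add: \<theta>(2) galois_one \<theta>(1))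
    then have "\<chi>0 g = 1" using galois_inj[OF \<theta>(1) in_F[OF g(1)] F_one] by simp
    then have "\<psi> g = 1" using g(1) by (simp add: \<theta>'(2) galois_one \<theta>'(1))
    moreover obtain \<eta> where \<eta>: "\<eta> \<in> irr_chars Q" "\<forall>g\<in>carrier Q. \<eta> g = (1 :: 'k) \<longrightarrow> g = \<one>\<^bsub>Q\<^esub>"
      using faithful_irr_char[OF Q \<zeta>] by blast
    moreover obtain j :: nat where "\<eta> = (\<lambda>q\<in>carrier Q. \<psi> q ^ j)"
      using \<psi>(2) \<eta>(1) by (auto simp: irr_chars_generator_def)
    ultimately show ?thesis using g(1) by simp
  qed
qed

section \<open>The idempotent of a cyclotomic class\<close>

locale strong_shoda_class = group G
  for G :: "('g, 'b) monoid_scheme" (structure) +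
  fixes p r :: nat and H K :: "'g set" and \<zeta> :: "'k :: alg_closed_field"
    and \<C> :: "('g set \<Rightarrow> 'k) set"
  assumes p: "Factorial_Ring.prime p" and r: "1 \<le> r"
    and finite_G: "finite (carrier G)" and coprime_G: "coprime p (Coset.order G)"
    and strong_shoda: "strong_shoda_pair G H K"
    and char: "CHAR('k) = p"
    and \<zeta>: "primitive_root_of_unity (Coset.order (subquotient G H K)) \<zeta>"
    and \<C>: "\<C> \<in> cyclotomic_classes (subquotient G H K) \<zeta>"

sublocale strong_shoda_class \<subseteq> finite_group_Zmod G "int p ^ r"
proof unfold_locales
  show "int p ^ r > 1" using p r prime_gt_1_nat[of p] by (intro one_less_power) auto
qed (rule finite_G)

context strong_shoda_class
begin

abbreviation "M \<equiv> int p ^ r"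
abbreviation "Q \<equiv> subquotient G H K"
abbreviation "k \<equiv> Coset.order Q"

lemma H: "subgroup H G" and K: "subgroup K G" and K_H: "K \<subseteq> H"
  and K_normal: "K \<lhd> G\<lparr>carrier := H\<rparr>" and Q_cyclic: "cyclic_group Q"
  using strong_shoda by (auto simp: strong_shoda_pair_def shoda_pair_def)

lemma H_G: "H \<subseteq> carrier G" and K_G: "K \<subseteq> carrier G"
  using H K subgroup.subset by auto

lemma H_carrier [simp]: "h \<in> H \<Longrightarrow> h \<in> carrier G"
  using H_G by auto

lemma H_closed [simp]: "h \<in> H \<Longrightarrow> h' \<in> H \<Longrightarrow> h \<otimes> h' \<in> H" "h \<in> H \<Longrightarrow> inv h \<in> H" "\<one> \<in> H"
  using subgroup.m_closed[OF H] subgroup.m_inv_closed[OF H] subgroup.one_closed[OF H] by auto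

lemma finite_H: "finite H"
  using finite_G H_G finite_subset by blast

lemma H_mult_iff: "h \<in> H \<Longrightarrow> x \<in> carrier G \<Longrightarrow> h \<otimes> x \<in> H \<longleftrightarrow> x \<in> H"
  "h \<in> H \<Longrightarrow> x \<in> carrier G \<Longrightarrow> x \<otimes> h \<in> H \<longleftrightarrow> x \<in> H"
proof -
  assume h: "h \<in> H" and x: "x \<in> carrier G"
  have "x \<in> H" if "h \<otimes> x \<in> H"
    using H_closed(1)[OF H_closed(2)[OF h] that] h x by (simp flip: m_assoc)
  then show "h \<otimes> x \<in> H \<longleftrightarrow> x \<in> H" using h by auto
  have "x \<in> H" if "x \<otimes> h \<in> H"
    using H_closed(1)[OF that H_closed(2)[OF h]] h x by (simp add: m_assoc)
  then show "x \<otimes> h \<in> H \<longleftrightarrow> x \<in> H" using h by auto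
qed

lemma group_Q: "group Q"
  using K_normal by (rule normal.factorgroup_is_group)

lemma carrier_Q: "carrier Q = (\<lambda>x. K #> x) ` H"
  by (auto simp: carrier_FactGroup r_coset_def)

lemma finite_Q: "finite (carrier Q)"
  using finite_H by (simp add: carrier_Q)

lemma coprime_card_H: "coprime p (card H)"
proof -
  have "card H dvd Coset.order G"
    unfolding lagrange_finite[OF finite_G H, symmetric] by (rule dvd_triv_right)
  from coprime_divisors[OF dvd_refl this coprime_G] show ?thesis .
qed

lemma coprime_k: "coprime p k"
proof -
  interpret GH: group "G\<lparr>carrier := H\<rparr>" by (rule subgroup_imp_group[OF H])
  have "card (rcosets\<^bsub>G\<lparr>carrier := H\<rparr>\<^esub> K) * card K = Coset.order (G\<lparr>carrier := H\<rparr>)"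
    using finite_H K_normal by (intro GH.lagrange_finite) (auto simp: normal_def)
  then have "k * card K = card H" by (simp add: Coset.order_def FactGroup_def)
  then have "k dvd card H" using dvd_triv_left[of k "card K"] by simp
  from coprime_divisors[OF dvd_refl this coprime_card_H] show ?thesis .
qed

sublocale cyclotomic_extension p k \<zeta>
  by unfold_locales (use p char \<zeta> coprime_k in auto)

definition \<chi> :: "'g \<Rightarrow> 'k" where
  "\<chi> h = (SOME \<chi>. \<chi> \<in> \<C>) (K #> h)"

lemma some_\<C>: "(SOME \<chi>. \<chi> \<in> \<C>) \<in> \<C>"
proof -
  have "\<exists>\<chi>. \<chi> \<in> \<C>" using \<C> by (auto simp: cyclotomic_classes_def)
  then show ?thesis by (rule someI_ex)
qed

lemmas char_facts =
  cyclotomic_class_character[OF group_Q finite_Q Q_cyclic p char coprime_k \<zeta> \<C> some_\<C>]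

lemma \<chi>_mult: "x \<in> H \<Longrightarrow> y \<in> H \<Longrightarrow> \<chi> (x \<otimes> y) = \<chi> x * \<chi> y"
proof -
  assume xy: "x \<in> H" "y \<in> H"
  have "(K #> x) \<otimes>\<^bsub>Q\<^esub> (K #> y) = K #> (x \<otimes> y)"
    using normal.rcos_sum[OF K_normal, of x y] xy by (simp add: r_coset_def set_mult_def)
  then show ?thesis using char_facts(1)[of "K #> x" "K #> y"] xy by (simp add: \<chi>_def carrier_Q)
qed

lemma \<chi>_one_iff: "x \<in> H \<Longrightarrow> \<chi> x = 1 \<longleftrightarrow> x \<in> K"
proof -
  assume x: "x \<in> H"
  have "\<chi> x = 1 \<longleftrightarrow> K #> x = K"
    using char_facts(2) char_facts(3)[of "K #> x"] x by (auto simp: \<chi>_def carrier_Q)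
  also have "\<dots> \<longleftrightarrow> x \<in> K"
    using coset_join1[OF _ _ K, of x] coset_join2[OF _ K, of x] K_G x by auto
  finally show ?thesis .
qed

lemma \<chi>_one: "\<chi> \<one> = 1"
  using \<chi>_one_iff[of \<one>] subgroup.one_closed[OF K] by simp

lemma \<chi>_inv: "x \<in> H \<Longrightarrow> \<chi> (inv x) * \<chi> x = 1"
  using \<chi>_mult[of "inv x" x] \<chi>_one by simp

lemma \<chi>_nonzero: "x \<in> H \<Longrightarrow> \<chi> x \<noteq> 0"
  using \<chi>_inv[of x] by auto

lemma \<chi>_pow: "x \<in> H \<Longrightarrow> \<chi> (x [^] (n::nat)) = \<chi> x ^ n \<and> x [^] n \<in> H"
  by (induction n) (auto simp: \<chi>_one \<chi>_mult)

lemma \<chi>_eqD: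
  assumes "x \<in> H" "y \<in> H" "\<chi> x = \<chi> y"
  shows "x \<otimes> inv y \<in> K"
proof -
  have "\<chi> (x \<otimes> inv y) = 1" using assms \<chi>_inv[of y] by (simp add: \<chi>_mult mult.commute)
  then show ?thesis using \<chi>_one_iff assms by simp
qed

lemma coset_pow: "x \<in> H \<Longrightarrow> (K #> x) [^]\<^bsub>Q\<^esub> (n::nat) = K #> (x [^] n)"
proof (induction n)
  case 0
  show ?case using coset_mult_one[OF K_G] by simp
next
  case (Suc n)
  have "(K #> (x [^] n)) \<otimes>\<^bsub>Q\<^esub> (K #> x) = K #> (x [^] n \<otimes> x)"
    using normal.rcos_sum[OF K_normal, of "x [^] n" x] Suc.prems \<chi>_pow[of x n] by (simp add: r_coset_def set_mult_def)
  then show ?case using Suc by simp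
qed

lemma \<chi>_k: "x \<in> H \<Longrightarrow> \<chi> x ^ k = 1"
proof -
  assume x: "x \<in> H"
  have "(K #> x) [^]\<^bsub>Q\<^esub> k = \<one>\<^bsub>Q\<^esub>"
    using group.pow_order_eq_1[OF group_Q, of "K #> x"] x by (simp add: carrier_Q)
  then have "K #> (x [^] k) = K" using coset_pow[OF x] by simp
  then have "\<chi> (x [^] k) = \<chi> \<one>" using coset_mult_one[OF K_G] by (simp add: \<chi>_def)
  then show ?thesis using \<chi>_pow[OF x] \<chi>_one by simp
qed

lemma \<chi>_F: "x \<in> H \<Longrightarrow> \<chi> x \<in> F"
  using \<chi>_k root_of_unity_in_F by blast

lemma \<zeta>_in_\<chi>: "\<exists>x\<in>H. \<zeta> = \<chi> x"
proof -
  let ?f = "\<lambda>q. (SOME \<chi>. \<chi> \<in> \<C>) q" and ?U = "{y :: 'k. y ^ k = 1}"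
  have "inj_on ?f (carrier Q)"
  proof (rule inj_onI)
    fix q q' assume "q \<in> carrier Q" "q' \<in> carrier Q" "?f q = ?f q'"
    then obtain x y where xy: "x \<in> H" "y \<in> H" "q = K #> x" "q' = K #> y" "\<chi> x = \<chi> y"
      by (auto simp: carrier_Q \<chi>_def)
    have "x \<otimes> inv y \<in> K" using \<chi>_eqD xy by blast
    then have "K #> (x \<otimes> inv y) = K" using coset_join2[OF _ K] K_G by auto
    then have "K #> (x \<otimes> inv y) #> y = K #> y" by simp
    then show "q = q'" using xy K_G by (simp add: coset_mult_assoc m_assoc)
  qed
  then have card: "card (?f ` carrier Q) = k" by (simp add: card_image Coset.order_def)
  have "?U \<subseteq> (\<lambda>i. \<zeta> ^ i) ` {..<k}" using root_of_unity_is_power[OF \<zeta>] by auto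
  then have "card ?U \<le> card ((\<lambda>i. \<zeta> ^ i) ` {..<k})" by (intro card_mono) auto
  also have "\<dots> \<le> k" using card_image_le[of "{..<k}" "\<lambda>i. \<zeta> ^ i"] by simp
  finally have "card ?U \<le> card (?f ` carrier Q)" using card by simp
  moreover have "?f ` carrier Q \<subseteq> ?U" using \<chi>_k by (auto simp: carrier_Q \<chi>_def)
  ultimately have "?f ` carrier Q = ?U"
    using finite_roots_of_unity[OF k_pos] by (intro card_seteq) auto
  then have "\<zeta> \<in> ?f ` carrier Q" using \<zeta>_k by simp
  then show ?thesis by (auto simp: carrier_Q \<chi>_def)
qed

subsection \<open>The character of the group ring\<close>

definition char_ring :: "('g \<Rightarrow> int) \<Rightarrow> 'k" where
  "char_ring f = (\<Sum>h\<in>H. of_int (f h) * \<chi> h)"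

abbreviation "SH \<equiv> supported H"
abbreviation "SR \<equiv> sub_group_ring (residue_ring M) G H"

lemma of_int_eq_iff: "(of_int a :: 'k) = of_int b \<longleftrightarrow> [a = b] (mod int p)"
  using of_int_eq_iff_cong_CHAR[where 'a = 'k] char by simp

lemma p_dvd_M: "int p dvd M"
  using r by (simp add: dvd_power)

lemma of_int_mod_M: "(of_int (a mod M) :: 'k) = of_int a"
  unfolding of_int_eq_iff using p_dvd_M by (simp add: cong_def mod_mod_cancel)

lemma of_int_0_iff: "(of_int a :: 'k) = 0 \<longleftrightarrow> int p dvd a"
  using of_int_eq_iff[of a 0] by (simp add: cong_0_iff)

lemma char_ring_add: "char_ring (f \<oplus>\<^bsub>ZG\<^esub> g) = char_ring f + char_ring g"
proof -
  have "of_int ((f \<oplus>\<^bsub>ZG\<^esub> g) h) = (of_int (f h) + of_int (g h) :: 'k)" if "h \<in> H" for h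
    using that by (simp add: grm_add_apply of_int_mod_M)
  then show ?thesis by (simp add: char_ring_def sum.distrib distrib_right)
qed

lemma char_ring_zero: "char_ring \<zero>\<^bsub>ZG\<^esub> = 0"
  by (simp add: char_ring_def grm_zero_apply)

lemma char_ring_elt: "u \<in> H \<Longrightarrow> char_ring (\<delta> u) = \<chi> u"
proof -
  assume u: "u \<in> H"
  have "of_int (\<delta> u h) * \<chi> h = (if h = u then \<chi> u else 0)" if "h \<in> H" for h
    using that by (simp add: grm_elt_apply)
  then have "char_ring (\<delta> u) = (\<Sum>h\<in>H. if h = u then \<chi> u else 0)" by (simp add: char_ring_def)
  then show ?thesis using u finite_H by simp
qed

lemma SH_ZG [simp]: "f \<in> SH \<Longrightarrow> f \<in> carrier ZG"
  by (rule supportedD)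

lemma SH_closed [simp]:
  "f \<in> SH \<Longrightarrow> g \<in> SH \<Longrightarrow> f \<otimes>\<^bsub>ZG\<^esub> g \<in> SH" "f \<in> SH \<Longrightarrow> g \<in> SH \<Longrightarrow> f \<oplus>\<^bsub>ZG\<^esub> g \<in> SH"
  "f \<in> SH \<Longrightarrow> \<ominus>\<^bsub>ZG\<^esub> f \<in> SH" "f \<in> SH \<Longrightarrow> g \<in> SH \<Longrightarrow> f \<ominus>\<^bsub>ZG\<^esub> g \<in> SH"
  "\<one>\<^bsub>ZG\<^esub> \<in> SH" "\<zero>\<^bsub>ZG\<^esub> \<in> SH" "u \<in> H \<Longrightarrow> \<delta> u \<in> SH"
  using subringE(2,3,5,6,7)[OF subring_supported[OF H]] by (auto simp: a_minus_def intro: gr_elt_supported)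

lemma SH_pow [simp]: "f \<in> SH \<Longrightarrow> f [^]\<^bsub>ZG\<^esub> (n::nat) \<in> SH"
  by (induction n) auto

lemma SH_outside: "f \<in> SH \<Longrightarrow> x \<in> carrier G \<Longrightarrow> x \<notin> H \<Longrightarrow> f x = 0"
  unfolding supported_def residue_ring_simps by blast

lemma SH_I: "f \<in> carrier ZG \<Longrightarrow> (\<And>x. x \<in> carrier G \<Longrightarrow> x \<notin> H \<Longrightarrow> f x = 0) \<Longrightarrow> f \<in> SH"
  unfolding supported_def residue_ring_simps by blast

lemma char_ring_elt_mult:
  assumes u: "u \<in> H" and g: "g \<in> SH"
  shows "char_ring (\<delta> u \<otimes>\<^bsub>ZG\<^esub> g) = \<chi> u * char_ring g"
proof -
  have "char_ring (\<delta> u \<otimes>\<^bsub>ZG\<^esub> g) = (\<Sum>h\<in>H. of_int (g (inv u \<otimes> h)) * \<chi> h)"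
    unfolding char_ring_def using u g by (intro sum.cong refl) (simp add: gr_elt_mult_left_apply)
  also have "\<dots> = (\<Sum>h\<in>H. of_int (g h) * \<chi> (u \<otimes> h))"
    by (rule sum.reindex_bij_witness[where i = "\<lambda>h. u \<otimes> h" and j = "\<lambda>h. inv u \<otimes> h"])
      (use u in \<open>simp_all flip: m_assoc\<close>)
  also have "\<dots> = \<chi> u * char_ring g"
    unfolding char_ring_def sum_distrib_left using u by (intro sum.cong refl) (simp add: \<chi>_mult)
  finally show ?thesis .
qed

lemma char_ring_mult:
  assumes "f \<in> SH" and g: "g \<in> SH"
  shows "char_ring (f \<otimes>\<^bsub>ZG\<^esub> g) = char_ring f * char_ring g"
  using assms(1) H_G
proof (induction rule: supported_induct)
  case zero
  show ?case using g by (simp add: char_ring_zero)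
next
  case (add f u)
  have "(f \<oplus>\<^bsub>ZG\<^esub> \<delta> u) \<otimes>\<^bsub>ZG\<^esub> g = f \<otimes>\<^bsub>ZG\<^esub> g \<oplus>\<^bsub>ZG\<^esub> \<delta> u \<otimes>\<^bsub>ZG\<^esub> g"
    using add g by (simp add: ZG.l_distr)
  then show ?case using add g by (simp add: char_ring_add char_ring_elt char_ring_elt_mult distrib_right)
qed

lemma char_ring_one: "char_ring \<one>\<^bsub>ZG\<^esub> = 1"
  by (simp add: gr_one_eq char_ring_elt \<chi>_one)

lemma char_ring_minus: "f \<in> SH \<Longrightarrow> char_ring (\<ominus>\<^bsub>ZG\<^esub> f) = - char_ring f"
  using char_ring_add[of "\<ominus>\<^bsub>ZG\<^esub> f" f] by (simp add: ZG.l_neg char_ring_zero eq_neg_iff_add_eq_0)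

lemma char_ring_diff: "f \<in> SH \<Longrightarrow> g \<in> SH \<Longrightarrow> char_ring (f \<ominus>\<^bsub>ZG\<^esub> g) = char_ring f - char_ring g"
  by (simp add: a_minus_def char_ring_add char_ring_minus)

lemma char_ring_pow: "f \<in> SH \<Longrightarrow> char_ring (f [^]\<^bsub>ZG\<^esub> (n::nat)) = char_ring f ^ n"
  by (induction n) (simp_all add: char_ring_one char_ring_mult mult.commute)

lemma char_ring_F: "char_ring f \<in> F"
  unfolding char_ring_def by (intro F_sum F_mult F_of_int \<chi>_F)

subsection \<open>The trace idempotent modulo p\<close>

abbreviation "tr \<equiv> cyclotomic_trace \<zeta>"

lemma tr_add: "y \<in> F \<Longrightarrow> z \<in> F \<Longrightarrow> tr (y + z) = tr y + tr z"
  by (simp add: cyclotomic_trace_def galois_add sum.distrib)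

lemma tr_zero: "tr 0 = 0"
  by (simp add: cyclotomic_trace_def galois_zero)

definition \<epsilon> :: "'g \<Rightarrow> int" where
  "\<epsilon> = eps_C p G H K \<zeta> \<C>"

abbreviation "cH \<equiv> inverse (of_nat (card H)) :: 'k"

lemma card_H_nonzero: "of_nat (card H) \<noteq> (0 :: 'k)"
proof
  assume "of_nat (card H) = (0 :: 'k)"
  then have "p dvd card H" using char by (simp add: of_nat_eq_0_iff_char_dvd)
  from coprime_common_divisor[OF coprime_card_H dvd_refl this] show False using p by simp
qed

lemma cH_frobenius: "cH ^ p = cH"
proof -
  have "(of_nat (card H) :: 'k) = (\<Sum>i<card H. 1)" by simp
  then have "(of_nat (card H) :: 'k) ^ p = (\<Sum>i<card H. 1 ^ p)" using frobenius_sum[of "\<lambda>_. 1" "{..<card H}"] by metis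
  then show ?thesis by (simp add: power_inverse)
qed

lemma eps_apply:
  assumes "x \<in> H"
  shows "of_int (\<epsilon> x) = cH * tr (\<chi> (inv x))" "0 \<le> \<epsilon> x" "\<epsilon> x < int p"
proof -
  have eq: "\<epsilon> x = residue_of p (cH * tr (\<chi> (inv x)))"
    using assms by (simp add: \<epsilon>_def eps_C_def \<chi>_def)
  have "(cH * tr (\<chi> (inv x))) ^ p = cH * tr (\<chi> (inv x))"
    using assms cH_frobenius trace_frobenius[OF \<chi>_F, of "inv x"] by (simp add: power_mult_distrib)
  from residue_of[OF p char this] show "of_int (\<epsilon> x) = cH * tr (\<chi> (inv x))" "0 \<le> \<epsilon> x" "\<epsilon> x < int p"
    by (simp_all add: eq)
qed

lemma eps_SH [simp]: "\<epsilon> \<in> SH"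
proof (rule SH_I)
  have out: "\<epsilon> x = 0" if "x \<in> carrier G" "x \<notin> H" for x using that by (simp add: \<epsilon>_def eps_C_def)
  then show "\<epsilon> x = 0" if "x \<in> carrier G" "x \<notin> H" for x using that by simp
  have pM: "int p \<le> M" by (rule zdvd_imp_le[OF p_dvd_M]) (use modulus in linarith)
  show "\<epsilon> \<in> carrier ZG"
    unfolding gr_carrier residue_ring_simps
  proof (rule PiE_I)
    fix x assume "x \<in> carrier G"
    then have "0 \<le> \<epsilon> x \<and> \<epsilon> x < M"
      using eps_apply(2,3)[of x] out[of x] pM modulus by (cases "x \<in> H") linarith+
    then show "\<epsilon> x \<in> {0..<M}" by simp
  qed (simp add: \<epsilon>_def eps_C_def)
qed

text \<open>Multiplication by \<open>\<epsilon>\<close> factors through the character: modulo \<open>p\<close>, the element \<open>f\<epsilon>\<close> is determined by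
  \<open>char_ring f\<close>.\<close>

lemma mult_eps_apply:
  assumes "f \<in> SH" and x: "x \<in> H"
  shows "of_int ((f \<otimes>\<^bsub>ZG\<^esub> \<epsilon>) x) = cH * tr (\<chi> (inv x) * char_ring f)"
  using assms(1) H_G
proof (induction rule: supported_induct)
  case zero
  show ?case using x by (simp add: grm_zero_apply char_ring_zero tr_zero)
next
  case (add f u)
  have "(f \<oplus>\<^bsub>ZG\<^esub> \<delta> u) \<otimes>\<^bsub>ZG\<^esub> \<epsilon> = f \<otimes>\<^bsub>ZG\<^esub> \<epsilon> \<oplus>\<^bsub>ZG\<^esub> \<delta> u \<otimes>\<^bsub>ZG\<^esub> \<epsilon>"
    using add by (simp add: ZG.l_distr)
  then have "of_int (((f \<oplus>\<^bsub>ZG\<^esub> \<delta> u) \<otimes>\<^bsub>ZG\<^esub> \<epsilon>) x) = (of_int ((f \<otimes>\<^bsub>ZG\<^esub> \<epsilon>) x) + of_int (\<epsilon> (inv u \<otimes> x)) :: 'k)"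
    using add x by (simp add: grm_add_apply of_int_mod_M gr_elt_mult_left_apply)
  also have "\<dots> = cH * tr (\<chi> (inv x) * char_ring f) + cH * tr (\<chi> (inv x) * \<chi> u)"
    using add x by (simp add: eps_apply(1) inv_mult_group \<chi>_mult)
  also have "\<dots> = cH * tr (\<chi> (inv x) * char_ring (f \<oplus>\<^bsub>ZG\<^esub> \<delta> u))"
    using add x by (simp add: char_ring_add char_ring_elt distrib_left tr_add F_mult \<chi>_F char_ring_F)
  finally show ?case .
qed

text \<open>Only the identity of the Galois group fixes the character, so that orthogonality of characters
  leaves a single term.\<close>

lemma char_ring_eps: "char_ring \<epsilon> = 1"
proof -
  have "char_ring \<epsilon> = (\<Sum>h\<in>H. \<Sum>\<theta>\<in>\<Gamma>. cH * (\<theta> (\<chi> (inv h)) * \<chi> h))"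
    unfolding char_ring_def
    by (intro sum.cong refl) (simp add: eps_apply(1) cyclotomic_trace_def sum_distrib_left sum_distrib_right mult.assoc)
  also have "\<dots> = (\<Sum>\<theta>\<in>\<Gamma>. \<Sum>h\<in>H. cH * (\<theta> (\<chi> (inv h)) * \<chi> h))" by (rule sum.swap)
  also have "\<dots> = (\<Sum>\<theta>\<in>\<Gamma>. if \<theta> = restrict id F then 1 else 0)"
  proof (intro sum.cong refl)
    fix \<theta> assume \<theta>: "\<theta> \<in> \<Gamma>"
    define \<phi> where "\<phi> h = \<theta> (\<chi> (inv h)) * \<chi> h" for h
    have \<phi>_mult: "\<phi> (g \<otimes> h) = \<phi> g * \<phi> h" if "g \<in> H" "h \<in> H" for g h
      using that \<theta> by (simp add: \<phi>_def inv_mult_group \<chi>_mult galois_mult \<chi>_F)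
    have sum: "(\<Sum>h\<in>H. cH * \<phi> h) = cH * (\<Sum>h\<in>H. \<phi> h)" by (simp add: sum_distrib_left)
    show "(\<Sum>h\<in>H. cH * (\<theta> (\<chi> (inv h)) * \<chi> h)) = (if \<theta> = restrict id F then 1 else 0)"
    proof (cases "\<theta> = restrict id F")
      case True
      have "\<phi> h = 1" if "h \<in> H" for h using that \<chi>_inv[of h] \<chi>_F[of "inv h"] by (simp add: \<phi>_def True)
      then have "(\<Sum>h\<in>H. \<phi> h) = of_nat (card H)" by simp
      then show ?thesis using sum card_H_nonzero True by (simp add: \<phi>_def)
    next
      case False
      have "\<exists>g\<in>H. \<phi> g \<noteq> 1"
      proof (rule ccontr)
        assume "\<not> (\<exists>g\<in>H. \<phi> g \<noteq> 1)"
        then have 1: "\<phi> g = 1" if "g \<in> H" for g using that by blast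
        obtain x where x: "x \<in> H" "\<zeta> = \<chi> x" using \<zeta>_in_\<chi> by blast
        have "\<theta> (\<chi> x) * \<chi> (inv x) = \<chi> x * \<chi> (inv x)"
          using 1[of "inv x"] \<chi>_inv[of x] x(1) by (simp add: \<phi>_def mult.commute)
        then have "\<theta> \<zeta> = restrict id F \<zeta>" using x \<chi>_nonzero[of "inv x"] F_\<zeta> by simp
        then show False using galois_eqI[OF \<theta> galois_id] False by blast
      qed
      then obtain g where g: "g \<in> H" "\<phi> g \<noteq> 1" by blast
      have "(\<Sum>h\<in>H. \<phi> h) = (\<Sum>h\<in>H. \<phi> (g \<otimes> h))"
        by (rule sum.reindex_bij_witness[where i = "\<lambda>h. g \<otimes> h" and j = "\<lambda>h. inv g \<otimes> h"])
          (use g in \<open>simp_all flip: m_assoc\<close>)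
      also have "\<dots> = \<phi> g * (\<Sum>h\<in>H. \<phi> h)" using g by (simp add: \<phi>_mult sum_distrib_left)
      finally have "(\<phi> g - 1) * (\<Sum>h\<in>H. \<phi> h) = 0" by (simp add: algebra_simps)
      then have "(\<Sum>h\<in>H. \<phi> h) = 0" using g(2) by simp
      then show ?thesis using sum False by (simp add: \<phi>_def)
    qed
  qed
  also have "\<dots> = 1" using galois_id finite_galois by simp
  finally show ?thesis .
qed

subsection \<open>Elements divisible by p\<close>

definition p_dvd :: "('g \<Rightarrow> int) \<Rightarrow> bool" where
  "p_dvd f \<longleftrightarrow> (\<forall>x\<in>carrier G. int p dvd f x)"

lemma p_dvd_mult: "f \<in> carrier ZG \<Longrightarrow> g \<in> carrier ZG \<Longrightarrow> p_dvd f \<Longrightarrow> p_dvd (f \<otimes>\<^bsub>ZG\<^esub> g)"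
  unfolding p_dvd_def
  by (intro ballI) (simp add: grm_mult_apply dvd_mod_iff p_dvd_M dvd_sum)

lemma p_dvd_nilpotent:
  assumes f: "f \<in> carrier ZG" "p_dvd f"
  shows "f [^]\<^bsub>ZG\<^esub> r = \<zero>\<^bsub>ZG\<^esub>"
proof -
  have pow: "int p ^ i dvd (f [^]\<^bsub>ZG\<^esub> i) x" if "i \<le> r" "x \<in> carrier G" for i x
    using that
  proof (induction i arbitrary: x)
    case (Suc i)
    have "int p ^ Suc i dvd (\<Sum>y\<in>carrier G. (f [^]\<^bsub>ZG\<^esub> i) y * f (inv y \<otimes> x))"
    proof (rule dvd_sum)
      fix y assume y: "y \<in> carrier G"
      have "int p ^ i * int p dvd (f [^]\<^bsub>ZG\<^esub> i) y * f (inv y \<otimes> x)"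
        using Suc y f(2) by (intro mult_dvd_mono) (auto simp: p_dvd_def)
      then show "int p ^ Suc i dvd (f [^]\<^bsub>ZG\<^esub> i) y * f (inv y \<otimes> x)" by (simp add: mult.commute)
    qed
    moreover have "int p ^ Suc i dvd M" using Suc.prems(1) by (rule le_imp_power_dvd)
    ultimately show ?case using f Suc.prems by (simp add: grm_mult_apply dvd_mod_iff del: power_Suc)
  qed simp
  show ?thesis
  proof (rule gr_ext)
    fix x assume x: "x \<in> carrier G"
    let ?v = "(f [^]\<^bsub>ZG\<^esub> r) x"
    have "M dvd ?v" using pow[of r] x by simp
    moreover have "0 \<le> ?v \<and> ?v < M" by (rule grm_range) (use f x in simp_all)
    ultimately have "?v = 0" using zdvd_not_zless[of ?v M] by (cases "?v = 0") auto
    then show "?v = \<zero>\<^bsub>ZG\<^esub> x" using x by (simp add: grm_zero_apply)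
  qed (use f in simp_all)
qed

lemma p_dvd_idempotent:
  assumes f: "f \<in> carrier ZG" "f \<otimes>\<^bsub>ZG\<^esub> f = f" "p_dvd f"
  shows "f = \<zero>\<^bsub>ZG\<^esub>"
proof -
  have "f [^]\<^bsub>ZG\<^esub> Suc n = f" for n by (induction n) (use f in simp_all)
  then have "f [^]\<^bsub>ZG\<^esub> r = f" using r by (metis Suc_pred' less_eq_Suc_le One_nat_def)
  then show ?thesis using p_dvd_nilpotent f by simp
qed

lemma p_dvd_mult_eps:
  assumes f: "f \<in> SH" "char_ring f = 0"
  shows "p_dvd (f \<otimes>\<^bsub>ZG\<^esub> \<epsilon>)"
  unfolding p_dvd_def
proof
  fix x assume x: "x \<in> carrier G"
  show "int p dvd (f \<otimes>\<^bsub>ZG\<^esub> \<epsilon>) x"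
  proof (cases "x \<in> H")
    case True
    then have "of_int ((f \<otimes>\<^bsub>ZG\<^esub> \<epsilon>) x) = (0 :: 'k)" using mult_eps_apply[OF f(1) True] f(2) by (simp add: tr_zero)
    then show ?thesis by (simp only: of_int_0_iff)
  next
    case False
    then show ?thesis using SH_outside[of "f \<otimes>\<^bsub>ZG\<^esub> \<epsilon>" x] f(1) x by simp
  qed
qed

subsection \<open>The lifted idempotent\<close>

definition \<omega> :: "'g \<Rightarrow> int" where
  "\<omega> = omega_C p r G H K \<zeta> \<C>"

lemma ring_SR: "ring SR"
  using ring_sub_group_ring[OF H] .

lemma SR_simps:
  "carrier SR = SH" "monoid.mult SR = monoid.mult ZG" "ring.add SR = ring.add ZG"
  "\<one>\<^bsub>SR\<^esub> = \<one>\<^bsub>ZG\<^esub>" "\<zero>\<^bsub>SR\<^esub> = \<zero>\<^bsub>ZG\<^esub>"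
  by (simp_all add: sub_group_ring_eq)

lemma SR_pow: "f [^]\<^bsub>SR\<^esub> (n::nat) = f [^]\<^bsub>ZG\<^esub> n"
  by (simp add: nat_pow_def SR_simps)

lemma SR_uminus: "f \<in> SH \<Longrightarrow> \<ominus>\<^bsub>SR\<^esub> f = \<ominus>\<^bsub>ZG\<^esub> f"
  by (rule a_inv_subcarrier)
    (use ring_SR ZG.abelian_group_axioms in \<open>auto simp: SR_simps ring.is_abelian_group\<close>)

text \<open>The character value \<open>1\<close> makes \<open>\<epsilon>\<close> idempotent modulo \<open>p\<close>, and \<open>p\<^sup>r = 0\<close>.\<close>

lemma eps_nilpotent: "(\<epsilon> \<otimes>\<^bsub>SR\<^esub> \<epsilon> \<ominus>\<^bsub>SR\<^esub> \<epsilon>) [^]\<^bsub>SR\<^esub> r = \<zero>\<^bsub>SR\<^esub>"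
proof -
  have eq: "\<epsilon> \<otimes>\<^bsub>SR\<^esub> \<epsilon> \<ominus>\<^bsub>SR\<^esub> \<epsilon> = \<epsilon> \<otimes>\<^bsub>ZG\<^esub> \<epsilon> \<ominus>\<^bsub>ZG\<^esub> \<epsilon>" by (simp add: a_minus_def SR_simps SR_uminus)
  have "p_dvd (\<epsilon> \<otimes>\<^bsub>ZG\<^esub> \<epsilon> \<ominus>\<^bsub>ZG\<^esub> \<epsilon>)"
    unfolding p_dvd_def
  proof
    fix x assume x: "x \<in> carrier G"
    show "int p dvd (\<epsilon> \<otimes>\<^bsub>ZG\<^esub> \<epsilon> \<ominus>\<^bsub>ZG\<^esub> \<epsilon>) x"
    proof (cases "x \<in> H")
      case True
      have "of_int ((\<epsilon> \<otimes>\<^bsub>ZG\<^esub> \<epsilon> \<ominus>\<^bsub>ZG\<^esub> \<epsilon>) x) = (0 :: 'k)"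
        using True by (simp add: grm_minus_apply of_int_mod_M mult_eps_apply eps_apply(1) char_ring_eps)
      then show ?thesis by (simp only: of_int_0_iff)
    next
      case False
      then show ?thesis using SH_outside[of "\<epsilon> \<otimes>\<^bsub>ZG\<^esub> \<epsilon> \<ominus>\<^bsub>ZG\<^esub> \<epsilon>" x] x by simp
    qed
  qed
  then have "(\<epsilon> \<otimes>\<^bsub>ZG\<^esub> \<epsilon> \<ominus>\<^bsub>ZG\<^esub> \<epsilon>) [^]\<^bsub>ZG\<^esub> r = \<zero>\<^bsub>ZG\<^esub>" by (intro p_dvd_nilpotent) simp_all
  then show ?thesis unfolding eq SR_pow SR_simps(5) .
qed

definition N :: nat where "N = nilpotency_index SR \<epsilon>"

lemma N_pos: "N > 0"
proof (rule ccontr)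
  assume "\<not> N > 0"
  have "(\<epsilon> \<otimes>\<^bsub>SR\<^esub> \<epsilon> \<ominus>\<^bsub>SR\<^esub> \<epsilon>) [^]\<^bsub>SR\<^esub> N = \<zero>\<^bsub>SR\<^esub>"
    unfolding N_def nilpotency_index_def using eps_nilpotent by (rule LeastI)
  then have "\<one>\<^bsub>ZG\<^esub> = \<zero>\<^bsub>ZG\<^esub>" using \<open>\<not> N > 0\<close> by (simp add: SR_pow SR_simps)
  then have "char_ring \<one>\<^bsub>ZG\<^esub> = char_ring \<zero>\<^bsub>ZG\<^esub>" by simp
  then show False by (simp add: char_ring_one char_ring_zero)
qed

lemma omega_eval: "\<omega> = int_poly_eval SR \<epsilon> (lift_poly N ^ N)"
  using lifted_idempotent_eq[OF ring_SR, of \<epsilon>] by (simp add: \<omega>_def omega_C_def SR_simps N_def \<epsilon>_def[symmetric])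

lemma eval_SH [simp]: "int_poly_eval SR \<epsilon> P \<in> SH"
  using ring.int_poly_eval_closed[OF ring_SR, of \<epsilon>] by (simp add: SR_simps)

lemma omega_SH [simp]: "\<omega> \<in> SH"
  by (simp add: omega_eval)

lemma omega_idem [simp]: "\<omega> \<otimes>\<^bsub>ZG\<^esub> \<omega> = \<omega>"
  using lifted_idempotent_idempotent[OF ring_SR _ eps_nilpotent]
  by (simp add: SR_simps \<omega>_def omega_C_def \<epsilon>_def[symmetric])

lemma omega_factor: "\<exists>z\<in>SH. \<omega> = \<epsilon> \<otimes>\<^bsub>ZG\<^esub> z"
proof -
  have "lift_poly N dvd lift_poly N ^ N" using N_pos by (simp add: dvd_power)
  then have "[:0, 1:] dvd lift_poly N ^ N" using X_dvd_lift_poly dvd_trans by blast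
  then obtain W where "lift_poly N ^ N = [:0, 1:] * W" by (elim dvdE)
  then have "\<omega> = int_poly_eval SR \<epsilon> [:0, 1:] \<otimes>\<^bsub>SR\<^esub> int_poly_eval SR \<epsilon> W"
    unfolding omega_eval using ring.int_poly_eval_mult[OF ring_SR] by (simp only: SR_simps eps_SH)
  also have "int_poly_eval SR \<epsilon> [:0, 1:] = \<epsilon>"
    by (rule ring.int_poly_eval_X[OF ring_SR]) (simp add: SR_simps)
  finally show ?thesis by (intro bexI[of _ "int_poly_eval SR \<epsilon> W"]) (simp_all add: SR_simps)
qed

lemma char_ring_int_smult: "char_ring ([(c::int)] \<cdot>\<^bsub>SR\<^esub> \<one>\<^bsub>SR\<^esub>) = of_int c"
proof -
  interpret SR: ring SR by (rule ring_SR)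
  have nat: "char_ring ([n] \<cdot>\<^bsub>SR\<^esub> \<one>\<^bsub>SR\<^esub>) = of_nat n \<and> [n] \<cdot>\<^bsub>SR\<^esub> \<one>\<^bsub>SR\<^esub> \<in> SH" for n :: nat
    by (induction n) (simp_all add: SR.add.nat_pow_Suc char_ring_add char_ring_one char_ring_zero SR_simps add.commute
        add_pow_def nat_pow_def)
  show ?thesis
  proof (cases "c \<ge> 0")
    case True
    then show ?thesis using nat[of "nat c"] by (simp add: add_pow_int_ge)
  next
    case False
    then show ?thesis using nat[of "nat (- c)"] by (simp add: add_pow_int_lt SR_uminus char_ring_minus)
  qed
qed

lemma char_ring_eval: "char_ring (int_poly_eval SR \<epsilon> P) = of_int (poly P 1)"
proof (induction P)
  case 0
  show ?case using ring.int_poly_eval_0[OF ring_SR, of \<epsilon>] by (simp add: SR_simps char_ring_zero)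
next
  case (pCons c P)
  have "int_poly_eval SR \<epsilon> (pCons c P) = [c] \<cdot>\<^bsub>SR\<^esub> \<one>\<^bsub>SR\<^esub> \<oplus>\<^bsub>ZG\<^esub> \<epsilon> \<otimes>\<^bsub>ZG\<^esub> int_poly_eval SR \<epsilon> P"
    using ring.int_poly_eval_pCons[OF ring_SR, of \<epsilon>] by (simp add: SR_simps)
  then show ?case
    using pCons by (simp add: char_ring_add char_ring_int_smult char_ring_mult char_ring_eps)
qed

lemma char_ring_omega: "char_ring \<omega> = 1"
proof -
  have "poly (lift_poly N ^ N) 1 = 1" using N_pos by (simp add: lift_poly_def power_0_left)
  then show ?thesis by (simp add: omega_eval char_ring_eval)
qed

lemma eps_cong:
  assumes "x \<in> carrier G" "y \<in> carrier G" "x \<in> H \<longleftrightarrow> y \<in> H" "x \<in> H \<Longrightarrow> \<chi> (inv x) = \<chi> (inv y)"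
  shows "\<epsilon> x = \<epsilon> y"
  using assms by (simp add: \<epsilon>_def eps_C_def \<chi>_def)

lemma omega_commute_elt: "u \<in> H \<Longrightarrow> \<delta> u \<otimes>\<^bsub>ZG\<^esub> \<omega> = \<omega> \<otimes>\<^bsub>ZG\<^esub> \<delta> u"
proof -
  assume u: "u \<in> H"
  have "\<delta> u \<otimes>\<^bsub>ZG\<^esub> \<epsilon> = \<epsilon> \<otimes>\<^bsub>ZG\<^esub> \<delta> u"
  proof (rule gr_ext)
    fix x assume x: "x \<in> carrier G"
    have "\<epsilon> (inv u \<otimes> x) = \<epsilon> (x \<otimes> inv u)"
      using u x by (intro eps_cong) (simp_all add: H_mult_iff inv_mult_group \<chi>_mult mult.commute)
    then show "(\<delta> u \<otimes>\<^bsub>ZG\<^esub> \<epsilon>) x = (\<epsilon> \<otimes>\<^bsub>ZG\<^esub> \<delta> u) x"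
      using u x by (simp add: gr_elt_mult_left_apply gr_elt_mult_right_apply)
  qed (use u in simp_all)
  then show ?thesis
    using ring.int_poly_eval_commute[OF ring_SR, of \<epsilon> "\<delta> u"] u by (simp add: SR_simps omega_eval)
qed

lemma omega_central: "f \<in> SH \<Longrightarrow> \<omega> \<otimes>\<^bsub>ZG\<^esub> f = f \<otimes>\<^bsub>ZG\<^esub> \<omega>"
  by (rule commute_supported[OF _ H_G]) (simp_all add: omega_commute_elt)

lemma K_omega: "u \<in> K \<Longrightarrow> \<delta> u \<otimes>\<^bsub>ZG\<^esub> \<omega> = \<omega>"
proof -
  assume u: "u \<in> K"
  then have uH: "u \<in> H" using K_H by auto
  have \<chi>u: "\<chi> u = 1" using \<chi>_one_iff[OF uH] u by simp
  have "\<delta> u \<otimes>\<^bsub>ZG\<^esub> \<epsilon> = \<epsilon>"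
  proof (rule gr_ext)
    fix x assume x: "x \<in> carrier G"
    have "\<epsilon> (inv u \<otimes> x) = \<epsilon> x"
      using uH x by (intro eps_cong) (simp_all add: H_mult_iff inv_mult_group \<chi>_mult \<chi>u)
    then show "(\<delta> u \<otimes>\<^bsub>ZG\<^esub> \<epsilon>) x = \<epsilon> x" using uH x by (simp add: gr_elt_mult_left_apply)
  qed simp_all
  moreover obtain z where "z \<in> SH" "\<omega> = \<epsilon> \<otimes>\<^bsub>ZG\<^esub> z" using omega_factor by blast
  ultimately show ?thesis using uH by (simp flip: ZG.m_assoc)
qed

lemma p_dvd_mult_omega:
  assumes "f \<in> SH" "char_ring f = 0"
  shows "p_dvd (f \<otimes>\<^bsub>ZG\<^esub> \<omega>)"
proof -
  obtain z where z: "z \<in> SH" "\<omega> = \<epsilon> \<otimes>\<^bsub>ZG\<^esub> z" using omega_factor by blast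
  have "f \<otimes>\<^bsub>ZG\<^esub> \<omega> = (f \<otimes>\<^bsub>ZG\<^esub> \<epsilon>) \<otimes>\<^bsub>ZG\<^esub> z" using z assms by (simp add: ZG.m_assoc)
  then show ?thesis using p_dvd_mult[OF _ _ p_dvd_mult_eps[OF assms], of z] z assms by simp
qed

text \<open>The corner of \<open>\<omega>\<close> has no idempotents except \<open>0\<close> and \<open>\<omega>\<close>: the character value is \<open>0\<close> or \<open>1\<close>,
  and an idempotent divisible by \<open>p\<close> vanishes, because \<open>p\<close> is nilpotent.\<close>

lemma idempotent_mult_omega:
  assumes e: "e \<in> SH" "e \<otimes>\<^bsub>ZG\<^esub> e = e"
  shows "char_ring e = 0 \<Longrightarrow> e \<otimes>\<^bsub>ZG\<^esub> \<omega> = \<zero>\<^bsub>ZG\<^esub>" "char_ring e = 1 \<Longrightarrow> e \<otimes>\<^bsub>ZG\<^esub> \<omega> = \<omega>"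
    "char_ring e = 0 \<or> char_ring e = 1"
proof -
  have zero: "f \<otimes>\<^bsub>ZG\<^esub> \<omega> = \<zero>\<^bsub>ZG\<^esub>" if f: "f \<in> SH" "f \<otimes>\<^bsub>ZG\<^esub> f = f" "char_ring f = 0" for f
  proof (rule p_dvd_idempotent)
    have "f \<otimes>\<^bsub>ZG\<^esub> \<omega> \<otimes>\<^bsub>ZG\<^esub> (f \<otimes>\<^bsub>ZG\<^esub> \<omega>) = f \<otimes>\<^bsub>ZG\<^esub> (\<omega> \<otimes>\<^bsub>ZG\<^esub> f) \<otimes>\<^bsub>ZG\<^esub> \<omega>"
      using f by (simp add: ZG.m_assoc)
    also have "\<dots> = (f \<otimes>\<^bsub>ZG\<^esub> f) \<otimes>\<^bsub>ZG\<^esub> (\<omega> \<otimes>\<^bsub>ZG\<^esub> \<omega>)"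
      unfolding omega_central[OF f(1)] using f(1) by (simp add: ZG.m_assoc)
    finally show "f \<otimes>\<^bsub>ZG\<^esub> \<omega> \<otimes>\<^bsub>ZG\<^esub> (f \<otimes>\<^bsub>ZG\<^esub> \<omega>) = f \<otimes>\<^bsub>ZG\<^esub> \<omega>" using f by simp
  qed (use f p_dvd_mult_omega in simp_all)
  show "char_ring e = 0 \<Longrightarrow> e \<otimes>\<^bsub>ZG\<^esub> \<omega> = \<zero>\<^bsub>ZG\<^esub>" using zero e by blast
  show "e \<otimes>\<^bsub>ZG\<^esub> \<omega> = \<omega>" if "char_ring e = 1"
  proof -
    let ?f = "\<one>\<^bsub>ZG\<^esub> \<ominus>\<^bsub>ZG\<^esub> e"
    have e': "e \<in> carrier ZG" using e by simp
    have "?f \<otimes>\<^bsub>ZG\<^esub> ?f = ?f \<ominus>\<^bsub>ZG\<^esub> (e \<ominus>\<^bsub>ZG\<^esub> e \<otimes>\<^bsub>ZG\<^esub> e)"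
      using e' by (simp add: a_minus_def ZG.l_distr ZG.r_distr ZG.l_minus ZG.r_minus ZG.minus_add ZG.a_assoc)
    also have "\<dots> = ?f" using e by (simp add: a_minus_def ZG.r_neg)
    finally have "?f \<otimes>\<^bsub>ZG\<^esub> \<omega> = \<zero>\<^bsub>ZG\<^esub>"
      using e that by (intro zero) (simp_all add: char_ring_diff char_ring_one)
    then have "\<omega> \<ominus>\<^bsub>ZG\<^esub> e \<otimes>\<^bsub>ZG\<^esub> \<omega> = \<zero>\<^bsub>ZG\<^esub>"
      using e' by (simp add: a_minus_def ZG.l_distr ZG.l_minus)
    then show ?thesis using e' by simp
  qed
  have "char_ring e * char_ring e = char_ring e" using char_ring_mult[OF e(1,1)] e(2) by simp
  then show "char_ring e = 0 \<or> char_ring e = 1" by simp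
qed

text \<open>Some power of the element is idempotent, because the ring is finite. Its character value is nonzero,
  so that this idempotent becomes the identity of the corner.\<close>

lemma unit_if_char_nonzero:
  assumes y: "y \<in> SH" "char_ring y \<noteq> 0"
  shows "\<exists>z\<in>SH. y \<otimes>\<^bsub>ZG\<^esub> z \<otimes>\<^bsub>ZG\<^esub> \<omega> = \<omega> \<and> z \<otimes>\<^bsub>ZG\<^esub> y \<otimes>\<^bsub>ZG\<^esub> \<omega> = \<omega>"
proof -
  obtain n :: nat where n: "n > 0" "y [^]\<^bsub>ZG\<^esub> n \<otimes>\<^bsub>ZG\<^esub> y [^]\<^bsub>ZG\<^esub> n = y [^]\<^bsub>ZG\<^esub> n"
    using ZG.finite_idempotent_power[OF finite_gr_carrier, of y] y by auto
  have "char_ring (y [^]\<^bsub>ZG\<^esub> n) \<noteq> 0" using y by (simp add: char_ring_pow)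
  then have 1: "y [^]\<^bsub>ZG\<^esub> n \<otimes>\<^bsub>ZG\<^esub> \<omega> = \<omega>"
    using idempotent_mult_omega[of "y [^]\<^bsub>ZG\<^esub> n"] n(2) y(1) by auto
  obtain i where i: "n = Suc i" using n(1) by (cases n) auto
  have "y [^]\<^bsub>ZG\<^esub> n = y \<otimes>\<^bsub>ZG\<^esub> y [^]\<^bsub>ZG\<^esub> i"
    using y(1) by (simp only: i ZG.nat_pow_Suc2 SH_ZG)
  moreover have "y [^]\<^bsub>ZG\<^esub> n = y [^]\<^bsub>ZG\<^esub> i \<otimes>\<^bsub>ZG\<^esub> y" by (simp add: i)
  ultimately show ?thesis using 1 y(1) by (intro bexI[of _ "y [^]\<^bsub>ZG\<^esub> i"]) simp_all
qed

text \<open>Roots of unity of order prime to \<open>p\<close> are determined by their images modulo \<open>p\<close>: in the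
  factorization \<open>y\<^sup>n - 1 = (y - 1)(1 + y + \<dots> + y\<^sup>n\<^sup>-\<^sup>1)\<close> the second factor has the nonzero character value
  \<open>n\<close>, so it is a unit of the corner.\<close>

lemma root_of_unity_rigid:
  assumes y: "y \<in> SH" "y \<otimes>\<^bsub>ZG\<^esub> \<omega> = y" and n: "y [^]\<^bsub>ZG\<^esub> n \<otimes>\<^bsub>ZG\<^esub> \<omega> = \<omega>" "coprime p n"
    and char_1: "char_ring y = 1"
  shows "y = \<omega>"
proof -
  have geo: "\<exists>s\<in>SH. (y \<ominus>\<^bsub>ZG\<^esub> \<one>\<^bsub>ZG\<^esub>) \<otimes>\<^bsub>ZG\<^esub> s = y [^]\<^bsub>ZG\<^esub> i \<ominus>\<^bsub>ZG\<^esub> \<one>\<^bsub>ZG\<^esub> \<and> char_ring s = of_nat i" for i :: nat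
  proof (induction i)
    case 0
    have "(y \<ominus>\<^bsub>ZG\<^esub> \<one>\<^bsub>ZG\<^esub>) \<otimes>\<^bsub>ZG\<^esub> \<zero>\<^bsub>ZG\<^esub> = y [^]\<^bsub>ZG\<^esub> (0::nat) \<ominus>\<^bsub>ZG\<^esub> \<one>\<^bsub>ZG\<^esub>"
      using y(1) by (simp add: a_minus_def[of ZG "\<one>\<^bsub>ZG\<^esub>"] ZG.r_neg)
    then show ?case by (intro bexI[of _ "\<zero>\<^bsub>ZG\<^esub>"]) (simp_all add: char_ring_zero)
  next
    case (Suc i)
    then obtain s where s: "s \<in> SH" "(y \<ominus>\<^bsub>ZG\<^esub> \<one>\<^bsub>ZG\<^esub>) \<otimes>\<^bsub>ZG\<^esub> s = y [^]\<^bsub>ZG\<^esub> i \<ominus>\<^bsub>ZG\<^esub> \<one>\<^bsub>ZG\<^esub>" "char_ring s = of_nat i"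
      by blast
    have y': "y \<in> carrier ZG" "y [^]\<^bsub>ZG\<^esub> i \<in> carrier ZG" "s \<in> carrier ZG" using y s by simp_all
    have "(y \<ominus>\<^bsub>ZG\<^esub> \<one>\<^bsub>ZG\<^esub>) \<otimes>\<^bsub>ZG\<^esub> (y [^]\<^bsub>ZG\<^esub> i \<oplus>\<^bsub>ZG\<^esub> s)
      = (y \<otimes>\<^bsub>ZG\<^esub> y [^]\<^bsub>ZG\<^esub> i \<ominus>\<^bsub>ZG\<^esub> y [^]\<^bsub>ZG\<^esub> i) \<oplus>\<^bsub>ZG\<^esub> (y \<ominus>\<^bsub>ZG\<^esub> \<one>\<^bsub>ZG\<^esub>) \<otimes>\<^bsub>ZG\<^esub> s"
      using y' by (simp add: a_minus_def ZG.l_distr ZG.r_distr ZG.l_minus)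
    also have "\<dots> = y \<otimes>\<^bsub>ZG\<^esub> y [^]\<^bsub>ZG\<^esub> i \<oplus>\<^bsub>ZG\<^esub> (\<ominus>\<^bsub>ZG\<^esub> (y [^]\<^bsub>ZG\<^esub> i) \<oplus>\<^bsub>ZG\<^esub> (y [^]\<^bsub>ZG\<^esub> i \<oplus>\<^bsub>ZG\<^esub> \<ominus>\<^bsub>ZG\<^esub> \<one>\<^bsub>ZG\<^esub>))"
      unfolding s(2) using y' by (simp add: a_minus_def ZG.a_assoc)
    also have "\<ominus>\<^bsub>ZG\<^esub> (y [^]\<^bsub>ZG\<^esub> i) \<oplus>\<^bsub>ZG\<^esub> (y [^]\<^bsub>ZG\<^esub> i \<oplus>\<^bsub>ZG\<^esub> \<ominus>\<^bsub>ZG\<^esub> \<one>\<^bsub>ZG\<^esub>) = \<ominus>\<^bsub>ZG\<^esub> \<one>\<^bsub>ZG\<^esub>"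
      using y' by (simp add: ZG.r_neg1)
    also have "y \<otimes>\<^bsub>ZG\<^esub> y [^]\<^bsub>ZG\<^esub> i = y [^]\<^bsub>ZG\<^esub> Suc i" using y'(1) by (simp only: ZG.nat_pow_Suc2)
    finally show ?case
      using y s by (intro bexI[of _ "y [^]\<^bsub>ZG\<^esub> i \<oplus>\<^bsub>ZG\<^esub> s"])
        (simp_all add: a_minus_def char_ring_add char_ring_pow char_1)
  qed
  obtain s where s: "s \<in> SH" "(y \<ominus>\<^bsub>ZG\<^esub> \<one>\<^bsub>ZG\<^esub>) \<otimes>\<^bsub>ZG\<^esub> s = y [^]\<^bsub>ZG\<^esub> n \<ominus>\<^bsub>ZG\<^esub> \<one>\<^bsub>ZG\<^esub>" "char_ring s = of_nat n"
    using geo[of n] by blast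
  have "of_nat n \<noteq> (0 :: 'k)"
  proof
    assume "of_nat n = (0 :: 'k)"
    then have "p dvd n" using char by (simp add: of_nat_eq_0_iff_char_dvd)
    from coprime_common_divisor[OF n(2) dvd_refl this] show False using p by simp
  qed
  then obtain z where z: "z \<in> SH" "s \<otimes>\<^bsub>ZG\<^esub> z \<otimes>\<^bsub>ZG\<^esub> \<omega> = \<omega>"
    using unit_if_char_nonzero[of s] s by auto
  let ?d = "y \<ominus>\<^bsub>ZG\<^esub> \<one>\<^bsub>ZG\<^esub>"
  have cl: "?d \<in> carrier ZG" "s \<in> carrier ZG" "z \<in> carrier ZG" "\<omega> \<in> carrier ZG" "y [^]\<^bsub>ZG\<^esub> n \<in> carrier ZG"
    using y s z by simp_all
  have "(y [^]\<^bsub>ZG\<^esub> n \<ominus>\<^bsub>ZG\<^esub> \<one>\<^bsub>ZG\<^esub>) \<otimes>\<^bsub>ZG\<^esub> \<omega> = \<zero>\<^bsub>ZG\<^esub>"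
    using cl n(1) by (simp add: a_minus_def ZG.l_distr ZG.l_minus ZG.r_neg)
  then have 0: "?d \<otimes>\<^bsub>ZG\<^esub> s \<otimes>\<^bsub>ZG\<^esub> \<omega> = \<zero>\<^bsub>ZG\<^esub>" using s(2) by simp
  have "?d \<otimes>\<^bsub>ZG\<^esub> \<omega> = ?d \<otimes>\<^bsub>ZG\<^esub> (s \<otimes>\<^bsub>ZG\<^esub> z \<otimes>\<^bsub>ZG\<^esub> \<omega>)" using z(2) by simp
  also have "\<dots> = ?d \<otimes>\<^bsub>ZG\<^esub> s \<otimes>\<^bsub>ZG\<^esub> (z \<otimes>\<^bsub>ZG\<^esub> \<omega>)" using cl by (simp add: ZG.m_assoc)
  also have "z \<otimes>\<^bsub>ZG\<^esub> \<omega> = \<omega> \<otimes>\<^bsub>ZG\<^esub> z" using omega_central[OF z(1)] by simp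
  also have "?d \<otimes>\<^bsub>ZG\<^esub> s \<otimes>\<^bsub>ZG\<^esub> (\<omega> \<otimes>\<^bsub>ZG\<^esub> z) = (?d \<otimes>\<^bsub>ZG\<^esub> s \<otimes>\<^bsub>ZG\<^esub> \<omega>) \<otimes>\<^bsub>ZG\<^esub> z" using cl by (simp add: ZG.m_assoc)
  also have "\<dots> = \<zero>\<^bsub>ZG\<^esub>" using 0 cl by simp
  finally have "y \<ominus>\<^bsub>ZG\<^esub> \<omega> = \<zero>\<^bsub>ZG\<^esub>" using y cl by (simp add: a_minus_def ZG.l_distr ZG.l_minus)
  then show ?thesis using y cl by simp
qed

end

context strong_shoda_class
begin

subsection \<open>The local ring of the idempotent\<close>

definition Rset :: "('g \<Rightarrow> int) set" where
  "Rset = {f \<in> SH. f \<otimes>\<^bsub>ZG\<^esub> \<omega> = f}"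

lemma Rset_SH [simp]: "f \<in> Rset \<Longrightarrow> f \<in> SH"
  by (simp add: Rset_def)

lemma Rset_omega: "f \<in> Rset \<Longrightarrow> f \<otimes>\<^bsub>ZG\<^esub> \<omega> = f" "f \<in> Rset \<Longrightarrow> \<omega> \<otimes>\<^bsub>ZG\<^esub> f = f"
proof -
  assume f: "f \<in> Rset"
  then show "f \<otimes>\<^bsub>ZG\<^esub> \<omega> = f" unfolding Rset_def by blast
  then show "\<omega> \<otimes>\<^bsub>ZG\<^esub> f = f" using omega_central[of f] f by simp
qed

lemma RsetI: "f \<in> SH \<Longrightarrow> f \<otimes>\<^bsub>ZG\<^esub> \<omega> = f \<Longrightarrow> f \<in> Rset"
  unfolding Rset_def by blast

lemma mult_omega_Rset: "f \<in> SH \<Longrightarrow> f \<otimes>\<^bsub>ZG\<^esub> \<omega> \<in> Rset"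
  by (rule RsetI) (simp_all add: ZG.m_assoc)

lemma omega_Rset: "\<omega> \<in> Rset"
  by (rule RsetI) simp_all

lemma Rset_zero: "\<zero>\<^bsub>ZG\<^esub> \<in> Rset"
  by (rule RsetI) simp_all

lemma Rset_mult: "f \<in> Rset \<Longrightarrow> g \<in> Rset \<Longrightarrow> f \<otimes>\<^bsub>ZG\<^esub> g \<in> Rset"
  by (rule RsetI) (simp_all add: ZG.m_assoc Rset_omega)

lemma Rset_add: "f \<in> Rset \<Longrightarrow> g \<in> Rset \<Longrightarrow> f \<oplus>\<^bsub>ZG\<^esub> g \<in> Rset"
  by (rule RsetI) (simp_all add: ZG.l_distr Rset_omega)

lemma Rset_minus: "f \<in> Rset \<Longrightarrow> g \<in> Rset \<Longrightarrow> f \<ominus>\<^bsub>ZG\<^esub> g \<in> Rset"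
  by (rule RsetI) (simp_all add: a_minus_def ZG.l_distr ZG.l_minus Rset_omega)

lemma Rset_pow: "f \<in> Rset \<Longrightarrow> n > 0 \<Longrightarrow> f [^]\<^bsub>ZG\<^esub> (n::nat) \<in> Rset"
proof -
  assume f: "f \<in> Rset"
  have "f [^]\<^bsub>ZG\<^esub> Suc i \<in> Rset" for i by (induction i) (use f Rset_mult in simp_all)
  then show "n > 0 \<Longrightarrow> f [^]\<^bsub>ZG\<^esub> n \<in> Rset" by (metis Suc_pred)
qed

lemma Rset_induct [consumes 1, case_names zero add]:
  assumes f: "f \<in> Rset" and zero: "P \<zero>\<^bsub>ZG\<^esub>"
    and add: "\<And>f h. f \<in> Rset \<Longrightarrow> P f \<Longrightarrow> h \<in> H \<Longrightarrow> P (f \<oplus>\<^bsub>ZG\<^esub> \<delta> h \<otimes>\<^bsub>ZG\<^esub> \<omega>)"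
  shows "P f"
proof -
  have "P (g \<otimes>\<^bsub>ZG\<^esub> \<omega>)" if "g \<in> SH" for g
    using that H_G
  proof (induction rule: supported_induct)
    case zero
    then show ?case using assms(2) by simp
  next
    case (add g u)
    have "(g \<oplus>\<^bsub>ZG\<^esub> \<delta> u) \<otimes>\<^bsub>ZG\<^esub> \<omega> = g \<otimes>\<^bsub>ZG\<^esub> \<omega> \<oplus>\<^bsub>ZG\<^esub> \<delta> u \<otimes>\<^bsub>ZG\<^esub> \<omega>"
      using add by (simp add: ZG.l_distr)
    then show ?case using add assms(3)[of "g \<otimes>\<^bsub>ZG\<^esub> \<omega>" u] by (simp add: mult_omega_Rset)
  qed
  from this[of f] show ?thesis using f by (simp add: Rset_omega)
qed

lemma Rset_char_cong:
  assumes f: "f \<in> Rset" and xy: "x \<in> H" "y \<in> H" "\<chi> x = \<chi> y"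
  shows "f x = f y"
proof -
  let ?u = "x \<otimes> inv y"
  have u: "?u \<in> K" by (rule \<chi>_eqD[OF xy])
  have uH: "?u \<in> H" using xy by simp
  have "\<delta> ?u \<otimes>\<^bsub>ZG\<^esub> f = (\<delta> ?u \<otimes>\<^bsub>ZG\<^esub> \<omega>) \<otimes>\<^bsub>ZG\<^esub> f"
    using f uH by (simp add: ZG.m_assoc Rset_omega)
  also have "\<dots> = f" using K_omega[OF u] f by (simp add: Rset_omega)
  finally have "f x = (\<delta> ?u \<otimes>\<^bsub>ZG\<^esub> f) x" by simp
  also have "\<dots> = f (inv ?u \<otimes> x)" using f uH xy by (intro gr_elt_mult_left_apply) simp_all
  also have "inv ?u \<otimes> x = y" using xy by (simp add: inv_mult_group m_assoc)
  finally show ?thesis .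
qed

lemma Rset_central:
  assumes f: "f \<in> Rset" and g: "g \<in> SH"
  shows "f \<otimes>\<^bsub>ZG\<^esub> g = g \<otimes>\<^bsub>ZG\<^esub> f"
proof (rule commute_supported[OF g H_G])
  fix u assume u: "u \<in> H"
  show "f \<otimes>\<^bsub>ZG\<^esub> \<delta> u = \<delta> u \<otimes>\<^bsub>ZG\<^esub> f"
  proof (rule gr_ext)
    fix x assume x: "x \<in> carrier G"
    have "f (x \<otimes> inv u) = f (inv u \<otimes> x)"
    proof (cases "x \<in> H")
      case True
      then show ?thesis using u by (intro Rset_char_cong[OF f]) (simp_all add: \<chi>_mult mult.commute)
    next
      case False
      then show ?thesis using u x f by (simp add: SH_outside H_mult_iff)
    qed
    then show "(f \<otimes>\<^bsub>ZG\<^esub> \<delta> u) x = (\<delta> u \<otimes>\<^bsub>ZG\<^esub> f) x"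
      using f u x by (simp add: gr_elt_mult_left_apply gr_elt_mult_right_apply)
  qed (use f u in simp_all)
qed (use f in simp)

text \<open>The ring \<open>R\<close> is generated additively by the roots of unity \<open>h\<omega>\<close>, whose order is prime to \<open>p\<close>.
  Hence a ring endomorphism is determined by its reduction modulo \<open>p\<close>.\<close>

lemma elt_omega_pow: "h \<in> H \<Longrightarrow> (\<delta> h \<otimes>\<^bsub>ZG\<^esub> \<omega>) [^]\<^bsub>ZG\<^esub> (n::nat) \<otimes>\<^bsub>ZG\<^esub> \<omega> = \<delta> (h [^] n) \<otimes>\<^bsub>ZG\<^esub> \<omega>"
proof (induction n)
  case 0
  show ?case by (simp add: gr_one_eq)
next
  case (Suc n)
  have hn: "h [^] n \<in> H" using \<chi>_pow[OF Suc.prems] by blast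
  let ?y = "\<delta> h \<otimes>\<^bsub>ZG\<^esub> \<omega>"
  have y: "?y \<in> Rset" using Suc.prems by (intro mult_omega_Rset) simp
  have "?y [^]\<^bsub>ZG\<^esub> Suc n \<otimes>\<^bsub>ZG\<^esub> \<omega> = ?y [^]\<^bsub>ZG\<^esub> n \<otimes>\<^bsub>ZG\<^esub> (?y \<otimes>\<^bsub>ZG\<^esub> \<omega>)" using y by (simp add: ZG.m_assoc)
  also have "?y \<otimes>\<^bsub>ZG\<^esub> \<omega> = \<omega> \<otimes>\<^bsub>ZG\<^esub> ?y" using y by (simp add: omega_central)
  also have "?y [^]\<^bsub>ZG\<^esub> n \<otimes>\<^bsub>ZG\<^esub> (\<omega> \<otimes>\<^bsub>ZG\<^esub> ?y) = (?y [^]\<^bsub>ZG\<^esub> n \<otimes>\<^bsub>ZG\<^esub> \<omega>) \<otimes>\<^bsub>ZG\<^esub> ?y" using y by (simp add: ZG.m_assoc)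
  also have "\<dots> = \<delta> (h [^] n) \<otimes>\<^bsub>ZG\<^esub> (\<omega> \<otimes>\<^bsub>ZG\<^esub> ?y)" using Suc y hn by (simp add: ZG.m_assoc)
  also have "\<omega> \<otimes>\<^bsub>ZG\<^esub> ?y = ?y" using y by (rule Rset_omega)
  also have "\<delta> (h [^] n) \<otimes>\<^bsub>ZG\<^esub> ?y = \<delta> (h [^] Suc n) \<otimes>\<^bsub>ZG\<^esub> \<omega>"
    using Suc.prems hn by (simp add: gr_elt_mult flip: ZG.m_assoc)
  finally show ?case .
qed

definition ring_endo :: "(('g \<Rightarrow> int) \<Rightarrow> 'g \<Rightarrow> int) \<Rightarrow> bool" where
  "ring_endo \<theta> \<longleftrightarrow> \<theta> \<omega> = \<omega> \<and> (\<forall>y\<in>Rset. \<theta> y \<in> Rset) \<and>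
     (\<forall>y\<in>Rset. \<forall>z\<in>Rset. \<theta> (y \<otimes>\<^bsub>ZG\<^esub> z) = \<theta> y \<otimes>\<^bsub>ZG\<^esub> \<theta> z \<and> \<theta> (y \<oplus>\<^bsub>ZG\<^esub> z) = \<theta> y \<oplus>\<^bsub>ZG\<^esub> \<theta> z)"

lemma ring_endoD:
  assumes "ring_endo \<theta>"
  shows "\<theta> \<omega> = \<omega>" "y \<in> Rset \<Longrightarrow> \<theta> y \<in> Rset"
    "y \<in> Rset \<Longrightarrow> z \<in> Rset \<Longrightarrow> \<theta> (y \<otimes>\<^bsub>ZG\<^esub> z) = \<theta> y \<otimes>\<^bsub>ZG\<^esub> \<theta> z"
    "y \<in> Rset \<Longrightarrow> z \<in> Rset \<Longrightarrow> \<theta> (y \<oplus>\<^bsub>ZG\<^esub> z) = \<theta> y \<oplus>\<^bsub>ZG\<^esub> \<theta> z"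
  using assms unfolding ring_endo_def by blast+

lemma ring_endo_zero:
  assumes "ring_endo \<theta>"
  shows "\<theta> \<zero>\<^bsub>ZG\<^esub> = \<zero>\<^bsub>ZG\<^esub>"
proof -
  have z: "\<theta> \<zero>\<^bsub>ZG\<^esub> \<in> carrier ZG" using ring_endoD(2)[OF assms Rset_zero] by simp
  have "\<theta> (\<zero>\<^bsub>ZG\<^esub> \<oplus>\<^bsub>ZG\<^esub> \<zero>\<^bsub>ZG\<^esub>) = \<theta> \<zero>\<^bsub>ZG\<^esub> \<oplus>\<^bsub>ZG\<^esub> \<theta> \<zero>\<^bsub>ZG\<^esub>"
    by (rule ring_endoD(4)[OF assms Rset_zero Rset_zero])
  then have "\<theta> \<zero>\<^bsub>ZG\<^esub> \<oplus>\<^bsub>ZG\<^esub> \<theta> \<zero>\<^bsub>ZG\<^esub> = \<theta> \<zero>\<^bsub>ZG\<^esub>" by simp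
  then show ?thesis using z ZG.add.r_cancel_one by blast
qed

lemma ring_endo_pow:
  assumes \<theta>: "ring_endo \<theta>" and y: "y \<in> Rset"
  shows "\<theta> y [^]\<^bsub>ZG\<^esub> (n::nat) \<otimes>\<^bsub>ZG\<^esub> \<omega> = \<theta> (y [^]\<^bsub>ZG\<^esub> n \<otimes>\<^bsub>ZG\<^esub> \<omega>)"
proof (induction n)
  case 0
  show ?case by (simp add: ring_endoD(1)[OF \<theta>])
next
  case (Suc n)
  have *: "z [^]\<^bsub>ZG\<^esub> Suc n \<otimes>\<^bsub>ZG\<^esub> \<omega> = (z [^]\<^bsub>ZG\<^esub> n \<otimes>\<^bsub>ZG\<^esub> \<omega>) \<otimes>\<^bsub>ZG\<^esub> z" if "z \<in> Rset" for z
  proof -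
    have "z [^]\<^bsub>ZG\<^esub> Suc n \<otimes>\<^bsub>ZG\<^esub> \<omega> = z [^]\<^bsub>ZG\<^esub> n \<otimes>\<^bsub>ZG\<^esub> (z \<otimes>\<^bsub>ZG\<^esub> \<omega>)" using that by (simp add: ZG.m_assoc)
    also have "z \<otimes>\<^bsub>ZG\<^esub> \<omega> = \<omega> \<otimes>\<^bsub>ZG\<^esub> z" using that by (simp add: omega_central)
    finally show ?thesis using that by (simp add: ZG.m_assoc)
  qed
  have "y [^]\<^bsub>ZG\<^esub> n \<otimes>\<^bsub>ZG\<^esub> \<omega> \<in> Rset" using y by (intro mult_omega_Rset) simp
  then show ?case
    using *[OF y] *[OF ring_endoD(2)[OF \<theta> y]] Suc y by (simp only: ring_endoD(3)[OF \<theta>])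
qed

lemma ring_endo_rigid:
  assumes \<theta>: "ring_endo \<theta>" and \<theta>': "ring_endo \<theta>'"
    and eq: "\<And>h. h \<in> H \<Longrightarrow> char_ring (\<theta> (\<delta> h \<otimes>\<^bsub>ZG\<^esub> \<omega>)) = char_ring (\<theta>' (\<delta> h \<otimes>\<^bsub>ZG\<^esub> \<omega>))"
    and y: "y \<in> Rset"
  shows "\<theta> y = \<theta>' y"
proof -
  have gen: "\<theta> (\<delta> h \<otimes>\<^bsub>ZG\<^esub> \<omega>) = \<theta>' (\<delta> h \<otimes>\<^bsub>ZG\<^esub> \<omega>)" if h: "h \<in> H" for h
  proof -
    let ?a = "\<delta> h \<otimes>\<^bsub>ZG\<^esub> \<omega>" and ?b = "\<delta> (inv h) \<otimes>\<^bsub>ZG\<^esub> \<omega>"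
    have a: "?a \<in> Rset" and b: "?b \<in> Rset" using h by (simp_all add: mult_omega_Rset)
    have "?a \<otimes>\<^bsub>ZG\<^esub> ?b = \<delta> h \<otimes>\<^bsub>ZG\<^esub> (\<omega> \<otimes>\<^bsub>ZG\<^esub> ?b)" using h b by (simp add: ZG.m_assoc)
    also have "\<dots> = \<omega>" using b h by (simp only: Rset_omega(2)) (simp add: gr_elt_inv_cancel)
    finally have ab: "?a \<otimes>\<^bsub>ZG\<^esub> ?b = \<omega>" .
    define u where "u = \<theta> ?a"
    define v where "v = \<theta>' ?b"
    have u: "u \<in> Rset" and v: "v \<in> Rset" and v': "\<theta>' ?a \<in> Rset"
      using ring_endoD(2)[OF \<theta> a] ring_endoD(2)[OF \<theta>' b] ring_endoD(2)[OF \<theta>' a] by (simp_all add: u_def v_def)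
    have ab': "\<theta>' ?a \<otimes>\<^bsub>ZG\<^esub> v = \<omega>"
      using ring_endoD(3)[OF \<theta>' a b] ab ring_endoD(1)[OF \<theta>'] by (simp add: v_def)
    define w where "w = v \<otimes>\<^bsub>ZG\<^esub> u"
    have w: "w \<in> Rset" unfolding w_def by (rule Rset_mult[OF v u])
    have hN: "g [^] card H = \<one>" if g: "g \<in> H" for g
    proof -
      have "g [^]\<^bsub>G\<lparr>carrier := H\<rparr>\<^esub> Coset.order (G\<lparr>carrier := H\<rparr>) = \<one>\<^bsub>G\<lparr>carrier := H\<rparr>\<^esub>"
        using group.pow_order_eq_1[OF subgroup_imp_group[OF H], of g] g by simp
      then show ?thesis by (simp add: Coset.order_def nat_pow_def)
    qed
    have uN: "u [^]\<^bsub>ZG\<^esub> card H \<otimes>\<^bsub>ZG\<^esub> \<omega> = \<omega>"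
      unfolding u_def ring_endo_pow[OF \<theta> a] elt_omega_pow[OF h] hN[OF h]
      by (simp add: ring_endoD(1)[OF \<theta>] flip: gr_one_eq)
    have vN: "v [^]\<^bsub>ZG\<^esub> card H \<otimes>\<^bsub>ZG\<^esub> \<omega> = \<omega>"
      unfolding v_def ring_endo_pow[OF \<theta>' b] elt_omega_pow[OF H_closed(2)[OF h]] hN[OF H_closed(2)[OF h]]
      by (simp add: ring_endoD(1)[OF \<theta>'] flip: gr_one_eq)
    have "w [^]\<^bsub>ZG\<^esub> card H = v [^]\<^bsub>ZG\<^esub> card H \<otimes>\<^bsub>ZG\<^esub> u [^]\<^bsub>ZG\<^esub> card H"
      unfolding w_def using u v Rset_central[OF v, of u] by (intro ZG.pow_mult_distrib) simp_all
    then have wN: "w [^]\<^bsub>ZG\<^esub> card H \<otimes>\<^bsub>ZG\<^esub> \<omega> = \<omega>"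
      using uN vN u v by (simp add: ZG.m_assoc)
    have "char_ring w = char_ring v * char_ring (\<theta>' ?a)"
      unfolding w_def using u v eq[OF h] by (simp add: char_ring_mult u_def)
    also have "\<dots> = char_ring (\<theta>' ?a \<otimes>\<^bsub>ZG\<^esub> v)" using v v' by (simp add: char_ring_mult)
    also have "\<dots> = 1" by (simp add: ab' char_ring_omega)
    finally have "w = \<omega>"
      using root_of_unity_rigid[of w "card H"] w wN coprime_card_H by (simp add: Rset_omega)
    have "\<theta>' ?a = \<theta>' ?a \<otimes>\<^bsub>ZG\<^esub> w" using v' \<open>w = \<omega>\<close> by (simp add: Rset_omega)
    also have "\<dots> = (\<theta>' ?a \<otimes>\<^bsub>ZG\<^esub> v) \<otimes>\<^bsub>ZG\<^esub> u" unfolding w_def using u v v' by (simp add: ZG.m_assoc)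
    also have "\<dots> = u" using ab' u by (simp add: Rset_omega)
    finally show ?thesis by (simp add: u_def)
  qed
  show ?thesis
    using y
  proof (induction rule: Rset_induct)
    case zero
    show ?case by (simp add: ring_endo_zero \<theta> \<theta>')
  next
    case (add f h)
    have "\<delta> h \<otimes>\<^bsub>ZG\<^esub> \<omega> \<in> Rset" using add by (simp add: mult_omega_Rset)
    then show ?case using add gen ring_endoD(4)[OF \<theta>] ring_endoD(4)[OF \<theta>'] by simp
  qed
qed

subsection \<open>The Frobenius automorphism\<close>

text \<open>For \<open>ij\<close> congruent to \<open>1\<close> modulo \<open>|H|\<close>, this is the linear extension of \<open>h \<mapsto> h\<^sup>i\<close>.\<close>

definition power_map :: "nat \<Rightarrow> ('g \<Rightarrow> int) \<Rightarrow> 'g \<Rightarrow> int" where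
  "power_map j f = (\<lambda>x\<in>carrier G. if x \<in> H then f (x [^] j) else 0)"

lemma pow_H: "x \<in> H \<Longrightarrow> x [^] (n::nat) \<in> H"
  using \<chi>_pow by blast

lemma power_map_SH [simp]: "f \<in> SH \<Longrightarrow> power_map j f \<in> SH"
proof (rule SH_I)
  assume f: "f \<in> SH"
  show "power_map j f \<in> carrier ZG"
    unfolding gr_carrier
  proof (rule PiE_I)
    fix x assume "x \<in> carrier G"
    then have "0 \<le> power_map j f x \<and> power_map j f x < M"
      using grm_range[of f "x [^] j"] f prime_gt_0_nat[OF p] by (cases "x \<in> H") (simp_all add: power_map_def)
    then show "power_map j f x \<in> carrier (residue_ring M)" by (simp add: residue_ring_simps)
  qed (simp add: power_map_def)
qed (simp add: power_map_def)

lemma power_map_add: "power_map j (f \<oplus>\<^bsub>ZG\<^esub> g) = power_map j f \<oplus>\<^bsub>ZG\<^esub> power_map j g" if "f \<in> SH" "g \<in> SH"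
proof (rule gr_ext)
  fix x assume x: "x \<in> carrier G"
  then show "power_map j (f \<oplus>\<^bsub>ZG\<^esub> g) x = (power_map j f \<oplus>\<^bsub>ZG\<^esub> power_map j g) x"
    by (simp add: power_map_def grm_add_apply)
qed (use that in simp_all)

lemma SH_mult_apply:
  assumes "f \<in> SH" "g \<in> carrier ZG" "x \<in> carrier G"
  shows "(f \<otimes>\<^bsub>ZG\<^esub> g) x = (\<Sum>y\<in>H. f y * g (inv y \<otimes> x)) mod M"
proof -
  have "(\<Sum>y\<in>carrier G. f y * g (inv y \<otimes> x)) = (\<Sum>y\<in>H. f y * g (inv y \<otimes> x))"
    using H_G finite_G SH_outside[OF assms(1)] by (intro sum.mono_neutral_right) auto
  then show ?thesis using assms by (simp add: grm_mult_apply)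
qed

context
  fixes i j :: nat
  assumes ij: "\<And>x. x \<in> H \<Longrightarrow> (x [^] i) [^] j = x" and ji: "\<And>x. x \<in> H \<Longrightarrow> (x [^] j) [^] i = x"
begin

text \<open>The group \<open>H\<close> need not be abelian, so power maps are not multiplicative on its group ring. They
  become so if one factor lies in the corner, whose elements are constant on the cosets of \<open>K\<close>.\<close>

lemma power_map_mult:
  assumes f: "f \<in> SH" and g: "g \<in> Rset"
  shows "power_map j (f \<otimes>\<^bsub>ZG\<^esub> g) = power_map j f \<otimes>\<^bsub>ZG\<^esub> power_map j g"
proof (rule gr_ext)
  fix x assume x: "x \<in> carrier G"
  show "power_map j (f \<otimes>\<^bsub>ZG\<^esub> g) x = (power_map j f \<otimes>\<^bsub>ZG\<^esub> power_map j g) x"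
  proof (cases "x \<in> H")
    case True
    have "(\<Sum>y\<in>H. power_map j f y * power_map j g (inv y \<otimes> x)) = (\<Sum>y\<in>H. f (y [^] j) * g (inv (y [^] j) \<otimes> x [^] j))"
    proof (intro sum.cong refl)
      fix y assume y: "y \<in> H"
      have "\<chi> ((inv y \<otimes> x) [^] j) = \<chi> (inv (y [^] j) \<otimes> x [^] j)"
      proof -
        have "\<chi> (inv y) ^ j * \<chi> (y [^] j) = \<chi> (inv (y [^] j)) * \<chi> (y [^] j)"
          using \<chi>_inv[of "y [^] j"] \<chi>_inv[OF y] \<chi>_pow[OF y, of j] by (simp flip: power_mult_distrib)
        then have "\<chi> (inv y) ^ j = \<chi> (inv (y [^] j))" using \<chi>_nonzero[OF pow_H[OF y]] by simp
        then show ?thesis using y True \<chi>_pow[of "inv y \<otimes> x" j] \<chi>_pow[of x j] pow_H[of y j]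
          by (simp add: \<chi>_mult power_mult_distrib)
      qed
      then have "g ((inv y \<otimes> x) [^] j) = g (inv (y [^] j) \<otimes> x [^] j)"
        using y True pow_H by (intro Rset_char_cong[OF g]) simp_all
      then show "power_map j f y * power_map j g (inv y \<otimes> x) = f (y [^] j) * g (inv (y [^] j) \<otimes> x [^] j)"
        using y True by (simp add: power_map_def)
    qed
    also have "\<dots> = (\<Sum>y\<in>H. f y * g (inv y \<otimes> x [^] j))"
      by (rule sum.reindex_bij_witness[where i = "\<lambda>y. y [^] i" and j = "\<lambda>y. y [^] j"])
        (simp_all add: ij ji pow_H)
    finally show ?thesis
      using True f g by (simp add: power_map_def[of _ "f \<otimes>\<^bsub>ZG\<^esub> g"] SH_mult_apply)
  next
    case False
    then show ?thesis
      using x f g SH_outside[of "power_map j f \<otimes>\<^bsub>ZG\<^esub> power_map j g" x] by (simp add: power_map_def[of _ "f \<otimes>\<^bsub>ZG\<^esub> g"])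
  qed
qed (use f g in simp_all)

lemma power_map_inverse: "f \<in> SH \<Longrightarrow> power_map i (power_map j f) = f"
proof (rule gr_ext)
  fix x assume "f \<in> SH" "x \<in> carrier G"
  then show "power_map i (power_map j f) x = f x"
    using SH_outside[of f x] by (simp add: power_map_def pow_H ij)
qed simp_all

lemma char_ring_power_map: "char_ring (power_map j f) = (\<Sum>y\<in>H. of_int (f y) * \<chi> y ^ i)"
proof -
  have "char_ring (power_map j f) = (\<Sum>x\<in>H. of_int (f (x [^] j)) * \<chi> x)"
    unfolding char_ring_def by (intro sum.cong refl) (simp add: power_map_def)
  also have "\<dots> = (\<Sum>y\<in>H. of_int (f y) * \<chi> (y [^] i))"
    by (rule sum.reindex_bij_witness[where i = "\<lambda>y. y [^] i" and j = "\<lambda>y. y [^] j"])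
      (simp_all add: ij ji pow_H)
  finally show ?thesis using \<chi>_pow by simp
qed

end

lemma of_int_frobenius: "(of_int c :: 'k) ^ p = of_int c"
proof -
  have "(of_int c :: 'k) \<in> prime_subfield"
  proof -
    have one: "1 \<in> (prime_subfield :: 'k set)"
      using generate_field.one[of ring_of_type_algebra "{}"] by (simp add: ring_of_type_algebra_simps)
    have add: "a + b \<in> prime_subfield" if "a \<in> prime_subfield" "b \<in> (prime_subfield :: 'k set)" for a b
      using generate_field.eng_add[OF that] by (simp add: ring_of_type_algebra_simps)
    have minus: "- a \<in> prime_subfield" if "a \<in> (prime_subfield :: 'k set)" for a
      using generate_field.a_inv[OF that] by (simp add: ring_of_type_algebra_minus)
    have zero: "0 \<in> (prime_subfield :: 'k set)" using add[OF one minus[OF one]] by simp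
    have nat: "of_nat n \<in> (prime_subfield :: 'k set)" for n
      by (induction n) (simp_all add: zero one add)
    show ?thesis by (cases c rule: int_cases2) (simp_all add: nat minus)
  qed
  then show ?thesis by (rule frobenius_prime_subfield)
qed

definition p_inv :: nat where "p_inv = (SOME j. [p * j = Suc 0] (mod card H))"

lemma p_inv: "[p * p_inv = Suc 0] (mod card H)"
  unfolding p_inv_def by (rule someI_ex) (rule cong_solve_coprime_nat[OF coprime_card_H])

lemma pow_p_inv: "x \<in> H \<Longrightarrow> x [^] (p * p_inv) = x"
proof -
  assume x: "x \<in> H"
  have 1: "x [^] card H = \<one>"
  proof -
    have "x [^]\<^bsub>G\<lparr>carrier := H\<rparr>\<^esub> Coset.order (G\<lparr>carrier := H\<rparr>) = \<one>\<^bsub>G\<lparr>carrier := H\<rparr>\<^esub>"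
      using group.pow_order_eq_1[OF subgroup_imp_group[OF H], of x] x by simp
    then show ?thesis by (simp add: Coset.order_def nat_pow_def)
  qed
  have pow: "x [^] n = x [^] (n mod card H)" for n :: nat
  proof -
    have "x [^] n = x [^] (card H * (n div card H) + n mod card H)" by simp
    also have "\<dots> = (x [^] card H) [^] (n div card H) \<otimes> x [^] (n mod card H)"
      using x by (simp only: nat_pow_mult[symmetric] nat_pow_pow H_carrier)
    finally show ?thesis using x 1 by simp
  qed
  have "x [^] (p * p_inv) = x [^] (Suc 0 mod card H)" using pow[of "p * p_inv"] p_inv by (simp add: cong_def)
  also have "\<dots> = x" using pow[of "Suc 0"] x by simp
  finally show ?thesis .
qed

abbreviation "\<phi> \<equiv> power_map p_inv"
abbreviation "\<psi> \<equiv> power_map p"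

lemma p_pow_inverse: "x \<in> H \<Longrightarrow> (x [^] p) [^] p_inv = x" "x \<in> H \<Longrightarrow> (x [^] p_inv) [^] p = x"
  using pow_p_inv[of x] by (simp_all add: nat_pow_pow mult.commute)

lemma char_ring_\<phi>: "char_ring (\<phi> f) = char_ring f ^ p"
  using char_ring_power_map[OF p_pow_inverse, of f]
  by (simp add: char_ring_def frobenius_sum power_mult_distrib of_int_frobenius)

text \<open>Both \<open>\<phi>\<close> and its inverse map \<open>\<omega>\<close> to an idempotent of character value \<open>1\<close>, which absorbs \<open>\<omega>\<close>.\<close>

lemma \<phi>_omega: "\<phi> \<omega> = \<omega>"
proof -
  have "\<phi> \<omega> \<otimes>\<^bsub>ZG\<^esub> \<phi> \<omega> = \<phi> \<omega>"
    using power_map_mult[OF p_pow_inverse omega_SH omega_Rset] by simp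
  then have 1: "\<phi> \<omega> \<otimes>\<^bsub>ZG\<^esub> \<omega> = \<omega>"
    by (intro idempotent_mult_omega) (simp_all add: char_ring_\<phi> char_ring_omega)
  have \<phi>\<psi>: "\<phi> (\<psi> \<omega>) = \<omega>" by (rule power_map_inverse[OF p_pow_inverse(2,1)]) simp_all
  have "char_ring (\<psi> \<omega>) ^ p = 1 ^ p" using char_ring_\<phi>[of "\<psi> \<omega>"] by (simp add: \<phi>\<psi> char_ring_omega)
  then have "char_ring (\<psi> \<omega>) = 1" by (rule frobenius_inj)
  moreover have "\<psi> \<omega> \<otimes>\<^bsub>ZG\<^esub> \<psi> \<omega> = \<psi> \<omega>"
    using power_map_mult[OF p_pow_inverse(2,1) omega_SH omega_Rset] by simp
  ultimately have "\<psi> \<omega> \<otimes>\<^bsub>ZG\<^esub> \<omega> = \<omega>" by (intro idempotent_mult_omega) simp_all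
  then have "\<phi> (\<psi> \<omega> \<otimes>\<^bsub>ZG\<^esub> \<omega>) = \<phi> \<omega>" by simp
  then have "\<omega> \<otimes>\<^bsub>ZG\<^esub> \<phi> \<omega> = \<phi> \<omega>"
    using power_map_mult[OF p_pow_inverse, of "\<psi> \<omega>" \<omega>] by (simp add: \<phi>\<psi> omega_Rset)
  then show ?thesis using 1 omega_central[of "\<phi> \<omega>"] by simp
qed

lemma \<psi>_omega: "\<psi> \<omega> = \<omega>"
  using power_map_inverse[OF p_pow_inverse, of \<omega>] by (simp add: \<phi>_omega)

lemma \<phi>_Rset: "f \<in> Rset \<Longrightarrow> \<phi> f \<in> Rset"
proof (rule RsetI)
  assume f: "f \<in> Rset"
  have "\<phi> (f \<otimes>\<^bsub>ZG\<^esub> \<omega>) = \<phi> f \<otimes>\<^bsub>ZG\<^esub> \<phi> \<omega>" using power_map_mult[OF p_pow_inverse] f omega_Rset by simp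
  then show "\<phi> f \<otimes>\<^bsub>ZG\<^esub> \<omega> = \<phi> f" using f by (simp add: \<phi>_omega Rset_omega)
qed simp

lemma \<psi>_Rset: "f \<in> Rset \<Longrightarrow> \<psi> f \<in> Rset"
proof (rule RsetI)
  assume f: "f \<in> Rset"
  have "\<psi> (f \<otimes>\<^bsub>ZG\<^esub> \<omega>) = \<psi> f \<otimes>\<^bsub>ZG\<^esub> \<psi> \<omega>" using power_map_mult[OF p_pow_inverse(2,1)] f omega_Rset by simp
  then show "\<psi> f \<otimes>\<^bsub>ZG\<^esub> \<omega> = \<psi> f" using f by (simp add: \<psi>_omega Rset_omega)
qed simp

lemma ring_endo_\<phi>: "ring_endo \<phi>"
  unfolding ring_endo_def
  by (simp add: \<phi>_omega \<phi>_Rset power_map_add power_map_mult[OF p_pow_inverse])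

abbreviation "RR \<equiv> corner_ring SR \<omega>"

lemma ring_RR: "ring RR"
  by (rule corner_ring_is_ring[OF ring_SR]) (simp_all add: SR_simps omega_central)

lemma carrier_RR: "carrier RR = Rset"
proof -
  have "y \<in> carrier RR \<longleftrightarrow> y \<in> SH \<and> y \<otimes>\<^bsub>ZG\<^esub> \<omega> = y" for y
    using corner_ring_carrier[OF ring_SR, of \<omega> y] by (simp only: SR_simps omega_SH omega_idem)
  then show ?thesis unfolding Rset_def by blast
qed

lemma RR_simps:
  "monoid.mult RR = monoid.mult ZG" "ring.add RR = ring.add ZG" "\<one>\<^bsub>RR\<^esub> = \<omega>" "\<zero>\<^bsub>RR\<^esub> = \<zero>\<^bsub>ZG\<^esub>"
  by (simp_all add: SR_simps)

lemma RR_minus: "y \<in> Rset \<Longrightarrow> z \<in> Rset \<Longrightarrow> y \<ominus>\<^bsub>RR\<^esub> z = y \<ominus>\<^bsub>ZG\<^esub> z"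
proof -
  assume z: "z \<in> Rset"
  have "\<ominus>\<^bsub>RR\<^esub> z = \<ominus>\<^bsub>ZG\<^esub> z"
  proof (rule a_inv_subcarrier)
    show "carrier RR \<subseteq> carrier ZG" using Rset_SH SH_ZG by (auto simp: carrier_RR)
  qed (use z ring_RR ZG.abelian_group_axioms in \<open>simp_all add: carrier_RR SR_simps ring.is_abelian_group\<close>)
  then show ?thesis by (simp add: a_minus_def SR_simps)
qed

lemma RR_pow: "y \<in> Rset \<Longrightarrow> n > 0 \<Longrightarrow> y [^]\<^bsub>RR\<^esub> (n::nat) = y [^]\<^bsub>ZG\<^esub> n"
proof -
  assume y: "y \<in> Rset" and n: "n > 0"
  interpret SR: ring SR by (rule ring_SR)
  have "y [^]\<^bsub>RR\<^esub> n = y [^]\<^bsub>SR\<^esub> n"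
    by (rule corner_ring_pow[OF SR.is_monoid]) (use y n in \<open>simp_all add: SR_simps Rset_omega\<close>)
  then show ?thesis by (simp add: SR_pow)
qed

lemma RR_smult: "[(n::nat)] \<cdot>\<^bsub>RR\<^esub> y = [n] \<cdot>\<^bsub>ZG\<^esub> y"
  by (simp add: add_pow_def nat_pow_def SR_simps)

lemma ZG_smult_mult: "y \<in> carrier ZG \<Longrightarrow> z \<in> carrier ZG \<Longrightarrow> ([(n::nat)] \<cdot>\<^bsub>ZG\<^esub> y) \<otimes>\<^bsub>ZG\<^esub> z = [n] \<cdot>\<^bsub>ZG\<^esub> (y \<otimes>\<^bsub>ZG\<^esub> z)"
  by (rule ZG.add_pow_ldistr)

lemma char_ring_p_multiple: "y \<in> SH \<Longrightarrow> char_ring ([p] \<cdot>\<^bsub>ZG\<^esub> y) = 0"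
proof -
  assume y: "y \<in> SH"
  have "(of_int (([p] \<cdot>\<^bsub>ZG\<^esub> y) h) :: 'k) = 0" if "h \<in> H" for h
  proof -
    have "([p] \<cdot>\<^bsub>ZG\<^esub> y) h = (int p * y h) mod M" using y that by (intro grm_nat_smult_apply) simp_all
    then have "(of_int (([p] \<cdot>\<^bsub>ZG\<^esub> y) h) :: 'k) = of_int (int p * y h)" by (simp only: of_int_mod_M)
    then show ?thesis by (simp only: of_int_0_iff dvd_triv_left)
  qed
  then show ?thesis by (simp add: char_ring_def)
qed

text \<open>Division of the coefficients by \<open>p\<close>, followed by multiplication by \<open>\<omega>\<close>.\<close>

lemma Rset_p_multiple:
  assumes f: "f \<in> Rset" "char_ring f = 0"
  shows "\<exists>w\<in>Rset. f = [p] \<cdot>\<^bsub>ZG\<^esub> w"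
proof -
  define v where "v = (\<lambda>x\<in>carrier G. f x div int p)"
  have p0: "int p > 0" using p prime_gt_0_nat by simp
  have pf: "int p dvd f x" if "x \<in> carrier G" for x
    using p_dvd_mult_omega[of f] f that by (simp add: Rset_omega p_dvd_def)
  have v: "v \<in> SH"
  proof (rule SH_I)
    show "v \<in> carrier ZG"
      unfolding gr_carrier residue_ring_simps
    proof (rule PiE_I)
      fix x assume x: "x \<in> carrier G"
      have "0 \<le> f x" "f x < M" using grm_range[of f x] f x by simp_all
      then have "0 \<le> f x div int p" "f x div int p \<le> f x"
        using p0 zdiv_mono2[of "f x" 1 "int p"] by (simp_all add: pos_imp_zdiv_nonneg_iff)
      then show "v x \<in> {0..<M}" using x \<open>f x < M\<close> by (simp add: v_def)
    qed (simp add: v_def)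
  qed (use f in \<open>simp add: v_def SH_outside\<close>)
  have "[p] \<cdot>\<^bsub>ZG\<^esub> v = f"
  proof (rule gr_ext)
    fix x assume x: "x \<in> carrier G"
    then show "([p] \<cdot>\<^bsub>ZG\<^esub> v) x = f x"
      using v f pf[OF x] grm_mod[of f x] by (simp add: grm_nat_smult_apply v_def)
  qed (use v f in simp_all)
  then have "f = [p] \<cdot>\<^bsub>ZG\<^esub> (v \<otimes>\<^bsub>ZG\<^esub> \<omega>)"
    using ZG_smult_mult[of v \<omega> p] v f by (simp add: Rset_omega)
  then show ?thesis using mult_omega_Rset[OF v] by blast
qed

lemma ring_endo_iso:
  assumes "\<theta> \<in> ring_iso RR RR"
  shows "ring_endo \<theta>"
  using assms unfolding ring_iso_def Ring.ring_hom_def ring_endo_def carrier_RR RR_simps by blast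

text \<open>The map \<open>h\<omega> \<mapsto> h\<^sup>p\<omega>\<close> induces the \<open>p\<close>-th power map modulo \<open>p\<close>, and by rigidity it is the only ring
  automorphism that does. So the description of \<open>galois_frobenius\<close> is proper.\<close>

theorem galois_frobenius_Rset: "y \<in> Rset \<Longrightarrow> galois_frobenius RR p y \<in> Rset"
proof -
  have p0: "p > 0" using p prime_gt_0_nat by simp
  let ?P = "\<lambda>\<theta>. \<theta> \<in> ring_iso RR RR \<and> \<theta> \<in> extensional (carrier RR) \<and>
        (\<forall>y\<in>carrier RR. \<exists>w\<in>carrier RR. \<theta> y \<ominus>\<^bsub>RR\<^esub> y [^]\<^bsub>RR\<^esub> p = [p] \<cdot>\<^bsub>RR\<^esub> w)"
  have "\<exists>!\<theta>. ?P \<theta>"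
  proof (rule ex1I[of _ "restrict \<phi> Rset"])
    have "restrict \<phi> Rset \<in> ring_iso RR RR"
      unfolding ring_iso_def
    proof (intro CollectI conjI ring_hom_memI)
      show "bij_betw (restrict \<phi> Rset) (carrier RR) (carrier RR)"
        unfolding carrier_RR
        by (rule bij_betwI[where g = \<psi>])
          (simp_all add: \<phi>_Rset \<psi>_Rset power_map_inverse[OF p_pow_inverse] power_map_inverse[OF p_pow_inverse(2,1)])
    qed (simp_all only: carrier_RR RR_simps restrict_apply' Rset_mult Rset_add omega_Rset \<phi>_Rset
        ring_endoD[OF ring_endo_\<phi>])
    moreover have "\<exists>w\<in>carrier RR. restrict \<phi> Rset y \<ominus>\<^bsub>RR\<^esub> y [^]\<^bsub>RR\<^esub> p = [p] \<cdot>\<^bsub>RR\<^esub> w" if "y \<in> carrier RR" for y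
    proof -
      have y: "y \<in> Rset" using that by (simp add: carrier_RR)
      have yp: "y [^]\<^bsub>ZG\<^esub> p \<in> Rset" by (rule Rset_pow[OF y p0])
      have "\<exists>w\<in>Rset. \<phi> y \<ominus>\<^bsub>ZG\<^esub> y [^]\<^bsub>ZG\<^esub> p = [p] \<cdot>\<^bsub>ZG\<^esub> w"
        using y yp by (intro Rset_p_multiple Rset_minus \<phi>_Rset) (simp_all add: char_ring_diff char_ring_\<phi> char_ring_pow)
      then show ?thesis using y yp p0 by (simp add: carrier_RR RR_smult RR_pow RR_minus \<phi>_Rset)
    qed
    ultimately show "?P (restrict \<phi> Rset)" by (auto simp: carrier_RR)
  next
    fix \<theta> assume \<theta>: "?P \<theta>"
    then have endo: "ring_endo \<theta>" by (intro ring_endo_iso) simp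
    have char_\<theta>: "char_ring (\<theta> y) = char_ring y ^ p" if y: "y \<in> Rset" for y
    proof -
      obtain w where w: "w \<in> Rset" "\<theta> y \<ominus>\<^bsub>RR\<^esub> y [^]\<^bsub>RR\<^esub> p = [p] \<cdot>\<^bsub>RR\<^esub> w" using \<theta> y carrier_RR by metis
      have "\<theta> y \<ominus>\<^bsub>ZG\<^esub> y [^]\<^bsub>ZG\<^esub> p = [p] \<cdot>\<^bsub>ZG\<^esub> w"
        using w(2) y ring_endoD(2)[OF endo y] Rset_pow[OF y p0] p0 by (simp add: RR_smult RR_pow RR_minus)
      then have "char_ring (\<theta> y \<ominus>\<^bsub>ZG\<^esub> y [^]\<^bsub>ZG\<^esub> p) = 0" using w(1) by (simp add: char_ring_p_multiple)
      then show ?thesis using y ring_endoD(2)[OF endo y] by (simp add: char_ring_diff char_ring_pow)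
    qed
    have "\<theta> y = \<phi> y" if "y \<in> Rset" for y
      by (rule ring_endo_rigid[OF endo ring_endo_\<phi> _ that]) (simp add: char_\<theta> char_ring_\<phi> mult_omega_Rset)
    moreover have "\<theta> \<in> extensional Rset" using \<theta> by (simp add: carrier_RR)
    ultimately show "\<theta> = restrict \<phi> Rset" by (intro extensionalityI[of _ Rset]) simp_all
  qed
  then have "?P (galois_frobenius RR p)" unfolding galois_frobenius_def by (rule theI')
  then have "ring_endo (galois_frobenius RR p)" by (intro ring_endo_iso) simp
  then show "y \<in> Rset \<Longrightarrow> galois_frobenius RR p y \<in> Rset" by (rule ring_endoD(2))
qed

lemma galois_pow_Rset: "y \<in> Rset \<Longrightarrow> galois_pow RR p j y \<in> Rset"
  unfolding galois_pow_def by (induction j) (simp_all add: galois_frobenius_Rset)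

end

section \<open>Orthogonality of the conjugates\<close>

lemma comm_monoid_center_ring:
  assumes "ring B"
  shows "comm_monoid (center_ring B)"
proof -
  interpret ring B by fact
  have sub: "x \<in> carrier B" if "x \<in> carrier (center_ring B)" for x
    using that unfolding center_ring_def by auto
  have ops: "monoid.mult (center_ring B) = monoid.mult B" "\<one>\<^bsub>center_ring B\<^esub> = \<one>\<^bsub>B\<^esub>"
    by (simp_all add: center_ring_def)
  show ?thesis
  proof (rule comm_monoidI)
    fix x y assume "x \<in> carrier (center_ring B)" "y \<in> carrier (center_ring B)"
    then have xy: "x \<in> carrier B" "y \<in> carrier B" "\<And>u. u \<in> carrier B \<Longrightarrow> x \<otimes>\<^bsub>B\<^esub> u = u \<otimes>\<^bsub>B\<^esub> x"
      "\<And>u. u \<in> carrier B \<Longrightarrow> y \<otimes>\<^bsub>B\<^esub> u = u \<otimes>\<^bsub>B\<^esub> y"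
      unfolding center_ring_def by auto
    have "x \<otimes>\<^bsub>B\<^esub> y \<otimes>\<^bsub>B\<^esub> u = u \<otimes>\<^bsub>B\<^esub> (x \<otimes>\<^bsub>B\<^esub> y)" if u: "u \<in> carrier B" for u
    proof -
      have "x \<otimes>\<^bsub>B\<^esub> y \<otimes>\<^bsub>B\<^esub> u = x \<otimes>\<^bsub>B\<^esub> (u \<otimes>\<^bsub>B\<^esub> y)" using xy(1,2) xy(4)[OF u] u by (simp add: m_assoc)
      also have "\<dots> = (x \<otimes>\<^bsub>B\<^esub> u) \<otimes>\<^bsub>B\<^esub> y" using xy(1,2) u by (simp add: m_assoc)
      also have "\<dots> = u \<otimes>\<^bsub>B\<^esub> (x \<otimes>\<^bsub>B\<^esub> y)" unfolding xy(3)[OF u] using xy(1,2) u by (simp add: m_assoc)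
      finally show ?thesis .
    qed
    then show "x \<otimes>\<^bsub>center_ring B\<^esub> y \<in> carrier (center_ring B)"
      unfolding ops using m_closed[OF xy(1,2)] by (simp add: center_ring_def)
    show "x \<otimes>\<^bsub>center_ring B\<^esub> y = y \<otimes>\<^bsub>center_ring B\<^esub> x" unfolding ops by (rule xy(3)[OF xy(2)])
  next
    show "\<one>\<^bsub>center_ring B\<^esub> \<in> carrier (center_ring B)" by (simp add: center_ring_def)
  qed (simp_all add: ops sub m_assoc)
qed

lemma finsum_ring_of_type_algebra:
  assumes "finite I"
  shows "finsum (ring_of_type_algebra :: 'k :: comm_ring_1 ring) f I = sum f I"
proof -
  interpret ring "ring_of_type_algebra :: 'k ring" by (rule ring_from_type_algebra)
  show ?thesis using assms
  proof (induction I rule: finite_induct)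
    case (insert i I)
    then have "finsum ring_of_type_algebra f (insert i I) = f i \<oplus>\<^bsub>ring_of_type_algebra\<^esub> finsum ring_of_type_algebra f I"
      by (intro finsum_insert) (simp_all add: ring_of_type_algebra_simps)
    then show ?case using insert by (simp add: ring_of_type_algebra_simps)
  qed (simp add: ring_of_type_algebra_simps)
qed

context strong_shoda_class
begin

interpretation QG: finite_group_ring G "rat_ring"
proof -
  interpret cring "ring_of_type_algebra :: rat ring" by (rule cring_from_type_algebra)
  show "finite_group_ring G rat_ring" by unfold_locales (rule finite_G)
qed

abbreviation "QG \<equiv> group_ring rat_ring G"

lemma QG_mult_apply: "x \<in> carrier G \<Longrightarrow> (f \<otimes>\<^bsub>QG\<^esub> h) x = (\<Sum>y\<in>carrier G. f y * h (inv y \<otimes> x))"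
  using finite_G by (simp add: QG.gr_mult_apply finsum_ring_of_type_algebra) (simp add: ring_of_type_algebra_simps)

lemma QG_carrier: "f \<in> carrier QG \<longleftrightarrow> f \<in> extensional (carrier G)"
  unfolding QG.gr_carrier by (simp add: ring_of_type_algebra_simps PiE_def)

lemma QG_minus_apply:
  assumes "f \<in> carrier QG" "h \<in> carrier QG" "x \<in> carrier G"
  shows "(f \<ominus>\<^bsub>QG\<^esub> h) x = f x - h x"
proof -
  have "((f \<ominus>\<^bsub>QG\<^esub> h) \<oplus>\<^bsub>QG\<^esub> h) x = f x"
    using assms by (simp add: a_minus_def QG.ZG.a_assoc QG.ZG.l_neg)
  then have "(f \<ominus>\<^bsub>QG\<^esub> h) x + h x = f x"
    using assms QG.gr_add_apply[of x "f \<ominus>\<^bsub>QG\<^esub> h" h] by (simp add: ring_of_type_algebra_simps)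
  then show ?thesis by simp
qed

text \<open>The rational idempotent \<open>shoda_eps\<close> has denominators prime to \<open>p\<close>. An element is called
  evaluable if some multiple prime to \<open>p\<close> is integral and if its character value in characteristic
  \<open>p\<close> is one.\<close>

definition evaluable :: "('g \<Rightarrow> rat) \<Rightarrow> bool" where
  "evaluable e \<longleftrightarrow> e \<in> QG.supported H \<and>
     (\<exists>c m. coprime p m \<and> (\<forall>x\<in>carrier G. of_int (c x) = of_nat m * e x) \<and>
        (\<Sum>h\<in>H. of_int (c h) * \<chi> h) = (of_nat m :: 'k))"

lemma QG_supported_iff: "e \<in> QG.supported H \<longleftrightarrow> e \<in> carrier QG \<and> (\<forall>x\<in>carrier G - H. e x = 0)"
  by (simp add: QG.supported_def ring_of_type_algebra_simps)

lemma sum_char_conv: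
  "(\<Sum>h\<in>H. of_int (\<Sum>y\<in>H. c y * c' (inv y \<otimes> h)) * \<chi> h)
    = (\<Sum>h\<in>H. of_int (c h) * \<chi> h) * ((\<Sum>h\<in>H. of_int (c' h) * \<chi> h) :: 'k)"
proof -
  have "(\<Sum>h\<in>H. of_int (\<Sum>y\<in>H. c y * c' (inv y \<otimes> h)) * \<chi> h)
    = (\<Sum>h\<in>H. \<Sum>y\<in>H. of_int (c y) * of_int (c' (inv y \<otimes> h)) * \<chi> h)"
    by (simp add: sum_distrib_right)
  also have "\<dots> = (\<Sum>y\<in>H. \<Sum>h\<in>H. of_int (c y) * of_int (c' (inv y \<otimes> h)) * \<chi> h)" by (rule sum.swap)
  also have "\<dots> = (\<Sum>y\<in>H. of_int (c y) * \<chi> y * (\<Sum>h\<in>H. of_int (c' h) * \<chi> h))"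
  proof (intro sum.cong refl)
    fix y assume y: "y \<in> H"
    have "(\<Sum>h\<in>H. of_int (c y) * of_int (c' (inv y \<otimes> h)) * \<chi> h)
      = (\<Sum>h\<in>H. of_int (c y) * of_int (c' h) * \<chi> (y \<otimes> h))"
      by (rule sum.reindex_bij_witness[where i = "\<lambda>h. y \<otimes> h" and j = "\<lambda>h. inv y \<otimes> h"])
        (use y in \<open>simp_all flip: m_assoc\<close>)
    also have "\<dots> = of_int (c y) * \<chi> y * (\<Sum>h\<in>H. of_int (c' h) * \<chi> h)"
      unfolding sum_distrib_left using y by (intro sum.cong refl) (simp add: \<chi>_mult mult_ac)
    finally show "(\<Sum>h\<in>H. of_int (c y) * of_int (c' (inv y \<otimes> h)) * \<chi> h)
      = of_int (c y) * \<chi> y * (\<Sum>h\<in>H. of_int (c' h) * \<chi> h)" .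
  qed
  finally show ?thesis by (simp add: sum_distrib_right)
qed

lemma evaluable_mult:
  assumes "evaluable e" "evaluable e'"
  shows "evaluable (e \<otimes>\<^bsub>QG\<^esub> e')"
proof -
  obtain c m where c: "coprime p m" "\<And>x. x \<in> carrier G \<Longrightarrow> of_int (c x) = of_nat m * e x"
    "(\<Sum>h\<in>H. of_int (c h) * \<chi> h) = (of_nat m :: 'k)" using assms(1) unfolding evaluable_def by blast
  obtain c' m' where c': "coprime p m'" "\<And>x. x \<in> carrier G \<Longrightarrow> of_int (c' x) = of_nat m' * e' x"
    "(\<Sum>h\<in>H. of_int (c' h) * \<chi> h) = (of_nat m' :: 'k)" using assms(2) unfolding evaluable_def by blast
  have e: "e \<in> QG.supported H" "e' \<in> QG.supported H" using assms unfolding evaluable_def by blast+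
  have e0: "e x = 0" if "x \<in> carrier G" "x \<notin> H" for x using e(1) that unfolding QG_supported_iff by blast
  have apply_H: "(e \<otimes>\<^bsub>QG\<^esub> e') x = (\<Sum>y\<in>H. e y * e' (inv y \<otimes> x))" if "x \<in> carrier G" for x
  proof -
    have "(\<Sum>y\<in>carrier G. e y * e' (inv y \<otimes> x)) = (\<Sum>y\<in>H. e y * e' (inv y \<otimes> x))"
      using H_G finite_G e0 by (intro sum.mono_neutral_right) auto
    then show ?thesis using that by (simp add: QG_mult_apply)
  qed
  show ?thesis
    unfolding evaluable_def
  proof (intro conjI exI ballI)
    show "e \<otimes>\<^bsub>QG\<^esub> e' \<in> QG.supported H" by (rule subringE(6)[OF QG.subring_supported[OF H] e])
    show "coprime p (m * m')" using c(1) c'(1) by simp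
    show "of_int (\<Sum>y\<in>H. c y * c' (inv y \<otimes> x)) = of_nat (m * m') * (e \<otimes>\<^bsub>QG\<^esub> e') x" if x: "x \<in> carrier G" for x
    proof -
      have "of_int (\<Sum>y\<in>H. c y * c' (inv y \<otimes> x)) = (\<Sum>y\<in>H. (of_nat m * e y) * (of_nat m' * e' (inv y \<otimes> x)))"
        using x by (simp add: c(2) c'(2))
      then show ?thesis using x by (simp add: apply_H sum_distrib_left mult_ac)
    qed
    show "(\<Sum>h\<in>H. of_int (\<Sum>y\<in>H. c y * c' (inv y \<otimes> h)) * \<chi> h) = (of_nat (m * m') :: 'k)"
      unfolding sum_char_conv c(3) c'(3) by simp
  qed
qed

lemma evaluable_one: "evaluable \<one>\<^bsub>QG\<^esub>"
  unfolding evaluable_def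
proof (intro conjI exI ballI)
  show "\<one>\<^bsub>QG\<^esub> \<in> QG.supported H" by (rule subringE(3)[OF QG.subring_supported[OF H]])
  show "coprime p (1::nat)" by simp
  show "of_int (if x = \<one> then 1 else 0) = of_nat 1 * \<one>\<^bsub>QG\<^esub> x" if "x \<in> carrier G" for x
    using that by (simp add: QG.gr_one_eq group_elt_def ring_of_type_algebra_simps)
  have "(\<Sum>h\<in>H. of_int (if h = \<one> then 1 else 0) * \<chi> h) = (\<Sum>h\<in>H. if h = \<one> then \<chi> h else 0)"
    by (intro sum.cong refl) simp
  then show "(\<Sum>h\<in>H. of_int (if h = \<one> then 1 else 0) * \<chi> h) = (of_nat 1 :: 'k)"
    using finite_H by (simp add: \<chi>_one)
qed

lemma subgroup_avg_supported: "L \<subseteq> H \<Longrightarrow> subgroup_avg G L \<in> QG.supported H"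
  unfolding QG_supported_iff QG_carrier by (auto simp: subgroup_avg_def)

lemma sum_\<chi>_subset: "L \<subseteq> H \<Longrightarrow> (\<Sum>h\<in>H. of_int (if h \<in> L then c else 0) * \<chi> h) = of_int c * (\<Sum>h\<in>L. \<chi> h)"
proof -
  assume L: "L \<subseteq> H"
  have "(\<Sum>h\<in>H. of_int (if h \<in> L then c else 0) * \<chi> h) = (\<Sum>h\<in>L. of_int c * \<chi> h)"
    using L finite_H by (intro sum.mono_neutral_cong_right) auto
  then show ?thesis by (simp add: sum_distrib_left)
qed

lemma sum_\<chi>_K: "(\<Sum>h\<in>K. \<chi> h) = of_nat (card K)"
proof -
  have "\<chi> h = 1" if "h \<in> K" for h using \<chi>_one_iff[of h] K_H that by auto
  then show ?thesis by simp
qed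

lemma coprime_card_subgroup: "subgroup L G \<Longrightarrow> coprime p (card L)"
proof -
  assume "subgroup L G"
  then have "card L dvd Coset.order G"
    using lagrange_finite[OF finite_G, of L] dvd_triv_right[of "card L" "card (rcosets L)"] by simp
  from coprime_divisors[OF dvd_refl this coprime_G] show ?thesis .
qed

lemma card_subgroup_pos: "subgroup L G \<Longrightarrow> card L > 0"
  using subgroup.finite_imp_card_positive finite_G by blast

lemma evaluable_avg_K: "evaluable (subgroup_avg G K)"
  unfolding evaluable_def
proof (intro conjI exI ballI)
  show "subgroup_avg G K \<in> QG.supported H" by (rule subgroup_avg_supported[OF K_H])
  show "coprime p (card K)" by (rule coprime_card_subgroup[OF K])
  show "of_int (if x \<in> K then 1 else 0) = of_nat (card K) * subgroup_avg G K x" if "x \<in> carrier G" for x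
    using that card_subgroup_pos[OF K] by (simp add: subgroup_avg_def)
  show "(\<Sum>h\<in>H. of_int (if h \<in> K then 1 else 0) * \<chi> h) = (of_nat (card K) :: 'k)"
    unfolding sum_\<chi>_subset[OF K_H] by (simp add: sum_\<chi>_K)
qed

text \<open>A subgroup properly containing the kernel of the character has character sum zero.\<close>

lemma sum_\<chi>_L:
  assumes L: "subgroup L G" "K \<subset> L" "L \<subseteq> H"
  shows "(\<Sum>h\<in>L. \<chi> h) = 0"
proof -
  obtain g where g: "g \<in> L" "g \<notin> K" using L(2) by blast
  have "\<chi> g \<noteq> 1" using \<chi>_one_iff[of g] g L(3) by blast
  have "(\<Sum>h\<in>L. \<chi> h) = (\<Sum>h\<in>L. \<chi> (g \<otimes> h))"
    by (rule sum.reindex_bij_witness[where i = "\<lambda>h. g \<otimes> h" and j = "\<lambda>h. inv g \<otimes> h"])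
      (use g L subgroup.m_closed[OF L(1)] subgroup.m_inv_closed[OF L(1)] subgroup.subset[OF L(1)] in
        \<open>auto simp: subset_eq simp flip: m_assoc\<close>)
  also have "\<dots> = (\<Sum>h\<in>L. \<chi> g * \<chi> h)" using g L(3) by (intro sum.cong refl \<chi>_mult) auto
  also have "\<dots> = \<chi> g * (\<Sum>h\<in>L. \<chi> h)" by (rule sum_distrib_left[symmetric])
  finally have "(\<chi> g - 1) * (\<Sum>h\<in>L. \<chi> h) = 0" by (simp add: left_diff_distrib)
  then show ?thesis using \<open>\<chi> g \<noteq> 1\<close> by simp
qed

lemma evaluable_difference:
  assumes L: "subgroup L G" "K \<subset> L" "L \<subseteq> H"
  shows "evaluable (subgroup_avg G K \<ominus>\<^bsub>QG\<^esub> subgroup_avg G L)"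
proof -
  let ?c = "\<lambda>x. (if x \<in> K then int (card L) else 0) - (if x \<in> L then int (card K) else 0)"
  have supp: "subgroup_avg G K \<in> QG.supported H" "subgroup_avg G L \<in> QG.supported H"
    using subgroup_avg_supported K_H L(3) by blast+
  have carr: "subgroup_avg G K \<in> carrier QG" "subgroup_avg G L \<in> carrier QG"
    using supp by (auto intro: QG.supportedD)
  show ?thesis
    unfolding evaluable_def
  proof (intro conjI exI ballI)
    show "subgroup_avg G K \<ominus>\<^bsub>QG\<^esub> subgroup_avg G L \<in> QG.supported H"
      unfolding a_minus_def
      by (rule subringE(7)[OF QG.subring_supported[OF H] supp(1) subringE(5)[OF QG.subring_supported[OF H] supp(2)]])
    show "coprime p (card K * card L)" using coprime_card_subgroup[OF K] coprime_card_subgroup[OF L(1)] by simp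
    show "of_int (?c x) = of_nat (card K * card L) * (subgroup_avg G K \<ominus>\<^bsub>QG\<^esub> subgroup_avg G L) x"
      if "x \<in> carrier G" for x
      unfolding QG_minus_apply[OF carr that]
      using that card_subgroup_pos[OF K] card_subgroup_pos[OF L(1)] by (simp add: subgroup_avg_def field_simps)
    have "(\<Sum>h\<in>H. of_int (?c h) * \<chi> h) = (\<Sum>h\<in>H. of_int (if h \<in> K then int (card L) else 0) * \<chi> h)
       - (\<Sum>h\<in>H. of_int (if h \<in> L then int (card K) else 0) * \<chi> h)"
      by (simp only: of_int_diff left_diff_distrib sum_subtractf)
    also have "\<dots> = of_nat (card K * card L)"
      unfolding sum_\<chi>_subset[OF K_H] sum_\<chi>_subset[OF L(3)] sum_\<chi>_K sum_\<chi>_L[OF L] by simp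
    finally show "(\<Sum>h\<in>H. of_int (?c h) * \<chi> h) = (of_nat (card K * card L) :: 'k)" .
  qed
qed

lemma subgroup_of_normal: "L \<lhd> G\<lparr>carrier := H\<rparr> \<Longrightarrow> subgroup L G \<and> L \<subseteq> H"
proof -
  assume "L \<lhd> G\<lparr>carrier := H\<rparr>"
  then have L: "subgroup L (G\<lparr>carrier := H\<rparr>)" by (simp add: normal_def)
  have "L \<subseteq> H" using subgroup.subset[OF L] by simp
  moreover have "subgroup L G" by (rule incl_subgroup[OF H L])
  ultimately show ?thesis by blast
qed

lemma subgroup_avg_central:
  assumes L: "L \<lhd> G\<lparr>carrier := H\<rparr>" and f: "f \<in> QG.supported H"
  shows "subgroup_avg G L \<otimes>\<^bsub>QG\<^esub> f = f \<otimes>\<^bsub>QG\<^esub> subgroup_avg G L"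
proof -
  have sub: "subgroup L G" "L \<subseteq> H" using subgroup_of_normal[OF L] by auto
  have supp: "subgroup_avg G L \<in> QG.supported H" by (rule subgroup_avg_supported[OF sub(2)])
  have mult: "u \<otimes>\<^bsub>QG\<^esub> v \<in> QG.supported H" if "u \<in> QG.supported H" "v \<in> QG.supported H" for u v
    by (rule subringE(6)[OF QG.subring_supported[OF H] that])
  have conj: "x \<otimes> y \<otimes> inv x \<in> L \<longleftrightarrow> y \<in> L" if x: "x \<in> H" and y: "y \<in> carrier G" for x y
  proof -
    have inv: "inv\<^bsub>G\<lparr>carrier := H\<rparr>\<^esub> z = inv z" if "z \<in> H" for z using m_inv_consistent[OF H that] .
    have *: "z \<otimes> u \<otimes> inv z \<in> L" if "z \<in> H" "u \<in> L" for z u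
      using normal.inv_op_closed2[OF L, of z u] that inv by simp
    have "y \<in> L" if "x \<otimes> y \<otimes> inv x \<in> L"
      using *[OF H_closed(2)[OF x] that] x y by (simp add: m_assoc) (simp flip: m_assoc add: x)
    then show ?thesis using * x by blast
  qed
  show ?thesis
  proof (rule QG.gr_ext)
    fix x assume x: "x \<in> carrier G"
    show "(subgroup_avg G L \<otimes>\<^bsub>QG\<^esub> f) x = (f \<otimes>\<^bsub>QG\<^esub> subgroup_avg G L) x"
    proof (cases "x \<in> H")
      case True
      have "(\<Sum>y\<in>carrier G. subgroup_avg G L y * f (inv y \<otimes> x))
        = (\<Sum>y\<in>carrier G. f y * subgroup_avg G L (inv y \<otimes> x))"
      proof (rule sum.reindex_bij_witness[where i = "\<lambda>y. x \<otimes> (inv y \<otimes> x) \<otimes> inv x" and j = "\<lambda>y. inv y \<otimes> x"])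
        fix y assume y: "y \<in> carrier G"
        show "x \<otimes> (inv (inv y \<otimes> x) \<otimes> x) \<otimes> inv x = y"
          using x y by (simp add: inv_mult_group m_assoc) (simp flip: m_assoc)
        show "inv (x \<otimes> (inv y \<otimes> x) \<otimes> inv x) \<otimes> x = y"
          using x y by (simp add: inv_mult_group m_assoc)
        have "inv (inv y \<otimes> x) \<otimes> x = inv x \<otimes> y \<otimes> inv (inv x)"
          using x y by (simp add: inv_mult_group m_assoc)
        then have "inv (inv y \<otimes> x) \<otimes> x \<in> L \<longleftrightarrow> y \<in> L" using conj[OF H_closed(2)[OF True] y] by simp
        then show "f (inv y \<otimes> x) * subgroup_avg G L (inv (inv y \<otimes> x) \<otimes> x) = subgroup_avg G L y * f (inv y \<otimes> x)"
          using x y by (simp add: subgroup_avg_def)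
      qed (use x in auto)
      then show ?thesis using x by (simp add: QG_mult_apply)
    next
      case False
      then show ?thesis using mult[OF supp f] mult[OF f supp] x unfolding QG_supported_iff by simp
    qed
  qed (use mult[OF supp f] mult[OF f supp] in \<open>auto intro: QG.supportedD\<close>)
qed

lemma evaluable_shoda_eps: "evaluable (shoda_eps G H K)"
proof (cases "H = K")
  case True
  then show ?thesis using evaluable_avg_K by (simp add: shoda_eps_def)
next
  case False
  let ?B = "sub_group_ring rat_ring G H"
  let ?f = "\<lambda>L. subgroup_avg G K \<ominus>\<^bsub>QG\<^esub> subgroup_avg G L"
  have B: "ring ?B" by (rule QG.ring_sub_group_ring[OF H])
  interpret Z: comm_monoid "center_ring ?B" by (rule comm_monoid_center_ring[OF B])
  have carr: "carrier (center_ring ?B) = {z \<in> QG.supported H. \<forall>y\<in>QG.supported H. z \<otimes>\<^bsub>QG\<^esub> y = y \<otimes>\<^bsub>QG\<^esub> z}"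
    by (simp add: center_ring_def QG.sub_group_ring_eq)
  have ops: "monoid.mult (center_ring ?B) = monoid.mult QG" "\<one>\<^bsub>center_ring ?B\<^esub> = \<one>\<^bsub>QG\<^esub>"
    by (simp_all add: center_ring_def QG.sub_group_ring_eq)
  have ev: "evaluable (?f L) \<and> ?f L \<in> carrier (center_ring ?B)" if "L \<in> minimal_normal_over G H K" for L
  proof -
    have L: "L \<lhd> G\<lparr>carrier := H\<rparr>" "K \<subset> L" using that by (auto simp: minimal_normal_over_def)
    have sub: "subgroup L G" "L \<subseteq> H" using subgroup_of_normal[OF L(1)] by auto
    have eval: "evaluable (?f L)" by (rule evaluable_difference[OF sub(1) L(2) sub(2)])
    have "?f L \<otimes>\<^bsub>QG\<^esub> y = y \<otimes>\<^bsub>QG\<^esub> ?f L" if y: "y \<in> QG.supported H" for y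
    proof -
      have a: "subgroup_avg G K \<in> carrier QG" "subgroup_avg G L \<in> carrier QG" "y \<in> carrier QG"
        using subgroup_avg_supported[OF K_H] subgroup_avg_supported[OF sub(2)] y by (auto intro: QG.supportedD)
      show ?thesis
        using a subgroup_avg_central[OF K_normal y] subgroup_avg_central[OF L(1) y]
        by (simp add: a_minus_def QG.ZG.l_distr QG.ZG.r_distr QG.ZG.l_minus QG.ZG.r_minus)
    qed
    then show ?thesis using eval unfolding carr evaluable_def by blast
  qed
  have "minimal_normal_over G H K \<subseteq> Pow H"
    using subgroup_of_normal by (auto simp: minimal_normal_over_def)
  then have fin: "finite (minimal_normal_over G H K)" using finite_H by (simp add: finite_subset)
  have "evaluable (\<Otimes>\<^bsub>center_ring ?B\<^esub>L\<in>A. ?f L)" if "finite A" "A \<subseteq> minimal_normal_over G H K" for A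
    using that
  proof (induction A rule: finite_induct)
    case empty
    show ?case by (simp add: Z.finprod_empty ops evaluable_one)
  next
    case (insert L A)
    have "(\<Otimes>\<^bsub>center_ring ?B\<^esub>L\<in>insert L A. ?f L) = ?f L \<otimes>\<^bsub>center_ring ?B\<^esub> (\<Otimes>\<^bsub>center_ring ?B\<^esub>L\<in>A. ?f L)"
      using insert ev by (intro Z.finprod_insert) auto
    moreover have "evaluable (?f L)" using insert.prems ev[of L] by blast
    moreover have "evaluable (\<Otimes>\<^bsub>center_ring ?B\<^esub>L\<in>A. ?f L)" using insert by blast
    ultimately show ?case by (simp only: ops evaluable_mult)
  qed
  from this[OF fin subset_refl] show ?thesis using False by (simp add: shoda_eps_def)
qed

text \<open>Clearing denominators and reducing modulo \<open>p\<^sup>r\<close> turns the last condition on a strong Shoda pair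
  into a zero product in the group ring modulo \<open>p\<^sup>r\<close>, one factor of which is a unit in the corner
  of \<open>\<omega>\<close>.\<close>

lemma omega_orthogonal_outside_normalizer:
  assumes g: "g \<in> carrier G" "g \<notin> normalizer G K"
  shows "\<omega> \<otimes>\<^bsub>ZG\<^esub> gr_conj (residue_ring M) G g \<omega> = \<zero>\<^bsub>ZG\<^esub>"
proof -
  let ?e = "shoda_eps G H K"
  have e: "?e \<in> QG.supported H" using evaluable_shoda_eps unfolding evaluable_def by blast
  then have e': "?e \<in> carrier QG" by (rule QG.supportedD)
  obtain c m where c: "coprime p m" "\<And>x. x \<in> carrier G \<Longrightarrow> of_int (c x) = of_nat m * ?e x"
    "(\<Sum>h\<in>H. of_int (c h) * \<chi> h) = (of_nat m :: 'k)"
    using evaluable_shoda_eps unfolding evaluable_def by blast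
  have c0: "c x = 0" if "x \<in> carrier G" "x \<notin> H" for x
  proof -
    have "?e x = 0" using e that unfolding QG_supported_iff by blast
    then have "(of_int (c x) :: rat) = 0" using c(2)[OF that(1)] by simp
    then show ?thesis by simp
  qed
  have zero: "?e \<otimes>\<^bsub>QG\<^esub> gr_conj rat_ring G g ?e = \<zero>\<^bsub>QG\<^esub>"
    using strong_shoda g by (simp add: strong_shoda_pair_def)
  have c_zero: "(\<Sum>y\<in>carrier G. c y * c (g \<otimes> (inv y \<otimes> x) \<otimes> inv g)) = 0" if x: "x \<in> carrier G" for x
  proof -
    have "(of_int (\<Sum>y\<in>carrier G. c y * c (g \<otimes> (inv y \<otimes> x) \<otimes> inv g)) :: rat)
      = (\<Sum>y\<in>carrier G. (of_nat m * ?e y) * (of_nat m * ?e (g \<otimes> (inv y \<otimes> x) \<otimes> inv g)))"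
      using x g by (simp add: c(2))
    also have "\<dots> = of_nat m * of_nat m * (\<Sum>y\<in>carrier G. ?e y * gr_conj rat_ring G g ?e (inv y \<otimes> x))"
      unfolding sum_distrib_left using x g e' by (intro sum.cong refl) (simp add: QG.gr_conj_apply)
    also have "\<dots> = of_nat m * of_nat m * (?e \<otimes>\<^bsub>QG\<^esub> gr_conj rat_ring G g ?e) x"
      using x by (simp add: QG_mult_apply)
    also have "\<dots> = 0" using zero x by (simp add: QG.gr_zero_apply ring_of_type_algebra_simps)
    finally show ?thesis by (simp only: of_int_0_eq_iff flip: of_int_eq_0_iff)
  qed
  define f where "f = (\<lambda>x\<in>carrier G. c x mod M)"
  have M0: "M > 0" using modulus by linarith
  have f: "f \<in> SH"
  proof (rule SH_I)
    show "f \<in> carrier ZG"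
      unfolding gr_carrier residue_ring_simps f_def restrict_PiE_iff using M0 by simp
  qed (simp add: f_def c0)
  have "char_ring f = (\<Sum>h\<in>H. of_int (c h) * \<chi> h)"
    unfolding char_ring_def by (intro sum.cong refl) (simp add: f_def of_int_mod_M)
  also have "\<dots> = of_nat m" by (rule c(3))
  also have "\<dots> \<noteq> (0 :: 'k)"
  proof
    assume "of_nat m = (0 :: 'k)"
    then have "p dvd m" using char by (simp add: of_nat_eq_0_iff_char_dvd)
    from coprime_common_divisor[OF c(1) dvd_refl this] show False using p by simp
  qed
  finally obtain z where z: "z \<in> SH" "f \<otimes>\<^bsub>ZG\<^esub> z \<otimes>\<^bsub>ZG\<^esub> \<omega> = \<omega>" "z \<otimes>\<^bsub>ZG\<^esub> f \<otimes>\<^bsub>ZG\<^esub> \<omega> = \<omega>"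
    using unit_if_char_nonzero[OF f] by blast
  let ?conj = "gr_conj (residue_ring M) G g"
  have ff: "f \<otimes>\<^bsub>ZG\<^esub> ?conj f = \<zero>\<^bsub>ZG\<^esub>"
  proof (rule gr_ext)
    fix x assume x: "x \<in> carrier G"
    have "(f \<otimes>\<^bsub>ZG\<^esub> ?conj f) x
      = (\<Sum>y\<in>carrier G. (c y mod M) * (c (g \<otimes> (inv y \<otimes> x) \<otimes> inv g) mod M)) mod M"
      using x g f by (simp add: grm_mult_apply gr_conj_apply f_def)
    also have "\<dots> = (\<Sum>y\<in>carrier G. ((c y mod M) * (c (g \<otimes> (inv y \<otimes> x) \<otimes> inv g) mod M)) mod M) mod M"
      by (rule mod_sum_eq[symmetric])
    also have "\<dots> = (\<Sum>y\<in>carrier G. (c y * c (g \<otimes> (inv y \<otimes> x) \<otimes> inv g)) mod M) mod M"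
      by (simp only: mod_mult_eq)
    also have "\<dots> = (\<Sum>y\<in>carrier G. c y * c (g \<otimes> (inv y \<otimes> x) \<otimes> inv g)) mod M" by (rule mod_sum_eq)
    finally show "(f \<otimes>\<^bsub>ZG\<^esub> ?conj f) x = \<zero>\<^bsub>ZG\<^esub> x" using x c_zero[OF x] by (simp add: grm_zero_apply)
  qed (use f g in simp_all)
  have cl: "f \<in> carrier ZG" "z \<in> carrier ZG" "\<omega> \<in> carrier ZG" using f z(1) by simp_all
  have "\<omega> = \<omega> \<otimes>\<^bsub>ZG\<^esub> (z \<otimes>\<^bsub>ZG\<^esub> f)" using z(3) omega_central[of "z \<otimes>\<^bsub>ZG\<^esub> f"] z(1) f by simp
  moreover have "?conj \<omega> = ?conj f \<otimes>\<^bsub>ZG\<^esub> (?conj z \<otimes>\<^bsub>ZG\<^esub> ?conj \<omega>)"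
    using arg_cong[OF z(2), of ?conj] cl g by (simp add: gr_conj_mult ZG.m_assoc)
  ultimately have "\<omega> \<otimes>\<^bsub>ZG\<^esub> ?conj \<omega>
      = (\<omega> \<otimes>\<^bsub>ZG\<^esub> (z \<otimes>\<^bsub>ZG\<^esub> f)) \<otimes>\<^bsub>ZG\<^esub> (?conj f \<otimes>\<^bsub>ZG\<^esub> (?conj z \<otimes>\<^bsub>ZG\<^esub> ?conj \<omega>))" by metis
  also have "\<dots> = \<omega> \<otimes>\<^bsub>ZG\<^esub> z \<otimes>\<^bsub>ZG\<^esub> (f \<otimes>\<^bsub>ZG\<^esub> ?conj f) \<otimes>\<^bsub>ZG\<^esub> (?conj z \<otimes>\<^bsub>ZG\<^esub> ?conj \<omega>)"
    using cl g by (simp add: ZG.m_assoc)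
  also have "\<dots> = \<zero>\<^bsub>ZG\<^esub>" using cl g by (simp add: ff)
  finally show ?thesis .
qed

abbreviation "Cen \<equiv> gr_centralizer (residue_ring M) G \<omega>"

text \<open>For \<open>g\<close> in the normalizer of \<open>K\<close> the conjugate of \<open>\<omega>\<close> lies in the group ring of \<open>H\<close>. As the corner has
  only two idempotents, it is orthogonal to \<open>\<omega>\<close> or absorbs it. If both the conjugates by \<open>g\<close> and by its
  inverse absorb \<open>\<omega>\<close>, then \<open>g\<close> centralizes \<open>\<omega>\<close>.\<close>

lemma omega_orthogonal:
  assumes g: "g \<in> carrier G" "g \<notin> Cen"
  shows "\<omega> \<otimes>\<^bsub>ZG\<^esub> gr_conj (residue_ring M) G g \<omega> = \<zero>\<^bsub>ZG\<^esub>"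
proof (cases "g \<in> normalizer G K")
  case True
  have HN: "H \<lhd> G\<lparr>carrier := normalizer G K\<rparr>" using strong_shoda by (simp add: strong_shoda_pair_def)
  have N: "subgroup (normalizer G K) G" by (rule normalizer_imp_subgroup[OF K_G])
  have conj_H: "n \<otimes> h \<otimes> inv n \<in> H" if "n \<in> normalizer G K" "h \<in> H" for n h
    using normal.inv_op_closed2[OF HN, of n h] that m_inv_consistent[OF N that(1)] by simp
  have idem: "gr_conj (residue_ring M) G n \<omega> \<in> SH \<and>
      gr_conj (residue_ring M) G n \<omega> \<otimes>\<^bsub>ZG\<^esub> gr_conj (residue_ring M) G n \<omega> = gr_conj (residue_ring M) G n \<omega>"
    if n: "n \<in> normalizer G K" for n
  proof
    have nG: "n \<in> carrier G" using n subgroup.subset[OF N] by blast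
    have nI: "inv n \<in> normalizer G K" using n by (rule subgroup.m_inv_closed[OF N])
    show "gr_conj (residue_ring M) G n \<omega> \<in> SH"
    proof (rule SH_I)
      fix x assume x: "x \<in> carrier G" "x \<notin> H"
      have "n \<otimes> x \<otimes> inv n \<notin> H"
      proof
        assume "n \<otimes> x \<otimes> inv n \<in> H"
        from conj_H[OF nI this] have "inv n \<otimes> (n \<otimes> x \<otimes> inv n) \<otimes> n \<in> H" using nG by simp
        moreover have "inv n \<otimes> (n \<otimes> x \<otimes> inv n) \<otimes> n = x" using nG x(1) by (simp add: m_assoc) (simp add: nG x(1) flip: m_assoc)
        ultimately show False using x(2) by simp
      qed
      then show "gr_conj (residue_ring M) G n \<omega> x = 0" using nG x SH_outside[OF omega_SH] by (simp add: gr_conj_apply)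
    qed simp
    show "gr_conj (residue_ring M) G n \<omega> \<otimes>\<^bsub>ZG\<^esub> gr_conj (residue_ring M) G n \<omega> = gr_conj (residue_ring M) G n \<omega>"
      using gr_conj_mult[of \<omega> \<omega> n] nG by simp
  qed
  let ?e = "gr_conj (residue_ring M) G g \<omega>" and ?e' = "gr_conj (residue_ring M) G (inv g) \<omega>"
  have gI: "inv g \<in> normalizer G K" using True by (rule subgroup.m_inv_closed[OF N])
  have conj_back: "gr_conj (residue_ring M) G g ?e' = \<omega>"
    using g(1) by (simp add: gr_conj_conj gr_conj_one)
  show ?thesis
  proof (cases "char_ring ?e = 0 \<or> char_ring ?e' = 0")
    case zero: True
    then show ?thesis
    proof
      assume "char_ring ?e = 0"
      then have "?e \<otimes>\<^bsub>ZG\<^esub> \<omega> = \<zero>\<^bsub>ZG\<^esub>" using idem[OF True] idempotent_mult_omega(1) by blast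
      then show ?thesis using omega_central[of ?e] idem[OF True] by simp
    next
      assume "char_ring ?e' = 0"
      then have "?e' \<otimes>\<^bsub>ZG\<^esub> \<omega> = \<zero>\<^bsub>ZG\<^esub>" using idem[OF gI] idempotent_mult_omega(1) by blast
      then have "gr_conj (residue_ring M) G g (?e' \<otimes>\<^bsub>ZG\<^esub> \<omega>) = \<zero>\<^bsub>ZG\<^esub>" using g(1) by (simp add: gr_conj_zero)
      then show ?thesis using g(1) conj_back gr_conj_mult[of ?e' \<omega> g] by simp
    qed
  next
    case False
    then have "?e \<otimes>\<^bsub>ZG\<^esub> \<omega> = \<omega>" "?e' \<otimes>\<^bsub>ZG\<^esub> \<omega> = \<omega>"
      using idem[OF True] idem[OF gI] idempotent_mult_omega(2,3) by blast+
    then have "\<omega> \<otimes>\<^bsub>ZG\<^esub> ?e = ?e" using g(1) conj_back gr_conj_mult[of ?e' \<omega> g] by simp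
    then have "?e = \<omega>" using \<open>?e \<otimes>\<^bsub>ZG\<^esub> \<omega> = \<omega>\<close> omega_central[of ?e] idem[OF True] by simp
    then have "g \<in> Cen" using g(1) by (simp add: gr_centralizer_def)
    then show ?thesis using g(2) by simp
  qed
next
  case False
  then show ?thesis using omega_orthogonal_outside_normalizer g by blast
qed

lemma subgroup_Cen: "subgroup Cen G"
  by (rule subgroup_gr_centralizer) simp

lemma H_Cen: "H \<subseteq> Cen"
  using omega_commute_elt by (auto simp: gr_centralizer_def gr_conj_eq_iff_commute)

lemma omega_elt_omega:
  assumes g: "g \<in> carrier G" "g \<notin> Cen"
  shows "\<omega> \<otimes>\<^bsub>ZG\<^esub> \<delta> g \<otimes>\<^bsub>ZG\<^esub> \<omega> = \<zero>\<^bsub>ZG\<^esub>"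
proof -
  have "inv g \<notin> Cen" using subgroup.m_inv_closed[OF subgroup_Cen, of "inv g"] g by auto
  then have 0: "\<omega> \<otimes>\<^bsub>ZG\<^esub> gr_conj (residue_ring M) G (inv g) \<omega> = \<zero>\<^bsub>ZG\<^esub>" using g by (intro omega_orthogonal) simp_all
  have "\<delta> g \<otimes>\<^bsub>ZG\<^esub> \<omega> = gr_conj (residue_ring M) G (inv g) \<omega> \<otimes>\<^bsub>ZG\<^esub> \<delta> g"
    using g by (simp add: gr_conj_def ZG.m_assoc gr_elt_inv)
  then have "\<omega> \<otimes>\<^bsub>ZG\<^esub> \<delta> g \<otimes>\<^bsub>ZG\<^esub> \<omega> = (\<omega> \<otimes>\<^bsub>ZG\<^esub> gr_conj (residue_ring M) G (inv g) \<omega>) \<otimes>\<^bsub>ZG\<^esub> \<delta> g"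
    by (simp add: ZG.m_assoc)
  then show ?thesis by (simp add: 0)
qed

end

section \<open>Cyclic crossed products with trivial twisting\<close>

lemma (in monoid) Units_if_pow_one:
  assumes y: "y \<in> carrier G" "y [^] l = \<one>" and l: "(l::nat) > 0"
  shows "y \<in> Units G"
proof -
  obtain n where "l = Suc n" using l by (cases l) auto
  then have "y \<otimes> y [^] n = \<one>" "y [^] n \<otimes> y = \<one>"
    using y by (simp_all add: nat_pow_Suc2 [symmetric] del: nat_pow_Suc)
  then show ?thesis using y by (auto simp: Units_def intro!: bexI[of _ "y [^] n"])
qed

lemma mod_difference_eq_0:
  fixes i k l :: nat
  assumes "i < l" "k < l"
  shows "(l - i + k) mod l = 0 \<longleftrightarrow> i = k"
proof (cases "i \<le> k")
  case True
  then have "l - i + k = l + (k - i)" using assms by simp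
  then have "(l - i + k) mod l = (k - i) mod l" by (simp only: mod_add_self1)
  then show ?thesis using True assms by auto
next
  case False
  then have "l - i + k < l" "l - i + k \<noteq> 0" using assms by simp_all
  then show ?thesis using False by simp
qed

definition ring_center :: "('a, 'b) ring_scheme \<Rightarrow> 'a set" where
  "ring_center A = {z \<in> carrier A. \<forall>y\<in>carrier A. z \<otimes>\<^bsub>A\<^esub> y = y \<otimes>\<^bsub>A\<^esub> z}"

text \<open>Here \<open>Rc\<close> is the coefficient ring of the crossed product, and conjugation by \<open>\<gamma>\<close> generates the action
  of a cyclic group of order dividing \<open>l\<close> on it.\<close>

locale cyclic_conjugation = ring A for A :: "'a ring" (structure) +
  fixes Rc :: "'a set" and \<gamma> :: 'a and l :: nat
  assumes finite_carrier: "finite (carrier A)"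
    and subring_Rc: "subring Rc A"
    and Rc_comm: "\<lbrakk>y \<in> Rc; y' \<in> Rc\<rbrakk> \<Longrightarrow> y \<otimes> y' = y' \<otimes> y"
    and \<gamma> [simp]: "\<gamma> \<in> carrier A" and \<gamma>_pow: "\<gamma> [^] l = \<one>" and l_pos: "l > 0"
    and l_Unit: "[l] \<cdot>\<^bsub>A\<^esub> \<one> \<in> Units A"
    and conj_Rc: "y \<in> Rc \<Longrightarrow> \<gamma> \<otimes> y \<otimes> inv \<gamma> \<in> Rc"
begin

lemma Rc_carrier [simp]: "y \<in> Rc \<Longrightarrow> y \<in> carrier A"
  using subringE(1)[OF subring_Rc] by auto

lemma Rc_closed [simp]:
  "\<zero> \<in> Rc" "\<one> \<in> Rc" "y \<in> Rc \<Longrightarrow> \<ominus> y \<in> Rc"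
  "\<lbrakk>y \<in> Rc; y' \<in> Rc\<rbrakk> \<Longrightarrow> y \<otimes> y' \<in> Rc" "\<lbrakk>y \<in> Rc; y' \<in> Rc\<rbrakk> \<Longrightarrow> y \<oplus> y' \<in> Rc"
  "\<lbrakk>y \<in> Rc; y' \<in> Rc\<rbrakk> \<Longrightarrow> y \<ominus> y' \<in> Rc"
  using subringE(2,3,5,6,7)[OF subring_Rc] by (auto simp: a_minus_def)

lemma Rc_finsum: "finite I \<Longrightarrow> f \<in> I \<rightarrow> Rc \<Longrightarrow> finsum A f I \<in> Rc"
  by (induction I rule: finite_induct) (auto simp: finsum_insert Pi_def)

lemma ring_center_carrier [simp]: "s \<in> ring_center A \<Longrightarrow> s \<in> carrier A"
  by (simp add: ring_center_def)

lemma ring_centerD: "\<lbrakk>s \<in> ring_center A; y \<in> carrier A\<rbrakk> \<Longrightarrow> s \<otimes> y = y \<otimes> s"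
  unfolding ring_center_def by blast

lemma ring_centerI:
  "\<lbrakk>s \<in> carrier A; \<And>y. y \<in> carrier A \<Longrightarrow> s \<otimes> y = y \<otimes> s\<rbrakk> \<Longrightarrow> s \<in> ring_center A"
  unfolding ring_center_def by blast

lemma ring_center_mult:
  assumes "s \<in> ring_center A" "s' \<in> ring_center A"
  shows "s \<otimes> s' \<in> ring_center A"
proof (rule ring_centerI)
  fix y assume y: "y \<in> carrier A"
  have "s \<otimes> s' \<otimes> y = s \<otimes> (y \<otimes> s')" using assms y by (simp add: m_assoc ring_centerD[of s' y])
  also have "\<dots> = y \<otimes> (s \<otimes> s')"
    using assms y ring_centerD[OF assms(1) y] by (simp flip: m_assoc)
  finally show "s \<otimes> s' \<otimes> y = y \<otimes> (s \<otimes> s')" .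
qed (use assms in simp)

lemma \<gamma>_Unit: "\<gamma> \<in> Units A"
  by (rule Units_if_pow_one[OF \<gamma> \<gamma>_pow l_pos])

lemma inv_\<gamma> [simp]: "inv \<gamma> \<in> carrier A"
  using \<gamma>_Unit by (rule Units_inv_closed)

lemma \<gamma>_inv_pow: "\<gamma> [^] k \<otimes> inv \<gamma> [^] k = \<one>" "inv \<gamma> [^] k \<otimes> \<gamma> [^] (k::nat) = \<one>"
proof (induction k)
  case (Suc k)
  have "\<gamma> [^] Suc k \<otimes> inv \<gamma> [^] Suc k = \<gamma> [^] k \<otimes> (\<gamma> \<otimes> inv \<gamma>) \<otimes> inv \<gamma> [^] k"
    unfolding nat_pow_Suc2[OF inv_\<gamma>] by (simp add: m_assoc)
  then show "\<gamma> [^] Suc k \<otimes> inv \<gamma> [^] Suc k = \<one>" using Suc \<gamma>_Unit by simp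
  have "inv \<gamma> [^] Suc k \<otimes> \<gamma> [^] Suc k = inv \<gamma> [^] k \<otimes> (inv \<gamma> \<otimes> \<gamma>) \<otimes> \<gamma> [^] k"
    unfolding nat_pow_Suc2[OF \<gamma>] by (simp add: m_assoc)
  then show "inv \<gamma> [^] Suc k \<otimes> \<gamma> [^] Suc k = \<one>" using Suc \<gamma>_Unit by simp
qed auto

lemma \<gamma>_inv_pow_cancel:
  assumes "y \<in> carrier A"
  shows "\<gamma> [^] k \<otimes> (inv \<gamma> [^] k \<otimes> y) = y" "inv \<gamma> [^] k \<otimes> (\<gamma> [^] (k::nat) \<otimes> y) = y"
  using assms by (simp_all add: \<gamma>_inv_pow flip: m_assoc)

lemma \<gamma>_pow_add_l: "\<gamma> [^] (l + k) = \<gamma> [^] k"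
  by (simp add: \<gamma>_pow flip: nat_pow_mult)

lemma \<gamma>_pow_mod: "\<gamma> [^] (k mod l) = \<gamma> [^] k"
proof -
  have "\<gamma> [^] (j * l + i) = \<gamma> [^] i" for i j
    by (induction j) (simp_all add: \<gamma>_pow_add_l add.assoc)
  from this[of "k div l" "k mod l"] show ?thesis by simp
qed

lemma inv_\<gamma>_pow: "k \<le> l \<Longrightarrow> inv \<gamma> [^] k = \<gamma> [^] (l - k)"
proof -
  assume "k \<le> l"
  then have "\<gamma> [^] (l - k) \<otimes> \<gamma> [^] k = \<one>" by (simp add: nat_pow_mult \<gamma>_pow)
  then have "\<gamma> [^] (l - k) \<otimes> (\<gamma> [^] k \<otimes> inv \<gamma> [^] k) = inv \<gamma> [^] k" by (simp flip: m_assoc)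
  then show ?thesis by (simp add: \<gamma>_inv_pow)
qed

subsection \<open>The conjugation action on the coefficient ring\<close>

definition T :: "nat \<Rightarrow> 'a \<Rightarrow> 'a" where
  "T k y = \<gamma> [^] k \<otimes> y \<otimes> inv \<gamma> [^] k"

lemma T_carrier [simp]: "y \<in> carrier A \<Longrightarrow> T k y \<in> carrier A"
  by (simp add: T_def)

lemma T_0 [simp]: "y \<in> carrier A \<Longrightarrow> T 0 y = y"
  by (simp add: T_def)

lemma T_T: "y \<in> carrier A \<Longrightarrow> T i (T j y) = T (i + j) y"
proof -
  assume "y \<in> carrier A"
  moreover have "\<gamma> [^] (i + j) = \<gamma> [^] i \<otimes> \<gamma> [^] j" by (simp add: nat_pow_mult)
  moreover have "inv \<gamma> [^] (i + j) = inv \<gamma> [^] j \<otimes> inv \<gamma> [^] i" by (simp add: nat_pow_mult add.commute)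
  ultimately show ?thesis by (simp add: T_def m_assoc)
qed

lemma T_Rc [simp]: "y \<in> Rc \<Longrightarrow> T k y \<in> Rc"
proof (induction k)
  case (Suc k)
  have "T (Suc k) y = T 1 (T k y)" using Suc.prems by (simp add: T_T)
  also have "\<dots> \<in> Rc" using Suc conj_Rc[of "T k y"] by (simp add: T_def[of "Suc 0"])
  finally show ?case .
qed simp

lemma T_mod: "y \<in> carrier A \<Longrightarrow> T (k mod l) y = T k y"
proof -
  assume y: "y \<in> carrier A"
  have l: "T l y = y" if "y \<in> carrier A" for y
    using that \<gamma>_inv_pow(1)[of l] by (simp add: T_def \<gamma>_pow)
  have "T (j * l + i) y = T i y" for i j
  proof (induction j)
    case (Suc j)
    have "T (Suc j * l + i) y = T l (T (j * l + i) y)" using y by (simp add: T_T add.assoc)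
    then show ?case using Suc y l by simp
  qed simp
  from this[of "k div l" "k mod l"] show ?thesis by simp
qed

lemma T_mult: "\<lbrakk>y \<in> carrier A; y' \<in> carrier A\<rbrakk> \<Longrightarrow> T k (y \<otimes> y') = T k y \<otimes> T k y'"
  by (simp add: T_def m_assoc \<gamma>_inv_pow_cancel)

lemma T_add: "\<lbrakk>y \<in> carrier A; y' \<in> carrier A\<rbrakk> \<Longrightarrow> T k (y \<oplus> y') = T k y \<oplus> T k y'"
  by (simp add: T_def l_distr r_distr)

lemma T_minus: "\<lbrakk>y \<in> carrier A; y' \<in> carrier A\<rbrakk> \<Longrightarrow> T k (y \<ominus> y') = T k y \<ominus> T k y'"
  by (simp add: T_def l_distr r_distr a_minus_def l_minus r_minus)

lemma T_zero [simp]: "T k \<zero> = \<zero>" and T_one [simp]: "T k \<one> = \<one>"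
  by (simp_all add: T_def \<gamma>_inv_pow)

lemma T_center: "s \<in> ring_center A \<Longrightarrow> T k s = s"
  using ring_centerD[of s "\<gamma> [^] k"] by (simp add: T_def m_assoc \<gamma>_inv_pow flip: ring_centerD[of s "\<gamma> [^] k"])

lemma T_finsum: "finite I \<Longrightarrow> f \<in> I \<rightarrow> carrier A \<Longrightarrow> T k (finsum A f I) = (\<Oplus>i\<in>I. T k (f i))"
  by (induction I rule: finite_induct) (auto simp: finsum_insert Pi_def T_add)

lemma \<gamma>_pow_move: "y \<in> carrier A \<Longrightarrow> \<gamma> [^] k \<otimes> y = T k y \<otimes> \<gamma> [^] k"
  by (simp add: T_def m_assoc \<gamma>_inv_pow)

lemma finsum_cyclic:
  assumes "\<And>i. f i \<in> carrier A" "f l = f 0"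
  shows "(\<Oplus>i\<in>{..<l}. f (Suc i)) = (\<Oplus>i\<in>{..<l}. f i)"
proof -
  obtain n where n: "l = Suc n" using l_pos by (cases l) auto
  then have set: "{..<l} = {..n}" by auto
  have "finsum A f {..Suc n} = (\<Oplus>i\<in>{..n}. f (Suc i)) \<oplus> f 0"
    using assms by (intro finsum_Suc2) auto
  moreover have "finsum A f {..Suc n} = f (Suc n) \<oplus> finsum A f {..n}"
    using assms by (intro finsum_Suc) auto
  ultimately have eq: "f 0 \<oplus> (\<Oplus>i\<in>{..n}. f (Suc i)) = f 0 \<oplus> finsum A f {..n}"
    using assms n by (simp add: a_comm Pi_def)
  show ?thesis unfolding set by (rule add.l_cancel[OF eq]) (simp_all add: assms(1) finsum_closed Pi_def)
qed

end

text \<open>Over a field the assumption \<open>regular\<close> says that the conjugations are pairwise distinct. In general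
  nontrivial differences may be zero divisors, and a regular one has to be provided.\<close>

locale cyclic_basis = cyclic_conjugation +
  assumes basis: "y \<in> carrier A \<Longrightarrow> \<exists>!c. c \<in> {..<l} \<rightarrow>\<^sub>E Rc \<and> y = (\<Oplus>i\<in>{..<l}. c i \<otimes> \<gamma> [^] i)"
    and regular: "\<lbrakk>0 < n; n < l\<rbrakk> \<Longrightarrow> \<exists>y\<in>Rc. \<forall>u\<in>Rc. u \<otimes> (T n y \<ominus> y) = \<zero> \<longrightarrow> u = \<zero>"
begin

lemma basis_zero:
  assumes c: "c \<in> {..<l} \<rightarrow> Rc" and 0: "(\<Oplus>i\<in>{..<l}. c i \<otimes> \<gamma> [^] i) = \<zero>" and i: "i < l"
  shows "c i = \<zero>"
proof -
  let ?P = "\<lambda>c. c \<in> {..<l} \<rightarrow>\<^sub>E Rc \<and> \<zero> = (\<Oplus>i\<in>{..<l}. c i \<otimes> \<gamma> [^] i)"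
  have "?P (restrict c {..<l})"
  proof
    have "(\<Oplus>i\<in>{..<l}. restrict c {..<l} i \<otimes> \<gamma> [^] i) = (\<Oplus>i\<in>{..<l}. c i \<otimes> \<gamma> [^] i)"
      using c by (intro finsum_cong') (auto simp: Pi_def)
    then show "\<zero> = (\<Oplus>i\<in>{..<l}. restrict c {..<l} i \<otimes> \<gamma> [^] i)" using 0 by simp
  qed (use c in auto)
  moreover have "?P (\<lambda>i\<in>{..<l}. \<zero>)"
    by (auto intro!: add.finprod_one_eqI[symmetric])
  ultimately have "restrict c {..<l} = (\<lambda>i\<in>{..<l}. \<zero>)" using basis[OF zero_closed] by blast
  then show ?thesis using i by (metis lessThan_iff restrict_apply')
qed

lemma basis_obtain:
  assumes "y \<in> carrier A"
  obtains c where "c \<in> {..<l} \<rightarrow> Rc" "y = (\<Oplus>i\<in>{..<l}. c i \<otimes> \<gamma> [^] i)"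
proof -
  obtain c where "c \<in> {..<l} \<rightarrow>\<^sub>E Rc" "y = (\<Oplus>i\<in>{..<l}. c i \<otimes> \<gamma> [^] i)"
    using ex1_implies_ex[OF basis[OF assms]] by (elim exE conjE)
  then show ?thesis using that[of c] by (simp add: PiE_iff)
qed

lemma centralI:
  assumes z: "z \<in> Rc" and comm: "z \<otimes> \<gamma> = \<gamma> \<otimes> z"
  shows "z \<in> ring_center A"
proof -
  have pow: "z \<otimes> \<gamma> [^] i = \<gamma> [^] i \<otimes> z" for i :: nat
  proof (induction i)
    case (Suc i)
    have "z \<otimes> \<gamma> [^] Suc i = (\<gamma> [^] i \<otimes> z) \<otimes> \<gamma>" using z Suc by (simp add: nat_pow_Suc flip: m_assoc)
    also have "\<dots> = \<gamma> [^] Suc i \<otimes> z" using z comm by (simp add: nat_pow_Suc m_assoc)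
    finally show ?case .
  qed (use z in simp)
  have "z \<otimes> y = y \<otimes> z" if y: "y \<in> carrier A" for y
  proof -
    obtain c where c: "c \<in> {..<l} \<rightarrow> Rc" "y = (\<Oplus>i\<in>{..<l}. c i \<otimes> \<gamma> [^] i)" by (rule basis_obtain[OF y])
    have "z \<otimes> y = (\<Oplus>i\<in>{..<l}. z \<otimes> (c i \<otimes> \<gamma> [^] i))"
      unfolding c(2) using c(1) z by (intro finsum_rdistr) (auto simp: Pi_def)
    also have "\<dots> = (\<Oplus>i\<in>{..<l}. c i \<otimes> \<gamma> [^] i \<otimes> z)"
    proof (intro finsum_cong' refl)
      fix i assume "i \<in> {..<l}"
      then have ci: "c i \<in> Rc" using c(1) by auto
      have "z \<otimes> (c i \<otimes> \<gamma> [^] i) = c i \<otimes> (z \<otimes> \<gamma> [^] i)"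
        using z ci Rc_comm[OF z ci] by (simp flip: m_assoc)
      then show "z \<otimes> (c i \<otimes> \<gamma> [^] i) = c i \<otimes> \<gamma> [^] i \<otimes> z" using z ci pow by (simp add: m_assoc)
    qed (use c(1) z in \<open>auto simp: Pi_def\<close>)
    also have "\<dots> = y \<otimes> z"
      unfolding c(2) using c(1) z by (intro finsum_ldistr[symmetric]) (auto simp: Pi_def)
    finally show ?thesis .
  qed
  then show ?thesis using z by (intro ring_centerI) simp_all
qed

text \<open>Compare the coefficients of \<open>\<gamma>\<^sup>i\<close> on the two sides of \<open>zy = yz\<close>, with \<open>y\<close> in the
  coefficient ring.\<close>

lemma center_subset: "ring_center A \<subseteq> Rc"
proof
  fix z assume z: "z \<in> ring_center A"
  obtain c where c: "c \<in> {..<l} \<rightarrow> Rc" "z = (\<Oplus>i\<in>{..<l}. c i \<otimes> \<gamma> [^] i)"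
    by (rule basis_obtain[OF ring_center_carrier[OF z]])
  have cl: "c i \<in> Rc" if "i < l" for i using c that by auto
  have comm: "c i \<otimes> (T i y \<ominus> y) = \<zero>" if i: "i < l" and y: "y \<in> Rc" for i y
  proof (rule basis_zero[where c = "\<lambda>i. c i \<otimes> (T i y \<ominus> y)", OF _ _ i])
    have "z \<otimes> y = (\<Oplus>i\<in>{..<l}. c i \<otimes> \<gamma> [^] i \<otimes> y)"
      unfolding c(2) using cl y by (intro finsum_ldistr) auto
    also have "\<dots> = (\<Oplus>i\<in>{..<l}. c i \<otimes> T i y \<otimes> \<gamma> [^] i)"
      using cl y by (intro finsum_cong' refl) (auto simp: m_assoc \<gamma>_pow_move)
    finally have l: "z \<otimes> y = (\<Oplus>i\<in>{..<l}. c i \<otimes> T i y \<otimes> \<gamma> [^] i)" .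
    have "y \<otimes> z = (\<Oplus>i\<in>{..<l}. y \<otimes> (c i \<otimes> \<gamma> [^] i))"
      unfolding c(2) using cl y by (intro finsum_rdistr) auto
    also have "\<dots> = (\<Oplus>i\<in>{..<l}. c i \<otimes> y \<otimes> \<gamma> [^] i)"
    proof (intro finsum_cong' refl)
      fix i assume "i \<in> {..<l}"
      then have ci: "c i \<in> Rc" using cl by simp
      show "y \<otimes> (c i \<otimes> \<gamma> [^] i) = c i \<otimes> y \<otimes> \<gamma> [^] i"
        using ci y by (simp add: Rc_comm[OF y ci] flip: m_assoc)
    qed (use cl y in auto)
    finally have r: "y \<otimes> z = (\<Oplus>i\<in>{..<l}. c i \<otimes> y \<otimes> \<gamma> [^] i)" .
    have sum: "(\<Oplus>i\<in>{..<l}. c i \<otimes> (T i y \<ominus> y) \<otimes> \<gamma> [^] i) \<oplus> (\<Oplus>i\<in>{..<l}. c i \<otimes> y \<otimes> \<gamma> [^] i)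
        = (\<Oplus>i\<in>{..<l}. c i \<otimes> T i y \<otimes> \<gamma> [^] i)"
    proof -
      have "c i \<otimes> (T i y \<ominus> y) \<otimes> \<gamma> [^] i \<oplus> c i \<otimes> y \<otimes> \<gamma> [^] i = c i \<otimes> T i y \<otimes> \<gamma> [^] i" if "i < l" for i
      proof -
        have "c i \<otimes> (T i y \<ominus> y) \<otimes> \<gamma> [^] i \<oplus> c i \<otimes> y \<otimes> \<gamma> [^] i = c i \<otimes> (T i y \<ominus> y \<oplus> y) \<otimes> \<gamma> [^] i"
          using cl[OF that] y by (simp add: l_distr r_distr)
        also have "T i y \<ominus> y \<oplus> y = T i y" using y by (simp add: a_minus_def a_assoc l_neg)
        finally show ?thesis .
      qed
      then have "(\<Oplus>i\<in>{..<l}. c i \<otimes> (T i y \<ominus> y) \<otimes> \<gamma> [^] i \<oplus> c i \<otimes> y \<otimes> \<gamma> [^] i)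
          = (\<Oplus>i\<in>{..<l}. c i \<otimes> T i y \<otimes> \<gamma> [^] i)"
        using cl y by (intro finsum_cong') auto
      moreover have "(\<Oplus>i\<in>{..<l}. c i \<otimes> (T i y \<ominus> y) \<otimes> \<gamma> [^] i \<oplus> c i \<otimes> y \<otimes> \<gamma> [^] i)
          = (\<Oplus>i\<in>{..<l}. c i \<otimes> (T i y \<ominus> y) \<otimes> \<gamma> [^] i) \<oplus> (\<Oplus>i\<in>{..<l}. c i \<otimes> y \<otimes> \<gamma> [^] i)"
        using cl y by (intro finsum_addf) auto
      ultimately show ?thesis by simp
    qed
    have cl': "(\<Oplus>i\<in>{..<l}. c i \<otimes> (T i y \<ominus> y) \<otimes> \<gamma> [^] i) \<in> carrier A" "(\<Oplus>i\<in>{..<l}. c i \<otimes> y \<otimes> \<gamma> [^] i) \<in> carrier A"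
      using cl y by (auto intro!: finsum_closed)
    have "z \<otimes> y = y \<otimes> z" using ring_centerD[OF z] y by simp
    then show "(\<Oplus>i\<in>{..<l}. c i \<otimes> (T i y \<ominus> y) \<otimes> \<gamma> [^] i) = \<zero>"
      using sum add.r_cancel_one[OF cl'(2,1)] unfolding l r by simp
  qed (use cl y in auto)
  have zero: "c i = \<zero>" if i: "0 < i" "i < l" for i
    using regular[OF i] comm[OF i(2)] cl[OF i(2)] by blast
  have "z = c 0"
    unfolding c(2)
  proof (rule finsum_delta[where i = 0])
    fix i assume "i \<in> {..<l}"
    then show "c i \<otimes> \<gamma> [^] i = (if i = 0 then c 0 else \<zero>)" using zero cl by (cases "i = 0") simp_all
  qed (use l_pos cl in auto)
  then show "z \<in> Rc" using cl l_pos by simp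
qed

end

locale cyclic_crossed_product = cyclic_basis +
  fixes \<beta> :: 'a
  assumes \<beta> [simp]: "\<beta> \<in> Rc"
    and spanning: "y \<in> Rc \<Longrightarrow> \<exists>s\<in>{..<l} \<rightarrow> ring_center A. y = (\<Oplus>k\<in>{..<l}. s k \<otimes> T k \<beta>)"
begin

subsection \<open>Independence of the conjugations\<close>

lemma regular_difference:
  assumes "i < l" "j < l" "i \<noteq> j"
  shows "\<exists>y\<in>Rc. \<forall>u\<in>Rc. u \<otimes> (T i y \<ominus> T j y) = \<zero> \<longrightarrow> u = \<zero>"
proof -
  have *: "\<exists>y\<in>Rc. \<forall>u\<in>Rc. u \<otimes> (T i y \<ominus> T j y) = \<zero> \<longrightarrow> u = \<zero>" if ij: "j < i" "i < l" for i j
  proof -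
    have "\<exists>y\<in>Rc. \<forall>u\<in>Rc. u \<otimes> (T (i - j) y \<ominus> y) = \<zero> \<longrightarrow> u = \<zero>"
      using regular[of "i - j"] ij by simp
    then obtain y where y: "y \<in> Rc" "\<And>u. u \<in> Rc \<Longrightarrow> u \<otimes> (T (i - j) y \<ominus> y) = \<zero> \<Longrightarrow> u = \<zero>"
      by blast
    have "u = \<zero>" if u: "u \<in> Rc" "u \<otimes> (T i y \<ominus> T j y) = \<zero>" for u
    proof -
      have mod: "T (l - j) (T j v) = v" if "v \<in> carrier A" for v
        using that ij T_mod[of v l] by (simp add: T_T)
      have "T (l - j) (u \<otimes> (T i y \<ominus> T j y)) = T (l - j) u \<otimes> (T (l - j) (T i y) \<ominus> T (l - j) (T j y))"
        using u(1) y(1) by (simp add: T_mult T_minus)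
      also have "\<dots> = T (l - j) u \<otimes> (T (l - j + i) y \<ominus> y)"
        using y(1) mod[of y] by (simp only: T_T Rc_carrier)
      finally have "T (l - j) u \<otimes> (T (l - j + i) y \<ominus> y) = \<zero>" using u(2) by simp
      also have "T (l - j + i) y = T (i - j) y"
      proof -
        have "l - j + i = l + (i - j)" using ij by simp
        then have "(l - j + i) mod l = (i - j) mod l" by simp
        then show ?thesis using y(1) T_mod[of y "l - j + i"] T_mod[of y "i - j"] by simp
      qed
      finally have "T (l - j) u = \<zero>" using u y(2)[of "T (l - j) u"] by simp
      then have "T j (T (l - j) u) = \<zero>" by simp
      then show "u = \<zero>" using u(1) ij T_mod[of u l] by (simp add: T_T)
    qed
    then show ?thesis using y(1) by blast
  qed
  show ?thesis
  proof (cases "j < i")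
    case True
    then show ?thesis using * assms by simp
  next
    case False
    then obtain y where y: "y \<in> Rc" "\<And>u. u \<in> Rc \<Longrightarrow> u \<otimes> (T j y \<ominus> T i y) = \<zero> \<Longrightarrow> u = \<zero>"
      using *[of i j] assms by auto
    have "u = \<zero>" if u: "u \<in> Rc" "u \<otimes> (T i y \<ominus> T j y) = \<zero>" for u
    proof -
      have "T j y \<ominus> T i y = \<ominus> (T i y \<ominus> T j y)"
        using y(1) by (simp add: a_minus_def minus_add a_comm)
      then have "u \<otimes> (T j y \<ominus> T i y) = \<zero>" using u y(1) by (simp add: r_minus)
      then show ?thesis using y(2) u by blast
    qed
    then show ?thesis using y(1) by blast
  qed
qed

text \<open>The independence argument of Dedekind works over a commutative ring if any two of the
  maps differ by a regular element somewhere.\<close>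

lemma T_independent:
  assumes J: "finite J" "J \<subseteq> {..<l}" and c: "c \<in> J \<rightarrow> Rc"
    and 0: "\<And>y. y \<in> Rc \<Longrightarrow> (\<Oplus>i\<in>J. c i \<otimes> T i y) = \<zero>" and i: "i \<in> J"
  shows "c i = \<zero>"
  using assms
proof (induction J arbitrary: c i rule: finite_induct)
  case (insert j J)
  have cR: "c i \<in> Rc" if "i \<in> insert j J" for i using insert.prems(2) that by auto
  have cJ: "c i = \<zero>" if i: "i \<in> J" for i
  proof -
    obtain z where z: "z \<in> Rc" "\<And>u. u \<in> Rc \<Longrightarrow> u \<otimes> (T i z \<ominus> T j z) = \<zero> \<Longrightarrow> u = \<zero>"
      using regular_difference[of i j] i insert.prems(1) insert.hyps(2) by (auto simp: subset_eq)
    have "c i \<otimes> (T i z \<ominus> T j z) = \<zero>"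
    proof (rule insert.IH[OF _ _ _ i])
      fix y assume y: "y \<in> Rc"
      have eq: "c i \<otimes> T i (z \<otimes> y) \<ominus> T j z \<otimes> (c i \<otimes> T i y)
          = c i \<otimes> (T i z \<ominus> T j z) \<otimes> T i y" if "i \<in> insert j J" for i
      proof -
        have "T j z \<otimes> (c i \<otimes> T i y) = c i \<otimes> T j z \<otimes> T i y"
          using z(1) cR[OF that] y Rc_comm[of "T j z" "c i"] by (simp flip: m_assoc)
        then show ?thesis
          using z(1) cR[OF that] y by (simp add: T_mult m_assoc a_minus_def r_distr l_distr l_minus r_minus)
      qed
      have cl: "c i \<otimes> T i (z \<otimes> y) \<in> carrier A" "T j z \<otimes> (c i \<otimes> T i y) \<in> carrier A"
        "c i \<otimes> T i y \<in> carrier A" "c i \<otimes> (T i z \<ominus> T j z) \<otimes> T i y \<in> carrier A"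
        if "i \<in> insert j J" for i
        using z(1) y cR[OF that] by auto
      have eq': "c i \<otimes> (T i z \<ominus> T j z) \<otimes> T i y
          = c i \<otimes> T i (z \<otimes> y) \<oplus> (\<ominus> T j z) \<otimes> (c i \<otimes> T i y)" if "i \<in> insert j J" for i
        unfolding eq[OF that, symmetric] using cl[OF that] z(1) cR[OF that] y by (simp add: a_minus_def l_minus)
      have "(\<Oplus>i\<in>insert j J. c i \<otimes> (T i z \<ominus> T j z) \<otimes> T i y)
        = (\<Oplus>i\<in>insert j J. c i \<otimes> T i (z \<otimes> y) \<oplus> (\<ominus> T j z) \<otimes> (c i \<otimes> T i y))"
        using cl z(1) y cR by (intro finsum_cong' refl eq') auto
      also have "\<dots> = (\<Oplus>i\<in>insert j J. c i \<otimes> T i (z \<otimes> y))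
          \<oplus> (\<Oplus>i\<in>insert j J. (\<ominus> T j z) \<otimes> (c i \<otimes> T i y))"
        using cl z(1) by (intro finsum_addf) (auto simp: l_minus)
      also have "(\<Oplus>i\<in>insert j J. (\<ominus> T j z) \<otimes> (c i \<otimes> T i y)) = (\<ominus> T j z) \<otimes> (\<Oplus>i\<in>insert j J. c i \<otimes> T i y)"
        using insert.hyps(1) cl z(1) by (intro finsum_rdistr[symmetric]) auto
      finally have "(\<Oplus>i\<in>insert j J. c i \<otimes> (T i z \<ominus> T j z) \<otimes> T i y) = \<zero>"
        using insert.prems(3)[of y] insert.prems(3)[of "z \<otimes> y"] y z(1) by simp
      moreover have "(\<Oplus>i\<in>insert j J. c i \<otimes> (T i z \<ominus> T j z) \<otimes> T i y)
        = c j \<otimes> (T j z \<ominus> T j z) \<otimes> T j y \<oplus> (\<Oplus>i\<in>J. c i \<otimes> (T i z \<ominus> T j z) \<otimes> T i y)"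
        using insert.hyps cl by (intro finsum_insert) auto
      ultimately show "(\<Oplus>i\<in>J. c i \<otimes> (T i z \<ominus> T j z) \<otimes> T i y) = \<zero>"
        using z(1) y cR cl insert.hyps(1) by (simp add: a_minus_def r_neg finsum_closed Pi_def)
    qed (use insert.prems(1) z(1) cR in auto)
    then show ?thesis using z(2)[of "c i"] cR i by simp
  qed
  have "(\<Oplus>i\<in>insert j J. c i \<otimes> T i \<one>) = c j"
    using insert.hyps cJ cR by (intro finsum_delta[where i = j]) auto
  then have "c j = \<zero>" using insert.prems(3)[of \<one>] by simp
  then show ?case using insert.prems(4) cJ by auto
qed simp

lemma T_independent_basis:
  assumes c: "c \<in> {..<l} \<rightarrow> Rc"
    and 0: "\<And>k. k < l \<Longrightarrow> (\<Oplus>i\<in>{..<l}. c i \<otimes> T (i + k) \<beta>) = \<zero>" and "i < l"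
  shows "c i = \<zero>"
proof (rule T_independent[OF _ _ c])
  fix y assume y: "y \<in> Rc"
  then obtain s where s: "s \<in> {..<l} \<rightarrow> ring_center A" "y = (\<Oplus>k\<in>{..<l}. s k \<otimes> T k \<beta>)"
    using spanning[OF y] by blast
  have cl: "c i \<in> Rc" "s i \<in> ring_center A" if "i < l" for i using that c s(1) by auto
  have "(\<Oplus>i\<in>{..<l}. c i \<otimes> T i y) = (\<Oplus>i\<in>{..<l}. \<Oplus>k\<in>{..<l}. s k \<otimes> (c i \<otimes> T (i + k) \<beta>))"
  proof (intro finsum_cong' refl)
    fix i assume "i \<in> {..<l}"
    then have i: "i < l" by simp
    have "T i y = (\<Oplus>k\<in>{..<l}. T i (s k \<otimes> T k \<beta>))"
      unfolding s(2) using cl by (intro T_finsum) auto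
    then have "c i \<otimes> T i y = (\<Oplus>k\<in>{..<l}. c i \<otimes> T i (s k \<otimes> T k \<beta>))"
      using cl i by (simp add: finsum_rdistr Pi_def)
    also have "\<dots> = (\<Oplus>k\<in>{..<l}. s k \<otimes> (c i \<otimes> T (i + k) \<beta>))"
    proof (intro finsum_cong' refl)
      fix k assume "k \<in> {..<l}"
      then have k: "k < l" by simp
      have "c i \<otimes> T i (s k \<otimes> T k \<beta>) = c i \<otimes> s k \<otimes> T (i + k) \<beta>"
        using cl[OF i] cl[OF k] by (simp add: T_mult T_T T_center m_assoc)
      also have "c i \<otimes> s k = s k \<otimes> c i" using cl[OF i] cl[OF k] by (simp add: ring_centerD)
      finally show "c i \<otimes> T i (s k \<otimes> T k \<beta>) = s k \<otimes> (c i \<otimes> T (i + k) \<beta>)"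
        using cl[OF i] cl[OF k] by (simp add: m_assoc)
    qed (use cl i in auto)
    finally show "c i \<otimes> T i y = (\<Oplus>k\<in>{..<l}. s k \<otimes> (c i \<otimes> T (i + k) \<beta>))" .
  qed (use cl in \<open>auto intro!: finsum_closed\<close>)
  also have "\<dots> = (\<Oplus>k\<in>{..<l}. \<Oplus>i\<in>{..<l}. s k \<otimes> (c i \<otimes> T (i + k) \<beta>))"
    using cl by (intro finsum_swap) auto
  also have "\<dots> = (\<Oplus>k\<in>{..<l}. s k \<otimes> (\<Oplus>i\<in>{..<l}. c i \<otimes> T (i + k) \<beta>))"
    using cl by (intro finsum_cong' refl finsum_rdistr[symmetric]) (auto intro!: finsum_closed)
  also have "\<dots> = \<zero>" using 0 cl by (intro add.finprod_one_eqI) auto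
  finally show "(\<Oplus>i\<in>{..<l}. c i \<otimes> T i y) = \<zero>" .
qed (use assms(3) in auto)

text \<open>A linear system over a finite commutative ring is uniquely solvable as soon as its
  homogeneous system has only the zero solution.\<close>

lemma normal_system_solvable:
  assumes b: "b \<in> {..<l} \<rightarrow> Rc"
  shows "\<exists>c\<in>{..<l} \<rightarrow> Rc. \<forall>k<l. (\<Oplus>i\<in>{..<l}. c i \<otimes> T (i + k) \<beta>) = b k"
proof -
  define \<Lambda> where "\<Lambda> c = (\<lambda>k\<in>{..<l}. \<Oplus>i\<in>{..<l}. c i \<otimes> T (i + k) \<beta>)" for c
  let ?V = "{..<l} \<rightarrow>\<^sub>E Rc"
  have "finite Rc" by (rule finite_subset[OF _ finite_carrier]) auto
  then have fin: "finite ?V" by (intro finite_PiE) auto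
  have inj: "inj_on \<Lambda> ?V"
  proof (rule inj_onI)
    fix c c' assume cc': "c \<in> ?V" "c' \<in> ?V" "\<Lambda> c = \<Lambda> c'"
    have cl: "c i \<in> Rc" "c' i \<in> Rc" if "i < l" for i using cc' that by auto
    have "c i \<ominus> c' i = \<zero>" if "i < l" for i
    proof (rule T_independent_basis[OF _ _ that])
      fix k assume k: "k < l"
      have "(\<Oplus>i\<in>{..<l}. (c i \<ominus> c' i) \<otimes> T (i + k) \<beta>)
        = (\<Oplus>i\<in>{..<l}. c i \<otimes> T (i + k) \<beta> \<oplus> (\<ominus> \<one>) \<otimes> (c' i \<otimes> T (i + k) \<beta>))"
        using cl by (intro finsum_cong' refl) (auto simp: l_distr a_minus_def l_minus)
      also have "\<dots> = (\<Oplus>i\<in>{..<l}. c i \<otimes> T (i + k) \<beta>)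
          \<oplus> (\<Oplus>i\<in>{..<l}. (\<ominus> \<one>) \<otimes> (c' i \<otimes> T (i + k) \<beta>))"
        using cl by (intro finsum_addf) auto
      also have "(\<Oplus>i\<in>{..<l}. (\<ominus> \<one>) \<otimes> (c' i \<otimes> T (i + k) \<beta>))
          = (\<ominus> \<one>) \<otimes> (\<Oplus>i\<in>{..<l}. c' i \<otimes> T (i + k) \<beta>)"
        using cl by (intro finsum_rdistr[symmetric]) auto
      also have "(\<Oplus>i\<in>{..<l}. c' i \<otimes> T (i + k) \<beta>) = (\<Oplus>i\<in>{..<l}. c i \<otimes> T (i + k) \<beta>)"
        using fun_cong[OF cc'(3), of k] k by (simp add: \<Lambda>_def)
      finally show "(\<Oplus>i\<in>{..<l}. (c i \<ominus> c' i) \<otimes> T (i + k) \<beta>) = \<zero>"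
        using cl by (simp add: l_minus finsum_closed Pi_def r_neg)
    qed (use cl in auto)
    then have "c i = c' i" if "i < l" for i using that cl by simp
    then show "c = c'" using cc' by (intro PiE_ext) auto
  qed
  have "\<Lambda> ` ?V \<subseteq> ?V"
  proof (rule image_subsetI)
    fix c assume "c \<in> ?V"
    then have "c i \<in> Rc" if "i < l" for i using that by auto
    then show "\<Lambda> c \<in> ?V"
      unfolding \<Lambda>_def restrict_PiE_iff by (intro ballI Rc_finsum) simp_all
  qed
  then have "\<Lambda> ` ?V = ?V" using fin inj by (intro endo_inj_surj)
  moreover have "restrict b {..<l} \<in> ?V" using b by auto
  ultimately obtain c where c: "c \<in> ?V" "restrict b {..<l} = \<Lambda> c" by blast
  have "(\<Oplus>i\<in>{..<l}. c i \<otimes> T (i + k) \<beta>) = b k" if "k < l" for k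
    using fun_cong[OF c(2), of k] that by (simp add: \<Lambda>_def)
  then show ?thesis using c(1) by (intro bexI[of _ c]) auto
qed

subsection \<open>The averaging idempotent\<close>

definition E :: 'a where
  "E = inv ([l] \<cdot>\<^bsub>A\<^esub> \<one>) \<otimes> (\<Oplus>i\<in>{..<l}. \<gamma> [^] i)"

abbreviation "linv \<equiv> inv ([l] \<cdot>\<^bsub>A\<^esub> \<one>)"

lemma linv_closed [simp]: "linv \<in> carrier A"
  using l_Unit by (rule Units_inv_closed)

lemma l_central: "y \<in> carrier A \<Longrightarrow> ([l] \<cdot>\<^bsub>A\<^esub> \<one>) \<otimes> y = [l] \<cdot>\<^bsub>A\<^esub> y" "y \<in> carrier A \<Longrightarrow> y \<otimes> ([l] \<cdot>\<^bsub>A\<^esub> \<one>) = [l] \<cdot>\<^bsub>A\<^esub> y"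
  by (simp_all add: add_pow_ldistr add_pow_rdistr)

lemma linv_center: "linv \<in> ring_center A"
proof -
  have "linv \<otimes> y = y \<otimes> linv" if y: "y \<in> carrier A" for y
  proof -
    have "linv \<otimes> y = linv \<otimes> (y \<otimes> ([l] \<cdot>\<^bsub>A\<^esub> \<one>)) \<otimes> linv"
      using y l_Unit by (simp add: m_assoc Units_closed)
    also have "\<dots> = linv \<otimes> (([l] \<cdot>\<^bsub>A\<^esub> \<one>) \<otimes> y) \<otimes> linv" using y by (simp only: l_central)
    also have "\<dots> = y \<otimes> linv" using y l_Unit by (simp add: Units_closed flip: m_assoc)
    finally show ?thesis .
  qed
  then show ?thesis by (intro ring_centerI) simp_all
qed

lemma l_cancel: "y \<in> carrier A \<Longrightarrow> [l] \<cdot>\<^bsub>A\<^esub> y = \<zero> \<Longrightarrow> y = \<zero>"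
proof -
  assume y: "y \<in> carrier A" "[l] \<cdot>\<^bsub>A\<^esub> y = \<zero>"
  have "y = linv \<otimes> (([l] \<cdot>\<^bsub>A\<^esub> \<one>) \<otimes> y)" using y(1) l_Unit by (simp add: Units_closed flip: m_assoc)
  then show "y = \<zero>" using y by (simp add: l_central)
qed

lemma E_closed [simp]: "E \<in> carrier A"
  by (simp add: E_def finsum_closed Pi_def)

lemma l_E: "[l] \<cdot>\<^bsub>A\<^esub> E = (\<Oplus>i\<in>{..<l}. \<gamma> [^] i)"
proof -
  have "[l] \<cdot>\<^bsub>A\<^esub> E = ([l] \<cdot>\<^bsub>A\<^esub> \<one>) \<otimes> E" by (simp add: l_central)
  also have "\<dots> = (\<Oplus>i\<in>{..<l}. \<gamma> [^] i)"
    using l_Unit by (simp add: E_def finsum_closed Pi_def Units_closed flip: m_assoc)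
  finally show ?thesis .
qed

lemma \<gamma>_E: "\<gamma> [^] (k::nat) \<otimes> E = E"
proof -
  have "\<gamma> \<otimes> E = linv \<otimes> (\<gamma> \<otimes> (\<Oplus>i\<in>{..<l}. \<gamma> [^] i))"
    unfolding E_def using ring_centerD[OF linv_center \<gamma>] by (simp add: finsum_closed Pi_def flip: m_assoc)
  also have "\<gamma> \<otimes> (\<Oplus>i\<in>{..<l}. \<gamma> [^] i) = (\<Oplus>i\<in>{..<l}. \<gamma> \<otimes> \<gamma> [^] i)"
    by (intro finsum_rdistr) auto
  also have "\<dots> = (\<Oplus>i\<in>{..<l}. \<gamma> [^] Suc i)"
    by (intro finsum_cong' refl) (auto simp only: nat_pow_Suc2 \<gamma> Pi_def nat_pow_closed)
  also have "\<dots> = (\<Oplus>i\<in>{..<l}. \<gamma> [^] i)"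
    by (intro finsum_cyclic[of "\<lambda>i. \<gamma> [^] i"]) (simp_all add: \<gamma>_pow)
  finally have "\<gamma> \<otimes> E = E" by (simp add: E_def)
  then show ?thesis
    by (induction k) (simp_all add: nat_pow_Suc m_assoc)
qed

lemma \<gamma>_mult_E: "y \<in> carrier A \<Longrightarrow> \<gamma> [^] i \<otimes> (y \<otimes> E) = T i y \<otimes> E"
proof -
  assume y: "y \<in> carrier A"
  have "\<gamma> [^] i \<otimes> (y \<otimes> E) = (\<gamma> [^] i \<otimes> y) \<otimes> E" using y by (simp add: m_assoc)
  also have "\<dots> = T i y \<otimes> (\<gamma> [^] i \<otimes> E)" unfolding \<gamma>_pow_move[OF y] using y by (simp add: m_assoc)
  finally show ?thesis by (simp only: \<gamma>_E)
qed

lemma finsum_const_A: "y \<in> carrier A \<Longrightarrow> (\<Oplus>i\<in>{..<l}. y) = [l] \<cdot>\<^bsub>A\<^esub> y"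
  using add.finprod_const[of y "{..<l}"] by simp

definition tr :: "'a \<Rightarrow> 'a" where
  "tr y = (\<Oplus>i\<in>{..<l}. T i y)"

lemma tr_closed [simp]: "y \<in> Rc \<Longrightarrow> tr y \<in> Rc"
  unfolding tr_def by (rule Rc_finsum) simp_all

lemma tr_center: "y \<in> Rc \<Longrightarrow> tr y \<in> ring_center A"
proof (rule centralI)
  assume y: "y \<in> Rc"
  have "T 1 (tr y) = (\<Oplus>i\<in>{..<l}. T (Suc i) y)"
    unfolding tr_def using y by (subst T_finsum) (auto simp: T_T)
  also have "\<dots> = tr y"
    unfolding tr_def using y T_mod[of y l] by (intro finsum_cyclic) auto
  finally have 1: "T 1 (tr y) = tr y" .
  have "\<gamma> \<otimes> tr y = T 1 (tr y) \<otimes> \<gamma>" using \<gamma>_pow_move[of "tr y" 1] y by simp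
  then show "tr y \<otimes> \<gamma> = \<gamma> \<otimes> tr y" unfolding 1 by (rule sym)
qed simp

lemma tr_T: "y \<in> Rc \<Longrightarrow> tr (T k y) = tr y"
proof (induction k)
  case (Suc k)
  have "tr (T (Suc k) y) = (\<Oplus>i\<in>{..<l}. T (Suc i) (T k y))"
    using Suc.prems by (simp add: tr_def T_T)
  also have "\<dots> = tr (T k y)"
    unfolding tr_def using Suc.prems T_mod[of "T k y" l] by (intro finsum_cyclic) auto
  finally show ?case using Suc by simp
qed simp

lemma tr_minus: "\<lbrakk>y \<in> Rc; y' \<in> Rc\<rbrakk> \<Longrightarrow> tr (y \<ominus> y') = tr y \<ominus> tr y'"
proof -
  assume y: "y \<in> Rc" "y' \<in> Rc"
  have "tr y = tr ((y \<ominus> y') \<oplus> y')" using y by (simp add: a_minus_def a_assoc l_neg)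
  also have "\<dots> = tr (y \<ominus> y') \<oplus> tr y'"
    unfolding tr_def using y by (simp add: T_add finsum_addf Pi_def)
  finally show ?thesis using y by (simp add: a_minus_def a_assoc r_neg)
qed

lemma E_sandwich: "y \<in> Rc \<Longrightarrow> E \<otimes> y \<otimes> E = linv \<otimes> tr y \<otimes> E"
proof -
  assume y: "y \<in> Rc"
  have "(\<Oplus>i\<in>{..<l}. \<gamma> [^] i) \<otimes> (y \<otimes> E) = (\<Oplus>i\<in>{..<l}. \<gamma> [^] i \<otimes> (y \<otimes> E))"
    using y by (intro finsum_ldistr) auto
  also have "\<dots> = (\<Oplus>i\<in>{..<l}. T i y \<otimes> E)"
    using y by (intro finsum_cong' refl) (simp_all add: \<gamma>_mult_E)
  also have "\<dots> = tr y \<otimes> E"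
    unfolding tr_def using y by (intro finsum_ldistr[symmetric]) auto
  finally show ?thesis using y by (simp add: E_def[THEN arg_cong, of "\<lambda>u. u \<otimes> y \<otimes> E"] m_assoc finsum_closed Pi_def)
qed

lemma E_idem: "E \<otimes> E = E"
proof -
  have "tr \<one> = [l] \<cdot>\<^bsub>A\<^esub> \<one>" by (simp add: tr_def finsum_const_A)
  then show ?thesis using E_sandwich[of \<one>] l_Unit by simp
qed

lemma mult_E_zero: "y \<in> Rc \<Longrightarrow> y \<otimes> E = \<zero> \<Longrightarrow> y = \<zero>"
proof -
  assume y: "y \<in> Rc" "y \<otimes> E = \<zero>"
  have "(\<Oplus>i\<in>{..<l}. y \<otimes> \<gamma> [^] i) = y \<otimes> (\<Oplus>i\<in>{..<l}. \<gamma> [^] i)"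
    using y by (intro finsum_rdistr[symmetric]) auto
  also have "\<dots> = \<zero>" using y by (simp add: add_pow_rdistr flip: l_E)
  finally show "y = \<zero>" using y(1) l_pos by (intro basis_zero[of "\<lambda>_. y" 0]) auto
qed

lemma sum_mult_E:
  assumes c: "c \<in> {..<l} \<rightarrow> Rc" and y: "y \<in> Rc"
  shows "(\<Oplus>i\<in>{..<l}. c i \<otimes> \<gamma> [^] i) \<otimes> (y \<otimes> E) = (\<Oplus>i\<in>{..<l}. c i \<otimes> T i y) \<otimes> E"
proof -
  have cl: "c i \<in> Rc" if "i < l" for i using c that by auto
  have "(\<Oplus>i\<in>{..<l}. c i \<otimes> \<gamma> [^] i) \<otimes> (y \<otimes> E) = (\<Oplus>i\<in>{..<l}. c i \<otimes> \<gamma> [^] i \<otimes> (y \<otimes> E))"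
    using cl y by (intro finsum_ldistr) auto
  also have "\<dots> = (\<Oplus>i\<in>{..<l}. c i \<otimes> T i y \<otimes> E)"
  proof (intro finsum_cong' refl)
    fix i assume "i \<in> {..<l}"
    then have ci: "c i \<in> Rc" using cl by auto
    show "c i \<otimes> \<gamma> [^] i \<otimes> (y \<otimes> E) = c i \<otimes> T i y \<otimes> E"
      using ci y by (simp add: m_assoc \<gamma>_mult_E)
  qed (use cl y in auto)
  also have "\<dots> = (\<Oplus>i\<in>{..<l}. c i \<otimes> T i y) \<otimes> E"
    using cl y by (intro finsum_ldistr[symmetric]) auto
  finally show ?thesis .
qed

text \<open>The left module \<open>AE = RE\<close> is the natural module \<open>R\<close> of the crossed product; it is faithful.\<close>

lemma faithful:
  assumes a: "a \<in> carrier A" and 0: "\<And>k. k < l \<Longrightarrow> a \<otimes> (T k \<beta> \<otimes> E) = \<zero>"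
  shows "a = \<zero>"
proof -
  obtain c where c: "c \<in> {..<l} \<rightarrow> Rc" "a = (\<Oplus>i\<in>{..<l}. c i \<otimes> \<gamma> [^] i)" by (rule basis_obtain[OF a])
  have cl: "c i \<in> Rc" if "i < l" for i using c that by auto
  have "(\<Oplus>i\<in>{..<l}. c i \<otimes> T (i + k) \<beta>) = \<zero>" if "k < l" for k
  proof (rule mult_E_zero)
    show "(\<Oplus>i\<in>{..<l}. c i \<otimes> T (i + k) \<beta>) \<otimes> E = \<zero>"
      using sum_mult_E[OF c(1), of "T k \<beta>"] 0[OF that] c(2) by (simp add: T_T)
  qed (intro Rc_finsum Pi_I; simp add: cl)
  then have "c i = \<zero>" if "i < l" for i using T_independent_basis[OF c(1)] that by blast
  then show ?thesis unfolding c(2) by (intro add.finprod_one_eqI) auto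
qed

lemma \<gamma>_T_E: "\<gamma> [^] i \<otimes> (T k \<beta> \<otimes> E) = T (i + k) \<beta> \<otimes> E"
  by (simp add: \<gamma>_mult_E T_T)

subsection \<open>Matrix units\<close>

definition normal_rhs :: "nat \<Rightarrow> 'a" where
  "normal_rhs k = (if k = 0 then tr \<beta> else \<beta> \<ominus> T k \<beta>)"

text \<open>The module \<open>AE\<close> is spanned by the elements \<open>T k \<beta> \<otimes> E\<close>, on which \<open>\<gamma>\<close> acts as a cyclic shift. By
  faithfulness each identity is checked on these elements, where the conjugate \<open>e\<close> of \<open>E\<close> acts as the
  projection onto the one with \<open>k = 0\<close>.\<close>

theorem matrix_units_exist:
  "\<exists>c\<in>{..<l} \<rightarrow> Rc. (\<forall>k<l. (\<Oplus>i\<in>{..<l}. c i \<otimes> T (i + k) \<beta>) = normal_rhs k) \<and>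
    (let \<alpha> = (\<Oplus>i\<in>{..<l}. c i \<otimes> \<gamma> [^] i); e = inv \<alpha> \<otimes> E \<otimes> \<alpha> in
      \<alpha> \<in> Units A \<and> e \<otimes> e = e \<and> (\<forall>n. 0 < n \<longrightarrow> n < l \<longrightarrow> e \<otimes> \<gamma> [^] n \<otimes> e = \<zero>) \<and>
      (\<Oplus>i\<in>{..<l}. \<gamma> [^] i \<otimes> e \<otimes> inv \<gamma> [^] i) = \<one> \<and>
      (\<forall>a\<in>carrier A. \<exists>s\<in>ring_center A. e \<otimes> a \<otimes> e = s \<otimes> e))"
proof -
  have "normal_rhs \<in> {..<l} \<rightarrow> Rc" by (auto simp: normal_rhs_def)
  then obtain c where c: "c \<in> {..<l} \<rightarrow> Rc"
    "\<And>k. k < l \<Longrightarrow> (\<Oplus>i\<in>{..<l}. c i \<otimes> T (i + k) \<beta>) = normal_rhs k"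
    using normal_system_solvable by blast
  have cl: "c i \<in> Rc" if "i < l" for i using c that by auto
  define \<alpha> where "\<alpha> = (\<Oplus>i\<in>{..<l}. c i \<otimes> \<gamma> [^] i)"
  have \<alpha>: "\<alpha> \<in> carrier A" unfolding \<alpha>_def by (intro finsum_closed Pi_I) (simp add: cl)
  have \<alpha>_act: "\<alpha> \<otimes> (T k \<beta> \<otimes> E) = normal_rhs k \<otimes> E" if "k < l" for k
    using sum_mult_E[OF c(1), of "T k \<beta>"] c(2)[OF that] by (simp add: \<alpha>_def T_T)
  \<comment> \<open>A left annihilator \<open>a\<close> of \<open>\<alpha>\<close> takes the same value on all \<open>T k \<beta> \<otimes> E\<close>, and the sum \<open>tr \<beta> \<otimes> E\<close> of these
    elements to zero. So \<open>l\<close> times the common value is zero, and \<open>l\<close> is a unit.\<close>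
  have "\<alpha> \<in> Units A"
  proof (rule finite_Units_if_right_regular[OF finite_carrier \<alpha>])
    fix a assume a: "a \<in> carrier A" "a \<otimes> \<alpha> = \<zero>"
    have rhs: "a \<otimes> (normal_rhs k \<otimes> E) = \<zero>" if "k < l" for k
    proof -
      have "a \<otimes> (normal_rhs k \<otimes> E) = (a \<otimes> \<alpha>) \<otimes> (T k \<beta> \<otimes> E)"
        using a(1) \<alpha> that by (simp only: m_assoc \<alpha>_act[OF that, symmetric] T_Rc Rc_carrier \<beta> E_closed m_closed)
      then show ?thesis using a by simp
    qed
    have eq: "a \<otimes> (T k \<beta> \<otimes> E) = a \<otimes> (\<beta> \<otimes> E)" if "k < l" for k
    proof (cases "k = 0")
      case False
      then have "a \<otimes> (\<beta> \<otimes> E) \<ominus> a \<otimes> (T k \<beta> \<otimes> E) = \<zero>"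
        using rhs[OF that] a by (simp add: normal_rhs_def a_minus_def l_distr r_distr l_minus r_minus)
      then show ?thesis using a by simp
    qed simp
    have "[l] \<cdot>\<^bsub>A\<^esub> (a \<otimes> (\<beta> \<otimes> E)) = (\<Oplus>k\<in>{..<l}. a \<otimes> (T k \<beta> \<otimes> E))"
      using a eq by (subst finsum_const_A[symmetric]) (auto intro!: finsum_cong')
    also have "\<dots> = a \<otimes> (tr \<beta> \<otimes> E)"
    proof -
      have "tr \<beta> \<otimes> E = (\<Oplus>k\<in>{..<l}. T k \<beta> \<otimes> E)"
        unfolding tr_def by (intro finsum_ldistr) auto
      then show ?thesis using a by (simp add: finsum_rdistr Pi_def)
    qed
    also have "\<dots> = \<zero>" using rhs[of 0] l_pos by (simp add: normal_rhs_def)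
    finally have 0: "a \<otimes> (\<beta> \<otimes> E) = \<zero>" using a(1) l_cancel[of "a \<otimes> (\<beta> \<otimes> E)"] by simp
    show "a = \<zero>" by (rule faithful[OF a(1)]) (simp add: eq 0)
  qed
  note \<alpha>_Unit = this and \<alpha>_inv = Units_inv_closed[OF this]
  define e where "e = inv \<alpha> \<otimes> E \<otimes> \<alpha>"
  have e: "e \<in> carrier A" using \<alpha> \<alpha>_inv by (simp add: e_def)
  have e_act: "e \<otimes> (T k \<beta> \<otimes> E) = (if k = 0 then \<beta> \<otimes> E else \<zero>)" if "k < l" for k
  proof -
    have 1: "e \<otimes> (T k \<beta> \<otimes> E) = inv \<alpha> \<otimes> (E \<otimes> normal_rhs k \<otimes> E)"
      using \<alpha> \<alpha>_inv \<alpha>_act[OF that] by (simp add: e_def m_assoc normal_rhs_def)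
    show ?thesis
    proof (cases "k = 0")
      case True
      have "E \<otimes> tr \<beta> \<otimes> E = tr \<beta> \<otimes> E"
        using ring_centerD[OF tr_center[OF \<beta>] E_closed, symmetric] by (simp add: m_assoc E_idem)
      also have "\<dots> = \<alpha> \<otimes> (\<beta> \<otimes> E)" using \<alpha>_act[of 0] l_pos by (simp add: normal_rhs_def)
      finally have "e \<otimes> (T k \<beta> \<otimes> E) = inv \<alpha> \<otimes> (\<alpha> \<otimes> (\<beta> \<otimes> E))"
        using 1 True by (simp add: normal_rhs_def)
      also have "\<dots> = (inv \<alpha> \<otimes> \<alpha>) \<otimes> (\<beta> \<otimes> E)" using \<alpha> \<alpha>_inv by (simp add: m_assoc)
      also have "\<dots> = \<beta> \<otimes> E" by (simp add: Units_l_inv[OF \<alpha>_Unit])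
      finally show ?thesis using True by simp
    next
      case False
      have "tr (\<beta> \<ominus> T k \<beta>) = \<zero>"
        using tr_minus[of \<beta> "T k \<beta>"] tr_T[of \<beta> k] by (simp add: r_neg a_minus_def[of A "tr \<beta>"])
      then have "E \<otimes> normal_rhs k \<otimes> E = \<zero>"
        using E_sandwich[of "\<beta> \<ominus> T k \<beta>"] False by (simp add: normal_rhs_def)
      then show ?thesis using 1 False \<alpha>_inv by simp
    qed
  qed
  have e_idem: "e \<otimes> e = e"
  proof -
    have "e \<otimes> e = inv \<alpha> \<otimes> E \<otimes> (\<alpha> \<otimes> inv \<alpha>) \<otimes> E \<otimes> \<alpha>"
      using \<alpha> \<alpha>_inv by (simp add: e_def m_assoc)
    also have "\<dots> = inv \<alpha> \<otimes> (E \<otimes> E) \<otimes> \<alpha>" using \<alpha> \<alpha>_inv \<alpha>_Unit by (simp add: m_assoc)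
    finally show ?thesis by (simp add: E_idem e_def)
  qed
  have e_orth: "e \<otimes> \<gamma> [^] n \<otimes> e = \<zero>" if n: "0 < n" "n < l" for n
  proof (rule faithful)
    fix k assume k: "k < l"
    have "e \<otimes> \<gamma> [^] n \<otimes> e \<otimes> (T k \<beta> \<otimes> E) = e \<otimes> (\<gamma> [^] n \<otimes> (if k = 0 then \<beta> \<otimes> E else \<zero>))"
      using e e_act[OF k] by (simp add: m_assoc)
    also have "\<dots> = \<zero>"
      using e \<gamma>_T_E[of n 0] e_act[OF n(2)] n by auto
    finally show "e \<otimes> \<gamma> [^] n \<otimes> e \<otimes> (T k \<beta> \<otimes> E) = \<zero>" .
  qed (use e in simp)
  have e_sum: "(\<Oplus>i\<in>{..<l}. \<gamma> [^] i \<otimes> e \<otimes> inv \<gamma> [^] i) = \<one>"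
  proof -
    let ?s = "\<Oplus>i\<in>{..<l}. \<gamma> [^] i \<otimes> e \<otimes> inv \<gamma> [^] i"
    have s: "?s \<in> carrier A" by (intro finsum_closed Pi_I) (simp add: e)
    have "?s \<ominus> \<one> = \<zero>"
    proof (rule faithful)
      fix k assume k: "k < l"
      have "?s \<otimes> (T k \<beta> \<otimes> E) = (\<Oplus>i\<in>{..<l}. \<gamma> [^] i \<otimes> e \<otimes> inv \<gamma> [^] i \<otimes> (T k \<beta> \<otimes> E))"
        using e by (intro finsum_ldistr) auto
      also have "\<dots> = T k \<beta> \<otimes> E"
      proof (rule finsum_delta[where i = k])
        fix i assume "i \<in> {..<l}"
        then have i: "i < l" by simp
        \<comment> \<open>\<open>\<gamma>\<^sup>-\<^sup>i\<close> shifts the index \<open>k\<close> to \<open>k - i\<close>, taken modulo \<open>l\<close>.\<close>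
        define q where "q = (l - i + k) mod l"
        have q: "q < l" "q = 0 \<longleftrightarrow> i = k"
          using l_pos mod_difference_eq_0[OF i k] by (simp_all add: q_def)
        have "inv \<gamma> [^] i \<otimes> (T k \<beta> \<otimes> E) = T q \<beta> \<otimes> E"
          using i \<gamma>_T_E[of "l - i" k] T_mod[of \<beta> "l - i + k"] by (simp add: inv_\<gamma>_pow q_def)
        then have "\<gamma> [^] i \<otimes> e \<otimes> inv \<gamma> [^] i \<otimes> (T k \<beta> \<otimes> E) = \<gamma> [^] i \<otimes> (e \<otimes> (T q \<beta> \<otimes> E))"
          using e by (simp add: m_assoc)
        also have "\<dots> = (if i = k then T k \<beta> \<otimes> E else \<zero>)"
          using e_act[OF q(1)] q(2) \<gamma>_T_E[of k 0] by auto
        finally show "\<gamma> [^] i \<otimes> e \<otimes> inv \<gamma> [^] i \<otimes> (T k \<beta> \<otimes> E) = (if i = k then T k \<beta> \<otimes> E else \<zero>)" .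
      qed (use k in auto)
      finally show "(?s \<ominus> \<one>) \<otimes> (T k \<beta> \<otimes> E) = \<zero>"
        using s by (simp add: a_minus_def l_distr l_minus r_neg)
    qed (use s in simp)
    then show ?thesis using s by simp
  qed
  have e_corner: "\<exists>s\<in>ring_center A. e \<otimes> a \<otimes> e = s \<otimes> e" if a: "a \<in> carrier A" for a
  proof -
    have "\<alpha> \<otimes> a \<otimes> inv \<alpha> \<in> carrier A" using a \<alpha> \<alpha>_inv by simp
    then obtain b where b: "b \<in> {..<l} \<rightarrow> Rc" "\<alpha> \<otimes> a \<otimes> inv \<alpha> = (\<Oplus>i\<in>{..<l}. b i \<otimes> \<gamma> [^] i)"
      by (rule basis_obtain)
    have bR: "(\<Oplus>i\<in>{..<l}. b i) \<in> Rc" using b(1) by (intro Rc_finsum) simp_all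
    have "(\<alpha> \<otimes> a \<otimes> inv \<alpha>) \<otimes> E = (\<Oplus>i\<in>{..<l}. b i) \<otimes> E"
    proof -
      have "b i \<in> Rc" if "i < l" for i using b(1) that by auto
      then have "(\<Oplus>i\<in>{..<l}. b i \<otimes> T i \<one>) = (\<Oplus>i\<in>{..<l}. b i)"
        by (intro finsum_cong') simp_all
      then show ?thesis using sum_mult_E[OF b(1), of \<one>] b(2) by simp
    qed
    moreover have "e \<otimes> a \<otimes> e = inv \<alpha> \<otimes> (E \<otimes> ((\<alpha> \<otimes> a \<otimes> inv \<alpha>) \<otimes> E)) \<otimes> \<alpha>"
      using \<alpha> \<alpha>_inv a by (simp add: e_def m_assoc)
    ultimately have "e \<otimes> a \<otimes> e = inv \<alpha> \<otimes> (E \<otimes> (\<Oplus>i\<in>{..<l}. b i) \<otimes> E) \<otimes> \<alpha>"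
      using bR by (simp add: m_assoc)
    also have "\<dots> = inv \<alpha> \<otimes> ((linv \<otimes> tr (\<Oplus>i\<in>{..<l}. b i)) \<otimes> E) \<otimes> \<alpha>"
      using E_sandwich[OF bR] by simp
    also have "\<dots> = (linv \<otimes> tr (\<Oplus>i\<in>{..<l}. b i)) \<otimes> e"
    proof -
      let ?z = "linv \<otimes> tr (\<Oplus>i\<in>{..<l}. b i)"
      have z: "?z \<in> ring_center A" by (intro ring_center_mult linv_center tr_center bR)
      have "inv \<alpha> \<otimes> (?z \<otimes> E) \<otimes> \<alpha> = (inv \<alpha> \<otimes> ?z) \<otimes> (E \<otimes> \<alpha>)"
        using \<alpha> \<alpha>_inv z by (simp only: m_assoc m_closed E_closed ring_center_carrier)
      also have "inv \<alpha> \<otimes> ?z = ?z \<otimes> inv \<alpha>" using ring_centerD[OF z \<alpha>_inv] by simp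
      finally show ?thesis
        using \<alpha> \<alpha>_inv z by (simp only: e_def m_assoc m_closed E_closed ring_center_carrier)
    qed
    finally show ?thesis
      by (intro bexI[of _ "linv \<otimes> tr (\<Oplus>i\<in>{..<l}. b i)"] ring_center_mult linv_center tr_center bR)
  qed
  show ?thesis
    using c \<alpha>_Unit e_idem e_orth e_sum e_corner
    by (intro bexI[of _ c]) (auto simp: Let_def \<alpha>_def[symmetric] e_def[symmetric])
qed

end

section \<open>Recognising matrix rings\<close>

lemma matrix_ring_carrier_iff:
  "N \<in> carrier (matrix_ring S n) \<longleftrightarrow> N \<in> carrier_mat n n \<and> (\<forall>i<n. \<forall>j<n. N $$ (i, j) \<in> carrier S)"
  by (fastforce simp: matrix_ring_def elements_mat_def)

text \<open>A system of matrix units \<open>f i j 1\<close> of \<open>B\<close> together with its multiples by scalars from \<open>S\<close>. The scalars are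
  recorded in \<open>f\<close>, so that \<open>S\<close> need not lie in \<open>B\<close>. By \<open>f_surj\<close> each corner is a copy of \<open>S\<close>.\<close>

locale matrix_system =
  B: ring B + S: ring S for B :: "'b ring" and S :: "'a ring" +
  fixes n :: nat and f :: "nat \<Rightarrow> nat \<Rightarrow> 'a \<Rightarrow> 'b"
  assumes f_closed [simp]: "\<lbrakk>i < n; j < n; s \<in> carrier S\<rbrakk> \<Longrightarrow> f i j s \<in> carrier B"
    and f_add: "\<lbrakk>i < n; j < n; s \<in> carrier S; s' \<in> carrier S\<rbrakk> \<Longrightarrow> f i j (s \<oplus>\<^bsub>S\<^esub> s') = f i j s \<oplus>\<^bsub>B\<^esub> f i j s'"
    and f_mult: "\<lbrakk>i < n; j < n; k < n; h < n; s \<in> carrier S; s' \<in> carrier S\<rbrakk> \<Longrightarrow>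
      f i j s \<otimes>\<^bsub>B\<^esub> f k h s' = (if j = k then f i h (s \<otimes>\<^bsub>S\<^esub> s') else \<zero>\<^bsub>B\<^esub>)"
    and f_one: "(\<Oplus>\<^bsub>B\<^esub>i\<in>{..<n}. f i i \<one>\<^bsub>S\<^esub>) = \<one>\<^bsub>B\<^esub>"
    and f_inj: "\<lbrakk>i < n; j < n; s \<in> carrier S; f i j s = \<zero>\<^bsub>B\<^esub>\<rbrakk> \<Longrightarrow> s = \<zero>\<^bsub>S\<^esub>"
    and f_surj: "\<lbrakk>i < n; j < n; y \<in> carrier B\<rbrakk> \<Longrightarrow>
      \<exists>s\<in>carrier S. f i i \<one>\<^bsub>S\<^esub> \<otimes>\<^bsub>B\<^esub> y \<otimes>\<^bsub>B\<^esub> f j j \<one>\<^bsub>S\<^esub> = f i j s"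
begin

lemma f_zero: "i < n \<Longrightarrow> j < n \<Longrightarrow> f i j \<zero>\<^bsub>S\<^esub> = \<zero>\<^bsub>B\<^esub>"
proof -
  assume ij: "i < n" "j < n"
  then have "f i j \<zero>\<^bsub>S\<^esub> \<oplus>\<^bsub>B\<^esub> f i j \<zero>\<^bsub>S\<^esub> = f i j \<zero>\<^bsub>S\<^esub>" using f_add[OF ij, of "\<zero>\<^bsub>S\<^esub>" "\<zero>\<^bsub>S\<^esub>"] by simp
  then show ?thesis using ij B.add.r_cancel_one f_closed[OF ij S.zero_closed] by blast
qed

lemma f_eqD:
  assumes ij: "i < n" "j < n" and s: "s \<in> carrier S" "s' \<in> carrier S" and eq: "f i j s = f i j s'"
  shows "s = s'"
proof -
  have "f i j (s \<ominus>\<^bsub>S\<^esub> s') \<oplus>\<^bsub>B\<^esub> f i j s' = f i j s"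
    using s f_add[OF ij, of "s \<ominus>\<^bsub>S\<^esub> s'" s'] by (simp add: a_minus_def S.a_assoc S.l_neg)
  then have "f i j (s \<ominus>\<^bsub>S\<^esub> s') \<oplus>\<^bsub>B\<^esub> f i j s' = f i j s'" using eq by simp
  then have "f i j (s \<ominus>\<^bsub>S\<^esub> s') = \<zero>\<^bsub>B\<^esub>" using ij s B.add.l_cancel_one f_closed by auto
  then have "s \<ominus>\<^bsub>S\<^esub> s' = \<zero>\<^bsub>S\<^esub>" using ij s by (intro f_inj[of i j]) auto
  then show ?thesis using s by simp
qed

lemma f_finsum:
  assumes "finite I" "g \<in> I \<rightarrow> carrier S" and ij: "i < n" "j < n"
  shows "f i j (\<Oplus>\<^bsub>S\<^esub>k\<in>I. g k) = (\<Oplus>\<^bsub>B\<^esub>k\<in>I. f i j (g k))"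
  using assms(1,2)
proof (induction I rule: finite_induct)
  case (insert k I)
  then have g: "g k \<in> carrier S" "g \<in> I \<rightarrow> carrier S" by auto
  have "f i j (\<Oplus>\<^bsub>S\<^esub>k\<in>insert k I. g k) = f i j (g k) \<oplus>\<^bsub>B\<^esub> f i j (\<Oplus>\<^bsub>S\<^esub>k\<in>I. g k)"
    using insert g ij by (simp add: S.finsum_insert f_add S.finsum_closed)
  also have "\<dots> = (\<Oplus>\<^bsub>B\<^esub>k\<in>insert k I. f i j (g k))"
    using insert g ij by (subst B.finsum_insert) (auto simp: Pi_def)
  finally show ?case .
qed (simp add: f_zero ij)

text \<open>The matrix of \<open>y\<close>.\<close>

definition coord :: "'b \<Rightarrow> nat \<Rightarrow> nat \<Rightarrow> 'a" where
  "coord y i j = (SOME s. s \<in> carrier S \<and> f i i \<one>\<^bsub>S\<^esub> \<otimes>\<^bsub>B\<^esub> y \<otimes>\<^bsub>B\<^esub> f j j \<one>\<^bsub>S\<^esub> = f i j s)"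

lemma coord:
  assumes "i < n" "j < n" "y \<in> carrier B"
  shows "coord y i j \<in> carrier S" "f i i \<one>\<^bsub>S\<^esub> \<otimes>\<^bsub>B\<^esub> y \<otimes>\<^bsub>B\<^esub> f j j \<one>\<^bsub>S\<^esub> = f i j (coord y i j)"
  using someI_ex[of "\<lambda>s. s \<in> carrier S \<and> f i i \<one>\<^bsub>S\<^esub> \<otimes>\<^bsub>B\<^esub> y \<otimes>\<^bsub>B\<^esub> f j j \<one>\<^bsub>S\<^esub> = f i j s"] f_surj[OF assms]
  unfolding coord_def by blast+

lemma coord_eqI:
  assumes "i < n" "j < n" "y \<in> carrier B" "s \<in> carrier S"
    and "f i i \<one>\<^bsub>S\<^esub> \<otimes>\<^bsub>B\<^esub> y \<otimes>\<^bsub>B\<^esub> f j j \<one>\<^bsub>S\<^esub> = f i j s"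
  shows "coord y i j = s"
  using f_eqD[OF assms(1,2) coord(1)[OF assms(1-3)] assms(4)] coord(2)[OF assms(1-3)] assms(5) by simp

lemma coord_add:
  assumes "i < n" "j < n" "y \<in> carrier B" "z \<in> carrier B"
  shows "coord (y \<oplus>\<^bsub>B\<^esub> z) i j = coord y i j \<oplus>\<^bsub>S\<^esub> coord z i j"
  using assms coord[of i j y] coord[of i j z]
  by (intro coord_eqI) (simp_all add: B.l_distr B.r_distr f_add)

lemma coord_f:
  assumes "i < n" "j < n" "k < n" "h < n" "s \<in> carrier S"
  shows "coord (f k h s) i j = (if i = k \<and> j = h then s else \<zero>\<^bsub>S\<^esub>)"
  using assms by (intro coord_eqI) (auto simp: f_mult f_zero)

lemma coord_mult:
  assumes ij: "i < n" "j < n" and y: "y \<in> carrier B" "z \<in> carrier B"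
  shows "coord (y \<otimes>\<^bsub>B\<^esub> z) i j = (\<Oplus>\<^bsub>S\<^esub>k\<in>{..<n}. coord y i k \<otimes>\<^bsub>S\<^esub> coord z k j)"
proof (rule coord_eqI[OF ij])
  have e: "f k k \<one>\<^bsub>S\<^esub> \<in> carrier B" if "k < n" for k using that by simp
  have c: "coord y i k \<in> carrier S" "coord z k j \<in> carrier S" if "k < n" for k
    using coord(1) ij y that by auto
  let ?l = "f i i \<one>\<^bsub>S\<^esub>" and ?r = "f j j \<one>\<^bsub>S\<^esub>"
  have lr: "?l \<in> carrier B" "?r \<in> carrier B" using ij by simp_all
  have "(\<Oplus>\<^bsub>B\<^esub>k\<in>{..<n}. y \<otimes>\<^bsub>B\<^esub> f k k \<one>\<^bsub>S\<^esub>) = y"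
    using y e by (subst B.finsum_rdistr[symmetric]) (auto simp: f_one)
  moreover have "(\<Oplus>\<^bsub>B\<^esub>k\<in>{..<n}. y \<otimes>\<^bsub>B\<^esub> f k k \<one>\<^bsub>S\<^esub>) \<otimes>\<^bsub>B\<^esub> z = (\<Oplus>\<^bsub>B\<^esub>k\<in>{..<n}. y \<otimes>\<^bsub>B\<^esub> f k k \<one>\<^bsub>S\<^esub> \<otimes>\<^bsub>B\<^esub> z)"
    using y e by (intro B.finsum_ldistr) auto
  ultimately have "y \<otimes>\<^bsub>B\<^esub> z = (\<Oplus>\<^bsub>B\<^esub>k\<in>{..<n}. y \<otimes>\<^bsub>B\<^esub> f k k \<one>\<^bsub>S\<^esub> \<otimes>\<^bsub>B\<^esub> z)" by (simp only:)
  then have "?l \<otimes>\<^bsub>B\<^esub> (y \<otimes>\<^bsub>B\<^esub> z) \<otimes>\<^bsub>B\<^esub> ?r = ?l \<otimes>\<^bsub>B\<^esub> (\<Oplus>\<^bsub>B\<^esub>k\<in>{..<n}. y \<otimes>\<^bsub>B\<^esub> f k k \<one>\<^bsub>S\<^esub> \<otimes>\<^bsub>B\<^esub> z) \<otimes>\<^bsub>B\<^esub> ?r" by simp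
  also have "\<dots> = (\<Oplus>\<^bsub>B\<^esub>k\<in>{..<n}. ?l \<otimes>\<^bsub>B\<^esub> (y \<otimes>\<^bsub>B\<^esub> f k k \<one>\<^bsub>S\<^esub> \<otimes>\<^bsub>B\<^esub> z)) \<otimes>\<^bsub>B\<^esub> ?r"
    using y e lr by (subst B.finsum_rdistr) auto
  also have "\<dots> = (\<Oplus>\<^bsub>B\<^esub>k\<in>{..<n}. ?l \<otimes>\<^bsub>B\<^esub> (y \<otimes>\<^bsub>B\<^esub> f k k \<one>\<^bsub>S\<^esub> \<otimes>\<^bsub>B\<^esub> z) \<otimes>\<^bsub>B\<^esub> ?r)"
    using y e lr by (intro B.finsum_ldistr) auto
  also have "\<dots> = (\<Oplus>\<^bsub>B\<^esub>k\<in>{..<n}. f i j (coord y i k \<otimes>\<^bsub>S\<^esub> coord z k j))"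
  proof (intro B.finsum_cong' refl)
    fix k assume "k \<in> {..<n}"
    then have k: "k < n" by simp
    have "f k k \<one>\<^bsub>S\<^esub> = f k k \<one>\<^bsub>S\<^esub> \<otimes>\<^bsub>B\<^esub> f k k \<one>\<^bsub>S\<^esub>" using k by (simp add: f_mult)
    then have "?l \<otimes>\<^bsub>B\<^esub> (y \<otimes>\<^bsub>B\<^esub> f k k \<one>\<^bsub>S\<^esub> \<otimes>\<^bsub>B\<^esub> z) \<otimes>\<^bsub>B\<^esub> ?r
      = ?l \<otimes>\<^bsub>B\<^esub> (y \<otimes>\<^bsub>B\<^esub> (f k k \<one>\<^bsub>S\<^esub> \<otimes>\<^bsub>B\<^esub> f k k \<one>\<^bsub>S\<^esub>) \<otimes>\<^bsub>B\<^esub> z) \<otimes>\<^bsub>B\<^esub> ?r" by simp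
    also have "\<dots> = (?l \<otimes>\<^bsub>B\<^esub> y \<otimes>\<^bsub>B\<^esub> f k k \<one>\<^bsub>S\<^esub>) \<otimes>\<^bsub>B\<^esub> (f k k \<one>\<^bsub>S\<^esub> \<otimes>\<^bsub>B\<^esub> z \<otimes>\<^bsub>B\<^esub> ?r)"
      using y e[OF k] lr by (simp only: B.m_assoc B.m_closed)
    also have "\<dots> = f i k (coord y i k) \<otimes>\<^bsub>B\<^esub> f k j (coord z k j)"
      unfolding coord(2)[OF ij(1) k y(1)] coord(2)[OF k ij(2) y(2)] ..
    also have "\<dots> = f i j (coord y i k \<otimes>\<^bsub>S\<^esub> coord z k j)" using c[OF k] ij k by (simp add: f_mult)
    finally show "?l \<otimes>\<^bsub>B\<^esub> (y \<otimes>\<^bsub>B\<^esub> f k k \<one>\<^bsub>S\<^esub> \<otimes>\<^bsub>B\<^esub> z) \<otimes>\<^bsub>B\<^esub> ?r = f i j (coord y i k \<otimes>\<^bsub>S\<^esub> coord z k j)" .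
  qed (use c ij in auto)
  also have "\<dots> = f i j (\<Oplus>\<^bsub>S\<^esub>k\<in>{..<n}. coord y i k \<otimes>\<^bsub>S\<^esub> coord z k j)"
    using c ij by (intro f_finsum[symmetric]) auto
  finally show "?l \<otimes>\<^bsub>B\<^esub> (y \<otimes>\<^bsub>B\<^esub> z) \<otimes>\<^bsub>B\<^esub> ?r = f i j (\<Oplus>\<^bsub>S\<^esub>k\<in>{..<n}. coord y i k \<otimes>\<^bsub>S\<^esub> coord z k j)" .
  show "(\<Oplus>\<^bsub>S\<^esub>k\<in>{..<n}. coord y i k \<otimes>\<^bsub>S\<^esub> coord z k j) \<in> carrier S"
    using c by (auto intro!: S.finsum_closed)
qed (use y in simp)

lemma coord_one: "i < n \<Longrightarrow> j < n \<Longrightarrow> coord \<one>\<^bsub>B\<^esub> i j = (if i = j then \<one>\<^bsub>S\<^esub> else \<zero>\<^bsub>S\<^esub>)"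
  by (intro coord_eqI) (auto simp: f_mult f_zero)

definition assemble :: "'a mat \<Rightarrow> 'b" where
  "assemble N = (\<Oplus>\<^bsub>B\<^esub>i\<in>{..<n}. \<Oplus>\<^bsub>B\<^esub>j\<in>{..<n}. f i j (N $$ (i, j)))"

lemma assemble_closed: "N \<in> carrier (matrix_ring S n) \<Longrightarrow> assemble N \<in> carrier B"
  unfolding assemble_def matrix_ring_carrier_iff by (intro B.finsum_closed Pi_I) simp

lemma coord_finsum:
  assumes "finite I" "g \<in> I \<rightarrow> carrier B" and ij: "i < n" "j < n"
  shows "coord (\<Oplus>\<^bsub>B\<^esub>k\<in>I. g k) i j = (\<Oplus>\<^bsub>S\<^esub>k\<in>I. coord (g k) i j)"
  using assms(1,2)
proof (induction I rule: finite_induct)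
  case empty
  then show ?case using ij by (simp, intro coord_eqI) (simp_all add: f_zero)
next
  case (insert k I)
  then have g: "g k \<in> carrier B" "g \<in> I \<rightarrow> carrier B" by auto
  have "coord (\<Oplus>\<^bsub>B\<^esub>k\<in>insert k I. g k) i j = coord (g k) i j \<oplus>\<^bsub>S\<^esub> coord (\<Oplus>\<^bsub>B\<^esub>k\<in>I. g k) i j"
    using insert g ij by (simp add: B.finsum_insert coord_add B.finsum_closed)
  also have "\<dots> = (\<Oplus>\<^bsub>S\<^esub>k\<in>insert k I. coord (g k) i j)"
    using insert g ij coord(1)[OF ij] by (subst S.finsum_insert) (auto simp: Pi_def)
  finally show ?case .
qed

lemma coord_assemble:
  assumes N: "N \<in> carrier (matrix_ring S n)" and ij: "i < n" "j < n"
  shows "coord (assemble N) i j = N $$ (i, j)"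
proof -
  have entry: "N $$ (k, h) \<in> carrier S" if "k < n" "h < n" for k h
    using N that by (simp add: matrix_ring_carrier_iff)
  have "coord (assemble N) i j = (\<Oplus>\<^bsub>S\<^esub>k\<in>{..<n}. coord (\<Oplus>\<^bsub>B\<^esub>h\<in>{..<n}. f k h (N $$ (k, h))) i j)"
    unfolding assemble_def using ij entry by (intro coord_finsum) (auto intro!: B.finsum_closed)
  also have "\<dots> = N $$ (i, j)"
  proof (rule S.finsum_delta[where i = i])
    fix k assume "k \<in> {..<n}"
    then have k: "k < n" by simp
    have "coord (\<Oplus>\<^bsub>B\<^esub>h\<in>{..<n}. f k h (N $$ (k, h))) i j
      = (\<Oplus>\<^bsub>S\<^esub>h\<in>{..<n}. coord (f k h (N $$ (k, h))) i j)"
      using ij k entry by (intro coord_finsum) auto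
    also have "\<dots> = (if k = i then N $$ (i, j) else \<zero>\<^bsub>S\<^esub>)"
      using ij k entry by (intro S.finsum_delta[where i = j]) (auto simp: coord_f)
    finally show "coord (\<Oplus>\<^bsub>B\<^esub>h\<in>{..<n}. f k h (N $$ (k, h))) i j = (if k = i then N $$ (i, j) else \<zero>\<^bsub>S\<^esub>)" .
  qed (use ij entry in auto)
  finally show ?thesis .
qed

lemma coord_inj:
  assumes y: "y \<in> carrier B" "z \<in> carrier B" and eq: "\<And>i j. i < n \<Longrightarrow> j < n \<Longrightarrow> coord y i j = coord z i j"
  shows "y = z"
proof -
  have expand: "u = (\<Oplus>\<^bsub>B\<^esub>i\<in>{..<n}. \<Oplus>\<^bsub>B\<^esub>j\<in>{..<n}. f i j (coord u i j))" if u: "u \<in> carrier B" for u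
  proof -
    have "u = (\<Oplus>\<^bsub>B\<^esub>i\<in>{..<n}. f i i \<one>\<^bsub>S\<^esub>) \<otimes>\<^bsub>B\<^esub> u" using u by (simp add: f_one)
    also have "\<dots> = (\<Oplus>\<^bsub>B\<^esub>i\<in>{..<n}. f i i \<one>\<^bsub>S\<^esub> \<otimes>\<^bsub>B\<^esub> u)" using u by (intro B.finsum_ldistr) auto
    also have "\<dots> = (\<Oplus>\<^bsub>B\<^esub>i\<in>{..<n}. \<Oplus>\<^bsub>B\<^esub>j\<in>{..<n}. f i j (coord u i j))"
    proof (intro B.finsum_cong' refl)
      fix i assume "i \<in> {..<n}"
      then have i: "i < n" by simp
      have "f i i \<one>\<^bsub>S\<^esub> \<otimes>\<^bsub>B\<^esub> u = f i i \<one>\<^bsub>S\<^esub> \<otimes>\<^bsub>B\<^esub> u \<otimes>\<^bsub>B\<^esub> (\<Oplus>\<^bsub>B\<^esub>j\<in>{..<n}. f j j \<one>\<^bsub>S\<^esub>)" using u i by (simp add: f_one)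
      also have "\<dots> = (\<Oplus>\<^bsub>B\<^esub>j\<in>{..<n}. f i i \<one>\<^bsub>S\<^esub> \<otimes>\<^bsub>B\<^esub> u \<otimes>\<^bsub>B\<^esub> f j j \<one>\<^bsub>S\<^esub>)"
        using u i by (intro B.finsum_rdistr) auto
      also have "\<dots> = (\<Oplus>\<^bsub>B\<^esub>j\<in>{..<n}. f i j (coord u i j))"
        using u i coord by (intro B.finsum_cong' refl) auto
      finally show "f i i \<one>\<^bsub>S\<^esub> \<otimes>\<^bsub>B\<^esub> u = (\<Oplus>\<^bsub>B\<^esub>j\<in>{..<n}. f i j (coord u i j))" .
    qed (use u coord(1) in \<open>auto intro!: B.finsum_closed\<close>)
    finally show ?thesis .
  qed
  have "(\<Oplus>\<^bsub>B\<^esub>i\<in>{..<n}. \<Oplus>\<^bsub>B\<^esub>j\<in>{..<n}. f i j (coord y i j)) = (\<Oplus>\<^bsub>B\<^esub>i\<in>{..<n}. \<Oplus>\<^bsub>B\<^esub>j\<in>{..<n}. f i j (coord z i j))"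
    using y coord(1) eq by (intro B.finsum_cong' refl) (auto intro!: B.finsum_closed)
  then show ?thesis using expand[OF y(1)] expand[OF y(2)] by simp
qed

theorem complete_elementary_set_units:
  "complete_elementary_set B S n {\<one>\<^bsub>B\<^esub> \<oplus>\<^bsub>B\<^esub> f i j s | i j s. i < n \<and> j < n \<and> s \<in> carrier S}"
proof -
  define \<psi> where "\<psi> y = mat n n (\<lambda>(i, j). coord y i j)" for y
  have \<psi>_closed: "\<psi> y \<in> carrier (matrix_ring S n)" if "y \<in> carrier B" for y
    using coord(1) that by (auto simp: \<psi>_def matrix_ring_carrier_iff)
  have "\<psi> \<in> ring_iso B (matrix_ring S n)"
    unfolding ring_iso_def
  proof (intro CollectI conjI ring_hom_memI)
    fix y z assume yz: "y \<in> carrier B" "z \<in> carrier B"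
    show "\<psi> (y \<otimes>\<^bsub>B\<^esub> z) = \<psi> y \<otimes>\<^bsub>matrix_ring S n\<^esub> \<psi> z"
      by (rule eq_matI) (use yz coord(1) in
        \<open>auto simp: \<psi>_def matrix_ring_def coord_mult intro!: S.finsum_cong'\<close>)
    show "\<psi> (y \<oplus>\<^bsub>B\<^esub> z) = \<psi> y \<oplus>\<^bsub>matrix_ring S n\<^esub> \<psi> z"
      by (rule eq_matI) (use yz in \<open>auto simp: \<psi>_def matrix_ring_def coord_add\<close>)
  next
    show "\<psi> \<one>\<^bsub>B\<^esub> = \<one>\<^bsub>matrix_ring S n\<^esub>"
      by (rule eq_matI) (auto simp: \<psi>_def matrix_ring_def coord_one)
    show "bij_betw \<psi> (carrier B) (carrier (matrix_ring S n))"
      unfolding bij_betw_def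
    proof
      show "inj_on \<psi> (carrier B)"
      proof (rule inj_onI)
        fix y z assume yz: "y \<in> carrier B" "z \<in> carrier B" "\<psi> y = \<psi> z"
        have "coord y i j = coord z i j" if "i < n" "j < n" for i j
          using arg_cong[OF yz(3), of "\<lambda>N. N $$ (i, j)"] that by (simp add: \<psi>_def)
        then show "y = z" using yz by (intro coord_inj) auto
      qed
      show "\<psi> ` carrier B = carrier (matrix_ring S n)"
      proof (intro equalityI subsetI)
        fix N assume N: "N \<in> carrier (matrix_ring S n)"
        have "N = \<psi> (assemble N)"
          by (rule eq_matI) (use N in \<open>auto simp: \<psi>_def coord_assemble matrix_ring_carrier_iff\<close>)
        then show "N \<in> \<psi> ` carrier B" using assemble_closed[OF N] by blast
      qed (use \<psi>_closed in auto)
    qed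
  qed (rule \<psi>_closed)
  moreover have elem: "\<psi> (\<one>\<^bsub>B\<^esub> \<oplus>\<^bsub>B\<^esub> f i j s) = elementary_matrix S n s i j" if "i < n" "j < n" "s \<in> carrier S" for i j s
    by (rule eq_matI) (use that in \<open>auto simp: \<psi>_def elementary_matrix_def matrix_ring_def coord_add coord_one coord_f\<close>)
  have "\<psi> ` {\<one>\<^bsub>B\<^esub> \<oplus>\<^bsub>B\<^esub> f i j s | i j s. i < n \<and> j < n \<and> s \<in> carrier S}
    = {elementary_matrix S n s i j | s i j. s \<in> carrier S \<and> i < n \<and> j < n}"
  proof (intro equalityI subsetI)
    fix N assume "N \<in> \<psi> ` {\<one>\<^bsub>B\<^esub> \<oplus>\<^bsub>B\<^esub> f i j s | i j s. i < n \<and> j < n \<and> s \<in> carrier S}"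
    then show "N \<in> {elementary_matrix S n s i j | s i j. s \<in> carrier S \<and> i < n \<and> j < n}" using elem by blast
  next
    fix N assume "N \<in> {elementary_matrix S n s i j | s i j. s \<in> carrier S \<and> i < n \<and> j < n}"
    then obtain s i j where *: "N = elementary_matrix S n s i j" "s \<in> carrier S" "i < n" "j < n" by blast
    have "N = \<psi> (\<one>\<^bsub>B\<^esub> \<oplus>\<^bsub>B\<^esub> f i j s)" using elem * by simp
    then show "N \<in> \<psi> ` {\<one>\<^bsub>B\<^esub> \<oplus>\<^bsub>B\<^esub> f i j s | i j s. i < n \<and> j < n \<and> s \<in> carrier S}" using * by blast
  qed
  moreover have "{\<one>\<^bsub>B\<^esub> \<oplus>\<^bsub>B\<^esub> f i j s | i j s. i < n \<and> j < n \<and> s \<in> carrier S} \<subseteq> carrier B" by auto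
  ultimately show ?thesis unfolding complete_elementary_set_def by blast
qed

end

lemma (in abelian_monoid) finsum_div_mod:
  fixes m l :: nat
  assumes "\<And>u i. u < m \<Longrightarrow> i < l \<Longrightarrow> g u i \<in> carrier G" "l > 0"
  shows "(\<Oplus>a\<in>{..<m * l}. g (a div l) (a mod l)) = (\<Oplus>u\<in>{..<m}. \<Oplus>i\<in>{..<l}. g u i)"
  using assms(1)
proof (induction m)
  case (Suc m)
  have cl: "g (a div l) (a mod l) \<in> carrier G" if "a < Suc m * l" for a
    using Suc.prems[of "a div l" "a mod l"] that assms(2) by (simp add: less_mult_imp_div_less)
  have split: "{..<Suc m * l} = {..<m * l} \<union> (\<lambda>i. m * l + i) ` {..<l}"
  proof (intro equalityI subsetI)
    fix a assume a: "a \<in> {..<Suc m * l}"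
    show "a \<in> {..<m * l} \<union> (\<lambda>i. m * l + i) ` {..<l}"
    proof (cases "a < m * l")
      case False
      then have "a = m * l + (a - m * l)" "a - m * l < l" using a by auto
      then show ?thesis by blast
    qed simp
  qed auto
  have "(\<Oplus>a\<in>{..<Suc m * l}. g (a div l) (a mod l))
    = (\<Oplus>a\<in>{..<m * l}. g (a div l) (a mod l)) \<oplus> (\<Oplus>a\<in>(\<lambda>i. m * l + i) ` {..<l}. g (a div l) (a mod l))"
    unfolding split
  proof (rule finsum_Un_disjoint)
    show "(\<lambda>a. g (a div l) (a mod l)) \<in> {..<m * l} \<rightarrow> carrier G"
      by (intro Pi_I cl) auto
    show "(\<lambda>a. g (a div l) (a mod l)) \<in> (\<lambda>i. m * l + i) ` {..<l} \<rightarrow> carrier G"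
      by (intro Pi_I cl) auto
  qed auto
  also have "(\<Oplus>a\<in>(\<lambda>i. m * l + i) ` {..<l}. g (a div l) (a mod l))
    = (\<Oplus>i\<in>{..<l}. g ((m * l + i) div l) ((m * l + i) mod l))"
  proof (rule finsum_reindex)
    show "(\<lambda>a. g (a div l) (a mod l)) \<in> (\<lambda>i. m * l + i) ` {..<l} \<rightarrow> carrier G"
      by (intro Pi_I cl) auto
  qed (simp add: inj_on_def)
  also have "\<dots> = (\<Oplus>i\<in>{..<l}. g m i)"
    using Suc.prems assms(2) by (intro finsum_cong' refl) auto
  also have "(\<Oplus>a\<in>{..<m * l}. g (a div l) (a mod l)) = (\<Oplus>u\<in>{..<m}. \<Oplus>i\<in>{..<l}. g u i)"
    using Suc by simp
  also have "(\<Oplus>u\<in>{..<m}. \<Oplus>i\<in>{..<l}. g u i) \<oplus> (\<Oplus>i\<in>{..<l}. g m i) = (\<Oplus>u\<in>{..<Suc m}. \<Oplus>i\<in>{..<l}. g u i)"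
    using Suc.prems by (simp add: lessThan_Suc finsum_insert Pi_def finsum_closed a_comm)
  finally show ?case .
qed (simp add: finsum_empty)

section \<open>The corner of the centralizer\<close>

lemma center_ring_eq: "center_ring A = A\<lparr>carrier := ring_center A\<rparr>"
  by (simp add: center_ring_def ring_center_def)

lemma ring_center_ring:
  fixes A (structure)
  assumes "ring A"
  shows "ring (center_ring A)"
proof -
  interpret ring A by fact
  have D: "s \<in> carrier A" "\<And>y. y \<in> carrier A \<Longrightarrow> s \<otimes> y = y \<otimes> s" if "s \<in> ring_center A" for s
    using that unfolding ring_center_def by blast+
  have I: "s \<in> ring_center A" if "s \<in> carrier A" "\<And>y. y \<in> carrier A \<Longrightarrow> s \<otimes> y = y \<otimes> s" for s
    using that unfolding ring_center_def by blast
  have "subring (ring_center A) A"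
  proof (rule subringI)
    show "ring_center A \<subseteq> carrier A" using D(1) by blast
    show "\<one> \<in> ring_center A" by (rule I) simp_all
  next
    fix s assume s: "s \<in> ring_center A"
    show "\<ominus> s \<in> ring_center A"
    proof (rule I)
      fix y assume y: "y \<in> carrier A"
      show "\<ominus> s \<otimes> y = y \<otimes> \<ominus> s" using D(1)[OF s] D(2)[OF s y] y by (simp add: l_minus r_minus)
    qed (use D(1)[OF s] in simp)
  next
    fix s s' assume s: "s \<in> ring_center A" and s': "s' \<in> ring_center A"
    show "s \<oplus> s' \<in> ring_center A"
    proof (rule I)
      fix y assume y: "y \<in> carrier A"
      show "(s \<oplus> s') \<otimes> y = y \<otimes> (s \<oplus> s')"
        using D(1)[OF s] D(1)[OF s'] D(2)[OF s y] D(2)[OF s' y] y by (simp add: l_distr r_distr)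
    qed (use D(1)[OF s] D(1)[OF s'] in simp)
    show "s \<otimes> s' \<in> ring_center A"
    proof (rule I)
      fix y assume y: "y \<in> carrier A"
      have "s \<otimes> s' \<otimes> y = s \<otimes> (y \<otimes> s')" using D(1)[OF s] D(1)[OF s'] D(2)[OF s' y] y by (simp add: m_assoc)
      also have "\<dots> = (s \<otimes> y) \<otimes> s'" using D(1)[OF s] D(1)[OF s'] y by (simp add: m_assoc)
      also have "\<dots> = y \<otimes> (s \<otimes> s')" unfolding D(2)[OF s y] using D(1)[OF s] D(1)[OF s'] y by (simp add: m_assoc)
      finally show "s \<otimes> s' \<otimes> y = y \<otimes> (s \<otimes> s')" .
    qed (use D(1)[OF s] D(1)[OF s'] in simp)
  qed
  then show ?thesis unfolding center_ring_eq by (rule subring_is_ring)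
qed

context strong_shoda_class
begin

abbreviation "SC \<equiv> sub_group_ring (residue_ring M) G Cen"
abbreviation "AA \<equiv> corner_ring SC \<omega>"

lemma Cen_G: "Cen \<subseteq> carrier G"
  by (rule subgroup.subset[OF subgroup_Cen])

lemma Cen_closed:
  "f \<in> supported Cen \<Longrightarrow> g \<in> supported Cen \<Longrightarrow> f \<otimes>\<^bsub>ZG\<^esub> g \<in> supported Cen"
  "f \<in> supported Cen \<Longrightarrow> g \<in> supported Cen \<Longrightarrow> f \<oplus>\<^bsub>ZG\<^esub> g \<in> supported Cen"
  using subringE(6,7)[OF subring_supported[OF subgroup_Cen]] by blast+

lemma omega_supported_Cen: "\<omega> \<in> supported Cen"
  using supported_mono[OF H_Cen] omega_SH by blast

lemma omega_Cen_commute: "f \<in> supported Cen \<Longrightarrow> \<omega> \<otimes>\<^bsub>ZG\<^esub> f = f \<otimes>\<^bsub>ZG\<^esub> \<omega>"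
proof (rule commute_supported[OF _ Cen_G])
  fix u assume "u \<in> Cen"
  then have "u \<in> carrier G" "gr_conj (residue_ring M) G u \<omega> = \<omega>" by (auto simp: gr_centralizer_def)
  then show "\<omega> \<otimes>\<^bsub>ZG\<^esub> \<delta> u = \<delta> u \<otimes>\<^bsub>ZG\<^esub> \<omega>" using gr_conj_eq_iff_commute[of \<omega> u] by simp
qed simp_all

definition Aset :: "('g \<Rightarrow> int) set" where
  "Aset = {f \<in> supported Cen. f \<otimes>\<^bsub>ZG\<^esub> \<omega> = f}"

lemma AsetI: "f \<in> supported Cen \<Longrightarrow> f \<otimes>\<^bsub>ZG\<^esub> \<omega> = f \<Longrightarrow> f \<in> Aset"
  unfolding Aset_def by blast

lemma Aset_supported: "f \<in> Aset \<Longrightarrow> f \<in> supported Cen"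
  unfolding Aset_def by blast

lemma Aset_ZG [simp]: "f \<in> Aset \<Longrightarrow> f \<in> carrier ZG"
  using Aset_supported supportedD by blast

lemma Aset_omega: "f \<in> Aset \<Longrightarrow> f \<otimes>\<^bsub>ZG\<^esub> \<omega> = f" "f \<in> Aset \<Longrightarrow> \<omega> \<otimes>\<^bsub>ZG\<^esub> f = f"
proof -
  assume f: "f \<in> Aset"
  then show 1: "f \<otimes>\<^bsub>ZG\<^esub> \<omega> = f" unfolding Aset_def by blast
  then show "\<omega> \<otimes>\<^bsub>ZG\<^esub> f = f" using omega_Cen_commute[OF Aset_supported[OF f]] by simp
qed

lemma Rset_Aset: "f \<in> Rset \<Longrightarrow> f \<in> Aset"
  using supported_mono[OF H_Cen] Rset_SH Rset_omega(1) by (intro AsetI) blast+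

lemma ring_SC: "ring SC"
  by (rule ring_sub_group_ring[OF subgroup_Cen])

lemma SC_simps:
  "carrier SC = supported Cen" "monoid.mult SC = monoid.mult ZG" "ring.add SC = ring.add ZG"
  "\<one>\<^bsub>SC\<^esub> = \<one>\<^bsub>ZG\<^esub>" "\<zero>\<^bsub>SC\<^esub> = \<zero>\<^bsub>ZG\<^esub>"
  by (simp_all add: sub_group_ring_eq)

lemma ring_AA: "ring AA"
proof (rule corner_ring_is_ring[OF ring_SC])
  show "\<omega> \<in> carrier SC" unfolding SC_simps by (rule omega_supported_Cen)
  show "\<omega> \<otimes>\<^bsub>SC\<^esub> \<omega> = \<omega>" unfolding SC_simps by (rule omega_idem)
  show "\<omega> \<otimes>\<^bsub>SC\<^esub> y = y \<otimes>\<^bsub>SC\<^esub> \<omega>" if "y \<in> carrier SC" for y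
    using that unfolding SC_simps by (rule omega_Cen_commute)
qed

lemma carrier_AA: "carrier AA = Aset"
proof -
  have "y \<in> carrier AA \<longleftrightarrow> y \<in> supported Cen \<and> y \<otimes>\<^bsub>ZG\<^esub> \<omega> = y" for y
    using corner_ring_carrier[OF ring_SC, of \<omega> y] omega_supported_Cen by (simp only: SC_simps omega_idem)
  then show ?thesis unfolding Aset_def by blast
qed

lemma AA_simps:
  "monoid.mult AA = monoid.mult ZG" "ring.add AA = ring.add ZG" "\<one>\<^bsub>AA\<^esub> = \<omega>" "\<zero>\<^bsub>AA\<^esub> = \<zero>\<^bsub>ZG\<^esub>"
  by (simp_all add: SC_simps)

interpretation A: ring AA by (rule ring_AA)

lemma Aset_closed:
  "f \<in> Aset \<Longrightarrow> g \<in> Aset \<Longrightarrow> f \<otimes>\<^bsub>ZG\<^esub> g \<in> Aset" "f \<in> Aset \<Longrightarrow> g \<in> Aset \<Longrightarrow> f \<oplus>\<^bsub>ZG\<^esub> g \<in> Aset"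
  "\<omega> \<in> Aset" "\<zero>\<^bsub>ZG\<^esub> \<in> Aset"
  using A.m_closed[of f g] A.a_closed[of f g] A.one_closed A.zero_closed unfolding carrier_AA AA_simps by blast+

lemma AA_minus: "f \<in> Aset \<Longrightarrow> g \<in> Aset \<Longrightarrow> f \<ominus>\<^bsub>AA\<^esub> g = f \<ominus>\<^bsub>ZG\<^esub> g"
proof -
  assume "g \<in> Aset"
  then have "\<ominus>\<^bsub>AA\<^esub> g = \<ominus>\<^bsub>ZG\<^esub> g"
    by (intro a_inv_subcarrier[OF A.abelian_group_axioms ZG.abelian_group_axioms])
      (auto simp only: carrier_AA AA_simps intro: Aset_ZG)
  then show ?thesis unfolding a_minus_def AA_simps by simp
qed

lemma finsum_AA: "f \<in> I \<rightarrow> Aset \<Longrightarrow> finsum AA f I = finsum ZG f I"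
  by (rule finsum_subcarrier[OF A.abelian_monoid_axioms ZG.abelian_monoid_axioms])
    (auto simp only: carrier_AA AA_simps intro: Aset_ZG)

lemma finsum_RR: "f \<in> I \<rightarrow> Rset \<Longrightarrow> finsum RR f I = finsum ZG f I"
proof -
  interpret R: ring RR by (rule ring_RR)
  show "f \<in> I \<rightarrow> Rset \<Longrightarrow> finsum RR f I = finsum ZG f I"
    by (rule finsum_subcarrier[OF R.abelian_monoid_axioms ZG.abelian_monoid_axioms])
      (auto simp only: carrier_RR RR_simps intro: SH_ZG Rset_SH)
qed

text \<open>Cutting down by \<open>\<omega>\<close> on both sides kills everything outside the centralizer.\<close>

lemma omega_corner:
  assumes y: "y \<in> carrier ZG"
  shows "\<omega> \<otimes>\<^bsub>ZG\<^esub> y \<otimes>\<^bsub>ZG\<^esub> \<omega> \<in> Aset"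
proof -
  have "y \<in> supported (carrier G)" by (simp add: supported_carrier y)
  from this subset_refl show ?thesis
  proof (induction y rule: supported_induct)
    case zero
    show ?case using Aset_closed(4) by simp
  next
    case (add f u)
    then have f: "f \<in> carrier ZG" by (simp add: supported_carrier)
    have "\<omega> \<otimes>\<^bsub>ZG\<^esub> \<delta> u \<otimes>\<^bsub>ZG\<^esub> \<omega> \<in> Aset"
    proof (cases "u \<in> Cen")
      case True
      show ?thesis
        by (intro AsetI Cen_closed omega_supported_Cen gr_elt_supported True) (simp add: ZG.m_assoc)
    next
      case False
      then show ?thesis using omega_elt_omega[of u] add Aset_closed(4) by simp
    qed
    moreover have "\<omega> \<otimes>\<^bsub>ZG\<^esub> (f \<oplus>\<^bsub>ZG\<^esub> \<delta> u) \<otimes>\<^bsub>ZG\<^esub> \<omega> = \<omega> \<otimes>\<^bsub>ZG\<^esub> f \<otimes>\<^bsub>ZG\<^esub> \<omega> \<oplus>\<^bsub>ZG\<^esub> \<omega> \<otimes>\<^bsub>ZG\<^esub> \<delta> u \<otimes>\<^bsub>ZG\<^esub> \<omega>"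
      using f by (simp add: ZG.l_distr ZG.r_distr)
    ultimately show ?case using add Aset_closed(2) by simp
  qed
qed

end

section \<open>The crossed product of a strong Shoda pair\<close>

locale strong_shoda_crossed = strong_shoda_class G p r H K \<zeta> \<C>
  for G :: "('g, 'b) monoid_scheme" (structure) and p r :: nat and H K :: "'g set"
    and \<zeta> :: "'k :: alg_closed_field" and \<C> :: "('g set \<Rightarrow> 'k) set" +
  fixes l m d :: nat and \<sigma> :: "('g \<Rightarrow> int) \<Rightarrow> 'g \<Rightarrow> int" and \<beta> \<gamma> :: "'g \<Rightarrow> int" and t :: "nat \<Rightarrow> 'g"
  assumes l_card: "l * card H = card Cen"
    and \<gamma>_A: "\<gamma> \<in> Aset" and \<gamma>_l: "\<gamma> [^]\<^bsub>AA\<^esub> l = \<omega>"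
    and \<gamma>_basis: "left_basis AA (carrier RR) {..<l} (\<lambda>i. \<gamma> [^]\<^bsub>AA\<^esub> i)"
    and \<sigma>: "\<sigma> \<in> galois_group RR (carrier (center_ring AA))"
    and galois_gen: "\<forall>\<theta>\<in>galois_group RR (carrier (center_ring AA)). \<exists>i::nat. \<forall>y\<in>carrier RR. \<theta> y = (\<sigma> ^^ i) y"
    and galois_card: "card (galois_group RR (carrier (center_ring AA))) = l"
    and normal_\<beta>: "normal_element RR (center_ring AA) \<beta>"
    and act: "y \<in> Rset \<Longrightarrow> y \<otimes>\<^bsub>ZG\<^esub> \<gamma> = \<gamma> \<otimes>\<^bsub>ZG\<^esub> \<sigma> y"
    and \<sigma>_frobenius: "y \<in> Rset \<Longrightarrow> \<sigma> (galois_pow RR p d y) = y"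
    and transversal: "right_transversal G Cen m t"
begin

interpretation A: ring AA by (rule ring_AA)

lemma l_positive: "l > 0"
proof -
  have "finite Cen" using finite_G Cen_G finite_subset by blast
  then have "card Cen > 0" using subgroup.one_closed[OF subgroup_Cen] by (auto simp: card_gt_0_iff)
  then show ?thesis unfolding l_card[symmetric] by simp
qed

lemma l_invertible: "[l] \<cdot>\<^bsub>AA\<^esub> \<one>\<^bsub>AA\<^esub> \<in> Units AA"
proof -
  have "card Cen dvd Coset.order G"
    unfolding lagrange_finite[OF finite_G subgroup_Cen, symmetric] by (rule dvd_triv_right)
  moreover have "l dvd card Cen" unfolding l_card[symmetric] by (rule dvd_triv_left)
  ultimately have "l dvd Coset.order G" by (rule dvd_trans[rotated])
  from coprime_divisors[OF dvd_refl this coprime_G] have "coprime l (p ^ r)"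
    by (simp add: coprime_commute)
  then obtain l' where l': "[l * l' = Suc 0] (mod p ^ r)" using cong_solve_coprime_nat by blast
  have smult: "[n] \<cdot>\<^bsub>AA\<^esub> \<omega> = [n] \<cdot>\<^bsub>ZG\<^esub> \<omega>" for n :: nat
  proof (induction n)
    case 0
    show ?case unfolding A.add.nat_pow_0 ZG.add.nat_pow_0 AA_simps ..
  next
    case (Suc n)
    show ?case unfolding A.add.nat_pow_Suc ZG.add.nat_pow_Suc AA_simps Suc ..
  qed
  have one: "[(l * l')] \<cdot>\<^bsub>AA\<^esub> \<omega> = \<omega>"
    unfolding smult
  proof (rule gr_ext)
    fix x assume x: "x \<in> carrier G"
    have "[int (l * l') = 1] (mod M)"
      using l' cong_int_iff[of "l * l'" "Suc 0" "p ^ r"] by simp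
    then have "[int (l * l') * \<omega> x = 1 * \<omega> x] (mod M)" by (rule cong_scalar_right)
    then have "(int (l * l') * \<omega> x) mod M = \<omega> x mod M" by (simp add: cong_def)
    then show "([(l * l')] \<cdot>\<^bsub>ZG\<^esub> \<omega>) x = \<omega> x" using x by (simp add: grm_nat_smult_apply grm_mod)
  qed simp_all
  have 1: "\<one>\<^bsub>AA\<^esub> = \<omega>" by (rule AA_simps(3))
  have cl: "[n] \<cdot>\<^bsub>AA\<^esub> \<one>\<^bsub>AA\<^esub> \<in> carrier AA" for n :: nat by (rule A.add.nat_pow_closed) (rule A.one_closed)
  have prod: "([a] \<cdot>\<^bsub>AA\<^esub> \<one>\<^bsub>AA\<^esub>) \<otimes>\<^bsub>AA\<^esub> ([b] \<cdot>\<^bsub>AA\<^esub> \<one>\<^bsub>AA\<^esub>) = [(b * a)] \<cdot>\<^bsub>AA\<^esub> \<one>\<^bsub>AA\<^esub>" for a b :: nat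
    using A.add_pow_ldistr[OF A.one_closed cl[of b], of a] A.l_one[OF cl[of b]] A.add.nat_pow_pow[OF A.one_closed, of a b]
    by (simp only:)
  have "([l] \<cdot>\<^bsub>AA\<^esub> \<one>\<^bsub>AA\<^esub>) \<otimes>\<^bsub>AA\<^esub> ([l'] \<cdot>\<^bsub>AA\<^esub> \<one>\<^bsub>AA\<^esub>) = \<one>\<^bsub>AA\<^esub>"
    unfolding prod using one unfolding 1 by (simp only: mult.commute)
  moreover have "([l'] \<cdot>\<^bsub>AA\<^esub> \<one>\<^bsub>AA\<^esub>) \<otimes>\<^bsub>AA\<^esub> ([l] \<cdot>\<^bsub>AA\<^esub> \<one>\<^bsub>AA\<^esub>) = \<one>\<^bsub>AA\<^esub>"
    unfolding prod using one unfolding 1 by (simp only:)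
  ultimately show ?thesis using cl unfolding Units_def by blast
qed

lemma \<gamma>_carrier: "\<gamma> \<in> carrier AA"
  unfolding carrier_AA by (rule \<gamma>_A)

lemma \<gamma>_pow_one: "\<gamma> [^]\<^bsub>AA\<^esub> l = \<one>\<^bsub>AA\<^esub>"
  unfolding AA_simps by (rule \<gamma>_l)

lemma \<gamma>_Units: "\<gamma> \<in> Units AA"
  by (rule A.Units_if_pow_one[OF \<gamma>_carrier \<gamma>_pow_one l_positive])

abbreviation "fr \<equiv> galois_pow RR p d"

lemma \<gamma>_conj: "y \<in> Rset \<Longrightarrow> \<gamma> \<otimes>\<^bsub>AA\<^esub> y \<otimes>\<^bsub>AA\<^esub> inv\<^bsub>AA\<^esub> \<gamma> = fr y"
proof -
  assume y: "y \<in> Rset"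
  have fr: "fr y \<in> Rset" by (rule galois_pow_Rset[OF y])
  then have frA: "fr y \<in> carrier AA" unfolding carrier_AA by (rule Rset_Aset)
  have "\<gamma> \<otimes>\<^bsub>AA\<^esub> y = fr y \<otimes>\<^bsub>AA\<^esub> \<gamma>" using act[OF fr] \<sigma>_frobenius[OF y] unfolding AA_simps by simp
  then have "\<gamma> \<otimes>\<^bsub>AA\<^esub> y \<otimes>\<^bsub>AA\<^esub> inv\<^bsub>AA\<^esub> \<gamma> = fr y \<otimes>\<^bsub>AA\<^esub> (\<gamma> \<otimes>\<^bsub>AA\<^esub> inv\<^bsub>AA\<^esub> \<gamma>)"
    using A.m_assoc[OF frA \<gamma>_carrier A.Units_inv_closed[OF \<gamma>_Units]] by (simp only:)
  also have "\<dots> = fr y" unfolding A.Units_r_inv[OF \<gamma>_Units] by (rule A.r_one[OF frA])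
  finally show ?thesis .
qed

lemma subring_Rset: "subring Rset AA"
proof (rule A.subringI)
  show "Rset \<subseteq> carrier AA" unfolding carrier_AA using Rset_Aset by blast
  show "\<one>\<^bsub>AA\<^esub> \<in> Rset" unfolding AA_simps by (rule omega_Rset)
  fix y z assume y: "y \<in> Rset"
  have "\<zero>\<^bsub>AA\<^esub> \<ominus>\<^bsub>AA\<^esub> y \<in> Rset"
    using AA_minus[OF Aset_closed(4) Rset_Aset[OF y]] Rset_minus[OF Rset_zero y] unfolding AA_simps by simp
  moreover have "y \<in> carrier AA" unfolding carrier_AA using y by (rule Rset_Aset)
  ultimately show "\<ominus>\<^bsub>AA\<^esub> y \<in> Rset" unfolding a_minus_def by (simp only: A.l_zero A.a_inv_closed)
  assume z: "z \<in> Rset"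
  show "y \<otimes>\<^bsub>AA\<^esub> z \<in> Rset" unfolding AA_simps by (rule Rset_mult[OF y z])
  show "y \<oplus>\<^bsub>AA\<^esub> z \<in> Rset" unfolding AA_simps by (rule Rset_add[OF y z])
qed

sublocale cc: cyclic_conjugation AA Rset \<gamma> l
proof (intro cyclic_conjugation.intro cyclic_conjugation_axioms.intro ring_AA subring_Rset
    \<gamma>_carrier \<gamma>_pow_one l_positive l_invertible)
  have "carrier AA \<subseteq> carrier ZG" unfolding carrier_AA using Aset_ZG by blast
  then show "finite (carrier AA)" using finite_gr_carrier finite_subset by blast
next
  fix y y' assume y: "y \<in> Rset" and y': "y' \<in> Rset"
  show "y \<otimes>\<^bsub>AA\<^esub> y' = y' \<otimes>\<^bsub>AA\<^esub> y"
    unfolding AA_simps by (rule Rset_central[OF y Rset_SH[OF y']])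
next
  fix y assume y: "y \<in> Rset"
  show "\<gamma> \<otimes>\<^bsub>AA\<^esub> y \<otimes>\<^bsub>AA\<^esub> inv\<^bsub>AA\<^esub> \<gamma> \<in> Rset"
    unfolding \<gamma>_conj[OF y] by (rule galois_pow_Rset[OF y])
qed

lemma T_galois_pow: "y \<in> Rset \<Longrightarrow> cc.T n y = galois_pow RR p (n * d) y"
proof (induction n)
  case 0
  then have "y \<in> carrier AA" by (rule cc.Rc_carrier)
  then show ?case by (simp only: cc.T_0 mult_0 galois_pow_def funpow_0)
next
  case (Suc n)
  have y: "y \<in> carrier AA" using Suc.prems by (rule cc.Rc_carrier)
  have "cc.T (Suc n) y = cc.T 1 (cc.T n y)" using cc.T_T[OF y, of 1 n] by simp
  also have "\<dots> = fr (cc.T n y)"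
    using \<gamma>_conj[OF cc.T_Rc[OF Suc.prems, of n]] A.nat_pow_eone[OF \<gamma>_carrier] A.nat_pow_eone[OF A.Units_inv_closed[OF \<gamma>_Units]]
    unfolding cc.T_def[of 1] by (simp only:)
  also have "\<dots> = galois_pow RR p (Suc n * d) y"
    using Suc by (simp add: galois_pow_def funpow_add)
  finally show ?case .
qed

lemma T_ring_endo: "ring_endo (cc.T n)"
  unfolding ring_endo_def
proof (intro conjI ballI)
  show "cc.T n \<omega> = \<omega>" using cc.T_one[of n] unfolding AA_simps .
  fix y z assume y: "y \<in> Rset" and z: "z \<in> Rset"
  show "cc.T n (y \<otimes>\<^bsub>ZG\<^esub> z) = cc.T n y \<otimes>\<^bsub>ZG\<^esub> cc.T n z"
    using cc.T_mult[OF cc.Rc_carrier[OF y] cc.Rc_carrier[OF z], of n] unfolding AA_simps .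
  show "cc.T n (y \<oplus>\<^bsub>ZG\<^esub> z) = cc.T n y \<oplus>\<^bsub>ZG\<^esub> cc.T n z"
    using cc.T_add[OF cc.Rc_carrier[OF y] cc.Rc_carrier[OF z], of n] unfolding AA_simps .
qed (rule cc.T_Rc)

lemma \<sigma>_Rset: "y \<in> Rset \<Longrightarrow> \<sigma> y \<in> Rset"
proof -
  have "\<sigma> \<in> ring_iso RR RR" using \<sigma> by (simp add: galois_group_def)
  from ring_endoD(2)[OF ring_endo_iso[OF this]] show "y \<in> Rset \<Longrightarrow> \<sigma> y \<in> Rset" .
qed

lemma \<sigma>_pow_Rset: "y \<in> Rset \<Longrightarrow> (\<sigma> ^^ i) y \<in> Rset"
  by (induction i) (simp_all add: \<sigma>_Rset)

lemma T_\<sigma>: "y \<in> Rset \<Longrightarrow> cc.T 1 (\<sigma> y) = y"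
proof -
  assume y: "y \<in> Rset"
  have yA: "y \<in> carrier AA" using y by (rule cc.Rc_carrier)
  have "\<gamma> \<otimes>\<^bsub>AA\<^esub> \<sigma> y = y \<otimes>\<^bsub>AA\<^esub> \<gamma>" using act[OF y] unfolding AA_simps by simp
  then have "cc.T 1 (\<sigma> y) = y \<otimes>\<^bsub>AA\<^esub> \<gamma> \<otimes>\<^bsub>AA\<^esub> inv\<^bsub>AA\<^esub> \<gamma>"
    unfolding cc.T_def using A.nat_pow_eone[OF \<gamma>_carrier] A.nat_pow_eone[OF A.Units_inv_closed[OF \<gamma>_Units]] by (simp only:)
  also have "\<dots> = y"
    using A.m_assoc[OF yA \<gamma>_carrier A.Units_inv_closed[OF \<gamma>_Units]] A.Units_r_inv[OF \<gamma>_Units] A.r_one[OF yA] by (simp only:)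
  finally show ?thesis .
qed

lemma T_\<sigma>_pow: "y \<in> Rset \<Longrightarrow> cc.T n ((\<sigma> ^^ n) y) = y"
proof (induction n)
  case 0
  then show ?case using cc.T_0[OF cc.Rc_carrier[OF 0]] by (simp only: funpow_0)
next
  case (Suc n)
  have "cc.T (Suc n) ((\<sigma> ^^ Suc n) y) = cc.T n (cc.T 1 (\<sigma> ((\<sigma> ^^ n) y)))"
    using cc.T_T[OF cc.Rc_carrier[OF \<sigma>_Rset[OF \<sigma>_pow_Rset[OF Suc.prems]]], of n 1 n] by simp
  then show ?case using Suc T_\<sigma>[OF \<sigma>_pow_Rset[OF Suc.prems]] by (simp only:)
qed

text \<open>A conjugation by \<open>\<gamma>\<^sup>n\<close> with \<open>0 < n < l\<close> is not the identity: otherwise the powers of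
  \<open>\<sigma>\<close> would be at most \<open>n\<close> automorphisms, while the Galois group has order \<open>l\<close>.\<close>

lemma T_nontrivial:
  assumes n: "0 < n" "n < l"
  shows "\<exists>y\<in>Rset. cc.T n y \<noteq> y"
proof (rule ccontr)
  assume "\<not> ?thesis"
  then have T: "cc.T n y = y" if "y \<in> Rset" for y using that by blast
  have \<sigma>n: "(\<sigma> ^^ n) y = y" if "y \<in> Rset" for y
    using T_\<sigma>_pow[OF that, of n] T[OF \<sigma>_pow_Rset[OF that]] by simp
  have \<sigma>n': "(\<sigma> ^^ (j * n + i)) y = (\<sigma> ^^ i) y" if "y \<in> Rset" for y i j
  proof (induction j)
    case (Suc j)
    have "(\<sigma> ^^ (Suc j * n + i)) y = (\<sigma> ^^ n) ((\<sigma> ^^ (j * n + i)) y)" by (simp add: funpow_add add.assoc)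
    then show ?case using Suc \<sigma>n[OF \<sigma>_pow_Rset[OF that]] by simp
  qed simp
  let ?gal = "galois_group RR (carrier (center_ring AA))"
  have "?gal \<subseteq> (\<lambda>i. restrict (\<sigma> ^^ i) Rset) ` {..<n}"
  proof
    fix \<theta> assume \<theta>: "\<theta> \<in> ?gal"
    obtain i where i: "\<And>y. y \<in> Rset \<Longrightarrow> \<theta> y = (\<sigma> ^^ i) y" using galois_gen \<theta> unfolding carrier_RR by blast
    have "\<theta> y = (\<sigma> ^^ (i mod n)) y" if "y \<in> Rset" for y
      using i[OF that] \<sigma>n'[OF that, of "i div n" "i mod n"] by simp
    moreover have "\<theta> \<in> extensional Rset" using \<theta> by (simp add: galois_group_def carrier_RR)
    ultimately have "\<theta> = restrict (\<sigma> ^^ (i mod n)) Rset" by (intro extensionalityI[of _ Rset]) simp_all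
    then show "\<theta> \<in> (\<lambda>i. restrict (\<sigma> ^^ i) Rset) ` {..<n}" using n(1) by auto
  qed
  then have "card ?gal \<le> card ((\<lambda>i. restrict (\<sigma> ^^ i) Rset) ` {..<n})" by (intro card_mono) simp_all
  also have "\<dots> \<le> n" using card_image_le[of "{..<n}" "\<lambda>i. restrict (\<sigma> ^^ i) Rset"] by simp
  finally show False using galois_card n(2) by simp
qed

text \<open>By rigidity \<open>T n\<close> moves some \<open>h\<omega>\<close> by an element of nonzero character value, which is a unit.\<close>

lemma T_regular:
  assumes n: "0 < n" "n < l"
  shows "\<exists>y\<in>Rset. \<forall>u\<in>Rset. u \<otimes>\<^bsub>AA\<^esub> (cc.T n y \<ominus>\<^bsub>AA\<^esub> y) = \<zero>\<^bsub>AA\<^esub> \<longrightarrow> u = \<zero>\<^bsub>AA\<^esub>"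
proof -
  have id: "ring_endo (\<lambda>y. y)" unfolding ring_endo_def by simp
  obtain h where h: "h \<in> H" "char_ring (cc.T n (\<delta> h \<otimes>\<^bsub>ZG\<^esub> \<omega>)) \<noteq> char_ring (\<delta> h \<otimes>\<^bsub>ZG\<^esub> \<omega>)"
    using ring_endo_rigid[OF T_ring_endo id] T_nontrivial[OF n] by blast
  let ?y = "\<delta> h \<otimes>\<^bsub>ZG\<^esub> \<omega>"
  have y: "?y \<in> Rset" using h(1) by (simp add: mult_omega_Rset)
  let ?v = "cc.T n ?y \<ominus>\<^bsub>ZG\<^esub> ?y"
  have v: "?v \<in> Rset" by (rule Rset_minus[OF cc.T_Rc[OF y] y])
  have "char_ring ?v \<noteq> 0"
    using h(2) char_ring_diff[OF Rset_SH[OF cc.T_Rc[OF y]] Rset_SH[OF y]] by simp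
  then obtain z where z: "z \<in> SH" "?v \<otimes>\<^bsub>ZG\<^esub> z \<otimes>\<^bsub>ZG\<^esub> \<omega> = \<omega>"
    using unit_if_char_nonzero[OF Rset_SH[OF v]] by blast
  have "u = \<zero>\<^bsub>ZG\<^esub>" if u: "u \<in> Rset" "u \<otimes>\<^bsub>ZG\<^esub> ?v = \<zero>\<^bsub>ZG\<^esub>" for u
  proof -
    have cl: "u \<in> carrier ZG" "?v \<in> carrier ZG" "z \<in> carrier ZG"
      using SH_ZG[OF Rset_SH[OF u(1)]] SH_ZG[OF Rset_SH[OF v]] SH_ZG[OF z(1)] .
    have "u = u \<otimes>\<^bsub>ZG\<^esub> (?v \<otimes>\<^bsub>ZG\<^esub> z \<otimes>\<^bsub>ZG\<^esub> \<omega>)" unfolding z(2) by (rule Rset_omega(1)[OF u(1), symmetric])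
    also have "\<dots> = (u \<otimes>\<^bsub>ZG\<^esub> ?v) \<otimes>\<^bsub>ZG\<^esub> (z \<otimes>\<^bsub>ZG\<^esub> \<omega>)" using cl by (simp only: ZG.m_assoc ZG.m_closed SH_ZG omega_SH)
    also have "\<dots> = \<zero>\<^bsub>ZG\<^esub>" unfolding u(2) using cl by simp
    finally show ?thesis .
  qed
  then show ?thesis
    unfolding AA_simps using y AA_minus[OF Rset_Aset[OF cc.T_Rc[OF y]] Rset_Aset[OF y]] by (intro bexI[of _ ?y]) simp_all
qed

lemma \<beta>_Rset: "\<beta> \<in> Rset"
  using normal_\<beta> by (simp add: normal_element_def carrier_RR)

lemma conjugate_is_T: "\<exists>k<l. (\<sigma> ^^ i) \<beta> = cc.T k \<beta>"
proof -
  obtain n where n: "l = Suc n" using l_positive by (cases l) auto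
  let ?b = "(\<sigma> ^^ i) \<beta>"
  have b: "?b \<in> carrier AA" by (rule cc.Rc_carrier[OF \<sigma>_pow_Rset[OF \<beta>_Rset]])
  have bA: "\<beta> \<in> carrier AA" by (rule cc.Rc_carrier[OF \<beta>_Rset])
  have "cc.T (n * i) \<beta> = cc.T (n * i) (cc.T i ?b)" by (simp only: T_\<sigma>_pow[OF \<beta>_Rset])
  also have "\<dots> = cc.T (n * i + i) ?b" by (rule cc.T_T[OF b])
  also have "n * i + i = l * i" by (simp add: n)
  also have "cc.T (l * i) ?b = cc.T ((l * i) mod l) ?b" by (rule cc.T_mod[OF b, symmetric])
  also have "\<dots> = ?b" using cc.T_0[OF b] by simp
  finally have "?b = cc.T ((n * i) mod l) \<beta>" using cc.T_mod[OF bA, of "n * i"] by simp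
  then show ?thesis using l_positive by (intro exI[of _ "(n * i) mod l"]) simp
qed

sublocale cb: cyclic_basis AA Rset \<gamma> l
proof
  show "\<exists>!c. c \<in> {..<l} \<rightarrow>\<^sub>E Rset \<and> y = (\<Oplus>\<^bsub>AA\<^esub>i\<in>{..<l}. c i \<otimes>\<^bsub>AA\<^esub> \<gamma> [^]\<^bsub>AA\<^esub> i)" if "y \<in> carrier AA" for y
    using \<gamma>_basis that unfolding left_basis_def carrier_RR by blast
qed (rule T_regular)

text \<open>The elements \<open>\<theta>(\<beta>)\<close> are the conjugates \<open>\<gamma>\<^sup>k\<beta>\<gamma>\<^sup>-\<^sup>k\<close>, so a normal element is one whose conjugates
  span the coefficient ring over the center.\<close>

lemma T_spanning:
  assumes y: "y \<in> Rset"
  shows "\<exists>s\<in>{..<l} \<rightarrow> ring_center AA. y = (\<Oplus>\<^bsub>AA\<^esub>n\<in>{..<l}. s n \<otimes>\<^bsub>AA\<^esub> cc.T n \<beta>)"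
proof -
  let ?I = "{\<theta> \<beta> | \<theta>. \<theta> \<in> galois_group RR (carrier (center_ring AA))}"
  have basis: "left_basis RR (carrier (center_ring AA)) ?I (\<lambda>b. b)"
    using normal_\<beta> by (simp add: normal_element_def)
  have fin: "finite ?I" and IR: "?I \<subseteq> Rset"
    using basis by (auto simp: left_basis_def carrier_RR)
  obtain c where c: "c \<in> ?I \<rightarrow>\<^sub>E carrier (center_ring AA)" "y = (\<Oplus>\<^bsub>RR\<^esub>b\<in>?I. c b \<otimes>\<^bsub>RR\<^esub> b)"
    using basis y unfolding left_basis_def carrier_RR by blast
  have cen: "carrier (center_ring AA) = ring_center AA" by (simp add: center_ring_eq)
  have ex: "\<exists>n<l. b = cc.T n \<beta>" if "b \<in> ?I" for b
  proof -
    obtain \<theta> where \<theta>: "\<theta> \<in> galois_group RR (carrier (center_ring AA))" "b = \<theta> \<beta>" using \<open>b \<in> ?I\<close> by blast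
    obtain i where "\<forall>y\<in>carrier RR. \<theta> y = (\<sigma> ^^ i) y" using galois_gen \<theta>(1) by blast
    then have "b = (\<sigma> ^^ i) \<beta>" unfolding carrier_RR \<theta>(2) by (rule bspec[OF _ \<beta>_Rset])
    moreover obtain n where "n < l" "(\<sigma> ^^ i) \<beta> = cc.T n \<beta>" using conjugate_is_T[of i] by blast
    ultimately show ?thesis by (intro exI[of _ n] conjI) (simp_all only:)
  qed
  define \<kappa> where "\<kappa> b = (SOME n. n < l \<and> b = cc.T n \<beta>)" for b
  have \<kappa>: "\<kappa> b < l" "cc.T (\<kappa> b) \<beta> = b" if "b \<in> ?I" for b
  proof -
    have *: "\<kappa> b < l \<and> b = cc.T (\<kappa> b) \<beta>" unfolding \<kappa>_def by (rule someI_ex[OF ex[OF that]])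
    show "\<kappa> b < l" by (rule conjunct1[OF *])
    show "cc.T (\<kappa> b) \<beta> = b" by (rule conjunct2[OF *, symmetric])
  qed
  have \<kappa>_inj: "inj_on \<kappa> ?I"
  proof (rule inj_onI)
    fix b b' assume b: "b \<in> ?I" and b': "b' \<in> ?I" and eq: "\<kappa> b = \<kappa> b'"
    have "b = cc.T (\<kappa> b) \<beta>" by (rule \<kappa>(2)[OF b, symmetric])
    also have "\<dots> = b'" unfolding eq by (rule \<kappa>(2)[OF b'])
    finally show "b = b'" .
  qed
  have cR: "c b \<in> ring_center AA" if "b \<in> ?I" for b using c(1) that unfolding cen by blast
  have cenA: "s \<in> Aset" if "s \<in> ring_center AA" for s using that unfolding ring_center_def carrier_AA by blast
  have zero_cen: "\<zero>\<^bsub>AA\<^esub> \<in> ring_center AA"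
    by (rule cc.ring_centerI[OF A.zero_closed]) (simp only: A.l_null A.r_null)
  define s where "s n = (if n \<in> \<kappa> ` ?I then c (cc.T n \<beta>) else \<zero>\<^bsub>AA\<^esub>)" for n
  have s_\<kappa>: "s (\<kappa> b) = c b" if "b \<in> ?I" for b
    unfolding s_def \<kappa>(2)[OF that] if_P[OF imageI[OF that]] ..
  have s: "s n \<in> ring_center AA" for n
  proof (cases "n \<in> \<kappa> ` ?I")
    case True
    then obtain b where b: "b \<in> ?I" "n = \<kappa> b" by blast
    show ?thesis unfolding b(2) s_\<kappa>[OF b(1)] by (rule cR[OF b(1)])
  next
    case False
    show ?thesis unfolding s_def if_not_P[OF False] by (rule zero_cen)
  qed
  have TA: "cc.T n \<beta> \<in> carrier AA" for n by (rule cc.T_carrier[OF cc.Rc_carrier[OF \<beta>_Rset]])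
  have sA: "s n \<in> carrier AA" for n using cenA[OF s] unfolding carrier_AA .
  have cb: "c b \<otimes>\<^bsub>ZG\<^esub> b \<in> Rset" if "b \<in> ?I" for b
  proof -
    have "c b \<in> Rset" using cR[OF that] cb.center_subset by blast
    then show ?thesis using IR that by (intro Rset_mult) blast+
  qed
  have "y = (\<Oplus>\<^bsub>ZG\<^esub>b\<in>?I. c b \<otimes>\<^bsub>ZG\<^esub> b)"
    unfolding c(2) RR_simps using cb by (intro finsum_RR) blast
  also have "\<dots> = (\<Oplus>\<^bsub>AA\<^esub>b\<in>?I. c b \<otimes>\<^bsub>ZG\<^esub> b)"
    using cb Rset_Aset by (intro finsum_AA[symmetric]) blast
  also have "\<dots> = (\<Oplus>\<^bsub>AA\<^esub>b\<in>?I. s (\<kappa> b) \<otimes>\<^bsub>AA\<^esub> cc.T (\<kappa> b) \<beta>)"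
  proof (rule A.finsum_cong'[OF refl])
    show "(\<lambda>b. s (\<kappa> b) \<otimes>\<^bsub>AA\<^esub> cc.T (\<kappa> b) \<beta>) \<in> ?I \<rightarrow> carrier AA"
      by (intro Pi_I A.m_closed sA TA)
    fix b assume b: "b \<in> ?I"
    show "c b \<otimes>\<^bsub>ZG\<^esub> b = s (\<kappa> b) \<otimes>\<^bsub>AA\<^esub> cc.T (\<kappa> b) \<beta>"
      unfolding AA_simps s_\<kappa>[OF b] \<kappa>(2)[OF b] ..
  qed
  also have "\<dots> = (\<Oplus>\<^bsub>AA\<^esub>n\<in>\<kappa> ` ?I. s n \<otimes>\<^bsub>AA\<^esub> cc.T n \<beta>)"
    by (rule A.finsum_reindex[OF _ \<kappa>_inj, symmetric]) (intro Pi_I A.m_closed sA TA)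
  also have "\<dots> = (\<Oplus>\<^bsub>AA\<^esub>n\<in>{..<l}. s n \<otimes>\<^bsub>AA\<^esub> cc.T n \<beta>)"
  proof (rule A.add.finprod_mono_neutral_cong_left)
    show "\<kappa> ` ?I \<subseteq> {..<l}" using \<kappa>(1) by blast
    show "s n \<otimes>\<^bsub>AA\<^esub> cc.T n \<beta> = \<zero>\<^bsub>AA\<^esub>" if "n \<in> {..<l} - \<kappa> ` ?I" for n
    proof -
      have "n \<notin> \<kappa> ` ?I" using that by blast
      then show ?thesis unfolding s_def by (simp only: if_not_P A.l_null[OF TA[of n]] not_False_eq_True if_False)
    qed
    show "(\<lambda>n. s n \<otimes>\<^bsub>AA\<^esub> cc.T n \<beta>) \<in> {..<l} \<rightarrow> carrier AA"
      by (intro Pi_I A.m_closed sA TA)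
  qed (rule finite_lessThan refl)+
  finally show ?thesis using s by (intro bexI[of _ s]) blast+
qed

sublocale cx: cyclic_crossed_product AA Rset \<gamma> l \<beta>
  by unfold_locales (rule \<beta>_Rset T_spanning; assumption?)+

lemma normal_systemI:
  assumes c: "c \<in> {..<l} \<rightarrow> Rset"
    and eq: "\<And>n. n < l \<Longrightarrow> (\<Oplus>\<^bsub>AA\<^esub>i\<in>{..<l}. c i \<otimes>\<^bsub>AA\<^esub> cc.T (i + n) \<beta>) = cx.normal_rhs n"
  shows "normal_system RR p d l \<beta> c"
  unfolding normal_system_def
proof (intro allI impI)
  fix n assume n: "n < l"
  have TR: "cc.T i \<beta> \<in> Rset" for i by (rule cc.T_Rc[OF \<beta>_Rset])
  have gp: "galois_pow RR p (i * d) \<beta> = cc.T i \<beta>" for i by (rule T_galois_pow[OF \<beta>_Rset, symmetric])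
  have cl: "c i \<in> Rset" if "i < l" for i using c that by auto
  have "(\<Oplus>\<^bsub>RR\<^esub>i\<in>{..<l}. galois_pow RR p (((n + i) mod l) * d) \<beta> \<otimes>\<^bsub>RR\<^esub> c i)
    = (\<Oplus>\<^bsub>RR\<^esub>i\<in>{..<l}. cc.T (i + n) \<beta> \<otimes>\<^bsub>ZG\<^esub> c i)"
    unfolding gp RR_simps cc.T_mod[OF cc.Rc_carrier[OF \<beta>_Rset]] by (simp only: add.commute)
  also have "\<dots> = (\<Oplus>\<^bsub>ZG\<^esub>i\<in>{..<l}. cc.T (i + n) \<beta> \<otimes>\<^bsub>ZG\<^esub> c i)"
    by (intro finsum_RR Pi_I Rset_mult TR cl) simp
  also have "\<dots> = (\<Oplus>\<^bsub>ZG\<^esub>i\<in>{..<l}. c i \<otimes>\<^bsub>ZG\<^esub> cc.T (i + n) \<beta>)"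
  proof (intro ZG.finsum_cong' refl Pi_I)
    fix i assume "i \<in> {..<l}"
    then have i: "c i \<in> Rset" using cl by simp
    show "cc.T (i + n) \<beta> \<otimes>\<^bsub>ZG\<^esub> c i = c i \<otimes>\<^bsub>ZG\<^esub> cc.T (i + n) \<beta>" by (rule Rset_central[OF TR Rset_SH[OF i]])
    show "c i \<otimes>\<^bsub>ZG\<^esub> cc.T (i + n) \<beta> \<in> carrier ZG" by (intro Aset_ZG Rset_Aset Rset_mult i TR)
  qed
  also have "\<dots> = (\<Oplus>\<^bsub>AA\<^esub>i\<in>{..<l}. c i \<otimes>\<^bsub>AA\<^esub> cc.T (i + n) \<beta>)"
    unfolding AA_simps by (intro finsum_AA[symmetric] Pi_I Rset_Aset Rset_mult TR cl) simp
  also have "\<dots> = cx.normal_rhs n" by (rule eq[OF n])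
  also have "cx.normal_rhs n = (if n = 0 then (\<Oplus>\<^bsub>RR\<^esub>i\<in>{1..l}. galois_pow RR p (i * d) \<beta>)
      else \<beta> \<ominus>\<^bsub>RR\<^esub> galois_pow RR p (n * d) \<beta>)"
  proof (cases "n = 0")
    case True
    have "(\<Oplus>\<^bsub>RR\<^esub>i\<in>{1..l}. cc.T i \<beta>) = (\<Oplus>\<^bsub>ZG\<^esub>i\<in>{1..l}. cc.T i \<beta>)" by (intro finsum_RR Pi_I TR)
    also have "\<dots> = (\<Oplus>\<^bsub>AA\<^esub>i\<in>{1..l}. cc.T i \<beta>)" by (intro finsum_AA[symmetric] Pi_I Rset_Aset TR)
    also have "\<dots> = (\<Oplus>\<^bsub>AA\<^esub>i\<in>{..<l}. cc.T (Suc i) \<beta>)"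
      unfolding image_Suc_lessThan[symmetric]
      by (intro A.finsum_reindex Pi_I cc.T_carrier cc.Rc_carrier \<beta>_Rset) simp
    also have "\<dots> = (\<Oplus>\<^bsub>AA\<^esub>i\<in>{..<l}. cc.T i \<beta>)"
      using cc.T_mod[OF cc.Rc_carrier[OF \<beta>_Rset], of l]
      by (intro cc.finsum_cyclic cc.T_carrier cc.Rc_carrier \<beta>_Rset) simp
    finally show ?thesis unfolding gp cx.normal_rhs_def cx.tr_def if_P[OF True] by (rule sym)
  next
    case False
    show ?thesis
      unfolding gp cx.normal_rhs_def if_not_P[OF False] RR_minus[OF \<beta>_Rset TR] AA_minus[OF Rset_Aset[OF \<beta>_Rset] Rset_Aset[OF TR]] ..
  qed
  finally show "(\<Oplus>\<^bsub>RR\<^esub>i\<in>{..<l}. galois_pow RR p (((n + i) mod l) * d) \<beta> \<otimes>\<^bsub>RR\<^esub> c i)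
    = (if n = 0 then (\<Oplus>\<^bsub>RR\<^esub>i\<in>{1..l}. galois_pow RR p (i * d) \<beta>)
      else \<beta> \<ominus>\<^bsub>RR\<^esub> galois_pow RR p (n * d) \<beta>)" .
qed

end

section \<open>Matrix units of a cyclic crossed product\<close>

locale cyclic_matrix_units = cyclic_conjugation +
  fixes e :: 'a
  assumes e [simp]: "e \<in> carrier A" and e_idem: "e \<otimes> e = e"
    and e_orth: "\<lbrakk>0 < n; n < l\<rbrakk> \<Longrightarrow> e \<otimes> \<gamma> [^] n \<otimes> e = \<zero>"
    and e_sum: "(\<Oplus>i\<in>{..<l}. \<gamma> [^] i \<otimes> e \<otimes> inv \<gamma> [^] i) = \<one>"
    and e_corner: "a \<in> carrier A \<Longrightarrow> \<exists>s\<in>ring_center A. e \<otimes> a \<otimes> e = s \<otimes> e"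
begin

definition unit :: "nat \<Rightarrow> nat \<Rightarrow> 'a" where
  "unit i j = \<gamma> [^] i \<otimes> e \<otimes> inv (\<gamma> [^] j)"

lemma inv_of_\<gamma>_pow: "inv (\<gamma> [^] k) = inv \<gamma> [^] (k::nat)"
  by (rule inv_char) (simp_all add: \<gamma>_inv_pow)

lemma unit_carrier [simp]: "unit i j \<in> carrier A"
  by (simp add: unit_def inv_of_\<gamma>_pow)

lemma unit_mod: "unit (i mod l) (j mod l) = unit i j"
  by (simp add: unit_def \<gamma>_pow_mod)

lemma unit_mult:
  assumes "i < l" "j < l" "k < l" "h < l"
  shows "unit i j \<otimes> unit k h = (if j = k then unit i h else \<zero>)"
proof -
  let ?q = "(l - j + k) mod l"
  have "inv \<gamma> [^] j \<otimes> \<gamma> [^] k = \<gamma> [^] ?q"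
    using assms by (simp add: inv_\<gamma>_pow nat_pow_mult \<gamma>_pow_mod)
  moreover have "e \<otimes> \<gamma> [^] ?q \<otimes> e = (if j = k then e else \<zero>)"
  proof (cases "j = k")
    case True
    have "?q = 0" using True mod_difference_eq_0[of j l k] assms by simp
    then show ?thesis using True e_idem by simp
  next
    case False
    then have "0 < ?q" using mod_difference_eq_0[of j l k] assms by simp
    moreover have "?q < l" using l_pos by simp
    ultimately show ?thesis using False e_orth by simp
  qed
  moreover have "unit i j \<otimes> unit k h = \<gamma> [^] i \<otimes> (e \<otimes> (inv \<gamma> [^] j \<otimes> \<gamma> [^] k) \<otimes> e) \<otimes> inv \<gamma> [^] h"
    by (simp add: unit_def inv_of_\<gamma>_pow m_assoc)
  ultimately show ?thesis by (simp add: unit_def inv_of_\<gamma>_pow)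
qed

lemma unit_sum: "(\<Oplus>i\<in>{..<l}. unit i i) = \<one>"
  using e_sum by (simp add: unit_def inv_of_\<gamma>_pow)

lemma unit_scalar_mult:
  assumes "i < l" "j < l" "k < l" "h < l" and s: "s \<in> ring_center A" "s' \<in> ring_center A"
  shows "s \<otimes> unit i j \<otimes> (s' \<otimes> unit k h) = (if j = k then s \<otimes> s' \<otimes> unit i h else \<zero>)"
proof -
  have "s \<otimes> unit i j \<otimes> (s' \<otimes> unit k h) = s \<otimes> (unit i j \<otimes> s') \<otimes> unit k h"
    using s by (simp add: m_assoc)
  also have "unit i j \<otimes> s' = s' \<otimes> unit i j" using ring_centerD[OF s(2), of "unit i j"] by simp
  also have "s \<otimes> (s' \<otimes> unit i j) \<otimes> unit k h = s \<otimes> s' \<otimes> (unit i j \<otimes> unit k h)"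
    using s by (simp add: m_assoc)
  finally show ?thesis using s assms(1-4) by (simp add: unit_mult)
qed

text \<open>A central scalar killing one matrix unit kills all of them, hence also their diagonal sum \<open>1\<close>.\<close>

lemma unit_scalar_zero:
  assumes ij: "i < l" "j < l" and s: "s \<in> ring_center A" and 0: "s \<otimes> unit i j = \<zero>"
  shows "s = \<zero>"
proof -
  have "s \<otimes> unit k k = \<zero>" if k: "k < l" for k
  proof -
    have "s \<otimes> unit k k = s \<otimes> (unit k i \<otimes> unit i j \<otimes> unit j k)" using ij k by (simp add: unit_mult)
    also have "\<dots> = (s \<otimes> unit k i) \<otimes> unit i j \<otimes> unit j k" using s by (simp add: m_assoc)
    also have "\<dots> = unit k i \<otimes> (s \<otimes> unit i j) \<otimes> unit j k"
      using s ring_centerD[OF s, of "unit k i"] by (simp add: m_assoc)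
    finally show ?thesis using 0 by simp
  qed
  then have "(\<Oplus>k\<in>{..<l}. s \<otimes> unit k k) = \<zero>" by (intro add.finprod_one_eqI) simp
  moreover have "(\<Oplus>k\<in>{..<l}. s \<otimes> unit k k) = s \<otimes> (\<Oplus>k\<in>{..<l}. unit k k)"
    using s by (intro finsum_rdistr[symmetric]) auto
  ultimately show ?thesis using s by (simp add: unit_sum)
qed

lemma unit_corner:
  assumes a: "a \<in> carrier A"
  shows "\<exists>s\<in>ring_center A. unit i i \<otimes> a \<otimes> unit j j = s \<otimes> unit i j"
proof -
  obtain s where s: "s \<in> ring_center A" "e \<otimes> (inv \<gamma> [^] i \<otimes> a \<otimes> \<gamma> [^] j) \<otimes> e = s \<otimes> e"
    using e_corner[of "inv \<gamma> [^] i \<otimes> a \<otimes> \<gamma> [^] j"] a by auto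
  have "unit i i \<otimes> a \<otimes> unit j j = \<gamma> [^] i \<otimes> (e \<otimes> (inv \<gamma> [^] i \<otimes> a \<otimes> \<gamma> [^] j) \<otimes> e) \<otimes> inv \<gamma> [^] j"
    using a by (simp add: unit_def inv_of_\<gamma>_pow m_assoc)
  also have "\<dots> = (\<gamma> [^] i \<otimes> s) \<otimes> e \<otimes> inv \<gamma> [^] j" using s by (simp add: m_assoc)
  also have "\<gamma> [^] i \<otimes> s = s \<otimes> \<gamma> [^] i" using ring_centerD[OF s(1), of "\<gamma> [^] i"] by simp
  also have "s \<otimes> \<gamma> [^] i \<otimes> e \<otimes> inv \<gamma> [^] j = s \<otimes> unit i j"
    using s(1) by (simp add: unit_def inv_of_\<gamma>_pow m_assoc)
  finally show ?thesis using s(1) by blast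
qed

end

section \<open>Blocks of the group ring\<close>

context strong_shoda_crossed
begin

text \<open>The entry \<open>f\<close> in position \<open>(u, v)\<close> of a matrix of size \<open>m\<close> over \<open>AA\<close>.\<close>

definition blk :: "nat \<Rightarrow> nat \<Rightarrow> ('g \<Rightarrow> int) \<Rightarrow> 'g \<Rightarrow> int" where
  "blk u v f = \<delta> (inv t u) \<otimes>\<^bsub>ZG\<^esub> f \<otimes>\<^bsub>ZG\<^esub> \<delta> (t v)"

lemma t_G: "u \<in> {1..m} \<Longrightarrow> t u \<in> carrier G"
  using transversal by (auto simp: right_transversal_def)

lemma t_Cen_eq:
  assumes uv: "u \<in> {1..m}" "v \<in> {1..m}" and c: "t u \<otimes> inv t v \<in> Cen"
  shows "u = v"
proof -
  have tu: "t u \<in> carrier G" and tv: "t v \<in> carrier G" using uv by (simp_all add: t_G)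
  have "t u = (t u \<otimes> inv t v) \<otimes> t v" using tu tv by (simp add: m_assoc)
  then have "t u \<in> Cen #> t v" unfolding r_coset_def using c by blast
  then have "Cen #> t v = Cen #> t u" using repr_independence[OF _ tv subgroup_Cen] by blast
  moreover have "inj_on (\<lambda>i. Cen #> t i) {1..m}"
    using transversal unfolding right_transversal_def bij_betw_def by blast
  ultimately show ?thesis using uv by (auto dest: inj_onD)
qed

lemma blk_closed [simp]: "f \<in> carrier ZG \<Longrightarrow> blk u v f \<in> carrier ZG"
  by (simp add: blk_def)

lemma blk_add: "\<lbrakk>f \<in> carrier ZG; h \<in> carrier ZG\<rbrakk> \<Longrightarrow> blk u v (f \<oplus>\<^bsub>ZG\<^esub> h) = blk u v f \<oplus>\<^bsub>ZG\<^esub> blk u v h"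
  by (simp add: blk_def ZG.l_distr ZG.r_distr)

lemma blk_zero [simp]: "blk u v \<zero>\<^bsub>ZG\<^esub> = \<zero>\<^bsub>ZG\<^esub>"
  by (simp add: blk_def)

lemma blk_finsum:
  "\<lbrakk>finite I; f \<in> I \<rightarrow> carrier ZG\<rbrakk> \<Longrightarrow> blk u v (\<Oplus>\<^bsub>ZG\<^esub>i\<in>I. f i) = (\<Oplus>\<^bsub>ZG\<^esub>i\<in>I. blk u v (f i))"
proof (induction I rule: finite_induct)
  case (insert i I)
  then have "f i \<in> carrier ZG" "f \<in> I \<rightarrow> carrier ZG" by auto
  then show ?case
    using insert by (simp add: ZG.finsum_insert blk_add ZG.finsum_closed Pi_def)
qed simp

lemma blk_eq_zeroD:
  assumes uv: "u \<in> {1..m}" "v \<in> {1..m}" and f: "f \<in> carrier ZG" and 0: "blk u v f = \<zero>\<^bsub>ZG\<^esub>"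
  shows "f = \<zero>\<^bsub>ZG\<^esub>"
proof -
  have "f = \<delta> (t u) \<otimes>\<^bsub>ZG\<^esub> blk u v f \<otimes>\<^bsub>ZG\<^esub> \<delta> (inv t v)"
    using t_G[OF uv(1)] t_G[OF uv(2)] f by (simp add: blk_def ZG.m_assoc gr_elt_inv_cancel gr_elt_inv)
  then show ?thesis using 0 by simp
qed

text \<open>Distinct translates of \<open>\<omega>\<close> are orthogonal, so the blocks multiply like matrix entries.\<close>

lemma blk_mult:
  assumes uv: "u \<in> {1..m}" "v \<in> {1..m}" "u' \<in> {1..m}" "v' \<in> {1..m}" and f: "f \<in> Aset" and h: "h \<in> Aset"
  shows "blk u v f \<otimes>\<^bsub>ZG\<^esub> blk u' v' h = (if v = u' then blk u v' (f \<otimes>\<^bsub>ZG\<^esub> h) else \<zero>\<^bsub>ZG\<^esub>)"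
proof -
  have "blk u v f \<otimes>\<^bsub>ZG\<^esub> blk u' v' h
    = \<delta> (inv t u) \<otimes>\<^bsub>ZG\<^esub> (f \<otimes>\<^bsub>ZG\<^esub> \<omega>) \<otimes>\<^bsub>ZG\<^esub> \<delta> (t v) \<otimes>\<^bsub>ZG\<^esub> (\<delta> (inv t u') \<otimes>\<^bsub>ZG\<^esub> (\<omega> \<otimes>\<^bsub>ZG\<^esub> h) \<otimes>\<^bsub>ZG\<^esub> \<delta> (t v'))"
    unfolding blk_def Aset_omega(1)[OF f] Aset_omega(2)[OF h] ..
  also have "\<dots> = \<delta> (inv t u) \<otimes>\<^bsub>ZG\<^esub> (f \<otimes>\<^bsub>ZG\<^esub> (\<omega> \<otimes>\<^bsub>ZG\<^esub> (\<delta> (t v) \<otimes>\<^bsub>ZG\<^esub> \<delta> (inv t u')) \<otimes>\<^bsub>ZG\<^esub> \<omega>) \<otimes>\<^bsub>ZG\<^esub> h) \<otimes>\<^bsub>ZG\<^esub> \<delta> (t v')"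
    using f h by (simp only: ZG.m_assoc ZG.m_closed gr_elt_closed Aset_ZG SH_ZG omega_SH)
  also have "\<delta> (t v) \<otimes>\<^bsub>ZG\<^esub> \<delta> (inv t u') = \<delta> (t v \<otimes> inv t u')"
    using t_G uv by (simp add: gr_elt_mult)
  also have "\<omega> \<otimes>\<^bsub>ZG\<^esub> \<delta> (t v \<otimes> inv t u') \<otimes>\<^bsub>ZG\<^esub> \<omega> = (if v = u' then \<omega> else \<zero>\<^bsub>ZG\<^esub>)"
  proof (cases "v = u'")
    case True
    then show ?thesis using t_G[OF uv(3)] by (simp add: gr_one_eq[symmetric] omega_idem)
  next
    case False
    then have "t v \<otimes> inv t u' \<notin> Cen" using t_Cen_eq[OF uv(2,3)] by blast
    then show ?thesis using False t_G uv by (simp add: omega_elt_omega)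
  qed
  finally show ?thesis using f h by (simp add: blk_def Aset_omega(1))
qed

lemma blk_corner:
  assumes uv: "u \<in> {1..m}" "v \<in> {1..m}" and f: "f \<in> Aset" and h: "h \<in> Aset" and y: "y \<in> carrier ZG"
  shows "\<exists>z\<in>Aset. blk u u f \<otimes>\<^bsub>ZG\<^esub> y \<otimes>\<^bsub>ZG\<^esub> blk v v h = blk u v (f \<otimes>\<^bsub>ZG\<^esub> z \<otimes>\<^bsub>ZG\<^esub> h)"
proof
  let ?z = "\<omega> \<otimes>\<^bsub>ZG\<^esub> (\<delta> (t u) \<otimes>\<^bsub>ZG\<^esub> y \<otimes>\<^bsub>ZG\<^esub> \<delta> (inv t v)) \<otimes>\<^bsub>ZG\<^esub> \<omega>"
  show "?z \<in> Aset" by (rule omega_corner) (simp add: y)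
  have "blk u u f \<otimes>\<^bsub>ZG\<^esub> y \<otimes>\<^bsub>ZG\<^esub> blk v v h = \<delta> (inv t u) \<otimes>\<^bsub>ZG\<^esub> (f \<otimes>\<^bsub>ZG\<^esub> \<omega>) \<otimes>\<^bsub>ZG\<^esub> \<delta> (t u) \<otimes>\<^bsub>ZG\<^esub> y
      \<otimes>\<^bsub>ZG\<^esub> (\<delta> (inv t v) \<otimes>\<^bsub>ZG\<^esub> (\<omega> \<otimes>\<^bsub>ZG\<^esub> h) \<otimes>\<^bsub>ZG\<^esub> \<delta> (t v))"
    unfolding blk_def Aset_omega(1)[OF f] Aset_omega(2)[OF h] ..
  also have "\<dots> = blk u v (f \<otimes>\<^bsub>ZG\<^esub> ?z \<otimes>\<^bsub>ZG\<^esub> h)"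
    using f h y unfolding blk_def by (simp only: ZG.m_assoc ZG.m_closed gr_elt_closed Aset_ZG SH_ZG omega_SH)
  finally show "blk u u f \<otimes>\<^bsub>ZG\<^esub> y \<otimes>\<^bsub>ZG\<^esub> blk v v h = blk u v (f \<otimes>\<^bsub>ZG\<^esub> ?z \<otimes>\<^bsub>ZG\<^esub> h)" .
qed

subsection \<open>The central idempotent of the sum of conjugates\<close>

abbreviation "w \<equiv> sum_of_conjugates (residue_ring M) G \<omega>"
abbreviation "B \<equiv> corner_ring ZG w"

lemma w_eq: "w = (\<Oplus>\<^bsub>ZG\<^esub>u\<in>{1..m}. blk u u \<omega>)"
proof -
  let ?c = "\<lambda>g. gr_conj (residue_ring M) G g \<omega>"
  have img: "?c ` carrier G = (\<lambda>u. ?c (t u)) ` {1..m}"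
  proof (intro equalityI subsetI)
    fix y assume "y \<in> ?c ` carrier G"
    then obtain g where g: "g \<in> carrier G" "y = ?c g" by blast
    have "Cen #> g \<in> rcosets Cen" using g(1) Cen_G by (rule rcosetsI[rotated])
    moreover have "rcosets Cen = (\<lambda>i. Cen #> t i) ` {1..m}"
      by (rule bij_betw_imp_surj_on[symmetric]) (use transversal in \<open>simp add: right_transversal_def\<close>)
    ultimately obtain u where u: "u \<in> {1..m}" "Cen #> g = Cen #> t u" by (metis (no_types, lifting) imageE)
    have "g \<in> Cen #> t u" using rcos_self[OF g(1) subgroup_Cen] unfolding u(2) .
    then obtain c where c: "c \<in> Cen" "g = c \<otimes> t u" unfolding r_coset_def by blast
    have cG: "c \<in> carrier G" and cc: "?c c = \<omega>" using c(1) by (simp_all add: gr_centralizer_def)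
    have "?c g = gr_conj (residue_ring M) G (t u) (?c c)"
      using cG t_G[OF u(1)] by (simp add: c(2) gr_conj_conj)
    then show "y \<in> (\<lambda>u. ?c (t u)) ` {1..m}" using g(2) cc u(1) by simp
  qed (use t_G in blast)
  have inj: "inj_on (\<lambda>u. ?c (t u)) {1..m}"
  proof (rule inj_onI)
    fix u v assume uv: "u \<in> {1..m}" "v \<in> {1..m}" "?c (t u) = ?c (t v)"
    have "?c (t u \<otimes> inv t v) = gr_conj (residue_ring M) G (inv t v) (?c (t v))"
      unfolding uv(3)[symmetric] using t_G[OF uv(1)] t_G[OF uv(2)] by (simp add: gr_conj_conj)
    also have "\<dots> = \<omega>" using t_G[OF uv(2)] by (simp add: gr_conj_conj gr_conj_one)
    finally have "t u \<otimes> inv t v \<in> Cen" using t_G uv by (simp add: gr_centralizer_def)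
    then show "u = v" by (rule t_Cen_eq[OF uv(1,2)])
  qed
  have "w = (\<Oplus>\<^bsub>ZG\<^esub>e\<in>(\<lambda>u. ?c (t u)) ` {1..m}. e)" unfolding sum_of_conjugates_def img ..
  also have "\<dots> = (\<Oplus>\<^bsub>ZG\<^esub>u\<in>{1..m}. ?c (t u))" using inj by (intro ZG.finsum_reindex) auto
  finally show ?thesis unfolding blk_def gr_conj_def .
qed

lemma w_ZG [simp]: "w \<in> carrier ZG"
  unfolding w_eq by (intro ZG.finsum_closed) auto

text \<open>With \<open>s = \<omega>\<close> the diagonal sum is \<open>w\<close>; with \<open>s\<close> in the center of \<open>AA\<close> it is \<open>central_scalar\<close>.\<close>

lemma diagonal_mult_blk:
  assumes uv: "u \<in> {1..m}" "v \<in> {1..m}" and s: "s \<in> Aset" and f: "f \<in> Aset"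
  shows "(\<Oplus>\<^bsub>ZG\<^esub>i\<in>{1..m}. blk i i s) \<otimes>\<^bsub>ZG\<^esub> blk u v f = blk u v (s \<otimes>\<^bsub>ZG\<^esub> f)"
    "blk u v f \<otimes>\<^bsub>ZG\<^esub> (\<Oplus>\<^bsub>ZG\<^esub>i\<in>{1..m}. blk i i s) = blk u v (f \<otimes>\<^bsub>ZG\<^esub> s)"
proof -
  have "(\<Oplus>\<^bsub>ZG\<^esub>i\<in>{1..m}. blk i i s) \<otimes>\<^bsub>ZG\<^esub> blk u v f = (\<Oplus>\<^bsub>ZG\<^esub>i\<in>{1..m}. blk i i s \<otimes>\<^bsub>ZG\<^esub> blk u v f)"
    using s f by (intro ZG.finsum_ldistr) auto
  also have "\<dots> = blk u v (s \<otimes>\<^bsub>ZG\<^esub> f)"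
    using uv s f by (intro ZG.finsum_delta[where i = u]) (auto simp: blk_mult)
  finally show "(\<Oplus>\<^bsub>ZG\<^esub>i\<in>{1..m}. blk i i s) \<otimes>\<^bsub>ZG\<^esub> blk u v f = blk u v (s \<otimes>\<^bsub>ZG\<^esub> f)" .
  have "blk u v f \<otimes>\<^bsub>ZG\<^esub> (\<Oplus>\<^bsub>ZG\<^esub>i\<in>{1..m}. blk i i s) = (\<Oplus>\<^bsub>ZG\<^esub>i\<in>{1..m}. blk u v f \<otimes>\<^bsub>ZG\<^esub> blk i i s)"
    using s f by (intro ZG.finsum_rdistr) auto
  also have "\<dots> = blk u v (f \<otimes>\<^bsub>ZG\<^esub> s)"
    using uv s f by (intro ZG.finsum_delta[where i = v]) (auto simp: blk_mult)
  finally show "blk u v f \<otimes>\<^bsub>ZG\<^esub> (\<Oplus>\<^bsub>ZG\<^esub>i\<in>{1..m}. blk i i s) = blk u v (f \<otimes>\<^bsub>ZG\<^esub> s)" .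
qed

lemma blk_w: "\<lbrakk>u \<in> {1..m}; v \<in> {1..m}; f \<in> Aset\<rbrakk> \<Longrightarrow> blk u v f \<otimes>\<^bsub>ZG\<^esub> w = blk u v f"
  by (simp only: w_eq diagonal_mult_blk(2) Aset_closed(3) Aset_omega(1))

lemma w_idem: "w \<otimes>\<^bsub>ZG\<^esub> w = w"
proof -
  have "(\<Oplus>\<^bsub>ZG\<^esub>u\<in>{1..m}. blk u u \<omega>) \<otimes>\<^bsub>ZG\<^esub> w = (\<Oplus>\<^bsub>ZG\<^esub>u\<in>{1..m}. blk u u \<omega> \<otimes>\<^bsub>ZG\<^esub> w)"
    by (intro ZG.finsum_ldistr) auto
  also have "\<dots> = (\<Oplus>\<^bsub>ZG\<^esub>u\<in>{1..m}. blk u u \<omega>)"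
    by (intro ZG.finsum_cong' refl blk_w Aset_closed(3)) auto
  finally show ?thesis unfolding w_eq[symmetric] .
qed

text \<open>Conjugation by a group element permutes the conjugates of \<open>\<omega>\<close>.\<close>

lemma w_central: "y \<in> carrier ZG \<Longrightarrow> w \<otimes>\<^bsub>ZG\<^esub> y = y \<otimes>\<^bsub>ZG\<^esub> w"
proof (rule commute_supported[OF _ subset_refl])
  fix g assume g: "g \<in> carrier G"
  let ?C = "(\<lambda>g. gr_conj (residue_ring M) G g \<omega>) ` carrier G"
  have fin: "finite ?C" using finite_G by simp
  have C: "?C \<subseteq> carrier ZG" by auto
  have img: "gr_conj (residue_ring M) G g ` ?C = ?C"
  proof (intro equalityI subsetI)
    fix y assume "y \<in> gr_conj (residue_ring M) G g ` ?C"
    then obtain h where h: "h \<in> carrier G" "y = gr_conj (residue_ring M) G g (gr_conj (residue_ring M) G h \<omega>)" by blast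
    then have "y = gr_conj (residue_ring M) G (h \<otimes> g) \<omega>" using g by (simp add: gr_conj_conj)
    then show "y \<in> ?C" using g h(1) by blast
  next
    fix y assume "y \<in> ?C"
    then obtain h where h: "h \<in> carrier G" "y = gr_conj (residue_ring M) G h \<omega>" by blast
    have "y = gr_conj (residue_ring M) G g (gr_conj (residue_ring M) G (h \<otimes> inv g) \<omega>)"
      using g h by (simp add: gr_conj_conj m_assoc)
    then show "y \<in> gr_conj (residue_ring M) G g ` ?C" using g h(1) by blast
  qed
  have inj: "inj_on (gr_conj (residue_ring M) G g) ?C"
  proof (rule inj_onI)
    fix y z assume yz: "y \<in> ?C" "z \<in> ?C" "gr_conj (residue_ring M) G g y = gr_conj (residue_ring M) G g z"
    have undo: "gr_conj (residue_ring M) G (inv g) (gr_conj (residue_ring M) G g x) = x" if "x \<in> carrier ZG" for x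
      using that g by (simp add: gr_conj_conj gr_conj_one)
    have "y = gr_conj (residue_ring M) G (inv g) (gr_conj (residue_ring M) G g y)"
      by (rule undo[OF subsetD[OF C yz(1)], symmetric])
    also have "\<dots> = z" unfolding yz(3) by (rule undo[OF subsetD[OF C yz(2)]])
    finally show "y = z" .
  qed
  have "gr_conj (residue_ring M) G g w = \<delta> (inv g) \<otimes>\<^bsub>ZG\<^esub> (\<Oplus>\<^bsub>ZG\<^esub>e\<in>?C. e) \<otimes>\<^bsub>ZG\<^esub> \<delta> g"
    by (simp add: gr_conj_def sum_of_conjugates_def)
  also have "\<dots> = (\<Oplus>\<^bsub>ZG\<^esub>e\<in>?C. \<delta> (inv g) \<otimes>\<^bsub>ZG\<^esub> e) \<otimes>\<^bsub>ZG\<^esub> \<delta> g"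
    using fin C by (subst ZG.finsum_rdistr) auto
  also have "\<dots> = (\<Oplus>\<^bsub>ZG\<^esub>e\<in>?C. gr_conj (residue_ring M) G g e)"
    unfolding gr_conj_def[of _ _ g] using fin C by (intro ZG.finsum_ldistr) auto
  also have "\<dots> = (\<Oplus>\<^bsub>ZG\<^esub>e\<in>gr_conj (residue_ring M) G g ` ?C. e)"
    using inj C by (intro ZG.finsum_reindex[symmetric]) auto
  also have "\<dots> = w" unfolding img sum_of_conjugates_def ..
  finally show "w \<otimes>\<^bsub>ZG\<^esub> \<delta> g = \<delta> g \<otimes>\<^bsub>ZG\<^esub> w" using g by (simp add: gr_conj_eq_iff_commute)
qed (simp_all add: supported_carrier)

lemma ring_B: "ring B"
  by (rule corner_ring_is_ring[OF ring_group_ring w_ZG w_idem w_central])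

lemma carrier_B: "y \<in> carrier B \<longleftrightarrow> y \<in> carrier ZG \<and> y \<otimes>\<^bsub>ZG\<^esub> w = y"
  by (rule corner_ring_carrier[OF ring_group_ring w_ZG w_idem])

lemma blk_B: "\<lbrakk>u \<in> {1..m}; v \<in> {1..m}; f \<in> Aset\<rbrakk> \<Longrightarrow> blk u v f \<in> carrier B"
  unfolding carrier_B by (simp only: blk_w blk_closed Aset_ZG)

lemma central_scalar_blk:
  assumes "u \<in> {1..m}" "v \<in> {1..m}" "s \<in> Aset" "f \<in> Aset"
  shows "central_scalar (residue_ring M) G m t s \<otimes>\<^bsub>ZG\<^esub> blk u v f = blk u v (s \<otimes>\<^bsub>ZG\<^esub> f)"
  using diagonal_mult_blk(1)[OF assms] by (simp only: central_scalar_def gr_conj_def blk_def)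

lemma m_l_index: "card (rcosets H) = m * l"
proof -
  have "m = card (rcosets Cen)" using transversal bij_betw_same_card[of _ "{1..m}"] by (fastforce simp: right_transversal_def)
  then have "m * (l * card H) = Coset.order G"
    unfolding l_card using lagrange_finite[OF finite_G subgroup_Cen] by (simp only:)
  also have "\<dots> = card (rcosets H) * card H" using lagrange_finite[OF finite_G H] by (simp only:)
  finally show ?thesis using card_subgroup_pos[OF H] by simp
qed

subsection \<open>The matrix units of the group ring\<close>

text \<open>An index \<open>a < m * l\<close> encodes the position \<open>a div l\<close> of a block and the position \<open>a mod l\<close> inside it; the
  blocks are numbered from \<open>1\<close>, like the transversal.\<close>

definition entry :: "('g \<Rightarrow> int) \<Rightarrow> nat \<Rightarrow> nat \<Rightarrow> ('g \<Rightarrow> int) \<Rightarrow> 'g \<Rightarrow> int" where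
  "entry e a b s = blk (Suc (a div l)) (Suc (b div l))
     (s \<otimes>\<^bsub>AA\<^esub> cyclic_matrix_units.unit AA \<gamma> e (a mod l) (b mod l))"

lemma matrix_system_entry:
  assumes "cyclic_matrix_units AA Rset \<gamma> l e"
  shows "matrix_system B (center_ring AA) (m * l) (entry e)"
proof -
  interpret u: cyclic_matrix_units AA Rset \<gamma> l e by fact
  have S_simps: "carrier (center_ring AA) = ring_center AA" "monoid.mult (center_ring AA) = monoid.mult ZG"
    "ring.add (center_ring AA) = ring.add ZG" "\<one>\<^bsub>center_ring AA\<^esub> = \<omega>" "\<zero>\<^bsub>center_ring AA\<^esub> = \<zero>\<^bsub>ZG\<^esub>"
    by (simp_all add: center_ring_eq SC_simps)
  have B_simps: "monoid.mult B = monoid.mult ZG" "ring.add B = ring.add ZG" "\<one>\<^bsub>B\<^esub> = w" "\<zero>\<^bsub>B\<^esub> = \<zero>\<^bsub>ZG\<^esub>"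
    by simp_all
  have uA: "u.unit i j \<in> Aset" for i j using u.unit_carrier[of i j] unfolding carrier_AA .
  have sA: "s \<in> Aset" if "s \<in> ring_center AA" for s
    using cc.ring_center_carrier[OF that] unfolding carrier_AA .
  have dv: "Suc (a div l) \<in> {1..m}" if "a < m * l" for a
    using that by (simp add: less_mult_imp_div_less Suc_leI)
  have md: "a mod l < l" for a using l_positive by simp
  have entry: "entry e a b s = blk (Suc (a div l)) (Suc (b div l)) (s \<otimes>\<^bsub>ZG\<^esub> u.unit (a mod l) (b mod l))" for a b s
    unfolding entry_def AA_simps ..
  have closed: "entry e a b s \<in> carrier B" if "a < m * l" "b < m * l" "s \<in> ring_center AA" for a b s
    unfolding entry by (intro blk_B dv Aset_closed(1) sA uA that)
  have one: "entry e a b \<omega> = blk (Suc (a div l)) (Suc (b div l)) (u.unit (a mod l) (b mod l))" for a b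
    unfolding entry Aset_omega(2)[OF uA] ..
  interpret B: ring B by (rule ring_B)
  show ?thesis
  proof (intro matrix_system.intro matrix_system_axioms.intro ring_B ring_center_ring[OF ring_AA], unfold S_simps B_simps)
    fix a b s assume ab: "a < m * l" "b < m * l" and s: "s \<in> ring_center AA"
    show "entry e a b s \<in> carrier B" by (rule closed[OF ab s])
    show "s = \<zero>\<^bsub>ZG\<^esub>" if "entry e a b s = \<zero>\<^bsub>ZG\<^esub>"
    proof -
      have "s \<otimes>\<^bsub>ZG\<^esub> u.unit (a mod l) (b mod l) = \<zero>\<^bsub>ZG\<^esub>"
        using blk_eq_zeroD[OF dv[OF ab(1)] dv[OF ab(2)] Aset_ZG[OF Aset_closed(1)[OF sA[OF s] uA]]] that
        unfolding entry .
      then show ?thesis using u.unit_scalar_zero[OF md md s] unfolding AA_simps by blast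
    qed
    fix s' assume s': "s' \<in> ring_center AA"
    show "entry e a b (s \<oplus>\<^bsub>ZG\<^esub> s') = entry e a b s \<oplus>\<^bsub>ZG\<^esub> entry e a b s'"
      unfolding entry using sA[OF s] sA[OF s'] uA by (simp add: ZG.l_distr blk_add Aset_ZG[OF uA])
    fix k h assume kh: "k < m * l" "h < m * l"
    have "entry e a b s \<otimes>\<^bsub>ZG\<^esub> entry e k h s'
      = (if b div l = k div l then blk (Suc (a div l)) (Suc (h div l))
          (s \<otimes>\<^bsub>ZG\<^esub> u.unit (a mod l) (b mod l) \<otimes>\<^bsub>ZG\<^esub> (s' \<otimes>\<^bsub>ZG\<^esub> u.unit (k mod l) (h mod l))) else \<zero>\<^bsub>ZG\<^esub>)"
      unfolding entry
      using blk_mult[OF dv[OF ab(1)] dv[OF ab(2)] dv[OF kh(1)] dv[OF kh(2)]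
        Aset_closed(1)[OF sA[OF s] uA] Aset_closed(1)[OF sA[OF s'] uA]] by (simp only: nat.inject)
    also have "s \<otimes>\<^bsub>ZG\<^esub> u.unit (a mod l) (b mod l) \<otimes>\<^bsub>ZG\<^esub> (s' \<otimes>\<^bsub>ZG\<^esub> u.unit (k mod l) (h mod l))
      = (if b mod l = k mod l then s \<otimes>\<^bsub>ZG\<^esub> s' \<otimes>\<^bsub>ZG\<^esub> u.unit (a mod l) (h mod l) else \<zero>\<^bsub>ZG\<^esub>)"
      using u.unit_scalar_mult[OF md md md md s s'] unfolding AA_simps by blast
    also have "(if b div l = k div l then blk (Suc (a div l)) (Suc (h div l)) \<dots> else \<zero>\<^bsub>ZG\<^esub>)
      = (if b = k then entry e a h (s \<otimes>\<^bsub>ZG\<^esub> s') else \<zero>\<^bsub>ZG\<^esub>)"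
    proof -
      have "b = k \<longleftrightarrow> b div l = k div l \<and> b mod l = k mod l" by (metis div_mult_mod_eq)
      then show ?thesis unfolding entry by simp
    qed
    finally show "entry e a b s \<otimes>\<^bsub>ZG\<^esub> entry e k h s' = (if b = k then entry e a h (s \<otimes>\<^bsub>ZG\<^esub> s') else \<zero>\<^bsub>ZG\<^esub>)" .
  next
    have "(\<Oplus>\<^bsub>B\<^esub>a\<in>{..<m * l}. entry e a a \<omega>) = (\<Oplus>\<^bsub>ZG\<^esub>a\<in>{..<m * l}. entry e a a \<omega>)"
    proof (rule finsum_subcarrier[OF B.abelian_monoid_axioms ZG.abelian_monoid_axioms])
      have "\<omega> \<in> ring_center AA" using cc.ring_centerI[OF cc.one_closed] cc.l_one cc.r_one unfolding AA_simps by simp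
      then show "(\<lambda>a. entry e a a \<omega>) \<in> {..<m * l} \<rightarrow> carrier B" using closed by simp
    qed (auto simp: carrier_B)
    also have "\<dots> = (\<Oplus>\<^bsub>ZG\<^esub>u\<in>{..<m}. \<Oplus>\<^bsub>ZG\<^esub>i\<in>{..<l}. blk (Suc u) (Suc u) (u.unit i i))"
      unfolding one by (rule ZG.finsum_div_mod[OF _ l_positive]) (intro blk_closed Aset_ZG uA)
    also have "\<dots> = (\<Oplus>\<^bsub>ZG\<^esub>u\<in>{..<m}. blk (Suc u) (Suc u) \<omega>)"
    proof (intro ZG.finsum_cong' refl Pi_I)
      fix u
      have "(\<Oplus>\<^bsub>ZG\<^esub>i\<in>{..<l}. u.unit i i) = \<omega>"
        using u.unit_sum finsum_AA[of "\<lambda>i. u.unit i i" "{..<l}"] uA unfolding AA_simps by simp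
      then show "(\<Oplus>\<^bsub>ZG\<^esub>i\<in>{..<l}. blk (Suc u) (Suc u) (u.unit i i)) = blk (Suc u) (Suc u) \<omega>"
        using blk_finsum[of "{..<l}" "\<lambda>i. u.unit i i" "Suc u" "Suc u"] uA by simp
    qed simp
    also have "\<dots> = (\<Oplus>\<^bsub>ZG\<^esub>u\<in>Suc ` {..<m}. blk u u \<omega>)" by (intro ZG.finsum_reindex[symmetric]) auto
    also have "Suc ` {..<m} = {1..m}" by (simp add: image_Suc_lessThan)
    also have "(\<Oplus>\<^bsub>ZG\<^esub>u\<in>{1..m}. blk u u \<omega>) = w" by (rule w_eq[symmetric])
    finally show "(\<Oplus>\<^bsub>B\<^esub>a\<in>{..<m * l}. entry e a a \<omega>) = w" .
  next
    fix a b y assume ab: "a < m * l" "b < m * l" and y: "y \<in> carrier B"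
    obtain z where z: "z \<in> Aset" "entry e a a \<omega> \<otimes>\<^bsub>ZG\<^esub> y \<otimes>\<^bsub>ZG\<^esub> entry e b b \<omega>
        = blk (Suc (a div l)) (Suc (b div l)) (u.unit (a mod l) (a mod l) \<otimes>\<^bsub>ZG\<^esub> z \<otimes>\<^bsub>ZG\<^esub> u.unit (b mod l) (b mod l))"
      using blk_corner[OF dv[OF ab(1)] dv[OF ab(2)] uA uA] y unfolding one carrier_B by blast
    obtain s where "s \<in> ring_center AA"
      "u.unit (a mod l) (a mod l) \<otimes>\<^bsub>ZG\<^esub> z \<otimes>\<^bsub>ZG\<^esub> u.unit (b mod l) (b mod l) = s \<otimes>\<^bsub>ZG\<^esub> u.unit (a mod l) (b mod l)"
      using u.unit_corner[of z] z(1) unfolding carrier_AA AA_simps by blast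
    then show "\<exists>s\<in>ring_center AA. entry e a a \<omega> \<otimes>\<^bsub>ZG\<^esub> y \<otimes>\<^bsub>ZG\<^esub> entry e b b \<omega> = entry e a b s"
      using z(2) unfolding entry by (intro bexI[of _ s]) simp_all
  qed
qed

text \<open>The exponents \<open>i\<close> and \<open>j\<close> run from \<open>1\<close> to \<open>l\<close> and matter modulo \<open>l\<close> only, so \<open>i = l\<close> stands for the
  residue \<open>0\<close>.\<close>

theorem elementary_matrices:
  "\<exists>\<alpha>s\<in>{..<l} \<rightarrow> Rset. normal_system RR p d l \<beta> \<alpha>s \<and>
    (let \<alpha> = (\<Oplus>\<^bsub>AA\<^esub>i\<in>{..<l}. \<alpha>s i \<otimes>\<^bsub>AA\<^esub> \<gamma> [^]\<^bsub>AA\<^esub> i) in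
      \<alpha> \<in> Units AA \<and>
      complete_elementary_set B (center_ring AA) (card (rcosets H))
        {w \<oplus>\<^bsub>ZG\<^esub> central_scalar (residue_ring M) G m t s \<otimes>\<^bsub>ZG\<^esub>
             (\<delta> (inv (t u)) \<otimes>\<^bsub>ZG\<^esub>
              (\<gamma> [^]\<^bsub>AA\<^esub> i \<otimes>\<^bsub>AA\<^esub> inv\<^bsub>AA\<^esub> \<alpha> \<otimes>\<^bsub>AA\<^esub> cx.E \<otimes>\<^bsub>AA\<^esub> \<alpha> \<otimes>\<^bsub>AA\<^esub> inv\<^bsub>AA\<^esub> (\<gamma> [^]\<^bsub>AA\<^esub> j) \<otimes>\<^bsub>AA\<^esub> \<omega>)
              \<otimes>\<^bsub>ZG\<^esub> \<delta> (t v))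
         | i j u v s. i \<in> {1..l} \<and> j \<in> {1..l} \<and> u \<in> {1..m} \<and> v \<in> {1..m} \<and> s \<in> carrier (center_ring AA)})"
proof -
  from cx.matrix_units_exist obtain c where c: "c \<in> {..<l} \<rightarrow> Rset"
    and c_units: "(\<forall>k<l. (\<Oplus>\<^bsub>AA\<^esub>i\<in>{..<l}. c i \<otimes>\<^bsub>AA\<^esub> cc.T (i + k) \<beta>) = cx.normal_rhs k) \<and>
      (let \<alpha> = (\<Oplus>\<^bsub>AA\<^esub>i\<in>{..<l}. c i \<otimes>\<^bsub>AA\<^esub> \<gamma> [^]\<^bsub>AA\<^esub> i); e = inv\<^bsub>AA\<^esub> \<alpha> \<otimes>\<^bsub>AA\<^esub> cx.E \<otimes>\<^bsub>AA\<^esub> \<alpha> in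
      \<alpha> \<in> Units AA \<and> e \<otimes>\<^bsub>AA\<^esub> e = e \<and> (\<forall>n. 0 < n \<longrightarrow> n < l \<longrightarrow> e \<otimes>\<^bsub>AA\<^esub> \<gamma> [^]\<^bsub>AA\<^esub> n \<otimes>\<^bsub>AA\<^esub> e = \<zero>\<^bsub>AA\<^esub>) \<and>
      (\<Oplus>\<^bsub>AA\<^esub>i\<in>{..<l}. \<gamma> [^]\<^bsub>AA\<^esub> i \<otimes>\<^bsub>AA\<^esub> e \<otimes>\<^bsub>AA\<^esub> inv\<^bsub>AA\<^esub> \<gamma> [^]\<^bsub>AA\<^esub> i) = \<one>\<^bsub>AA\<^esub> \<and>
      (\<forall>a\<in>carrier AA. \<exists>s\<in>ring_center AA. e \<otimes>\<^bsub>AA\<^esub> a \<otimes>\<^bsub>AA\<^esub> e = s \<otimes>\<^bsub>AA\<^esub> e))"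
    by (rule bexE)
  define \<alpha> where "\<alpha> = (\<Oplus>\<^bsub>AA\<^esub>i\<in>{..<l}. c i \<otimes>\<^bsub>AA\<^esub> \<gamma> [^]\<^bsub>AA\<^esub> i)"
  define e where "e = inv\<^bsub>AA\<^esub> \<alpha> \<otimes>\<^bsub>AA\<^esub> cx.E \<otimes>\<^bsub>AA\<^esub> \<alpha>"
  note system = c_units[THEN conjunct1, rule_format]
  note units = c_units[THEN conjunct2, unfolded Let_def, folded \<alpha>_def, folded e_def]
  note \<alpha>U = units[THEN conjunct1]
  note \<alpha> = cc.Units_closed[OF \<alpha>U] and \<alpha>_inv = cc.Units_inv_closed[OF \<alpha>U]
  have e: "e \<in> carrier AA" unfolding e_def by (intro cc.m_closed \<alpha> \<alpha>_inv cx.E_closed)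
  interpret u: cyclic_matrix_units AA Rset \<gamma> l e
    by (rule cyclic_matrix_units.intro[OF cc.cyclic_conjugation_axioms cyclic_matrix_units_axioms.intro[OF e
        units[THEN conjunct2, THEN conjunct1]
        units[THEN conjunct2, THEN conjunct2, THEN conjunct1, rule_format]
        units[THEN conjunct2, THEN conjunct2, THEN conjunct2, THEN conjunct1]
        units[THEN conjunct2, THEN conjunct2, THEN conjunct2, THEN conjunct2, rule_format]]])
  interpret mx: matrix_system B "center_ring AA" "m * l" "entry e"
    by (rule matrix_system_entry) unfold_locales
  have S: "carrier (center_ring AA) = ring_center AA" by (simp add: center_ring_eq)
  have uA: "u.unit i j \<in> Aset" for i j using u.unit_carrier[of i j] unfolding carrier_AA .
  have sA: "s \<in> Aset" if "s \<in> ring_center AA" for s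
    using cc.ring_center_carrier[OF that] unfolding carrier_AA .
  have pow: "\<gamma> [^]\<^bsub>AA\<^esub> i \<in> carrier AA" "inv\<^bsub>AA\<^esub> (\<gamma> [^]\<^bsub>AA\<^esub> i) \<in> carrier AA" for i :: nat
    using cc.nat_pow_closed[OF \<gamma>_carrier] cc.Units_inv_closed[OF cc.Units_pow_closed[OF \<gamma>_Units]] by blast+
  have conj: "\<gamma> [^]\<^bsub>AA\<^esub> i \<otimes>\<^bsub>AA\<^esub> inv\<^bsub>AA\<^esub> \<alpha> \<otimes>\<^bsub>AA\<^esub> cx.E \<otimes>\<^bsub>AA\<^esub> \<alpha> \<otimes>\<^bsub>AA\<^esub> inv\<^bsub>AA\<^esub> (\<gamma> [^]\<^bsub>AA\<^esub> j) \<otimes>\<^bsub>AA\<^esub> \<omega>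
      = u.unit (i mod l) (j mod l)" for i j
  proof -
    have "\<gamma> [^]\<^bsub>AA\<^esub> i \<otimes>\<^bsub>AA\<^esub> inv\<^bsub>AA\<^esub> \<alpha> \<otimes>\<^bsub>AA\<^esub> cx.E \<otimes>\<^bsub>AA\<^esub> \<alpha> \<otimes>\<^bsub>AA\<^esub> inv\<^bsub>AA\<^esub> (\<gamma> [^]\<^bsub>AA\<^esub> j) = u.unit i j"
      unfolding u.unit_def unfolding e_def using pow \<alpha> \<alpha>_inv cx.E_closed by (simp only: cc.m_assoc cc.m_closed)
    then show ?thesis using Aset_omega(1)[OF uA[of i j]] unfolding u.unit_mod AA_simps by simp
  qed
  let ?el = "\<lambda>i j u v s. w \<oplus>\<^bsub>ZG\<^esub> central_scalar (residue_ring M) G m t s \<otimes>\<^bsub>ZG\<^esub> blk u v (u.unit (i mod l) (j mod l))"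
  have el: "?el i j u v s = w \<oplus>\<^bsub>ZG\<^esub> blk u v (s \<otimes>\<^bsub>ZG\<^esub> u.unit (i mod l) (j mod l))"
    if "u \<in> {1..m}" "v \<in> {1..m}" "s \<in> ring_center AA" for i j u v s
    unfolding central_scalar_blk[OF that(1,2) sA[OF that(3)] uA] ..
  have set_eq: "{?el i j u v s | i j u v s. i \<in> {1..l} \<and> j \<in> {1..l} \<and> u \<in> {1..m} \<and> v \<in> {1..m} \<and> s \<in> ring_center AA}
    = {w \<oplus>\<^bsub>ZG\<^esub> entry e a b s | a b s. a < m * l \<and> b < m * l \<and> s \<in> ring_center AA}"
  proof (intro equalityI subsetI)
    fix y assume "y \<in> {?el i j u v s | i j u v s. i \<in> {1..l} \<and> j \<in> {1..l} \<and> u \<in> {1..m} \<and> v \<in> {1..m} \<and> s \<in> ring_center AA}"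
    then obtain i j u v s where y: "y = ?el i j u v s" and uv: "u \<in> {1..m}" "v \<in> {1..m}" and s: "s \<in> ring_center AA" by blast
    have ix: "\<exists>a<m * l. Suc (a div l) = u \<and> a mod l = i mod l" if u: "u \<in> {1..m}" for u i
    proof (intro exI[of _ "(u - 1) * l + i mod l"] conjI)
      have "(u - 1) * l + i mod l < Suc (u - 1) * l" using l_positive by simp
      also have "\<dots> \<le> m * l" using u by (intro mult_right_mono) auto
      finally show "(u - 1) * l + i mod l < m * l" .
    qed (use u l_positive in auto)
    obtain a b where ab: "a < m * l" "Suc (a div l) = u" "a mod l = i mod l" "b < m * l" "Suc (b div l) = v" "b mod l = j mod l"
      using ix[OF uv(1), of i] ix[OF uv(2), of j] by blast
    have "y = w \<oplus>\<^bsub>ZG\<^esub> entry e a b s" unfolding y el[OF uv s] entry_def ab AA_simps ..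
    then show "y \<in> {w \<oplus>\<^bsub>ZG\<^esub> entry e a b s | a b s. a < m * l \<and> b < m * l \<and> s \<in> ring_center AA}" using ab s by blast
  next
    fix y assume "y \<in> {w \<oplus>\<^bsub>ZG\<^esub> entry e a b s | a b s. a < m * l \<and> b < m * l \<and> s \<in> ring_center AA}"
    then obtain a b s where y: "y = w \<oplus>\<^bsub>ZG\<^esub> entry e a b s" and ab: "a < m * l" "b < m * l" and s: "s \<in> ring_center AA" by blast
    have dv: "Suc (a div l) \<in> {1..m}" if "a < m * l" for a
      using that by (simp add: less_mult_imp_div_less Suc_leI)
    have ex: "\<exists>i\<in>{1..l}. i mod l = a mod l" for a
      by (cases "a mod l = 0") (use l_positive in \<open>auto intro: bexI[of _ l] bexI[of _ "a mod l"] simp: less_imp_le\<close>)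
    obtain i j where ij: "i \<in> {1..l}" "i mod l = a mod l" "j \<in> {1..l}" "j mod l = b mod l" using ex[of a] ex[of b] by blast
    have "y = ?el i j (Suc (a div l)) (Suc (b div l)) s"
      unfolding y el[OF dv[OF ab(1)] dv[OF ab(2)] s] entry_def ij AA_simps ..
    then show "y \<in> {?el i j u v s | i j u v s. i \<in> {1..l} \<and> j \<in> {1..l} \<and> u \<in> {1..m} \<and> v \<in> {1..m} \<and> s \<in> ring_center AA}"
      using ij(1,3) dv[OF ab(1)] dv[OF ab(2)] s by blast
  qed
  have "complete_elementary_set B (center_ring AA) (card (rcosets H))
    {?el i j u v s | i j u v s. i \<in> {1..l} \<and> j \<in> {1..l} \<and> u \<in> {1..m} \<and> v \<in> {1..m} \<and> s \<in> ring_center AA}"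
    using mx.complete_elementary_set_units unfolding set_eq m_l_index S by simp
  then show ?thesis
    using c normal_systemI[OF c system] \<alpha>U unfolding Let_def blk_def S
    by (intro bexI[of _ c]) (simp_all only: \<alpha>_def[symmetric] conj)
qed

end

theorem theorem4p10:
  fixes p r :: nat
    and G :: "('g, 'b) monoid_scheme"
    and H K :: "'g set"
    and \<zeta> :: "'k :: alg_closed_field"
    and \<C> :: "('g set \<Rightarrow> 'k) set"
    and k l m d :: nat
    and \<omega> w \<beta> a \<gamma> E :: "'g \<Rightarrow> int"
    and C :: "'g set"
    and ZG A R S :: "('g \<Rightarrow> int) ring"
    and \<sigma> :: "('g \<Rightarrow> int) \<Rightarrow> 'g \<Rightarrow> int"
    and x :: 'g
    and t :: "nat \<Rightarrow> 'g"
    and z :: "'g set \<Rightarrow> 'g \<Rightarrow> int"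
    and act :: "'g set \<Rightarrow> ('g \<Rightarrow> int) \<Rightarrow> 'g \<Rightarrow> int"
  assumes "Factorial_Ring.prime p" and "1 \<le> r"
    and "group G" and "finite (carrier G)" and "coprime p (Coset.order G)"
    and "strong_shoda_pair G H K"
    and k: "k = Coset.order (subquotient G H K)"
    and "is_closure_of_prime_field TYPE('k) p"
    and "primitive_root_of_unity k \<zeta>"
    and "\<C> \<in> cyclotomic_classes (subquotient G H K) \<zeta>"
    \<comment> \<open>the idempotents, the subgroup \<open>C\<close> and the rings\<close>
    and \<omega>: "\<omega> = omega_C p r G H K \<zeta> \<C>"
    and w: "w = sum_of_conjugates (Zmod p r) G \<omega>"
    and C: "C = gr_centralizer (Zmod p r) G \<omega>"
    and ZG: "ZG = group_ring (Zmod p r) G"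
    and A: "A = corner_ring (sub_group_ring (Zmod p r) G C) \<omega>"
    and R: "R = corner_ring (sub_group_ring (Zmod p r) G H) \<omega>"
    and S: "S = center_ring A"
    and l: "l = Coset.order (subquotient G C H)"
    and m: "m = card (rcosets\<^bsub>G\<^esub> C)"
    and d: "d = Pocklington.ord k p div l"
    and "is_galois_ring p r d S"
    \<comment> \<open>the Galois extension \<open>R\<close> over \<open>S\<close> and the normal element\<close>
    and "\<sigma> \<in> galois_group R (carrier S)"
    and "\<forall>\<theta>\<in>galois_group R (carrier S). \<exists>i::nat. \<forall>y\<in>carrier R. \<theta> y = (\<sigma> ^^ i) y"
    and "card (galois_group R (carrier S)) = l"
    and "normal_element R S \<beta>"
    \<comment> \<open>the crossed product, with trivial twisting, and its basis of powers of \<open>\<gamma>\<close>\<close>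
    and "x \<in> C" and "\<forall>q\<in>carrier (subquotient G C H). \<exists>i::nat. q = (H #>\<^bsub>G\<^esub> x) [^]\<^bsub>subquotient G C H\<^esub> i"
    and "a \<in> carrier R" and "\<gamma> = a \<otimes>\<^bsub>ZG\<^esub> group_elt (Zmod p r) G x"
    and "\<gamma> [^]\<^bsub>A\<^esub> l = \<omega>"
    and "crossed_product A R (subquotient G C H) z act (\<lambda>_ _. \<omega>)"
    and "z (H #>\<^bsub>G\<^esub> x) = \<gamma>"
    and "\<forall>y\<in>carrier R. act (H #>\<^bsub>G\<^esub> x) y = \<sigma> y"
    and "left_basis A (carrier R) {..<l} (\<lambda>i. \<gamma> [^]\<^bsub>A\<^esub> i)"
    \<comment> \<open>orientation of \<open>\<sigma>\<close>: \<open>\<gamma>y\<gamma>\<inverse> = \<sigma>\<inverse>(y)\<close> is \<open>y\<close> to the power \<open>p\<^sup>d\<close>\<close>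
    and "\<forall>y\<in>carrier R. \<sigma> (galois_pow R p d y) = y"
    and "right_transversal G C m t"
    and E: "E = inv\<^bsub>A\<^esub> ([l] \<cdot>\<^bsub>A\<^esub> \<one>\<^bsub>A\<^esub>) \<otimes>\<^bsub>A\<^esub> (\<Oplus>\<^bsub>A\<^esub>i\<in>{..<l}. \<gamma> [^]\<^bsub>A\<^esub> i)"
  shows "\<exists>\<alpha>s \<in> {..<l} \<rightarrow> carrier R.
    normal_system R p d l \<beta> \<alpha>s \<and>
    (let \<alpha> = (\<Oplus>\<^bsub>A\<^esub>i\<in>{..<l}. \<alpha>s i \<otimes>\<^bsub>A\<^esub> \<gamma> [^]\<^bsub>A\<^esub> i) in
      \<alpha> \<in> Units A \<and>
      complete_elementary_set (corner_ring ZG w) S (card (rcosets\<^bsub>G\<^esub> H))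
        {w \<oplus>\<^bsub>ZG\<^esub> central_scalar (Zmod p r) G m t s \<otimes>\<^bsub>ZG\<^esub>
             (group_elt (Zmod p r) G (inv\<^bsub>G\<^esub> (t u)) \<otimes>\<^bsub>ZG\<^esub>
              (\<gamma> [^]\<^bsub>A\<^esub> i \<otimes>\<^bsub>A\<^esub> inv\<^bsub>A\<^esub> \<alpha> \<otimes>\<^bsub>A\<^esub> E \<otimes>\<^bsub>A\<^esub> \<alpha> \<otimes>\<^bsub>A\<^esub> inv\<^bsub>A\<^esub> (\<gamma> [^]\<^bsub>A\<^esub> j) \<otimes>\<^bsub>A\<^esub> \<omega>)
              \<otimes>\<^bsub>ZG\<^esub> group_elt (Zmod p r) G (t v))
         | i j u v s. i \<in> {1..l} \<and> j \<in> {1..l} \<and> u \<in> {1..m} \<and> v \<in> {1..m} \<and> s \<in> carrier S})"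
proof -
  note fold = \<omega>[symmetric] C[symmetric] A[symmetric] R[symmetric] S[symmetric]
  have prime_p: "CHAR('k) = p" using assms(8) by (simp add: is_closure_of_prime_field_def)
  interpret strong_shoda_class G p r H K \<zeta> \<C>
    using assms(1-6) assms(9,10)[unfolded k] prime_p
    by (intro strong_shoda_class.intro strong_shoda_class_axioms.intro) simp_all
  note fold = \<omega>_def fold
  have q: "H #>\<^bsub>G\<^esub> x \<in> carrier (subquotient G C H)"
    using assms(26) by (auto simp: FactGroup_def RCOSETS_def r_coset_def)
  have crossed: "left_basis A (carrier R) (carrier (subquotient G C H)) z"
    "\<And>g y. g \<in> carrier (subquotient G C H) \<Longrightarrow> y \<in> carrier R \<Longrightarrow> y \<otimes>\<^bsub>A\<^esub> z g = z g \<otimes>\<^bsub>A\<^esub> act g y"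
    using assms(31) unfolding crossed_product_def by blast+
  have \<gamma>A: "\<gamma> \<in> carrier A"
    using crossed(1) q assms(32) unfolding left_basis_def by (blast dest: funcset_mem)
  have mult_A: "monoid.mult A = monoid.mult (group_ring (Zmod p r) G)"
    using AA_simps(1) unfolding fold .
  \<comment> \<open>The number of powers of \<open>\<gamma>\<close> is the index of \<open>H\<close> in \<open>C\<close>, and the coset of \<open>x\<close> acts by \<open>\<sigma>\<close>.\<close>
  interpret strong_shoda_crossed G p r H K \<zeta> \<C> l m d \<sigma> \<beta> \<gamma> t
  proof (unfold_locales, unfold fold)
    have sub: "subgroup C G" using subgroup_Cen unfolding fold .
    have HC: "subgroup H (G\<lparr>carrier := C\<rparr>)"
      using H_Cen unfolding fold by (intro subgroup_incl H sub)
    interpret GC: group "G\<lparr>carrier := C\<rparr>" by (rule subgroup.subgroup_is_group[OF sub assms(3)])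
    have "finite (carrier (G\<lparr>carrier := C\<rparr>))"
      using subgroup.subset[OF sub] assms(4) by (auto intro: finite_subset)
    from GC.lagrange_finite[OF this HC] show "l * card H = card C"
      by (simp add: l Coset.order_def FactGroup_def)
    show "\<gamma> \<in> Aset" using \<gamma>A carrier_AA unfolding fold by simp
    show "y \<otimes>\<^bsub>group_ring (Zmod p r) G\<^esub> \<gamma> = \<gamma> \<otimes>\<^bsub>group_ring (Zmod p r) G\<^esub> \<sigma> y" if "y \<in> Rset" for y
    proof -
      have y: "y \<in> carrier R" using that carrier_RR unfolding fold by simp
      show ?thesis using crossed(2)[OF q y] assms(32,33) y by (simp add: mult_A)
    qed
    show "\<sigma> (galois_pow R p d y) = y" if "y \<in> Rset" for y
      using that assms(35) carrier_RR unfolding fold by simp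
  qed (fact assms)+
  have E_eq: "cyclic_crossed_product.E A \<gamma> l = E"
    using cx.E_def unfolding fold E[symmetric] .
  show ?thesis
    using elementary_matrices
    unfolding carrier_RR[symmetric] fold w[symmetric] ZG[symmetric] E_eq .
qed

end
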